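(* Let $d\ge 1$, $\varrho\in\,]0,1]$ and let $p\in\mathscr{C}^{0,\varrho}_{\mathrm{pw}}S_d$ with set of potential singularities $\mathscr{U}_p$. Assume: (A1) there exists $\kappa_1\in\,]0,1]$ such that, for $0<r\ll 1$, $\mathrm{L}\big((\mathscr{U}_p+B(0,r))\cap[0,1]^d\big)=\mathcal{O}(r^{\kappa_1})$; (A2) there exists $\kappa_2\in\,]0,1]$ such that, uniformly for $z\in\mathbb{C}$, for $0\le t\ll 1$, $\mathrm{L}\big(\{\rho\in[0,1]^d\times\mathbb{T}^d:\ |p(\rho)-z|^2\le t\}\big)=\mathcal{O}(t^{\kappa_2})$. For each $N\ge1$ let $Q_N$ be a random $N^d\times N^d$ complex matrix such that: (A3-i) there exists $\kappa_3>0$ with $\mathbb{E}(\|Q_N\|)=\mathcal{O}(N^{\kappa_3})$; (A3-ii) for each $\theta>0$ there exists $\beta>0$ such that for every sequence $(A_N)$ of deterministic $N^d\times N^d$ matrices with $\|A_N\|=\mathcal{O}(N^\theta)$, one has $\mathbb{P}\big(s_{N^d}(A_N+Q_N)\le N^{-\beta}\big)\to 0$ as $N\to+\infty$. Let $\delta_0>0$ and $\delta:=N^{-(\kappa_3+\delta_0)}$. Let $R_N$ be an $N^d\times N^d$ complex deterministic matrix such that there exists $0<\kappa_4\le d$ with $$\mathrm{rank}(R_N)=\mathcal{O}(N^{d-\kappa_4})\quad\text{and}\quad\|R_N\|=\mathcal{O}(1).$$ Then the empirical spectral measure $\mu_N=\frac{1}{N^d}\sum_{\lambda\in\sigma(M_N(p)+R_N+\delta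 Q_N)}\delta_\lambda$ of $M_N(p)+R_N+\delta Q_N$ converges weakly in probability, as $N\to+\infty$, to the push-forward $p_*\mathrm{L}$ of the normalized Lebesgue measure on $[0,1]^d\times\mathbb{T}^d$ by $p$.
   Context: $\mathbb{T}^d=(\mathbb{R}/\mathbb{Z})^d$; $\mathrm{L}$ denotes (normalized) Lebesgue measure on $[0,1]^d$ or on $[0,1]^d\times\mathbb{T}^d$; $B(0,r)$ is the ball of radius $r$ in $\mathbb{R}^d$. $\|A\|$ and $s_{N^d}(A)$ denote the greatest and the smallest singular value of an $N^d\times N^d$ matrix $A$. $\mathcal{O}(\cdot)$ means bounded by a constant multiple, the constant being independent of $N$ (resp. of $r$, $t$); "for $0<r\ll1$" means for all sufficiently small $r>0$. Eigenvalues in $\mu_N$ are counted with multiplicity. Symbol class. For $\varrho\in\,]0,1]$, $\mathscr{C}^{0,\varrho}_{\mathrm{pw}}S_d$ is the set of functions $f:[0,1]^d_x\times\mathbb{T}^d_\xi\to\mathbb{C}$ that are smooth with respect to $\xi$ and such that: (1) there is a finite family of open connected disjoint sets $U_1,\dots,U_s$ of $[0,1]^d$ with $\overline{\bigsqcup_{j=1}^sU_j}=[0,1]^d$; (2) for all $j\in\{1,\dots,s\}$ there exists $f_j:\overline{U_j}\times\mathbb{T}^d\to\mathbb{C}$ with $f_j=f$ on $U_j\times\mathbb{T}^d$ and such that for all $\beta\in\mathbb{N}^d$ there exists $C_{j,\beta}>0$ with $\|\partial_\xi^\beta f_j(\cdot,\xi)\|_{\mathscr{C}^{0,\varrho}(\overline{U_j})}\le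 C_{j,\beta}$ for all $\xi\in\mathbb{T}^d$ (Hölder norm of exponent $\varrho$). One sets $\mathscr{U}_f:=\bigcup_{j=1}^s\partial U_j$. Matrix. Write $p_\nu(x)=\int_{\mathbb{T}^d}p(x,\xi)e^{-2i\pi\langle\nu,\xi\rangle}d\xi$ for $\nu\in\mathbb{Z}^d$. $M_N(p)$ is the $N^d\times N^d$ matrix indexed by $\{1,\dots,N\}^d$ with entries $M_N(p)_{n,j}=p_{n-j}(n/N)$, $n,j\in\{1,\dots,N\}^d$. Weak convergence in probability of $\mu_N$ to $\mu$ means: for every bounded continuous $f:\mathbb{C}\to\mathbb{R}$ and every $\varepsilon>0$, $\mathbb{P}(|\int f\,d\mu_N-\int f\,d\mu|\ge\varepsilon)\to0$ as $N\to+\infty$.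
   Formalization: The symbol p is additionally required to be bounded on [0,1]^d × T^d, which restricts it only on the boundaries of the pieces U_j; without this, for d ≥ 2, p may grow arbitrarily fast at rational boundary points sampled by M_N(p), and the conclusion can fail. *)

theory Defs
  imports
    "HOL-Probability.Probability"
    "HOL-Library.Landau_Symbols"
    "HOL-Computational_Algebra.Fundamental_Theorem_Algebra"
    "Jordan_Normal_Form.Schur_Decomposition"
    "Jordan_Normal_Form.DL_Rank"
begin

text \<open>
  The dimension d is the cardinality of the finite index type of \<^typ>\<open>real ^ 'd\<close>.
  A function on the torus is represented by its lift to \<^typ>\<open>real ^ 'd\<close>, which has period 1
  in every coordinate; integrals over the torus are integrals over the unit cube.
  The infix dollar sign is avoided for vector components because both
  HOL-Analysis and Jordan_Normal_Form declare it.
\<close>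

abbreviation unit_cube :: "(real ^ 'd::finite) set" where
  "unit_cube \<equiv> cbox 0 1"

text \<open>
  The normalized Lebesgue measure L on the product of the cube and the torus. The completed measure
  is used because a symbol is arbitrary (apart from being bounded) on a null set of \<open>x\<close>, so it is
  Lebesgue measurable but need not be Borel measurable.
\<close>

definition phase_measure :: "((real ^ 'd::finite) \<times> (real ^ 'd)) measure" where
  "phase_measure = lebesgue_on (unit_cube \<times> unit_cube)"

definition partial :: "'d::finite \<Rightarrow> (real ^ 'd \<Rightarrow> complex) \<Rightarrow> real ^ 'd \<Rightarrow> complex" where
  "partial i g \<xi> = vector_derivative (\<lambda>t. g (\<xi> + t *\<^sub>R axis i 1)) (at 0)"

text \<open>
  Iterated partial derivatives along a list of coordinates. For smooth functions the order of the
  list is immaterial, so ranging over all lists is the same as ranging over all multi-indices.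
\<close>

fun partials :: "'d::finite list \<Rightarrow> (real ^ 'd \<Rightarrow> complex) \<Rightarrow> real ^ 'd \<Rightarrow> complex" where
  "partials [] g = g"
| "partials (i # is) g = partial i (partials is g)"

definition torus_smooth :: "(real ^ 'd::finite \<Rightarrow> complex) \<Rightarrow> bool" where
  "torus_smooth g \<longleftrightarrow>
     (\<forall>i \<xi>. g (\<xi> + axis i 1) = g \<xi>) \<and> (\<forall>is \<xi>. partials is g differentiable (at \<xi>))"

definition hoelder_norm ::
    "real \<Rightarrow> (real ^ 'd::finite) set \<Rightarrow> (real ^ 'd \<Rightarrow> complex) \<Rightarrow> ennreal" where
  "hoelder_norm \<rho> K h =
     (SUP x\<in>K. ennreal (norm (h x))) +
     (SUP (x, y)\<in>{(x, y). x \<in> K \<and> y \<in> K \<and> x \<noteq> y}.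
        ennreal (norm (h x - h y) / dist x y powr \<rho>))"

text \<open>
  \<open>pw_symbol \<rho> \<U> f\<close>: the function \<open>f\<close> belongs to the class of piecewise Hoelder symbols, as witnessed
  by the family \<open>\<U>\<close> of pieces. The pieces are open in the cube (relative topology).
  Boundedness of \<open>f\<close> on the union of the pieces follows from the Hoelder bounds; the explicit
  clause restricts \<open>f\<close> only at the remaining points \<open>x\<close> (contained in the boundaries of the
  pieces), where nothing else bounds \<open>f\<close> uniformly in \<open>x\<close> although the matrix below samples \<open>f\<close> there.
\<close>

definition pw_symbol ::
    "real \<Rightarrow> (real ^ 'd::finite) set set \<Rightarrow> (real ^ 'd \<Rightarrow> real ^ 'd \<Rightarrow> complex) \<Rightarrow> bool" where
  "pw_symbol \<rho> \<U> f \<longleftrightarrow>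
     (\<forall>x\<in>unit_cube. torus_smooth (f x)) \<and>
     bounded {f x \<xi> | x \<xi>. x \<in> unit_cube} \<and>
     finite \<U> \<and> disjoint \<U> \<and>
     (\<forall>U\<in>\<U>. openin (top_of_set unit_cube) U \<and> connected U) \<and>
     closure (\<Union>\<U>) = unit_cube \<and>
     (\<forall>U\<in>\<U>. \<exists>g.
        (\<forall>x\<in>closure U. torus_smooth (g x)) \<and>
        (\<forall>x\<in>U. \<forall>\<xi>. g x \<xi> = f x \<xi>) \<and>
        (\<forall>is. \<exists>C>0. \<forall>\<xi>.
           hoelder_norm \<rho> (closure U) (\<lambda>x. partials is (g x) \<xi>) \<le> ennreal C))"

definition singular_set :: "(real ^ 'd::finite) set set \<Rightarrow> (real ^ 'd) set" where
  "singular_set \<U> = (\<Union>U\<in>\<U>. top_of_set unit_cube frontier_of U)"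

definition fourier_coeff ::
    "(real ^ 'd::finite \<Rightarrow> real ^ 'd \<Rightarrow> complex) \<Rightarrow> int ^ 'd \<Rightarrow> real ^ 'd \<Rightarrow> complex" where
  "fourier_coeff p \<nu> x =
     (LINT \<xi>|lebesgue_on unit_cube.
        p x \<xi> * exp (- 2 * \<i> * of_real pi *
          of_real (\<Sum>i\<in>UNIV. of_int (vec_nth \<nu> i) * vec_nth \<xi> i)))"

definition grid :: "nat \<Rightarrow> (int ^ 'd::finite) set" where
  "grid N = {n. \<forall>i. 1 \<le> vec_nth n i \<and> vec_nth n i \<le> int N}"

text \<open>
  Matrices indexed by the grid are written as ordinary matrices by means of an enumeration
  \<open>e\<close> of the grid, that is, a bijection from \<open>{..<N ^ d}\<close> to \<^term>\<open>grid N\<close>.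
\<close>

definition symbol_matrix ::
    "nat \<Rightarrow> (nat \<Rightarrow> int ^ 'd::finite) \<Rightarrow> (real ^ 'd \<Rightarrow> real ^ 'd \<Rightarrow> complex) \<Rightarrow> complex mat" where
  "symbol_matrix N e p =
     mat (N ^ CARD('d)) (N ^ CARD('d))
       (\<lambda>(k, l). fourier_coeff p (e k - e l) (\<chi> i. of_int (vec_nth (e k) i) / of_nat N))"

definition singular_values :: "complex mat \<Rightarrow> real set" where
  "singular_values A = {sqrt (Re a) | a. eigenvalue (mat_adjoint A * A) a}"

definition max_sv :: "complex mat \<Rightarrow> real" where
  "max_sv A = Max (singular_values A)"

definition min_sv :: "complex mat \<Rightarrow> real" where
  "min_sv A = Min (singular_values A)"

text \<open>The multiset of roots of the characteristic polynomial accounts for multiplicities.\<close>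

definition spectral_measure :: "complex mat \<Rightarrow> complex measure" where
  "spectral_measure A = distr (measure_pmf (pmf_of_multiset (proots (char_poly A)))) borel (\<lambda>z. z)"

definition random_matrix :: "'w measure \<Rightarrow> nat \<Rightarrow> ('w \<Rightarrow> complex mat) \<Rightarrow> bool" where
  "random_matrix M n Q \<longleftrightarrow>
     (\<forall>\<omega>\<in>space M. Q \<omega> \<in> carrier_mat n n) \<and>
     (\<forall>i<n. \<forall>j<n. (\<lambda>\<omega>. Q \<omega> $$ (i, j)) \<in> borel_measurable M)"

text \<open>The random measures may live on a different probability space for each index.\<close>

definition weakly_conv_in_prob ::
    "(nat \<Rightarrow> 'w measure) \<Rightarrow> (nat \<Rightarrow> 'w \<Rightarrow> complex measure) \<Rightarrow> complex measure \<Rightarrow> bool" where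
  "weakly_conv_in_prob M \<mu> \<mu>0 \<longleftrightarrow>
     (\<forall>f :: complex \<Rightarrow> real. continuous_on UNIV f \<longrightarrow> bounded (range f) \<longrightarrow>
        (\<forall>\<epsilon>>0. (\<lambda>N. measure (M N)
            {\<omega> \<in> space (M N). \<bar>(LINT z|\<mu> N \<omega>. f z) - (LINT z|\<mu>0. f z)\<bar> \<ge> \<epsilon>})
          \<longlonglongrightarrow> 0))"

end

theory Submission
  imports Defs "Jordan_Normal_Form.Spectral_Radius"
begin

text \<open>
  Let \<open>B\<close> be the perturbed matrix, of size \<open>n = N ^ d\<close>, and let \<open>h i\<close> be the squared singular values of
  \<open>B - z\<close>. The logarithmic potential of the spectral measure at \<open>z\<close> is \<open>(1 / 2n) \<Sum> ln (h i)\<close>. Its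
  regularization \<open>(1 / n) \<Sum> ln (\<tau>\<^sup>2 + h i)\<close> is computed with wave packets: plane waves of frequency
  \<open>\<xi>\<close>, cut off to blocks of side about \<open>sqrt N\<close>, resolve the identity, and in mean square they
  are approximate eigenvectors of \<open>B - z\<close> and of its adjoint, with eigenvalue \<open>p x \<xi> - z\<close>. A perturbation
  enters only through its Hilbert-Schmidt norm, which is small for both summands. By concavity of the logarithm the
  regularization is, up to \<open>N powr - c / \<tau>\<close>, a Riemann sum of \<open>ln (\<tau>\<^sup>2 + |p - z|\<^sup>2)\<close>, uniformly in \<open>z\<close>,
  and (A2) allows \<open>\<tau>\<close> to tend to 0 in the limiting integral. This bounds the potentials from above for all
  \<open>z\<close>. At a fixed \<open>z\<close>, (A3-ii) keeps the singular values polynomially large, and comparing a power of \<open>N\<close> with a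
  fixed \<open>\<tau>\<close> shows that the small ones are too few to matter, which gives the lower bound. Upper bounds
  everywhere and lower bounds at finitely many points determine the weak limit.
\<close>

section \<open>Singular values\<close>

text \<open>Blocks of side m cost a boundary fraction of order 1/m in the Fourier tail and a
  distance m/N over which the symbol varies; sqrt N turns both into powers of N. The packets are not
  orthonormal, but a trace asks only for a resolution of the identity. The obstacle is that mean
  square errors say nothing about singular values near 0. It is overcome because the error is a
  power of N divided by \<tau>: one may take \<tau> to be a small negative power of N, and then the
  logarithms of the smallest admissible singular value and of \<tau> are both multiples of ln N.
  Their ratio, the price of comparing one with the other, is a constant. Upper bounds hold for all z
  outside a single event, whereas a lower bound costs one event for each z; so the finite set of
  test points has to be fixed before the matrix is drawn. Such sets arise because circle means of
  the potential are replaced by means over the vertices of regular polygons.\<close>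

lemma orthonormal_extension:
  fixes v :: "nat \<Rightarrow> complex"
  assumes n: "n > 0" and v: "(\<Sum>k<n. v k * cnj (v k)) = 1"
  shows "\<exists>w. w 0 = v \<and> (\<forall>i<n. \<forall>j<n. (\<Sum>k<n. w i k * cnj (w j k)) = of_bool (i = j))"
proof -
  interpret cof_vec_space n "TYPE(complex)" .
  define v' where "v' = vec n v"
  have v'c: "v' \<in> carrier_vec n" by (simp add: v'_def)
  have v'0: "v' \<noteq> 0\<^sub>v n"
  proof
    assume "v' = 0\<^sub>v n"
    hence "\<And>k. k < n \<Longrightarrow> v k = 0" unfolding v'_def by (metis index_vec index_zero_vec(1))
    with v show False by simp
  qed
  define b where "b = basis_completion v'"
  note bc = basis_completion[OF v'c v'0, folded b_def]
  define ws where "ws = gram_schmidt n b"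
  have ws: "set ws \<subseteq> carrier_vec n" "corthogonal ws" "length ws = n"
    using gram_schmidt_result[OF bc(2,4,5) refl, folded ws_def] bc(6) by auto
  from bc(6,7) n obtain vs where bv: "b = v' # vs" by (cases b) auto
  have hd: "hd ws = v'" using gram_schmidt_hd[OF v'c, of vs, folded bv] by (simp add: ws_def)
  have ws0: "ws ! 0 = v'" using hd ws(3) n by (metis hd_conv_nth length_0_conv less_numeral_extra(3))
  define c where "c i j = (\<Sum>k<n. vec_index (ws!i) k * cnj (vec_index (ws!j) k))" for i j
  have cs: "c i j = scalar_prod (ws!i) (conjugate (ws!j))" if "i<n" "j<n" for i j
  proof -
    have "ws!i \<in> carrier_vec n" "ws!j \<in> carrier_vec n" using ws that by auto
    thus ?thesis unfolding c_def scalar_prod_def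
      by (auto intro!: sum.cong simp: conjugate_vec_def lessThan_atLeast0)
  qed
  have c0: "c i j = 0 \<longleftrightarrow> i \<noteq> j" if "i<n" "j<n" for i j
    using corthogonalD[OF ws(2)] that ws(3) cs by auto
  define r where "r i = sqrt (\<Sum>k<n. (cmod (vec_index (ws!i) k))\<^sup>2)" for i
  have cr: "c i i = of_real ((r i)\<^sup>2)" for i
    unfolding c_def r_def by (simp add: sum_nonneg complex_norm_square del: of_real_power)
  have r0: "r i \<noteq> 0" if "i<n" for i using c0[OF that that] cr by auto
  have r1: "r 0 = 1"
  proof -
    have "c 0 0 = 1" unfolding c_def ws0 v'_def using v by simp
    hence "(r 0)\<^sup>2 = 1" using cr by (metis of_real_eq_1_iff)
    moreover have "r 0 \<ge> 0" unfolding r_def by (simp add: sum_nonneg)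
    ultimately show ?thesis by (simp add: power2_eq_1_iff)
  qed
  \<comment> \<open>For \<open>i = 0\<close> the function \<open>v\<close> itself is taken, also at
    arguments beyond \<open>n\<close>, so that \<open>w 0 = v\<close> is an equality of
    functions.\<close>
  define w where "w i k = (if i = 0 then v k else vec_index (ws!i) k / of_real (r i))" for i k
  have w: "w i k = vec_index (ws!i) k / of_real (r i)" if "k<n" for i k
    using that by (simp add: w_def ws0 r1 v'_def)
  have "(\<Sum>k<n. w i k * cnj (w j k)) = of_bool (i = j)" if "i<n" "j<n" for i j
  proof -
    have "(\<Sum>k<n. w i k * cnj (w j k)) = c i j / (of_real (r i) * of_real (r j))"
      unfolding c_def sum_divide_distrib by (auto intro!: sum.cong simp: w)
    thus ?thesis using c0[OF that] cr[of i] r0[OF that(1)] by (cases "i=j") (auto simp: power2_eq_square)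
  qed
  moreover have "w 0 = v" by (auto simp: w_def)
  ultimately show ?thesis by blast
qed

text \<open>A right inverse of a square matrix is also a left inverse, so orthonormal rows have
  orthonormal columns.\<close>

lemma orthonormal_complete:
  fixes w :: "nat \<Rightarrow> nat \<Rightarrow> complex"
  assumes "\<forall>i<n. \<forall>j<n. (\<Sum>k<n. w i k * cnj (w j k)) = of_bool (i = j)"
    and "k < n" "l < n"
  shows "(\<Sum>i<n. w i k * cnj (w i l)) = of_bool (k = l)"
proof -
  define U where "U = Matrix.mat n n (\<lambda>(i,k). w i k)"
  define V where "V = Matrix.mat n n (\<lambda>(k,i). cnj (w i k))"
  have c: "U \<in> carrier_mat n n" "V \<in> carrier_mat n n" by (auto simp: U_def V_def)
  have "U * V = 1\<^sub>m n"
    by (rule eq_matI) (use assms(1) in \<open>auto simp: U_def V_def scalar_prod_def lessThan_atLeast0\<close>)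
  hence "V * U = 1\<^sub>m n" using mat_mult_left_right_inverse c by blast
  hence "(V * U) $$ (l,k) = (1\<^sub>m n) $$ (l,k)" by simp
  thus ?thesis using assms(2,3)
    by (auto simp: U_def V_def scalar_prod_def lessThan_atLeast0 mult.commute split: if_splits)
qed

text \<open>Induction on the dimension: one eigenvector exists over the complex numbers, and the
  matrix is compressed to its orthogonal complement. With matrices as plain functions the induction
  changes only the range of summation.\<close>

lemma hermitian_spectral:
  fixes H :: "nat \<Rightarrow> nat \<Rightarrow> complex"
  assumes "\<And>i j. i < n \<Longrightarrow> j < n \<Longrightarrow> H i j = cnj (H j i)"
  shows "\<exists>u (h::nat \<Rightarrow> real). (\<forall>i<n. \<forall>j<n. (\<Sum>k<n. u i k * cnj (u j k)) = of_bool (i = j)) \<and>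
           (\<forall>i<n. \<forall>k<n. (\<Sum>l<n. H k l * u i l) = of_real (h i) * u i k)"
  using assms
proof (induction n arbitrary: H)
  case 0
  show ?case by simp
next
  case (Suc n H)
  define A where "A = Matrix.mat (Suc n) (Suc n) (\<lambda>(i,j). H i j)"
  have A: "A \<in> carrier_mat (Suc n) (Suc n)" by (simp add: A_def)
  have "spectrum A \<noteq> {}" by (rule spectrum_non_empty[OF A]) simp
  then obtain e where "eigenvalue A e" unfolding spectrum_def by auto
  then obtain v where "eigenvector A v e" unfolding eigenvalue_def by auto
  hence v: "v \<in> carrier_vec (Suc n)" "v \<noteq> 0\<^sub>v (Suc n)" "A *\<^sub>v v = e \<cdot>\<^sub>v v"
    using A unfolding eigenvector_def by auto
  define r where "r = sqrt (\<Sum>k<Suc n. (cmod (vec_index v k))\<^sup>2)"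
  have "r \<noteq> 0"
  proof
    assume "r = 0"
    hence "(\<Sum>k<Suc n. (cmod (vec_index v k))\<^sup>2) = 0" by (simp add: r_def)
    hence "\<forall>k<Suc n. vec_index v k = 0" by (subst (asm) sum_nonneg_eq_0_iff) auto
    hence "v = 0\<^sub>v (Suc n)" using v(1) by (intro eq_vecI) auto
    with v show False by simp
  qed
  define x where "x k = vec_index v k / of_real r" for k
  have x1: "(\<Sum>k<Suc n. x k * cnj (x k)) = 1"
  proof -
    have "r\<^sup>2 = (\<Sum>k<Suc n. (cmod (vec_index v k))\<^sup>2)" unfolding r_def by (rule real_sqrt_pow2) (simp add: sum_nonneg)
    moreover have "(\<Sum>k<Suc n. x k * cnj (x k)) = of_real ((\<Sum>k<Suc n. (cmod (vec_index v k))\<^sup>2) / r\<^sup>2)"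
      unfolding x_def of_real_divide of_real_sum sum_divide_distrib complex_norm_square
      by (auto intro!: sum.cong simp: complex_norm_square power2_eq_square simp del: sum.lessThan_Suc)
    moreover have "r\<^sup>2 \<noteq> 0" using \<open>r \<noteq> 0\<close> by simp
    ultimately show ?thesis by (simp del: sum.lessThan_Suc)
  qed
  have xe: "(\<Sum>l<Suc n. H k l * x l) = e * x k" if "k < Suc n" for k
  proof -
    have "vec_index (A *\<^sub>v v) k = e * vec_index v k" using v that by simp
    moreover have "vec_index (A *\<^sub>v v) k = (\<Sum>l<Suc n. H k l * vec_index v l)"
      using that v(1) A by (auto simp: A_def scalar_prod_def lessThan_atLeast0 simp del: sum.lessThan_Suc sum.op_ivl_Suc intro!: sum.cong)
    ultimately have "(\<Sum>l<Suc n. H k l * vec_index v l) / of_real r = e * vec_index v k / of_real r" by simp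
    thus ?thesis unfolding x_def sum_divide_distrib by (simp del: sum.lessThan_Suc)
  qed
  obtain w where w: "w 0 = x" "\<And>i j. i < Suc n \<Longrightarrow> j < Suc n \<Longrightarrow> (\<Sum>k<Suc n. w i k * cnj (w j k)) = of_bool (i = j)"
    using orthonormal_extension[OF _ x1] by auto
  have wc: "(\<Sum>i<Suc n. w i k * cnj (w i l)) = of_bool (k = l)" if "k < Suc n" "l < Suc n" for k l
    using orthonormal_complete[of "Suc n" w k l] w(2) that by blast
  \<comment> \<open>Compression of \<open>H\<close> to the orthogonal complement of the eigenvector \<open>x = w 0\<close>.\<close>
  define K where "K i j = (\<Sum>k<Suc n. \<Sum>l<Suc n. cnj (w (Suc i) k) * H k l * w (Suc j) l)" for i j
  have hc: "cnj (H i j) = H j i" if "i < Suc n" "j < Suc n" for i j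
    using Suc.prems[of j i] that by simp
  have herm: "K i j = cnj (K j i)" for i j
  proof -
    have "cnj (K j i) = (\<Sum>k<Suc n. \<Sum>l<Suc n. w (Suc j) k * H l k * cnj (w (Suc i) l))"
      unfolding K_def cnj_sum by (intro sum.cong refl) (use hc in \<open>simp add: mult.commute\<close>)
    also have "\<dots> = K i j" unfolding K_def
      by (subst sum.swap) (intro sum.cong refl, simp add: mult_ac)
    finally show ?thesis by simp
  qed
  from Suc.IH[of K] herm obtain y h where
    y: "\<And>i j. i<n \<Longrightarrow> j<n \<Longrightarrow> (\<Sum>k<n. y i k * cnj (y j k)) = of_bool (i = j)"
       "\<And>i k. i<n \<Longrightarrow> k<n \<Longrightarrow> (\<Sum>l<n. K k l * y i l) = of_real (h i) * y i k" by blast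
  have ereal: "e = of_real (Re e)"
  proof -
    have 1: "(\<Sum>k<Suc n. cnj (x k) * (\<Sum>l<Suc n. H k l * x l)) = e"
    proof -
      have "(\<Sum>k<Suc n. cnj (x k) * (\<Sum>l<Suc n. H k l * x l)) = (\<Sum>k<Suc n. e * (x k * cnj (x k)))"
        by (intro sum.cong refl) (subst xe, simp, simp only: mult_ac)
      also have "\<dots> = e" unfolding sum_distrib_left[symmetric] x1 by simp
      finally show ?thesis .
    qed
    have "cnj e = (\<Sum>k<Suc n. \<Sum>l<Suc n. x k * H l k * cnj (x l))"
      unfolding 1[symmetric] cnj_sum complex_cnj_mult sum_distrib_left
      by (intro sum.cong refl) (use hc in \<open>simp add: mult_ac\<close>)
    also have "\<dots> = (\<Sum>k<Suc n. cnj (x k) * (\<Sum>l<Suc n. H k l * x l))"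
      unfolding sum_distrib_left by (subst sum.swap) (intro sum.cong refl, simp add: mult_ac)
    finally have "cnj e = e" using 1 by simp
    thus ?thesis by (metis Reals_cnj_iff complex_is_Real_iff of_real_Re)
  qed
  \<comment> \<open>Eigenvectors of the compression \<open>K\<close> are coordinate vectors with
    respect to \<open>w 1, ..., w n\<close>; they are carried back to the full space here.\<close>
  define u where "u i k = (case i of 0 \<Rightarrow> x k | Suc i' \<Rightarrow> (\<Sum>j<n. y i' j * w (Suc j) k))" for i k
  define g where "g i = (case i of 0 \<Rightarrow> Re e | Suc i' \<Rightarrow> h i')" for i
  have uip: "(\<Sum>k<Suc n. u (Suc i) k * cnj (w j k)) = (case j of 0 \<Rightarrow> 0 | Suc j' \<Rightarrow> y i j')" if "i<n" "j<Suc n" for i j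
  proof -
    have "(\<Sum>k<Suc n. u (Suc i) k * cnj (w j k)) = (\<Sum>a<n. y i a * (\<Sum>k<Suc n. w (Suc a) k * cnj (w j k)))"
      unfolding u_def nat.case sum_distrib_right sum_distrib_left by (subst sum.swap) (simp only: mult.assoc)
    also have "\<dots> = (\<Sum>a<n. y i a * of_bool (Suc a = j))"
      by (intro sum.cong refl) (subst w(2), use that in auto)
    also have "\<dots> = (case j of 0 \<Rightarrow> 0 | Suc j' \<Rightarrow> y i j')"
      using that by (auto simp: of_bool_def if_distrib sum.delta cong: if_cong split: nat.split)
    finally show ?thesis .
  qed
  have orth: "(\<Sum>k<Suc n. u i k * cnj (u j k)) = of_bool (i = j)" if "i<Suc n" "j<Suc n" for i j
  proof -
    have S0: "(\<Sum>k<Suc n. u (Suc i) k * cnj (u j k)) = of_bool (Suc i = j)" if "i<n" "j<Suc n" for i j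
    proof (cases j)
      case 0
      thus ?thesis using uip[OF that(1), of 0] w(1) by (simp add: u_def[of 0] del: sum.lessThan_Suc)
    next
      case (Suc j')
      have "(\<Sum>k<Suc n. u (Suc i) k * cnj (u j k)) = (\<Sum>a<n. cnj (y j' a) * (\<Sum>k<Suc n. u (Suc i) k * cnj (w (Suc a) k)))"
        unfolding Suc u_def[of "Suc j'"] nat.case cnj_sum complex_cnj_mult sum_distrib_left
        by (subst sum.swap) (simp only: mult_ac)
      also have "\<dots> = (\<Sum>a<n. y i a * cnj (y j' a))"
        by (intro sum.cong refl) (subst uip, use that in \<open>auto simp: mult.commute\<close>)
      finally show ?thesis using y(1) that Suc by simp
    qed
    show ?thesis
    proof (cases i)
      case (Suc i') thus ?thesis using S0 that by simp
    next
      case 0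
      show ?thesis
      proof (cases j)
        case 0 thus ?thesis using \<open>i = 0\<close> x1 by (simp add: u_def del: sum.lessThan_Suc)
      next
        case (Suc j')
        have "(\<Sum>k<Suc n. u i k * cnj (u j k)) = cnj (\<Sum>k<Suc n. u j k * cnj (u i k))"
          unfolding cnj_sum by (simp add: mult.commute del: sum.lessThan_Suc)
        also have "\<dots> = of_bool (i = j)" unfolding Suc using S0[of j' i] that Suc \<open>i = 0\<close> by simp
        finally show ?thesis .
      qed
    qed
  qed
  have eig: "(\<Sum>l<Suc n. H k l * u i l) = of_real (g i) * u i k" if "i<Suc n" "k<Suc n" for i k
  proof (cases i)
    case 0 thus ?thesis using xe[OF that(2)] ereal by (simp add: u_def g_def del: sum.lessThan_Suc)
  next
    case (Suc i')
    hence i': "i' < n" using that by simp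
    define z where "z k = (\<Sum>l<Suc n. H k l * u i l)" for k
    have zc: "z k = (\<Sum>j<Suc n. (\<Sum>l<Suc n. z l * cnj (w j l)) * w j k)" if "k < Suc n" for k
    proof -
      have "(\<Sum>j<Suc n. (\<Sum>l<Suc n. z l * cnj (w j l)) * w j k) = (\<Sum>l<Suc n. z l * (\<Sum>j<Suc n. w j k * cnj (w j l)))"
        unfolding sum_distrib_right sum_distrib_left by (subst sum.swap) (simp only: mult_ac)
      also have "\<dots> = (\<Sum>l<Suc n. if k = l then z l else 0)"
        by (intro sum.cong refl) (subst wc, use that in auto)
      also have "\<dots> = z k" using that by (simp add: sum.delta' del: sum.lessThan_Suc)
      finally show ?thesis by simp
    qed
    \<comment> \<open>A hermitian matrix maps the complement of its eigenvector \<open>x\<close>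
      into itself, so the compression loses no component along \<open>w 0\<close>.\<close>
    have z0: "(\<Sum>l<Suc n. z l * cnj (w 0 l)) = 0"
    proof -
      have "(\<Sum>l<Suc n. z l * cnj (w 0 l)) = (\<Sum>m<Suc n. u i m * cnj (\<Sum>l<Suc n. H m l * x l))"
        unfolding z_def w(1) cnj_sum sum_distrib_right sum_distrib_left
        by (subst sum.swap) (intro sum.cong refl, use hc in \<open>simp add: mult_ac\<close>)
      also have "\<dots> = (\<Sum>m<Suc n. cnj e * (u i m * cnj (w 0 m)))"
        unfolding w(1) by (intro sum.cong refl) (subst xe, simp, simp only: mult_ac complex_cnj_mult)
      also have "\<dots> = 0" unfolding sum_distrib_left[symmetric] Suc using uip[OF i', of 0] by simp
      finally show ?thesis .
    qed
    have zS: "(\<Sum>l<Suc n. z l * cnj (w (Suc j) l)) = of_real (h i') * y i' j" if "j<n" for j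
    proof -
      have "(\<Sum>l<Suc n. z l * cnj (w (Suc j) l)) =
         (\<Sum>l<Suc n. \<Sum>m<Suc n. \<Sum>a<n. cnj (w (Suc j) l) * H l m * w (Suc a) m * y i' a)"
        unfolding z_def Suc u_def nat.case sum_distrib_right sum_distrib_left
        by (intro sum.cong refl) (simp add: mult_ac)
      also have "\<dots> = (\<Sum>l<Suc n. \<Sum>a<n. \<Sum>m<Suc n. cnj (w (Suc j) l) * H l m * w (Suc a) m * y i' a)"
        by (intro sum.cong refl sum.swap)
      also have "\<dots> = (\<Sum>a<n. \<Sum>l<Suc n. \<Sum>m<Suc n. cnj (w (Suc j) l) * H l m * w (Suc a) m * y i' a)"
        by (rule sum.swap)
      also have "\<dots> = (\<Sum>a<n. K j a * y i' a)"
        unfolding K_def sum_distrib_right ..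
      finally show ?thesis using y(2)[OF i' that] by simp
    qed
    have "z k = (\<Sum>j<Suc n. (\<Sum>l<Suc n. z l * cnj (w j l)) * w j k)" by (rule zc[OF that(2)])
    also have "\<dots> = (\<Sum>j<n. (\<Sum>l<Suc n. z l * cnj (w (Suc j) l)) * w (Suc j) k)"
      by (subst sum.lessThan_Suc_shift) (simp add: z0 del: sum.lessThan_Suc)
    also have "\<dots> = (\<Sum>j<n. of_real (h i') * y i' j * w (Suc j) k)"
      by (intro sum.cong refl) (simp add: zS del: sum.lessThan_Suc)
    also have "\<dots> = of_real (g i) * u i k" unfolding Suc u_def g_def nat.case sum_distrib_left by (simp add: mult.assoc)
    finally show ?thesis unfolding z_def .
  qed
  show ?case using orth eig by blast
qed

text \<open>\<open>u\<close> lists right singular vectors and \<open>h\<close> the squared singular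
  values with multiplicity. The remaining clauses are the consequences through which a matrix is
  accessed later: norms of images, \<open>singular_values\<close>, and determinants.\<close>

definition svd :: "nat \<Rightarrow> complex mat \<Rightarrow> (nat \<Rightarrow> nat \<Rightarrow> complex) \<Rightarrow> (nat \<Rightarrow> real) \<Rightarrow> bool" where
  "svd n A u h \<longleftrightarrow>
     (\<forall>i<n. h i \<ge> 0) \<and>
     (\<forall>i<n. \<forall>j<n. (\<Sum>k<n. u i k * cnj (u j k)) = of_bool (i = j)) \<and>
     (\<forall>k<n. \<forall>l<n. (\<Sum>i<n. u i k * cnj (u i l)) = of_bool (k = l)) \<and>
     (\<forall>i<n. \<forall>j<n. (\<Sum>k<n. (\<Sum>l<n. A $$ (k,l) * u i l) * cnj (\<Sum>l<n. A $$ (k,l) * u j l)) =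
        (if i = j then of_real (h i) else 0)) \<and>
     (\<forall>v. (\<Sum>k<n. (cmod (\<Sum>l<n. A $$ (k,l) * v l))\<^sup>2) = (\<Sum>i<n. h i * (cmod (\<Sum>k<n. v k * cnj (u i k)))\<^sup>2)) \<and>
     singular_values A = (\<lambda>i. sqrt (h i)) ` {..<n} \<and>
     (\<forall>s. det (s \<cdot>\<^sub>m 1\<^sub>m n + mat_adjoint A * A) = (\<Prod>i<n. s + of_real (h i))) \<and>
     (cmod (det A))\<^sup>2 = (\<Prod>i<n. h i)"

lemma mat_adjoint_index [simp]:
  assumes "A \<in> carrier_mat n n" "i < n" "j < n"
  shows "mat_adjoint A $$ (i,j) = conjugate (A $$ (j,i))"
  using assms by (simp add: mat_adjoint_def mat_of_rows_def)

lemma mat_adjoint_carrier: "A \<in> carrier_mat n n \<Longrightarrow> mat_adjoint A \<in> carrier_mat n n"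
  unfolding mat_adjoint_def by (auto simp: mat_of_rows_def)

lemma det_mat_adjoint:
  assumes A: "(A :: complex mat) \<in> carrier_mat n n"
  shows "det (mat_adjoint A) = cnj (det A)"
proof -
  interpret comm_ring_hom cnj by unfold_locales auto
  have "mat_adjoint A = transpose_mat (map_mat cnj A)"
    by (rule eq_matI) (use A carrier_matD[OF mat_adjoint_carrier[OF A]] in \<open>auto\<close>)
  hence "det (mat_adjoint A) = det (map_mat cnj A)" using det_transpose[of "map_mat cnj A" n] A by simp
  thus ?thesis by (simp add: hom_det)
qed

text \<open>Only \<open>mat_adjoint A * A\<close> is diagonalized. The images of the
  \<open>u i\<close> under \<open>A\<close> are then orthogonal with squared norms
  \<open>h i\<close>, which does the work of left singular vectors.\<close>

lemma svd_exists:
  assumes A: "(A :: complex mat) \<in> carrier_mat n n"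
  shows "\<exists>u h. svd n A u h"
proof -
  define H where "H i j = (\<Sum>k<n. cnj (A $$ (k,i)) * A $$ (k,j))" for i j
  have "H i j = cnj (H j i)" for i j by (simp add: H_def mult.commute)
  then obtain u and h :: "nat \<Rightarrow> real" where
    u: "\<And>i j. i<n \<Longrightarrow> j<n \<Longrightarrow> (\<Sum>k<n. u i k * cnj (u j k)) = of_bool (i = j)" and
    uH: "\<And>i k. i<n \<Longrightarrow> k<n \<Longrightarrow> (\<Sum>l<n. H k l * u i l) = of_real (h i) * u i k"
    using hermitian_spectral[of n H] by blast
  have uc: "(\<Sum>i<n. u i k * cnj (u i l)) = of_bool (k = l)" if "k<n" "l<n" for k l
    using orthonormal_complete[of n u k l] u that by blast
  define Av where "Av v k = (\<Sum>l<n. A $$ (k,l) * v l)" for v k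
  define c where "c v i = (\<Sum>k<n. v k * cnj (u i k))" for v i
  have ip: "(\<Sum>k<n. Av v k * cnj (Av w k)) = (\<Sum>i<n. (\<Sum>j<n. H i j * v j) * cnj (w i))" for v w
  proof -
    have "(\<Sum>k<n. Av v k * cnj (Av w k)) = (\<Sum>k<n. \<Sum>i<n. \<Sum>j<n. cnj (A $$ (k,i)) * A $$ (k,j) * v j * cnj (w i))"
      unfolding Av_def cnj_sum sum_product by (subst sum.swap) (simp add: mult_ac)
    also have "\<dots> = (\<Sum>i<n. \<Sum>k<n. \<Sum>j<n. cnj (A $$ (k,i)) * A $$ (k,j) * v j * cnj (w i))" by (rule sum.swap)
    also have "\<dots> = (\<Sum>i<n. \<Sum>j<n. \<Sum>k<n. cnj (A $$ (k,i)) * A $$ (k,j) * v j * cnj (w i))"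
      by (intro sum.cong refl sum.swap)
    also have "\<dots> = (\<Sum>i<n. (\<Sum>j<n. H i j * v j) * cnj (w i))"
      unfolding H_def sum_distrib_right by simp
    finally show ?thesis .
  qed
  have ex: "v k = (\<Sum>i<n. c v i * u i k)" if "k<n" for v k
  proof -
    have "(\<Sum>i<n. c v i * u i k) = (\<Sum>l<n. v l * (\<Sum>i<n. u i k * cnj (u i l)))"
      unfolding c_def sum_distrib_right sum_distrib_left by (subst sum.swap) (simp only: mult_ac)
    also have "\<dots> = (\<Sum>l<n. if k = l then v l else 0)"
      by (intro sum.cong refl) (subst uc, use that in auto)
    also have "\<dots> = v k" using that by (simp add: sum.delta')
    finally show ?thesis by simp
  qed
  have ipu: "(\<Sum>k<n. Av (u i) k * cnj (Av w k)) = of_real (h i) * cnj (c w i)" if "i<n" for i w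
  proof -
    have "(\<Sum>k<n. Av (u i) k * cnj (Av w k)) = (\<Sum>k<n. of_real (h i) * u i k * cnj (w k))"
      unfolding ip by (intro sum.cong refl) (simp add: uH that)
    also have "\<dots> = of_real (h i) * cnj (c w i)"
      unfolding c_def cnj_sum sum_distrib_left by (simp add: mult_ac)
    finally show ?thesis .
  qed
  have cu: "c (u j) i = of_bool (i = j)" if "i<n" "j<n" for i j
    unfolding c_def using u[of j i] that by auto
  have sq: "complex_of_real (\<Sum>k<n. (cmod (f k))\<^sup>2) = (\<Sum>k<n. f k * cnj (f k))" for f
    unfolding of_real_sum by (simp add: complex_norm_square del: of_real_power)
  have h0: "h i \<ge> 0" if "i<n" for i
  proof -
    have "complex_of_real (\<Sum>k<n. (cmod (Av (u i) k))\<^sup>2) = of_real (h i)"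
      unfolding sq ipu[OF that] cu[OF that that] by simp
    hence "h i = (\<Sum>k<n. (cmod (Av (u i) k))\<^sup>2)" by (metis of_real_eq_iff)
    thus ?thesis by (simp add: sum_nonneg)
  qed
  have nrm: "(\<Sum>k<n. (cmod (Av v k))\<^sup>2) = (\<Sum>i<n. h i * (cmod (c v i))\<^sup>2)" for v
  proof -
    have avx: "Av v k = (\<Sum>i<n. c v i * Av (u i) k)" for k
    proof -
      have "Av v k = (\<Sum>l<n. A $$ (k,l) * (\<Sum>i<n. c v i * u i l))"
        unfolding Av_def by (intro sum.cong refl) (subst ex[of _ v], auto)
      also have "\<dots> = (\<Sum>i<n. c v i * Av (u i) k)" unfolding Av_def sum_distrib_left
        by (subst sum.swap) (simp only: mult_ac)
      finally show ?thesis .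
    qed
    hence "(\<Sum>k<n. Av v k * cnj (Av v k)) = (\<Sum>k<n. (\<Sum>i<n. c v i * Av (u i) k) * cnj (Av v k))"
      by (intro sum.cong refl arg_cong2[where f = "(*)"] avx)
    also have "\<dots> = (\<Sum>i<n. c v i * (\<Sum>k<n. Av (u i) k * cnj (Av v k)))"
      unfolding sum_distrib_right sum_distrib_left by (subst sum.swap) (simp only: mult_ac)
    also have "\<dots> = (\<Sum>i<n. of_real (h i) * (c v i * cnj (c v i)))"
      by (intro sum.cong refl) (simp add: ipu mult_ac)
    also have "\<dots> = of_real (\<Sum>i<n. h i * (cmod (c v i))\<^sup>2)"
      unfolding of_real_sum by (simp add: complex_norm_square del: of_real_power)
    finally show ?thesis unfolding sq[symmetric] by (simp only: of_real_eq_iff)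
  qed
  define B where "B = mat_adjoint A * A"
  have B: "B \<in> carrier_mat n n" unfolding B_def by (rule mult_carrier_mat[OF mat_adjoint_carrier[OF A] A])
  have BH: "B $$ (i,j) = H i j" if "i<n" "j<n" for i j
    using that A carrier_matD[OF mat_adjoint_carrier[OF A]]
    by (auto simp: B_def scalar_prod_def H_def lessThan_atLeast0 intro!: sum.cong)
  have sv: "singular_values A = (\<lambda>i. sqrt (h i)) ` {..<n}"
  proof (intro equalityI subsetI)
    fix s assume "s \<in> singular_values A"
    then obtain a where s: "s = sqrt (Re a)" and "eigenvalue B a" unfolding singular_values_def B_def by auto
    then obtain v where v: "v \<in> carrier_vec n" "v \<noteq> 0\<^sub>v n" "B *\<^sub>v v = a \<cdot>\<^sub>v v"
      using B unfolding eigenvalue_def eigenvector_def by auto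
    define x where "x k = vec_index v k" for k
    have xB: "(\<Sum>l<n. H k l * x l) = a * x k" if "k<n" for k
    proof -
      have "vec_index (B *\<^sub>v v) k = a * x k" using v that by (simp add: x_def)
      thus ?thesis using that v(1) B by (auto simp: scalar_prod_def lessThan_atLeast0 x_def BH intro!: sum.cong)
    qed
    \<comment> \<open>An eigenvector has a nonzero coordinate along some \<open>u i\<close>, and
      this coordinate forces its eigenvalue to be \<open>h i\<close>.\<close>
    have "\<exists>i<n. c x i \<noteq> 0"
    proof (rule ccontr)
      assume "\<not> ?thesis"
      hence "\<And>k. k<n \<Longrightarrow> x k = 0" using ex[of _ x] by simp
      hence "v = 0\<^sub>v n" using v(1) by (intro eq_vecI) (auto simp: x_def)
      thus False using v by simp
    qed
    then obtain i where i: "i<n" "c x i \<noteq> 0" by blast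
    have "(\<Sum>k<n. Av x k * cnj (Av (u i) k)) = a * c x i"
      unfolding ip c_def sum_distrib_left by (intro sum.cong refl) (simp add: xB)
    moreover have "(\<Sum>k<n. Av x k * cnj (Av (u i) k)) = cnj (\<Sum>k<n. Av (u i) k * cnj (Av x k))"
      unfolding cnj_sum by (simp add: mult.commute)
    ultimately have "a * c x i = of_real (h i) * c x i" using ipu[OF i(1), of x] by auto
    hence "a = of_real (h i)" using i by auto
    thus "s \<in> (\<lambda>i. sqrt (h i)) ` {..<n}" using s i by auto
  next
    fix s assume "s \<in> (\<lambda>i. sqrt (h i)) ` {..<n}"
    then obtain i where i: "i<n" "s = sqrt (h i)" by auto
    define v where "v = vec n (u i)"
    have "B *\<^sub>v v = of_real (h i) \<cdot>\<^sub>v v"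
    proof (rule eq_vecI)
      fix k assume "k < dim_vec (of_real (h i) \<cdot>\<^sub>v v)"
      hence k: "k<n" by (simp add: v_def)
      have "vec_index (B *\<^sub>v v) k = (\<Sum>l<n. H k l * u i l)"
        using k B by (auto simp: scalar_prod_def v_def BH lessThan_atLeast0 intro!: sum.cong)
      thus "vec_index (B *\<^sub>v v) k = vec_index (of_real (h i) \<cdot>\<^sub>v v) k" using uH[OF i(1) k] k by (simp add: v_def)
    qed (use B in \<open>auto simp: v_def\<close>)
    moreover have "v \<noteq> 0\<^sub>v n"
    proof
      assume "v = 0\<^sub>v n"
      hence "\<And>k. k < n \<Longrightarrow> u i k = 0" unfolding v_def by (metis index_vec index_zero_vec(1))
      thus False using u[OF i(1) i(1)] by simp
    qed
    ultimately have "eigenvector B v (of_real (h i))" using B unfolding eigenvector_def by (auto simp: v_def)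
    hence "eigenvalue B (of_real (h i))" unfolding eigenvalue_def by blast
    thus "s \<in> singular_values A" unfolding singular_values_def B_def[symmetric] using i by force
  qed
  have dt: "det (s \<cdot>\<^sub>m 1\<^sub>m n + B) = (\<Prod>i<n. s + of_real (h i))" for s
  proof -
    define U where "U = Matrix.mat n n (\<lambda>(k,i). u i k)"
    define W where "W = Matrix.mat n n (\<lambda>(i,k). cnj (u i k))"
    define D where "D = Matrix.mat n n (\<lambda>(i,j). if i = j then s + of_real (h i) else 0 :: complex)"
    have cr: "U \<in> carrier_mat n n" "W \<in> carrier_mat n n" "D \<in> carrier_mat n n" "s \<cdot>\<^sub>m 1\<^sub>m n + B \<in> carrier_mat n n"
      using B by (auto simp: U_def W_def D_def)
    have "W * U = 1\<^sub>m n"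
      by (rule eq_matI) (use u in \<open>auto simp: U_def W_def scalar_prod_def lessThan_atLeast0 mult.commute\<close>)
    hence "det W * det U = 1" using det_mult[OF cr(2,1)] by simp
    hence U0: "det U \<noteq> 0" by auto
    have "(s \<cdot>\<^sub>m 1\<^sub>m n + B) * U = U * D"
    proof (rule eq_matI)
      fix k i assume "k < dim_row (U * D)" "i < dim_col (U * D)"
      hence k: "k<n" "i<n" using cr by auto
      have "((s \<cdot>\<^sub>m 1\<^sub>m n + B) * U) $$ (k,i) = (\<Sum>l<n. ((if k = l then s else 0) + H k l) * u i l)"
        using k B by (auto simp: scalar_prod_def U_def BH lessThan_atLeast0 intro!: sum.cong)
      also have "\<dots> = (\<Sum>l<n. if k = l then s * u i l else 0) + (\<Sum>l<n. H k l * u i l)"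
        unfolding sum.distrib[symmetric] by (intro sum.cong) (auto simp: algebra_simps)
      also have "\<dots> = (s + of_real (h i)) * u i k"
        using k uH by (simp add: sum.delta' algebra_simps)
      also have "\<dots> = (\<Sum>l<n. if l = i then u l k * (s + of_real (h l)) else 0)" using k by (simp add: sum.delta mult.commute)
      also have "\<dots> = (U * D) $$ (k,i)"
        using k unfolding lessThan_atLeast0 by (simp add: scalar_prod_def U_def D_def if_distrib cong: if_cong)
      finally show "((s \<cdot>\<^sub>m 1\<^sub>m n + B) * U) $$ (k,i) = (U * D) $$ (k,i)" .
    qed (use cr B in auto)
    hence "det (s \<cdot>\<^sub>m 1\<^sub>m n + B) * det U = det U * det D" using det_mult[OF cr(4,1)] det_mult[OF cr(1,3)] by metis
    hence "det (s \<cdot>\<^sub>m 1\<^sub>m n + B) = det D" using U0 by (metis mult.commute mult_left_cancel)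
    also have "det D = prod_list (diag_mat D)"
      by (rule det_upper_triangular) (use cr in \<open>auto simp: D_def\<close>)
    also have "\<dots> = (\<Prod>i<n. s + of_real (h i))"
      by (auto simp: prod_list_diag_prod D_def lessThan_atLeast0 intro!: prod.cong)
    finally show ?thesis .
  qed
  have "det B = (\<Prod>i<n. of_real (h i))"
  proof -
    have "0 \<cdot>\<^sub>m 1\<^sub>m n + B = B" by (rule eq_matI) (use B in auto)
    thus ?thesis using dt[of 0] by simp
  qed
  moreover have "det B = of_real ((cmod (det A))\<^sup>2)"
    unfolding B_def det_mult[OF mat_adjoint_carrier[OF A] A] det_mat_adjoint[OF A]
    by (simp add: complex_norm_square mult.commute del: of_real_power)
  ultimately have dA: "(cmod (det A))\<^sup>2 = (\<Prod>i<n. h i)"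
    by (metis of_real_eq_iff of_real_prod)
  have im: "(\<Sum>k<n. Av (u i) k * cnj (Av (u j) k)) = (if i = j then of_real (h i) else 0)" if "i<n" "j<n" for i j
    unfolding ipu[OF that(1)] cu[OF that] by simp
  have "svd n A u h"
    unfolding svd_def
    by (intro conjI allI impI)
      (rule h0 u uc im[unfolded Av_def] nrm[unfolded Av_def c_def] sv dt[unfolded B_def] dA; assumption)+
  thus ?thesis by blast
qed

text \<open>A maximal independent set of columns has as many elements as the rank; these columns are
  \<open>c\<close>, and the coordinates of all columns in them are \<open>X\<close>.\<close>

lemma rank_factorization:
  assumes A: "(A :: complex mat) \<in> carrier_mat n n"
  shows "\<exists>c X. \<forall>k<n. \<forall>l<n. A $$ (k,l) = (\<Sum>a<vec_space.rank n A. c a k * X a l)"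
proof -
  interpret vec_space "TYPE(complex)" n .
  let ?P = "\<lambda>T. T \<subseteq> set (cols A) \<and> lin_indpt T"
  have carr: "set (cols A) \<subseteq> carrier_vec n" using A cols_dim by blast
  have "lin_indpt {}" by (simp add: lin_dep_def)
  then obtain C where C: "finite C" "maximal C ?P"
    using maximal_exists_superset[of "set (cols A)" ?P "{}"] by auto
  have CC: "C \<subseteq> set (cols A)" "lin_indpt C" using C(2) unfolding maximal_def by auto
  have r: "rank A = card C" using rank_card_indpt[OF A C(2)] .
  have Cc: "C \<subseteq> carrier_vec n" using CC carr by auto
  have sp: "s \<in> span C" if s: "s \<in> set (cols A)" for s
  proof (cases "s \<in> C")
    case True
    show ?thesis by (rule span_mem) (use True Cc in simp_all)
  next
    case False
    have "C \<subset> C \<union> {s}" "C \<union> {s} \<subseteq> set (cols A)" using False s CC(1) by auto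
    hence ld: "lin_dep (C \<union> {s})" using C(2) unfolding maximal_def by (metis psubsetE)
    have sc: "s \<in> carrier_vec n" using carr s by auto
    show ?thesis using lin_dep_iff_in_span[OF _ CC(2) _ False] ld Cc sc by simp
  qed
  obtain f where f: "bij_betw f {..<card C} C" using C(1) ex_bij_betw_nat_finite[of C] by (auto simp: lessThan_atLeast0)
  have "\<exists>x. \<forall>k<n. A $$ (k,l) = (\<Sum>a<card C. vec_index (f a) k * x a)" if l: "l < n" for l
  proof -
    have "col A l \<in> set (cols A)" using A l by (auto simp: cols_def)
    from finite_in_span[OF C(1) _ sp[OF this]] Cc obtain a where a: "lincomb a C = col A l" by auto
    have "A $$ (k,l) = (\<Sum>i<card C. vec_index (f i) k * a (f i))" if k: "k < n" for k
    proof -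
      have "A $$ (k,l) = vec_index (lincomb a C) k" using a A k l by auto
      also have "\<dots> = (\<Sum>x\<in>C. a x * vec_index x k)" by (rule lincomb_index[OF k Cc])
      also have "\<dots> = (\<Sum>i<card C. a (f i) * vec_index (f i) k)"
        by (rule sum.reindex_bij_betw[OF f, symmetric])
      finally show ?thesis by (simp add: mult.commute)
    qed
    thus ?thesis by (intro exI[of _ "\<lambda>i. a (f i)"]) auto
  qed
  then obtain X where "\<forall>l<n. \<forall>k<n. A $$ (k,l) = (\<Sum>a<card C. vec_index (f a) k * X l a)" by metis
  thus ?thesis unfolding r by (intro exI[of _ "\<lambda>a k. vec_index (f a) k"] exI[of _ "\<lambda>a l. X l a"]) auto
qed

text \<open>The homogeneous system has fewer equations than unknowns. It is padded with zero rows to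
  a square matrix, so that the vanishing determinant yields a kernel vector; the padding row with
  index \<open>r\<close> witnesses that the transpose is singular.\<close>

lemma nontrivial_solution:
  fixes Y :: "nat \<Rightarrow> 'i \<Rightarrow> complex"
  assumes "finite S" "r < card S"
  shows "\<exists>y. (\<exists>i\<in>S. y i \<noteq> 0) \<and> (\<forall>a<r. (\<Sum>i\<in>S. Y a i * y i) = 0)"
proof -
  define m where "m = card S"
  obtain f where f: "bij_betw f {..<m} S" unfolding m_def using assms(1) ex_bij_betw_nat_finite[of S] by (auto simp: lessThan_atLeast0)
  define Z where "Z = Matrix.mat m m (\<lambda>(a,i). if a < r then Y a (f i) else 0)"
  have Z: "Z \<in> carrier_mat m m" by (simp add: Z_def)
  have "transpose_mat Z *\<^sub>v unit_vec m r = 0\<^sub>v m"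
    by (rule eq_vecI) (use assms in \<open>auto simp: Z_def m_def scalar_prod_right_unit\<close>)
  moreover have "unit_vec m r \<in> (carrier_vec m :: complex vec set)" "unit_vec m r \<noteq> (0\<^sub>v m :: complex vec)"
    using assms by (auto simp: m_def dest: arg_cong[of _ _ "\<lambda>v. vec_index v r"])
  ultimately have "\<exists>v. v \<in> carrier_vec m \<and> v \<noteq> 0\<^sub>v m \<and> transpose_mat Z *\<^sub>v v = 0\<^sub>v m"
    by (intro exI[of _ "unit_vec m r"] conjI)
  hence "det (transpose_mat Z) = 0"
    using det_0_iff_vec_prod_zero[OF transpose_carrier_mat[THEN iffD2, OF Z]] by blast
  hence "det Z = 0" using det_transpose[OF Z] by simp
  then obtain v where v: "v \<in> carrier_vec m" "v \<noteq> 0\<^sub>v m" "Z *\<^sub>v v = 0\<^sub>v m"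
    using det_0_iff_vec_prod_zero[OF Z] by blast
  define g where "g = the_inv_into {..<m} f"
  have gf: "g (f i) = i" if "i < m" for i
    unfolding g_def using f that by (simp add: bij_betw_def the_inv_into_f_f)
  have "\<exists>i<m. vec_index v i \<noteq> 0"
  proof (rule ccontr)
    assume "\<not> ?thesis"
    hence "v = 0\<^sub>v m" using v(1) by (intro eq_vecI) auto
    thus False using v by simp
  qed
  then obtain i where i: "i<m" "vec_index v i \<noteq> 0" by blast
  have "(\<Sum>i\<in>S. Y a i * vec_index v (g i)) = 0" if a: "a<r" for a
  proof -
    have am: "a < m" using a assms by (simp add: m_def)
    have "(\<Sum>i\<in>S. Y a i * vec_index v (g i)) = (\<Sum>i<m. Y a (f i) * vec_index v (g (f i)))"
      by (rule sum.reindex_bij_betw[OF f, symmetric])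
    also have "\<dots> = (\<Sum>i<m. Y a (f i) * vec_index v i)" by (intro sum.cong refl) (simp add: gf)
    also have "\<dots> = vec_index (Z *\<^sub>v v) a"
      using am a v(1) Z by (auto simp: Z_def scalar_prod_def lessThan_atLeast0 intro!: sum.cong)
    also have "\<dots> = 0" using v am by simp
    finally show ?thesis .
  qed
  moreover have "f i \<in> S" "vec_index v (g (f i)) \<noteq> 0" using i f gf by (auto simp: bij_betw_def)
  ultimately show ?thesis by (intro exI[of _ "\<lambda>i. vec_index v (g i)"]) blast
qed

section \<open>Norms, extreme singular values and rank read off from a singular value
  decomposition\<close>

lemma complex_square_sum: "complex_of_real (\<Sum>k\<in>S. (cmod (f k))\<^sup>2) = (\<Sum>k\<in>S. f k * cnj (f k))"
  unfolding of_real_sum by (simp add: complex_norm_square del: of_real_power)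

context
  fixes n :: nat and A u h
  assumes svd: "svd n A u h"

begin

lemmas svd_nonneg = svd[unfolded svd_def, THEN conjunct1, rule_format]

lemmas svd_orth = svd[unfolded svd_def, THEN conjunct2, THEN conjunct1, rule_format]

lemmas svd_complete = svd[unfolded svd_def, THEN conjunct2, THEN conjunct2, THEN conjunct1, rule_format]

lemmas svd_images = svd[unfolded svd_def, THEN conjunct2, THEN conjunct2, THEN conjunct2, THEN conjunct1, rule_format]

lemmas svd_norm = svd[unfolded svd_def, THEN conjunct2, THEN conjunct2, THEN conjunct2, THEN conjunct2, THEN conjunct1, rule_format]

lemmas svd_values = svd[unfolded svd_def, THEN conjunct2, THEN conjunct2, THEN conjunct2, THEN conjunct2, THEN conjunct2, THEN conjunct1, rule_format]

lemmas svd_det_shift = svd[unfolded svd_def, THEN conjunct2, THEN conjunct2, THEN conjunct2, THEN conjunct2, THEN conjunct2, THEN conjunct2, THEN conjunct1, rule_format]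

lemmas svd_det = svd[unfolded svd_def, THEN conjunct2, THEN conjunct2, THEN conjunct2, THEN conjunct2, THEN conjunct2, THEN conjunct2, THEN conjunct2, rule_format]

lemma svd_parseval: "(\<Sum>i<n. (cmod (\<Sum>k<n. v k * cnj (u i k)))\<^sup>2) = (\<Sum>k<n. (cmod (v k))\<^sup>2)"
proof -
  have "complex_of_real (\<Sum>i<n. (cmod (\<Sum>k<n. v k * cnj (u i k)))\<^sup>2)
      = (\<Sum>i<n. \<Sum>k<n. \<Sum>l<n. v k * cnj (v l) * (u i l * cnj (u i k)))"
    unfolding complex_square_sum cnj_sum sum_product by (simp add: mult_ac)
  also have "\<dots> = (\<Sum>k<n. \<Sum>i<n. \<Sum>l<n. v k * cnj (v l) * (u i l * cnj (u i k)))" by (rule sum.swap)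
  also have "\<dots> = (\<Sum>k<n. \<Sum>l<n. \<Sum>i<n. v k * cnj (v l) * (u i l * cnj (u i k)))"
    by (intro sum.cong refl sum.swap)
  also have "\<dots> = (\<Sum>k<n. \<Sum>l<n. if l = k then v k * cnj (v l) else 0)"
    unfolding sum_distrib_left[symmetric] by (intro sum.cong refl) (auto simp: svd_complete)
  also have "\<dots> = (\<Sum>k<n. v k * cnj (v k))" by (intro sum.cong refl) (simp add: sum.delta)
  also have "\<dots> = complex_of_real (\<Sum>k<n. (cmod (v k))\<^sup>2)" by (rule complex_square_sum[symmetric])
  finally show ?thesis by (simp only: of_real_eq_iff)
qed

lemma svd_image_norm: "i < n \<Longrightarrow> (\<Sum>k<n. (cmod (\<Sum>l<n. A $$ (k,l) * u i l))\<^sup>2) = h i"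
  using svd_images[of i i] unfolding complex_square_sum[symmetric] by (simp del: of_real_sum)

text \<open>Parseval's identity for each conjugated row of \<open>A\<close> in the orthonormal basis
  \<open>u\<close>.\<close>

lemma svd_hilbert_schmidt: "(\<Sum>k<n. \<Sum>l<n. (cmod (A $$ (k,l)))\<^sup>2) = (\<Sum>i<n. h i)"
proof -
  have "(\<Sum>i<n. h i) = (\<Sum>i<n. \<Sum>k<n. (cmod (\<Sum>l<n. A $$ (k,l) * u i l))\<^sup>2)"
    by (intro sum.cong refl) (simp add: svd_image_norm)
  also have "\<dots> = (\<Sum>k<n. \<Sum>i<n. (cmod (\<Sum>l<n. cnj (A $$ (k,l)) * cnj (u i l)))\<^sup>2)"
    unfolding complex_cnj_mult[symmetric] cnj_sum[symmetric] complex_mod_cnj by (rule sum.swap)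
  also have "\<dots> = (\<Sum>k<n. \<Sum>l<n. (cmod (A $$ (k,l)))\<^sup>2)" by (rule sum.cong[OF refl], subst svd_parseval, simp)
  finally show ?thesis by simp
qed

lemma svd_max: assumes "n > 0" shows "\<And>i. i < n \<Longrightarrow> h i \<le> (max_sv A)\<^sup>2" "max_sv A \<ge> 0" "\<exists>i<n. max_sv A = sqrt (h i)"
proof -
  have fin: "finite (singular_values A)" "singular_values A \<noteq> {}" using assms by (auto simp: svd_values)
  have le: "sqrt (h i) \<le> max_sv A" if "i<n" for i
    unfolding max_sv_def using fin that by (intro Max_ge) (auto simp: svd_values)
  show "max_sv A \<ge> 0" using le[OF assms] svd_nonneg[OF assms] by (meson order_trans real_sqrt_ge_zero)
  show "h i \<le> (max_sv A)\<^sup>2" if "i<n" for i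
    using power_mono[OF le[OF that], of 2] svd_nonneg[OF that] by simp
  show "\<exists>i<n. max_sv A = sqrt (h i)"
    using Max_in[OF fin] unfolding max_sv_def svd_values by auto
qed

lemma svd_min: assumes "n > 0" shows "\<And>i. i < n \<Longrightarrow> (min_sv A)\<^sup>2 \<le> h i" "min_sv A \<ge> 0" "\<exists>i<n. min_sv A = sqrt (h i)"
proof -
  have fin: "finite (singular_values A)" "singular_values A \<noteq> {}" using assms by (auto simp: svd_values)
  show m: "\<exists>i<n. min_sv A = sqrt (h i)"
    using Min_in[OF fin] unfolding min_sv_def svd_values by auto
  thus p: "min_sv A \<ge> 0" using svd_nonneg by auto
  have le: "min_sv A \<le> sqrt (h i)" if "i<n" for i
    unfolding min_sv_def using fin that by (intro Min_le) (auto simp: svd_values)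
  show "(min_sv A)\<^sup>2 \<le> h i" if "i<n" for i
    using power_mono[OF le[OF that] p, of 2] svd_nonneg[OF that] by simp
qed

lemma svd_norm_le: assumes "n > 0"
  shows "(\<Sum>k<n. (cmod (\<Sum>l<n. A $$ (k,l) * v l))\<^sup>2) \<le> (max_sv A)\<^sup>2 * (\<Sum>k<n. (cmod (v k))\<^sup>2)"
  unfolding svd_norm svd_parseval[of v, symmetric] sum_distrib_left
  by (intro sum_mono mult_right_mono svd_max assms) auto

lemma svd_norm_ge: assumes "n > 0"
  shows "(min_sv A)\<^sup>2 * (\<Sum>k<n. (cmod (v k))\<^sup>2) \<le> (\<Sum>k<n. (cmod (\<Sum>l<n. A $$ (k,l) * v l))\<^sup>2)"
  unfolding svd_norm svd_parseval[of v, symmetric] sum_distrib_left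
  by (intro sum_mono mult_right_mono svd_min assms) auto

lemma svd_unit: "i < n \<Longrightarrow> (\<Sum>k<n. (cmod (u i k))\<^sup>2) = 1"
  using svd_orth[of i i] unfolding complex_square_sum[symmetric] by (simp del: of_real_sum)

text \<open>If more singular values than the rank were nonzero, some nontrivial combination of their
  vectors would lie in the kernel of \<open>A\<close>; but by \<open>svd_norm\<close> the map
  \<open>A\<close> is injective on the span of these vectors.\<close>

lemma svd_rank:
  assumes A: "A \<in> carrier_mat n n"
  shows "card {i. i < n \<and> h i \<noteq> 0} \<le> vec_space.rank n A"
proof (rule ccontr)
  define S where "S = {i. i < n \<and> h i \<noteq> 0}"
  assume "\<not> ?thesis"
  hence less: "vec_space.rank n A < card S" by (simp add: S_def)
  have fin: "finite S" by (simp add: S_def)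
  obtain c X where cX: "\<And>k l. k<n \<Longrightarrow> l<n \<Longrightarrow> A $$ (k,l) = (\<Sum>a<vec_space.rank n A. c a k * X a l)"
    using rank_factorization[OF A] by blast
  obtain y where y: "\<exists>i\<in>S. y i \<noteq> 0" "\<And>a. a < vec_space.rank n A \<Longrightarrow> (\<Sum>i\<in>S. (\<Sum>l<n. X a l * u i l) * y i) = 0"
    using nontrivial_solution[OF fin less, of "\<lambda>a i. \<Sum>l<n. X a l * u i l"] by blast
  define v where "v l = (\<Sum>i\<in>S. y i * u i l)" for l
  have Av0: "(\<Sum>l<n. A $$ (k,l) * v l) = 0" if k: "k<n" for k
  proof -
    have "(\<Sum>l<n. A $$ (k,l) * v l) = (\<Sum>l<n. \<Sum>a<vec_space.rank n A. \<Sum>i\<in>S. c a k * (X a l * u i l * y i))"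
    proof (intro sum.cong refl)
      fix l assume l: "l \<in> {..<n}"
      have "A $$ (k,l) * v l = (\<Sum>a<vec_space.rank n A. c a k * X a l) * (\<Sum>i\<in>S. y i * u i l)"
        using l k by (simp add: cX v_def)
      also have "\<dots> = (\<Sum>a<vec_space.rank n A. \<Sum>i\<in>S. c a k * (X a l * u i l * y i))"
        unfolding sum_product by (intro sum.cong refl) (simp add: mult_ac)
      finally show "A $$ (k,l) * v l = (\<Sum>a<vec_space.rank n A. \<Sum>i\<in>S. c a k * (X a l * u i l * y i))" .
    qed
    also have "\<dots> = (\<Sum>a<vec_space.rank n A. \<Sum>l<n. \<Sum>i\<in>S. c a k * (X a l * u i l * y i))" by (rule sum.swap)
    also have "\<dots> = (\<Sum>a<vec_space.rank n A. \<Sum>i\<in>S. \<Sum>l<n. c a k * (X a l * u i l * y i))"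
      by (intro sum.cong refl sum.swap)
    also have "\<dots> = (\<Sum>a<vec_space.rank n A. c a k * (\<Sum>i\<in>S. (\<Sum>l<n. X a l * u i l) * y i))"
      by (simp add: sum_distrib_left sum_distrib_right)
    also have "\<dots> = 0" using y(2) by simp
    finally show ?thesis .
  qed
  have cv: "(\<Sum>k<n. v k * cnj (u i k)) = y i" if "i \<in> S" for i
  proof -
    have "(\<Sum>k<n. v k * cnj (u i k)) = (\<Sum>j\<in>S. y j * (\<Sum>k<n. u j k * cnj (u i k)))"
      unfolding v_def sum_distrib_right sum_distrib_left by (subst sum.swap) (simp only: mult.assoc)
    also have "\<dots> = (\<Sum>j\<in>S. if j = i then y j else 0)"
      by (intro sum.cong refl) (use that in \<open>auto simp: svd_orth S_def\<close>)
    also have "\<dots> = y i" using that fin by (simp add: sum.delta)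
    finally show ?thesis .
  qed
  obtain i where i: "i \<in> S" "y i \<noteq> 0" using y(1) by blast
  have "0 = (\<Sum>i<n. h i * (cmod (\<Sum>k<n. v k * cnj (u i k)))\<^sup>2)"
    unfolding svd_norm[symmetric] using Av0 by simp
  hence "\<forall>i\<in>{..<n}. h i * (cmod (\<Sum>k<n. v k * cnj (u i k)))\<^sup>2 = 0"
    by (subst sum_nonneg_eq_0_iff[symmetric]) (auto simp: svd_nonneg)
  hence "h i * (cmod (\<Sum>k<n. v k * cnj (u i k)))\<^sup>2 = 0" using i by (auto simp: S_def)
  thus False using cv[OF i(1)] i by (auto simp: S_def)
qed

text \<open>This is how the low rank of the deterministic perturbation is used: with bounded norm,
  its squared Hilbert-Schmidt norm is small compared with the dimension.\<close>

lemma svd_hilbert_schmidt_rank: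
  assumes A: "A \<in> carrier_mat n n" and n: "n > 0"
  shows "(\<Sum>k<n. \<Sum>l<n. (cmod (A $$ (k,l)))\<^sup>2) \<le> real (vec_space.rank n A) * (max_sv A)\<^sup>2"
proof -
  have "(\<Sum>i<n. h i) = (\<Sum>i\<in>{i. i < n \<and> h i \<noteq> 0}. h i)"
    by (rule sum.mono_neutral_right) auto
  also have "\<dots> \<le> real (card {i. i < n \<and> h i \<noteq> 0}) * (max_sv A)\<^sup>2"
    using svd_max[OF n] by (intro sum_bounded_above) auto
  also have "\<dots> \<le> real (vec_space.rank n A) * (max_sv A)\<^sup>2"
    using svd_rank[OF A] by (intro mult_right_mono) auto
  finally show ?thesis by (simp add: svd_hilbert_schmidt)
qed

end

section \<open>Log-determinants through resolutions of the identity\<close>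

lemma borel_measurable_cnj [measurable (raw)]:
  "f \<in> borel_measurable M \<Longrightarrow> (\<lambda>x. cnj (f x)) \<in> borel_measurable M"
  by (rule measurable_compose[OF _ borel_measurable_continuous_onI[OF continuous_on_cnj[OF continuous_on_id]]])

lemma integral_sum_sum_mult:
  fixes f :: "'a \<Rightarrow> 'b \<Rightarrow> 'x \<Rightarrow> complex"
  assumes "\<And>k l. k \<in> A \<Longrightarrow> l \<in> B \<Longrightarrow> integrable M (f k l)"
  shows "(LINT x|M. (\<Sum>k\<in>A. \<Sum>l\<in>B. f k l x * c k l)) = (\<Sum>k\<in>A. \<Sum>l\<in>B. (LINT x|M. f k l x) * c k l)"
proof -
  have "(LINT x|M. (\<Sum>k\<in>A. \<Sum>l\<in>B. f k l x * c k l)) = (\<Sum>k\<in>A. LINT x|M. (\<Sum>l\<in>B. f k l x * c k l))"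
    by (rule Bochner_Integration.integral_sum, rule Bochner_Integration.integrable_sum, rule integrable_mult_left) (rule assms)
  also have "\<dots> = (\<Sum>k\<in>A. \<Sum>l\<in>B. LINT x|M. f k l x * c k l)"
    by (intro sum.cong refl, rule Bochner_Integration.integral_sum, rule integrable_mult_left) (rule assms)
  also have "\<dots> = (\<Sum>k\<in>A. \<Sum>l\<in>B. (LINT x|M. f k l x) * c k l)"
    by (intro sum.cong refl) simp
  finally show ?thesis .
qed

text \<open>Jensen's inequality, from the tangent of the logarithm at the mean
  \<open>a\<close>.\<close>

lemma ln_weighted_sum_le:
  fixes w x :: "'i \<Rightarrow> real"
  assumes "\<And>i. i \<in> I \<Longrightarrow> w i \<ge> 0" "(\<Sum>i\<in>I. w i) = 1" "\<And>i. i \<in> I \<Longrightarrow> x i > 0" and a: "(\<Sum>i\<in>I. w i * x i) = a" "a > 0"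
  shows "(\<Sum>i\<in>I. w i * ln (x i)) \<le> ln a"
proof -
  have "w i * ln (x i) \<le> w i * (x i / a - 1 + ln a)" if "i \<in> I" for i
  proof (intro mult_left_mono)
    have "ln (x i / a) \<le> x i / a - 1" using assms(3)[OF that] a by (intro ln_le_minus_one) simp
    thus "ln (x i) \<le> x i / a - 1 + ln a" using assms(3)[OF that] a by (simp add: ln_div)
  qed (use assms that in auto)
  hence "(\<Sum>i\<in>I. w i * ln (x i)) \<le> (\<Sum>i\<in>I. w i * (x i / a - 1 + ln a))" by (rule sum_mono)
  also have "\<dots> = (\<Sum>i\<in>I. w i * x i) / a + (\<Sum>i\<in>I. w i) * (ln a - 1)"
    unfolding sum_divide_distrib sum_distrib_right sum.distrib[symmetric]
    by (intro sum.cong refl) (simp add: algebra_simps)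
  also have "\<dots> = ln a" using assms by simp
  finally show ?thesis .
qed

text \<open>With \<open>s\<close> the value of the argument at \<open>e = 0\<close>, both
  \<open>a \<le> s / \<tau>\<close> and \<open>\<tau>\<^sup>2 \<le> s\<close> hold, so the argument
  grows at most by the factor \<open>(1 + e / \<tau>)\<^sup>2\<close>.\<close>

lemma ln_shift_upper:
  fixes a e \<tau> :: real
  assumes "a \<ge> 0" "e \<ge> 0" "\<tau> > 0"
  shows "ln (\<tau>\<^sup>2 + (a + e)\<^sup>2) \<le> ln (\<tau>\<^sup>2 + a\<^sup>2) + 2 * e / \<tau>"
proof -
  define s where "s = \<tau>\<^sup>2 + a\<^sup>2"
  have s: "s > 0" "\<tau>\<^sup>2 \<le> s" using assms by (auto simp: s_def add_pos_nonneg)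
  have "2 * \<tau> * a \<le> s" unfolding s_def using sum_squares_bound[of \<tau> a] by simp
  hence "\<tau> * a \<le> s" using assms mult_nonneg_nonneg[of \<tau> a] by linarith
  hence "a \<le> s / \<tau>" using assms by (simp add: field_simps)
  hence "2 * a * e \<le> 2 * (s / \<tau>) * e" using assms by (intro mult_right_mono) auto
  moreover have "e\<^sup>2 \<le> s * (e / \<tau>)\<^sup>2"
  proof -
    have "e\<^sup>2 * \<tau>\<^sup>2 \<le> e\<^sup>2 * s" using s by (intro mult_left_mono) auto
    thus ?thesis using assms by (simp add: power_divide field_simps)
  qed
  moreover have "\<tau>\<^sup>2 + (a + e)\<^sup>2 = s + 2 * a * e + e\<^sup>2" by (simp add: s_def power2_sum)
  moreover have "s * (1 + e / \<tau>)\<^sup>2 = s + 2 * (s / \<tau>) * e + s * (e / \<tau>)\<^sup>2"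
    by (simp add: power2_sum algebra_simps)
  ultimately have le: "\<tau>\<^sup>2 + (a + e)\<^sup>2 \<le> s * (1 + e / \<tau>)\<^sup>2" by linarith
  have "\<tau>\<^sup>2 + (a + e)\<^sup>2 > 0" using assms by (simp add: add_pos_nonneg)
  hence "ln (\<tau>\<^sup>2 + (a + e)\<^sup>2) \<le> ln (s * (1 + e / \<tau>)\<^sup>2)" using le by simp
  also have "\<dots> = ln s + 2 * ln (1 + e / \<tau>)"
  proof -
    have "1 + e / \<tau> > 0" using assms by (simp add: add_pos_nonneg)
    thus ?thesis using s by (simp add: ln_mult ln_realpow)
  qed
  also have "\<dots> \<le> ln s + 2 * (e / \<tau>)"
    using ln_add_one_self_le_self[of "e / \<tau>"] assms by simp
  finally show ?thesis by (simp add: s_def)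
qed

context
  fixes n :: nat and B u h
  assumes svd: "svd n B u h"

begin

text \<open>
  If \<open>\<phi>\<close> is almost an eigenvector of \<open>B\<close> (respectively of its adjoint) then concavity of the
  logarithm bounds the quadratic form of \<open>ln (\<tau>\<^sup>2 + B\<^sup>*B)\<close> at \<open>\<phi>\<close> from above
  (respectively, through the resolvent, from below).
\<close>

lemma log_form_upper:
  fixes \<phi> :: "nat \<Rightarrow> complex" and \<tau> :: real and z :: complex
  assumes \<tau>: "\<tau> > 0" and \<phi>: "(\<Sum>k<n. (cmod (\<phi> k))\<^sup>2) = 1"
  defines "e \<equiv> L2_set (\<lambda>k. cmod ((\<Sum>l<n. B $$ (k,l) * \<phi> l) - z * \<phi> k)) {..<n}"
  shows "(\<Sum>i<n. (cmod (\<Sum>k<n. \<phi> k * cnj (u i k)))\<^sup>2 * ln (\<tau>\<^sup>2 + h i)) \<le> ln (\<tau>\<^sup>2 + (cmod z)\<^sup>2) + 2 * e / \<tau>"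
proof -
  \<comment> \<open>The weights form a probability vector: the spectral measure of the positive
    matrix at the unit vector \<phi>.\<close>
  define w where "w i = (cmod (\<Sum>k<n. \<phi> k * cnj (u i k)))\<^sup>2" for i
  have w1: "(\<Sum>i<n. w i) = 1" unfolding w_def svd_parseval[OF svd] \<phi> ..
  have e0: "e \<ge> 0" by (simp add: e_def L2_set_nonneg)
  define b where "b = L2_set (\<lambda>k. cmod (\<Sum>l<n. B $$ (k,l) * \<phi> l)) {..<n}"
  have b2: "b\<^sup>2 = (\<Sum>i<n. w i * h i)"
  proof -
    have "b\<^sup>2 = (\<Sum>k<n. (cmod (\<Sum>l<n. B $$ (k,l) * \<phi> l))\<^sup>2)"
      unfolding b_def L2_set_def by (simp add: sum_nonneg)
    thus ?thesis unfolding svd_norm[OF svd] w_def by (simp add: mult.commute)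
  qed
  have "b \<le> L2_set (\<lambda>k. cmod (z * \<phi> k) + cmod ((\<Sum>l<n. B $$ (k,l) * \<phi> l) - z * \<phi> k)) {..<n}"
    unfolding b_def by (intro L2_set_mono) (auto intro: norm_triangle_sub)
  also have "\<dots> \<le> L2_set (\<lambda>k. cmod (z * \<phi> k)) {..<n} + e" unfolding e_def by (rule L2_set_triangle_ineq)
  also have "L2_set (\<lambda>k. cmod (z * \<phi> k)) {..<n} = cmod z"
    using \<phi> by (simp add: L2_set_def norm_mult power_mult_distrib sum_distrib_left[symmetric])
  finally have be: "b \<le> cmod z + e" .
  have b0: "b \<ge> 0" by (simp add: b_def L2_set_nonneg)
  have "(\<Sum>i<n. w i * (\<tau>\<^sup>2 + h i)) = \<tau>\<^sup>2 * (\<Sum>i<n. w i) + (\<Sum>i<n. w i * h i)"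
    unfolding sum_distrib_left sum.distrib[symmetric] by (intro sum.cong refl) (simp add: algebra_simps)
  hence wx: "(\<Sum>i<n. w i * (\<tau>\<^sup>2 + h i)) = \<tau>\<^sup>2 + b\<^sup>2" by (simp add: w1 b2)
  have "(\<Sum>i<n. w i * ln (\<tau>\<^sup>2 + h i)) \<le> ln (\<tau>\<^sup>2 + b\<^sup>2)"
    by (rule ln_weighted_sum_le[OF _ w1 _ wx]) (use \<tau> svd_nonneg[OF svd] in \<open>auto simp: w_def add_pos_nonneg\<close>)
  also have "\<dots> \<le> ln (\<tau>\<^sup>2 + (cmod z + e)\<^sup>2)"
    using \<tau> be b0 by (simp add: add_pos_nonneg power_mono)
  also have "\<dots> \<le> ln (\<tau>\<^sup>2 + (cmod z)\<^sup>2) + 2 * e / \<tau>" using \<tau> e0 by (intro ln_shift_upper) auto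
  finally show ?thesis unfolding w_def .
qed

lemma log_form_lower:
  fixes \<phi> :: "nat \<Rightarrow> complex" and \<tau> :: real and z :: complex
  assumes \<tau>: "\<tau> > 0" and \<phi>: "(\<Sum>k<n. (cmod (\<phi> k))\<^sup>2) = 1"
  defines "e \<equiv> L2_set (\<lambda>l. cmod ((\<Sum>k<n. cnj (B $$ (k,l)) * \<phi> k) - cnj z * \<phi> l)) {..<n}"
  shows "(\<Sum>i<n. (cmod (\<Sum>k<n. \<phi> k * cnj (u i k)))\<^sup>2 * ln (\<tau>\<^sup>2 + h i)) \<ge> ln (\<tau>\<^sup>2 + (cmod z)\<^sup>2) - 2 * e / \<tau>"
proof -
  define c where "c i = (\<Sum>k<n. \<phi> k * cnj (u i k))" for i
  define w where "w i = (cmod (c i))\<^sup>2" for i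
  define t where "t i = \<tau>\<^sup>2 + h i" for i
  have t0: "t i > 0" if "i<n" for i unfolding t_def using \<tau> svd_nonneg[OF svd that] by (simp add: add_pos_nonneg)
  have w1: "(\<Sum>i<n. w i) = 1" unfolding w_def c_def svd_parseval[OF svd] \<phi> ..
  have w0: "w i \<ge> 0" for i by (simp add: w_def)
  have e0: "e \<ge> 0" by (simp add: e_def L2_set_nonneg)
  \<comment> \<open>\<open>X\<close> is the quadratic form at \<phi> of the inverse of \<tau>^2 plus
    the positive matrix. Jensen's inequality for the reciprocals \<open>1 / t i\<close> reduces the
    claim to an upper bound on \<open>X\<close>.\<close>
  define X where "X = (\<Sum>i<n. w i / t i)"
  have "X > 0"
  proof -
    obtain j where "j \<in> {..<n}" "w j \<noteq> 0" using w1 by (metis sum.neutral zero_neq_one)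
    thus ?thesis unfolding X_def using t0 w0
      by (intro sum_pos2[of _ j]) (auto simp: less_le intro!: divide_pos_pos divide_nonneg_nonneg)
  qed
  \<comment> \<open>The resolvent applied to \<phi>; hence \<open>X\<close> is the inner product of
    \<open>v\<close> with \<phi>, and also equals
    \<open>\<tau>\<^sup>2 * p\<^sup>2 + q\<^sup>2\<close>.\<close>
  define v where "v l = (\<Sum>i<n. c i / of_real (t i) * u i l)" for l
  have cv: "(\<Sum>k<n. v k * cnj (u i k)) = c i / of_real (t i)" if i: "i<n" for i
  proof -
    have "(\<Sum>k<n. v k * cnj (u i k)) = (\<Sum>j<n. c j / of_real (t j) * (\<Sum>k<n. u j k * cnj (u i k)))"
      unfolding v_def sum_distrib_right sum_distrib_left by (subst sum.swap) (simp only: mult.assoc)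
    also have "\<dots> = (\<Sum>j<n. if j = i then c j / of_real (t j) else 0)"
      by (intro sum.cong refl) (use i in \<open>auto simp: svd_orth[OF svd]\<close>)
    also have "\<dots> = c i / of_real (t i)" using i by (simp add: sum.delta)
    finally show ?thesis .
  qed
  define p q where "p = L2_set (\<lambda>k. cmod (v k)) {..<n}" and "q = L2_set (\<lambda>k. cmod (\<Sum>l<n. B $$ (k,l) * v l)) {..<n}"
  have p0: "p \<ge> 0" "q \<ge> 0" by (auto simp: p_def q_def L2_set_nonneg)
  have p2: "p\<^sup>2 = (\<Sum>i<n. w i / (t i)\<^sup>2)"
  proof -
    have "p\<^sup>2 = (\<Sum>i<n. (cmod (\<Sum>k<n. v k * cnj (u i k)))\<^sup>2)"
      unfolding p_def L2_set_def svd_parseval[OF svd] by (simp add: sum_nonneg)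
    also have "\<dots> = (\<Sum>i<n. w i / (t i)\<^sup>2)"
      by (intro sum.cong refl) (simp add: cv w_def norm_divide power_divide)
    finally show ?thesis .
  qed
  have q2: "q\<^sup>2 = (\<Sum>i<n. h i * (w i / (t i)\<^sup>2))"
  proof -
    have "q\<^sup>2 = (\<Sum>i<n. h i * (cmod (\<Sum>k<n. v k * cnj (u i k)))\<^sup>2)"
      unfolding q_def L2_set_def svd_norm[OF svd, symmetric] by (simp add: sum_nonneg)
    also have "\<dots> = (\<Sum>i<n. h i * (w i / (t i)\<^sup>2))"
      by (intro sum.cong refl) (simp add: cv w_def norm_divide power_divide)
    finally show ?thesis .
  qed
  have pq: "\<tau>\<^sup>2 * p\<^sup>2 + q\<^sup>2 = X"
    unfolding p2 q2 X_def sum_distrib_left sum.distrib[symmetric]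
  proof (intro sum.cong refl)
    fix i assume "i \<in> {..<n}"
    hence "t i \<noteq> 0" using t0 by force
    have "\<tau>\<^sup>2 * (w i / (t i)\<^sup>2) + h i * (w i / (t i)\<^sup>2) = t i * (w i / (t i)\<^sup>2)" unfolding t_def by (rule distrib_right[symmetric])
    thus "\<tau>\<^sup>2 * (w i / (t i)\<^sup>2) + h i * (w i / (t i)\<^sup>2) = w i / t i" using \<open>t i \<noteq> 0\<close> by (simp add: power2_eq_square)
  qed
  have vX: "(\<Sum>l<n. v l * cnj (\<phi> l)) = of_real X"
  proof -
    have "(\<Sum>l<n. v l * cnj (\<phi> l)) = (\<Sum>i<n. c i / of_real (t i) * cnj (c i))"
      unfolding v_def c_def cnj_sum sum_distrib_right sum_distrib_left
      by (subst sum.swap) (simp add: mult_ac)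
    also have "\<dots> = of_real X" unfolding X_def of_real_sum
      by (intro sum.cong refl) (simp add: w_def complex_norm_square del: of_real_power)
    finally show ?thesis .
  qed
  have cs: "cmod (\<Sum>k<n. f k * cnj (g k)) \<le> L2_set (\<lambda>k. cmod (f k)) {..<n} * L2_set (\<lambda>k. cmod (g k)) {..<n}" for f g
  proof -
    have "cmod (\<Sum>k<n. f k * cnj (g k)) \<le> (\<Sum>k<n. \<bar>cmod (f k)\<bar> * \<bar>cmod (g k)\<bar>)"
      by (rule order_trans[OF norm_sum]) (simp add: norm_mult)
    also have "\<dots> \<le> L2_set (\<lambda>k. cmod (f k)) {..<n} * L2_set (\<lambda>k. cmod (g k)) {..<n}" by (rule L2_set_mult_ineq)
    finally show ?thesis .
  qed
  have \<phi>1: "L2_set (\<lambda>k. cmod (\<phi> k)) {..<n} = 1" using \<phi> by (simp add: L2_set_def)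
  have Xp: "X \<le> p" using cs[of v \<phi>] vX \<phi>1 \<open>X > 0\<close> by (simp add: p_def)
  \<comment> \<open>The image of \<open>v\<close> is paired with \<phi>. Moving the matrix to the
    other side turns \<phi> into a multiple of itself up to the vector \<open>g\<close> of norm
    \<open>e\<close>.\<close>
  have aX: "cmod z * X \<le> q + p * e"
  proof -
    define g where "g l = (\<Sum>k<n. cnj (B $$ (k,l)) * \<phi> k) - cnj z * \<phi> l" for l
    have "(\<Sum>k<n. (\<Sum>l<n. B $$ (k,l) * v l) * cnj (\<phi> k)) = (\<Sum>l<n. v l * cnj (\<Sum>k<n. cnj (B $$ (k,l)) * \<phi> k))"
      unfolding cnj_sum sum_distrib_right sum_distrib_left by (subst sum.swap) (simp add: mult_ac)
    also have "\<dots> = (\<Sum>l<n. z * (v l * cnj (\<phi> l)) + v l * cnj (g l))"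
      by (intro sum.cong refl) (simp add: g_def algebra_simps)
    also have "\<dots> = z * of_real X + (\<Sum>l<n. v l * cnj (g l))"
      by (simp add: sum.distrib sum_distrib_left[symmetric] vX)
    finally have "z * of_real X = (\<Sum>k<n. (\<Sum>l<n. B $$ (k,l) * v l) * cnj (\<phi> k)) - (\<Sum>l<n. v l * cnj (g l))" by simp
    hence "cmod (z * of_real X) \<le> cmod (\<Sum>k<n. (\<Sum>l<n. B $$ (k,l) * v l) * cnj (\<phi> k)) + cmod (\<Sum>l<n. v l * cnj (g l))"
      by (simp add: norm_triangle_ineq4)
    also have "\<dots> \<le> q * 1 + p * e"
      using cs[of "\<lambda>k. \<Sum>l<n. B $$ (k,l) * v l" \<phi>] cs[of v g] unfolding \<phi>1
      by (intro add_mono) (auto simp: q_def p_def e_def g_def)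
    finally show ?thesis using \<open>X > 0\<close> by (simp add: norm_mult)
  qed
  define \<epsilon> where "\<epsilon> = e / \<tau>"
  have \<epsilon>: "\<epsilon> \<ge> 0" "e = \<tau> * \<epsilon>" using e0 \<tau> by (auto simp: \<epsilon>_def)
  define P where "P = \<tau> * p"
  have P: "P \<ge> 0" "P\<^sup>2 + q\<^sup>2 = X" "\<tau> * X \<le> P" "cmod z * X \<le> q + P * \<epsilon>"
    using p0 pq Xp aX \<tau> \<epsilon> by (auto simp: P_def power_mult_distrib mult_ac)
  \<comment> \<open>One power of \<open>X\<close> is recovered from
    \<open>P\<^sup>2 + q\<^sup>2 = X\<close>; after cancelling it, \<open>X\<close> is at most
    \<open>(1 + \<epsilon>)\<^sup>2\<close> divided by the expected value.\<close>
  have "(\<tau>\<^sup>2 + (cmod z)\<^sup>2) * X\<^sup>2 = (\<tau> * X)\<^sup>2 + (cmod z * X)\<^sup>2" by (simp add: algebra_simps power_mult_distrib)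
  also have "\<dots> \<le> P\<^sup>2 + (q + P * \<epsilon>)\<^sup>2" using P \<tau> \<open>X > 0\<close> by (intro add_mono power_mono) auto
  also have "\<dots> \<le> (P\<^sup>2 + q\<^sup>2) * (1 + \<epsilon>)\<^sup>2"
  proof -
    have "2 * P * q \<le> P\<^sup>2 + q\<^sup>2" by (rule sum_squares_bound)
    hence "2 * P * q * \<epsilon> \<le> (P\<^sup>2 + q\<^sup>2) * \<epsilon>" using \<epsilon> by (intro mult_right_mono) auto
    moreover have "0 \<le> (P\<^sup>2 + q\<^sup>2) * \<epsilon>" "0 \<le> q\<^sup>2 * \<epsilon>\<^sup>2" using \<epsilon> by auto
    moreover have "P\<^sup>2 + (q + P * \<epsilon>)\<^sup>2 = P\<^sup>2 + q\<^sup>2 + 2 * P * q * \<epsilon> + P\<^sup>2 * \<epsilon>\<^sup>2"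
      "(P\<^sup>2 + q\<^sup>2) * (1 + \<epsilon>)\<^sup>2 = P\<^sup>2 + q\<^sup>2 + 2 * ((P\<^sup>2 + q\<^sup>2) * \<epsilon>) + P\<^sup>2 * \<epsilon>\<^sup>2 + q\<^sup>2 * \<epsilon>\<^sup>2"
      by (auto simp: power2_eq_square algebra_simps)
    ultimately show ?thesis by linarith
  qed
  also have "\<dots> = X * (1 + \<epsilon>)\<^sup>2" by (simp add: P)
  finally have "(\<tau>\<^sup>2 + (cmod z)\<^sup>2) * X * X \<le> (1 + \<epsilon>)\<^sup>2 * X" by (simp add: power2_eq_square mult_ac)
  hence Xle: "(\<tau>\<^sup>2 + (cmod z)\<^sup>2) * X \<le> (1 + \<epsilon>)\<^sup>2" using \<open>X > 0\<close> by simp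
  have s0: "\<tau>\<^sup>2 + (cmod z)\<^sup>2 > 0" using \<tau> by (simp add: add_pos_nonneg)
  have "ln (\<tau>\<^sup>2 + (cmod z)\<^sup>2) + ln X = ln ((\<tau>\<^sup>2 + (cmod z)\<^sup>2) * X)"
    using s0 \<open>X > 0\<close> by (simp only: ln_mult_pos)
  also have "\<dots> \<le> ln ((1 + \<epsilon>)\<^sup>2)" using Xle s0 \<open>X > 0\<close> \<epsilon> by (subst ln_le_cancel_iff) (auto simp: add_pos_nonneg)
  also have "\<dots> = 2 * ln (1 + \<epsilon>)" using \<epsilon> by (simp add: ln_realpow)
  also have "\<dots> \<le> 2 * \<epsilon>" using ln_add_one_self_le_self[of \<epsilon>] \<epsilon> by simp
  finally have lnX: "ln X \<le> 2 * \<epsilon> - ln (\<tau>\<^sup>2 + (cmod z)\<^sup>2)" by simp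
  have "(\<Sum>i<n. w i * ln (1 / t i)) \<le> ln X"
    by (rule ln_weighted_sum_le[OF _ w1]) (use w0 t0 \<open>X > 0\<close> in \<open>auto simp: X_def\<close>)
  also have "(\<Sum>i<n. w i * ln (1 / t i)) = - (\<Sum>i<n. w i * ln (t i))"
    unfolding sum_negf[symmetric] by (intro sum.cong refl) (use t0 in \<open>simp add: ln_div\<close>)
  finally show ?thesis using lnX unfolding w_def c_def t_def \<epsilon>_def by simp
qed

text \<open>Because the vectors resolve the identity, integrating the quadratic forms of the
  logarithm gives its trace. The two one-sided bounds for a single vector are integrated; they are
  linear in the errors, while the hypotheses control the squares.\<close>

lemma frame_log_det:
  fixes M :: "'x measure" and \<phi> :: "'j \<Rightarrow> 'x \<Rightarrow> nat \<Rightarrow> complex" and \<mu> :: "'j \<Rightarrow> 'x \<Rightarrow> complex" and \<tau> K :: real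
  assumes M: "finite_measure M" and \<tau>: "\<tau> > 0" and J: "finite J"
    and meas: "\<And>j k. j \<in> J \<Longrightarrow> k < n \<Longrightarrow> (\<lambda>x. \<phi> j x k) \<in> borel_measurable M" "\<And>j. j \<in> J \<Longrightarrow> \<mu> j \<in> borel_measurable M"
    and bnd: "\<And>j x. j \<in> J \<Longrightarrow> x \<in> space M \<Longrightarrow> cmod (\<mu> j x) \<le> K"
    and unit: "\<And>j x. j \<in> J \<Longrightarrow> x \<in> space M \<Longrightarrow> (\<Sum>k<n. (cmod (\<phi> j x k))\<^sup>2) = 1"
    and resol: "\<And>k l. k < n \<Longrightarrow> l < n \<Longrightarrow> (\<Sum>j\<in>J. LINT x|M. \<phi> j x k * cnj (\<phi> j x l)) = of_bool (k = l)"
    and err: "(\<Sum>j\<in>J. LINT x|M. (\<Sum>k<n. (cmod ((\<Sum>l<n. B $$ (k,l) * \<phi> j x l) - \<mu> j x * \<phi> j x k))\<^sup>2)) \<le> real n * \<eta>\<^sup>2"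
             "(\<Sum>j\<in>J. LINT x|M. (\<Sum>l<n. (cmod ((\<Sum>k<n. cnj (B $$ (k,l)) * \<phi> j x k) - cnj (\<mu> j x) * \<phi> j x l))\<^sup>2)) \<le> real n * \<eta>\<^sup>2"
    and \<eta>: "\<eta> > 0"
  shows "\<bar>(\<Sum>i<n. ln (\<tau>\<^sup>2 + h i)) - (\<Sum>j\<in>J. LINT x|M. ln (\<tau>\<^sup>2 + (cmod (\<mu> j x))\<^sup>2))\<bar> \<le> 2 * real n * \<eta> / \<tau>"
proof -
  interpret finite_measure M by fact
  define c where "c j x i = (cmod (\<Sum>k<n. \<phi> j x k * cnj (u i k)))\<^sup>2" for j x i
  have \<phi>1: "cmod (\<phi> j x k) \<le> 1" if "j \<in> J" "x \<in> space M" "k < n" for j x k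
  proof -
    have "(cmod (\<phi> j x k))\<^sup>2 \<le> (\<Sum>k<n. (cmod (\<phi> j x k))\<^sup>2)"
      using that by (intro member_le_sum) auto
    hence "(cmod (\<phi> j x k))\<^sup>2 \<le> 1" using unit that by simp
    thus ?thesis by (simp add: abs_square_le_1)
  qed
  have int\<phi>: "integrable M (\<lambda>x. \<phi> j x k * cnj (\<phi> j x l))" if "j \<in> J" "k < n" "l < n" for j k l
  proof (rule integrable_const_bound[of _ 1])
    show "AE x in M. cmod (\<phi> j x k * cnj (\<phi> j x l)) \<le> 1"
      using \<phi>1 that by (intro AE_I2) (auto simp: norm_mult intro!: mult_le_one)
    show "(\<lambda>x. \<phi> j x k * cnj (\<phi> j x l)) \<in> borel_measurable M" using meas(1) that by measurable
  qed
  have cc: "complex_of_real (c j x i) = (\<Sum>k<n. \<Sum>l<n. (\<phi> j x k * cnj (\<phi> j x l)) * (cnj (u i k) * u i l))" for j x i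
    unfolding c_def complex_norm_square cnj_sum sum_product by (simp add: mult_ac)
  have mc: "(\<lambda>x. c j x i) \<in> borel_measurable M" if "j \<in> J" for j i
    unfolding c_def using meas(1) that by (intro borel_measurable_power borel_measurable_norm[THEN measurable_compose, rotated] borel_measurable_sum borel_measurable_times) auto
  have c0: "c j x i \<ge> 0" for j x i by (simp add: c_def)
  have csum: "(\<Sum>i<n. c j x i) = 1" if "j \<in> J" "x \<in> space M" for j x
    unfolding c_def svd_parseval[OF svd] using unit that by simp
  have c1: "c j x i \<le> 1" if "j \<in> J" "x \<in> space M" "i < n" for j x i
    unfolding csum[OF that(1,2), symmetric] using that c0 by (intro member_le_sum) auto
  have intc: "integrable M (\<lambda>x. c j x i)" if "j \<in> J" "i < n" for j i
    by (rule integrable_const_bound[of _ 1]) (use c1 c0 that mc in \<open>auto intro!: AE_I2\<close>)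
  \<comment> \<open>The resolution of the identity, tested on the unit vector
    \<open>u i\<close>.\<close>
  have C1: "(\<Sum>j\<in>J. LINT x|M. c j x i) = 1" if i: "i < n" for i
  proof -
    have "complex_of_real (LINT x|M. c j x i) = (\<Sum>k<n. \<Sum>l<n. (LINT x|M. \<phi> j x k * cnj (\<phi> j x l)) * (cnj (u i k) * u i l))" if j: "j \<in> J" for j
    proof -
      have "complex_of_real (LINT x|M. c j x i) = (LINT x|M. complex_of_real (c j x i))" by simp
      also have "\<dots> = (LINT x|M. (\<Sum>k<n. \<Sum>l<n. (\<phi> j x k * cnj (\<phi> j x l)) * (cnj (u i k) * u i l)))"
        unfolding cc ..
      also have "\<dots> = (\<Sum>k<n. \<Sum>l<n. (LINT x|M. \<phi> j x k * cnj (\<phi> j x l)) * (cnj (u i k) * u i l))"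
        by (rule integral_sum_sum_mult) (use int\<phi>[OF j] in auto)
      finally show ?thesis .
    qed
    hence "complex_of_real (\<Sum>j\<in>J. LINT x|M. c j x i) = (\<Sum>j\<in>J. \<Sum>k<n. \<Sum>l<n. (LINT x|M. \<phi> j x k * cnj (\<phi> j x l)) * (cnj (u i k) * u i l))"
      unfolding of_real_sum by (intro sum.cong refl) auto
    also have "\<dots> = (\<Sum>k<n. \<Sum>j\<in>J. \<Sum>l<n. (LINT x|M. \<phi> j x k * cnj (\<phi> j x l)) * (cnj (u i k) * u i l))"
      by (rule sum.swap)
    also have "\<dots> = (\<Sum>k<n. \<Sum>l<n. \<Sum>j\<in>J. (LINT x|M. \<phi> j x k * cnj (\<phi> j x l)) * (cnj (u i k) * u i l))"
      by (intro sum.cong refl sum.swap)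
    also have "\<dots> = (\<Sum>k<n. \<Sum>l<n. if l = k then cnj (u i k) * u i l else 0)"
      unfolding sum_distrib_right[symmetric] by (intro sum.cong refl) (auto simp: resol)
    also have "\<dots> = (\<Sum>k<n. u i k * cnj (u i k))" by (intro sum.cong refl) (simp add: sum.delta mult.commute)
    also have "\<dots> = 1" using svd_orth[OF svd i i] by simp
    finally show ?thesis by (simp only: of_real_eq_1_iff)
  qed
  define e where "e j x = L2_set (\<lambda>k. cmod ((\<Sum>l<n. B $$ (k,l) * \<phi> j x l) - \<mu> j x * \<phi> j x k)) {..<n}" for j x
  define f where "f j x = L2_set (\<lambda>l. cmod ((\<Sum>k<n. cnj (B $$ (k,l)) * \<phi> j x k) - cnj (\<mu> j x) * \<phi> j x l)) {..<n}" for j x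
  \<comment> \<open>A crude bound that serves integrability of the errors; it does not enter the
    final estimate.\<close>
  define b where "b = (\<Sum>k<n. \<Sum>l<n. cmod (B $$ (k,l)))"
  have entry: "(\<Sum>l<n. cmod (B $$ (k,l))) \<le> b" "(\<Sum>l<n. cmod (B $$ (l,k))) \<le> b" if "k < n" for k
  proof -
    show "(\<Sum>l<n. cmod (B $$ (k,l))) \<le> b" unfolding b_def using that
      by (intro member_le_sum[of k "{..<n}" "\<lambda>k. \<Sum>l<n. cmod (B $$ (k,l))"]) (auto intro: sum_nonneg)
    show "(\<Sum>l<n. cmod (B $$ (l,k))) \<le> b" unfolding b_def using that
      by (intro sum_mono member_le_sum) auto
  qed
  have bb: "cmod ((\<Sum>l<n. a l * \<phi> j x l) - y * \<phi> j x k) \<le> b + K"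
    if "(\<Sum>l<n. cmod (a l)) \<le> b" "cmod y = cmod (\<mu> j x)" "j \<in> J" "x \<in> space M" "k < n" for a y j x k
  proof -
    have "cmod (\<Sum>l<n. a l * \<phi> j x l) \<le> (\<Sum>l<n. cmod (a l) * 1)"
      using \<phi>1 that by (intro sum_norm_le) (auto simp: norm_mult intro!: mult_left_le)
    moreover have "K \<ge> 0" using bnd[OF that(3,4)] norm_ge_zero[of "\<mu> j x"] by linarith
    hence "cmod (y * \<phi> j x k) \<le> K * 1"
      unfolding norm_mult using \<phi>1 bnd that by (intro mult_mono) auto
    ultimately show ?thesis using norm_triangle_ineq4[of "\<Sum>l<n. a l * \<phi> j x l" "y * \<phi> j x k"] that(1) by simp
  qed
  have bE: "cmod ((\<Sum>l<n. B $$ (k,l) * \<phi> j x l) - \<mu> j x * \<phi> j x k) \<le> b + K"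
    "cmod ((\<Sum>l<n. cnj (B $$ (l,k)) * \<phi> j x l) - cnj (\<mu> j x) * \<phi> j x k) \<le> b + K"
    if "j \<in> J" "x \<in> space M" "k < n" for j x k
    using bb[OF _ _ that, of "\<lambda>l. B $$ (k,l)" "\<mu> j x"] bb[OF _ _ that, of "\<lambda>l. cnj (B $$ (l,k))" "cnj (\<mu> j x)"] entry[OF that(3)] by auto
  have e2: "(e j x)\<^sup>2 = (\<Sum>k<n. (cmod ((\<Sum>l<n. B $$ (k,l) * \<phi> j x l) - \<mu> j x * \<phi> j x k))\<^sup>2)"
    and f2: "(f j x)\<^sup>2 = (\<Sum>l<n. (cmod ((\<Sum>k<n. cnj (B $$ (k,l)) * \<phi> j x k) - cnj (\<mu> j x) * \<phi> j x l))\<^sup>2)" for j x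
    unfolding e_def f_def L2_set_def by (simp_all add: sum_nonneg)
  have e0: "e j x \<ge> 0" "f j x \<ge> 0" for j x by (simp_all add: e_def f_def L2_set_nonneg)
  have me: "e j \<in> borel_measurable M" "f j \<in> borel_measurable M" if "j \<in> J" for j
  proof -
    have [measurable]: "\<And>k. k \<in> {..<n} \<Longrightarrow> (\<lambda>x. \<phi> j x k) \<in> borel_measurable M" "\<mu> j \<in> borel_measurable M"
      using meas that by auto
    show "e j \<in> borel_measurable M" "f j \<in> borel_measurable M"
      unfolding e_def f_def L2_set_def by measurable
  qed
  have eb: "(e j x)\<^sup>2 \<le> real n * (b + K)\<^sup>2" "(f j x)\<^sup>2 \<le> real n * (b + K)\<^sup>2" if "j \<in> J" "x \<in> space M" for j x
    unfolding e2 f2 using bE[OF that]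
    by (auto intro!: sum_bounded_above[of "{..<n}", simplified] power_mono)
  have ie2: "integrable M (\<lambda>x. (e j x)\<^sup>2)" "integrable M (\<lambda>x. (f j x)\<^sup>2)" if "j \<in> J" for j
    by (rule integrable_const_bound[of _ "real n * (b + K)\<^sup>2"]; use eb me that in \<open>auto intro!: AE_I2\<close>)+
  \<comment> \<open>The weight \<eta> in the inequality between \<open>g\<close> and its square is
    the size of the root mean square error, so that both resulting terms sum to the same
    amount.\<close>
  have L2L1: "integrable M g \<and> (LINT x|M. g x) \<le> ((LINT x|M. (g x)\<^sup>2) / \<eta> + \<eta> * measure M (space M)) / 2"
    if g: "integrable M (\<lambda>x. (g x)\<^sup>2)" "g \<in> borel_measurable M" "\<And>x. g x \<ge> 0" for g :: "'x \<Rightarrow> real"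
  proof -
    have am: "g x \<le> ((g x)\<^sup>2 / \<eta> + \<eta>) / 2" for x
    proof -
      have "2 * g x * \<eta> \<le> (g x)\<^sup>2 + \<eta>\<^sup>2" by (rule sum_squares_bound)
      thus ?thesis using \<eta> by (simp add: field_simps power2_eq_square)
    qed
    have I: "integrable M (\<lambda>x. ((g x)\<^sup>2 / \<eta> + \<eta>) / 2)" using g by auto
    have i1: "integrable M g"
      by (rule Bochner_Integration.integrable_bound[OF I g(2)]) (use am g(3) \<eta> in \<open>auto intro!: AE_I2 order_trans[OF am]\<close>)
    have "(LINT x|M. g x) \<le> (LINT x|M. ((g x)\<^sup>2 / \<eta> + \<eta>) / 2)" by (rule integral_mono[OF i1 I am])
    also have "\<dots> = ((LINT x|M. (g x)\<^sup>2) / \<eta> + \<eta> * measure M (space M)) / 2"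
      using g(1) by simp
    finally show ?thesis using i1 by blast
  qed
  \<comment> \<open>The total mass is the trace of the identity.\<close>
  have total: "(\<Sum>j\<in>J. measure M (space M)) = real n"
  proof -
    have "(\<Sum>j\<in>J. measure M (space M)) = (\<Sum>j\<in>J. LINT x|M. (\<Sum>i<n. c j x i))"
    proof (intro sum.cong refl)
      fix j assume j: "j \<in> J"
      have "(LINT x|M. (\<Sum>i<n. c j x i)) = (LINT x|M. 1)"
        by (rule Bochner_Integration.integral_cong) (use csum[OF j] in auto)
      thus "measure M (space M) = (LINT x|M. (\<Sum>i<n. c j x i))" by simp
    qed
    also have "\<dots> = (\<Sum>j\<in>J. \<Sum>i<n. LINT x|M. c j x i)"
      by (intro sum.cong refl Bochner_Integration.integral_sum) (use intc in auto)
    also have "\<dots> = (\<Sum>i<n. \<Sum>j\<in>J. LINT x|M. c j x i)" by (rule sum.swap)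
    also have "\<dots> = real n" by (simp add: C1)
    finally show ?thesis .
  qed
  have L1: "(\<Sum>j\<in>J. LINT x|M. g j x) \<le> real n * \<eta>"
    if "\<And>j. j \<in> J \<Longrightarrow> integrable M (\<lambda>x. (g j x)\<^sup>2)" "\<And>j. j \<in> J \<Longrightarrow> g j \<in> borel_measurable M" "\<And>j x. g j x \<ge> 0"
      "(\<Sum>j\<in>J. LINT x|M. (g j x)\<^sup>2) \<le> real n * \<eta>\<^sup>2" for g :: "'j \<Rightarrow> 'x \<Rightarrow> real"
  proof -
    have "(\<Sum>j\<in>J. LINT x|M. g j x) \<le> (\<Sum>j\<in>J. ((LINT x|M. (g j x)\<^sup>2) / \<eta> + \<eta> * measure M (space M)) / 2)"
      by (rule sum_mono) (use L2L1 that in blast)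
    also have "\<dots> = ((\<Sum>j\<in>J. LINT x|M. (g j x)\<^sup>2) / \<eta> + \<eta> * real n) / 2"
      unfolding total[symmetric] sum_divide_distrib sum_distrib_left sum.distrib[symmetric] ..
    also have "\<dots> \<le> ((real n * \<eta>\<^sup>2) / \<eta> + \<eta> * real n) / 2"
      using that(4) \<eta> by (intro divide_right_mono add_right_mono) auto
    also have "\<dots> = real n * \<eta>" using \<eta> by (simp add: power2_eq_square field_simps)
    finally show ?thesis .
  qed
  have E: "(\<Sum>j\<in>J. LINT x|M. e j x) \<le> real n * \<eta>" "(\<Sum>j\<in>J. LINT x|M. f j x) \<le> real n * \<eta>"
    by (rule L1; use ie2 me e0 err e2 f2 in simp)+
  have iE: "integrable M (e j)" "integrable M (f j)" if "j \<in> J" for j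
    using L2L1[of "e j"] L2L1[of "f j"] ie2[OF that] me[OF that] e0 by auto
  have iln: "integrable M (\<lambda>x. ln (\<tau>\<^sup>2 + (cmod (\<mu> j x))\<^sup>2))" if j: "j \<in> J" for j
  proof (rule integrable_const_bound[of _ "\<bar>ln (\<tau>\<^sup>2)\<bar> + \<bar>ln (\<tau>\<^sup>2 + K\<^sup>2)\<bar>"])
    show "AE x in M. norm (ln (\<tau>\<^sup>2 + (cmod (\<mu> j x))\<^sup>2)) \<le> \<bar>ln (\<tau>\<^sup>2)\<bar> + \<bar>ln (\<tau>\<^sup>2 + K\<^sup>2)\<bar>"
    proof (intro AE_I2)
      fix x assume "x \<in> space M"
      hence "(cmod (\<mu> j x))\<^sup>2 \<le> K\<^sup>2" using bnd j by (intro power_mono) auto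
      hence "ln (\<tau>\<^sup>2 + (cmod (\<mu> j x))\<^sup>2) \<le> ln (\<tau>\<^sup>2 + K\<^sup>2)" "ln (\<tau>\<^sup>2) \<le> ln (\<tau>\<^sup>2 + (cmod (\<mu> j x))\<^sup>2)"
        using \<tau> by (auto simp: add_pos_nonneg)
      thus "norm (ln (\<tau>\<^sup>2 + (cmod (\<mu> j x))\<^sup>2)) \<le> \<bar>ln (\<tau>\<^sup>2)\<bar> + \<bar>ln (\<tau>\<^sup>2 + K\<^sup>2)\<bar>"
        unfolding real_norm_def by linarith
    qed
    have [measurable]: "\<mu> j \<in> borel_measurable M" using meas j by auto
    show "(\<lambda>x. ln (\<tau>\<^sup>2 + (cmod (\<mu> j x))\<^sup>2)) \<in> borel_measurable M" by measurable
  qed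
  define G where "G j x = (\<Sum>i<n. c j x i * ln (\<tau>\<^sup>2 + h i))" for j x
  have iG: "integrable M (G j)" if "j \<in> J" for j
    unfolding G_def using intc that by (intro Bochner_Integration.integrable_sum integrable_mult_left) auto
  have Gsum: "(\<Sum>j\<in>J. LINT x|M. G j x) = (\<Sum>i<n. ln (\<tau>\<^sup>2 + h i))"
  proof -
    have "(\<Sum>j\<in>J. LINT x|M. G j x) = (\<Sum>j\<in>J. \<Sum>i<n. (LINT x|M. c j x i) * ln (\<tau>\<^sup>2 + h i))"
      unfolding G_def
    proof (intro sum.cong refl)
      fix j assume j: "j \<in> J"
      have "(LINT x|M. (\<Sum>i<n. c j x i * ln (\<tau>\<^sup>2 + h i))) = (\<Sum>i<n. LINT x|M. c j x i * ln (\<tau>\<^sup>2 + h i))"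
        by (rule Bochner_Integration.integral_sum) (use intc[OF j] in auto)
      thus "(LINT x|M. (\<Sum>i<n. c j x i * ln (\<tau>\<^sup>2 + h i))) = (\<Sum>i<n. (LINT x|M. c j x i) * ln (\<tau>\<^sup>2 + h i))"
        by simp
    qed
    also have "\<dots> = (\<Sum>i<n. (\<Sum>j\<in>J. LINT x|M. c j x i) * ln (\<tau>\<^sup>2 + h i))"
      unfolding sum_distrib_right by (rule sum.swap)
    finally show ?thesis by (simp add: C1)
  qed
  have up: "(LINT x|M. G j x) \<le> (LINT x|M. ln (\<tau>\<^sup>2 + (cmod (\<mu> j x))\<^sup>2)) + 2 / \<tau> * (LINT x|M. e j x)" if j: "j \<in> J" for j
  proof -
    have "(LINT x|M. G j x) \<le> (LINT x|M. ln (\<tau>\<^sup>2 + (cmod (\<mu> j x))\<^sup>2) + 2 / \<tau> * e j x)"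
    proof (rule integral_mono)
      show "G j x \<le> ln (\<tau>\<^sup>2 + (cmod (\<mu> j x))\<^sup>2) + 2 / \<tau> * e j x" if "x \<in> space M" for x
        using log_form_upper[OF \<tau> unit[OF j that], of "\<mu> j x"] by (simp add: G_def c_def e_def)
    qed (use iG[OF j] iln[OF j] iE[OF j] in auto)
    thus ?thesis using iln[OF j] iE[OF j] by simp
  qed
  have lo: "(LINT x|M. G j x) \<ge> (LINT x|M. ln (\<tau>\<^sup>2 + (cmod (\<mu> j x))\<^sup>2)) - 2 / \<tau> * (LINT x|M. f j x)" if j: "j \<in> J" for j
  proof -
    have "(LINT x|M. G j x) \<ge> (LINT x|M. ln (\<tau>\<^sup>2 + (cmod (\<mu> j x))\<^sup>2) - 2 / \<tau> * f j x)"
    proof (rule integral_mono)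
      show "G j x \<ge> ln (\<tau>\<^sup>2 + (cmod (\<mu> j x))\<^sup>2) - 2 / \<tau> * f j x" if "x \<in> space M" for x
        using log_form_lower[OF \<tau> unit[OF j that], of "\<mu> j x"] by (simp add: G_def c_def f_def)
    qed (use iG[OF j] iln[OF j] iE[OF j] in auto)
    thus ?thesis using iln[OF j] iE[OF j] by simp
  qed
  let ?I = "\<Sum>j\<in>J. LINT x|M. ln (\<tau>\<^sup>2 + (cmod (\<mu> j x))\<^sup>2)"
  have "(\<Sum>i<n. ln (\<tau>\<^sup>2 + h i)) \<le> ?I + 2 / \<tau> * (\<Sum>j\<in>J. LINT x|M. e j x)"
    unfolding Gsum[symmetric] sum_distrib_left sum.distrib[symmetric] by (rule sum_mono[OF up])
  moreover have "(\<Sum>i<n. ln (\<tau>\<^sup>2 + h i)) \<ge> ?I - 2 / \<tau> * (\<Sum>j\<in>J. LINT x|M. f j x)"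
    unfolding Gsum[symmetric] sum_distrib_left sum_subtractf[symmetric] by (rule sum_mono[OF lo])
  moreover have "2 / \<tau> * (\<Sum>j\<in>J. LINT x|M. e j x) \<le> 2 / \<tau> * (real n * \<eta>)" "2 / \<tau> * (\<Sum>j\<in>J. LINT x|M. f j x) \<le> 2 / \<tau> * (real n * \<eta>)"
    using E \<tau> by (auto intro!: mult_left_mono simp del: times_divide_eq_left)
  ultimately have "\<bar>(\<Sum>i<n. ln (\<tau>\<^sup>2 + h i)) - ?I\<bar> \<le> 2 / \<tau> * (real n * \<eta>)" by linarith
  thus ?thesis by (simp add: mult.assoc)
qed

end

section \<open>Fourier coefficients on the torus\<close>

definition character :: "int ^ 'd::finite \<Rightarrow> real ^ 'd \<Rightarrow> complex" where
  "character \<nu> \<xi> = exp (2 * \<i> * of_real pi * of_real (\<Sum>i\<in>UNIV. of_int (vec_nth \<nu> i) * vec_nth \<xi> i))"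

lemma character_0 [simp]: "character 0 \<xi> = 1"
  by (simp add: character_def)

lemma character_add: "character (\<mu> + \<nu>) \<xi> = character \<mu> \<xi> * character \<nu> \<xi>"
  by (simp add: character_def exp_add[symmetric] algebra_simps sum.distrib)

lemma cnj_character: "cnj (character \<nu> \<xi>) = character (- \<nu>) \<xi>"
  by (simp add: character_def exp_cnj sum_negf)

lemma norm_character [simp]: "cmod (character \<nu> \<xi>) = 1"
  unfolding character_def norm_exp_eq_Re by simp

lemma character_mult_cnj [simp]: "character \<nu> \<xi> * cnj (character \<nu> \<xi>) = 1"
  by (simp add: cnj_character character_add[symmetric])

lemma character_diff: "character (\<mu> - \<nu>) \<xi> = character \<mu> \<xi> * cnj (character \<nu> \<xi>)"
  unfolding cnj_character character_add[symmetric] by simp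

lemma continuous_on_character [continuous_intros]: "continuous_on S (character \<nu>)"
  unfolding character_def by (intro continuous_intros)

lemma integral_exp_unit_interval:
  "(LINT t|lborel. indicator {0..1::real} t *\<^sub>R exp (2 * \<i> * of_real pi * of_real (of_int k * t))) = of_bool (k = 0)"
  "integrable lborel (\<lambda>t. indicator {0..1::real} t *\<^sub>R exp (2 * \<i> * of_real pi * of_real (of_int k * t)))"
proof -
  show "integrable lborel (\<lambda>t. indicator {0..1::real} t *\<^sub>R exp (2 * \<i> * of_real pi * of_real (of_int k * t)))"
    unfolding set_integrable_def[symmetric]
    by (rule borel_integrable_atLeastAtMost') (intro continuous_intros)
  show "(LINT t|lborel. indicator {0..1::real} t *\<^sub>R exp (2 * \<i> * of_real pi * of_real (of_int k * t))) = of_bool (k = 0)"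
  proof (cases "k = 0")
    case True
    thus ?thesis by simp
  next
    case False
    define c where "c = 2 * \<i> * of_real pi * of_int k"
    have c0: "c \<noteq> 0" using False by (simp add: c_def)
    have ec: "exp (2 * \<i> * of_real pi * of_real (of_int k * t)) = exp (c * of_real t)" for t
      by (simp add: c_def mult_ac)
    have "(LINT t|lborel. indicator {0..1} t *\<^sub>R exp (c * of_real t)) = exp (c * of_real 1) / c - exp (c * of_real 0) / c"
    proof (rule integral_FTC_Icc)
      fix t :: real
      show "((\<lambda>t. exp (c * of_real t) / c) has_vector_derivative exp (c * of_real t)) (at t within {0..1})"
        using c0 by (auto intro!: derivative_eq_intros has_vector_derivative_real_field simp: )
    qed (auto intro!: continuous_intros)
    also have "exp (c * of_real 1) = 1"
      unfolding c_def using exp_integer_2pi[of "of_int k"] by (simp add: mult_ac)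
    finally show ?thesis using False unfolding ec by simp
  qed
qed

lemma integral_lebesgue_on_cube:
  fixes f :: "real ^ 'd::finite \<Rightarrow> 'b::{banach, second_countable_topology}"
  assumes "f \<in> borel_measurable borel"
  shows "(LINT \<xi>|lebesgue_on unit_cube. f \<xi>) = (LINT \<xi>|lborel. indicator unit_cube \<xi> *\<^sub>R f \<xi>)"
proof -
  have "(LINT \<xi>|lebesgue_on unit_cube. f \<xi>) = (LINT \<xi>|lebesgue. indicator unit_cube \<xi> *\<^sub>R f \<xi>)"
    by (rule integral_restrict_space) auto
  also have "\<dots> = (LINT \<xi>|lborel. indicator unit_cube \<xi> *\<^sub>R f \<xi>)"
    using assms by (intro integral_completion) measurable
  finally show ?thesis .
qed

lemma integral_character:
  "(LINT \<xi>|lebesgue_on unit_cube. character (\<nu> :: int ^ 'd::finite) \<xi>) = of_bool (\<nu> = 0)"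
proof -
  \<comment> \<open>The product form of \<open>lborel\<close> is indexed by basis vectors, not by
    coordinates; \<open>n\<close> reads off the frequency that belongs to a basis vector.\<close>
  define n where "n b = vec_nth \<nu> (SOME i. b = axis i (1::real))" for b :: "real ^ 'd"
  have n_axis: "n (axis i 1) = vec_nth \<nu> i" for i
  proof -
    have "(SOME j. axis i (1::real) = axis j 1) = i" by (rule some_equality) (auto simp: axis_eq_axis)
    thus ?thesis by (simp add: n_def)
  qed
  define g where "g b t = indicator {0..1::real} t *\<^sub>R exp (2 * \<i> * of_real pi * of_real (of_int (n b) * t))" for b t
  interpret product_sigma_finite "\<lambda>b :: real ^ 'd. lborel :: real measure" by unfold_locales
  have memc: "\<xi> \<in> unit_cube \<longleftrightarrow> (\<forall>b\<in>Basis. 0 \<le> inner \<xi> b \<and> inner \<xi> b \<le> 1)" for \<xi> :: "real ^ 'd"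
    unfolding mem_box by (intro ball_cong refl) (auto simp: Basis_vec_def inner_axis)
  have comp: "indicator unit_cube \<xi> *\<^sub>R character \<nu> \<xi> = (\<Prod>b\<in>Basis. g b (inner \<xi> b))" for \<xi>
  proof -
    have "(\<Prod>b\<in>Basis. g b (inner \<xi> b)) = (\<Prod>b\<in>Basis. of_real (indicator {0..1} (inner \<xi> b))) *
        (\<Prod>b\<in>Basis. exp (2 * \<i> * of_real pi * of_real (of_int (n b) * (inner \<xi> b))))"
      unfolding g_def scaleR_conv_of_real prod.distrib[symmetric] ..
    also have "(\<Prod>b\<in>Basis. of_real (indicator {0..1} (inner \<xi> b))) = (of_real (indicator unit_cube \<xi>) :: complex)"
    proof (cases "\<xi> \<in> unit_cube")
      case True
      thus ?thesis by (simp add: memc)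
    next
      case False
      then obtain b where b: "b \<in> (Basis :: (real^'d) set)" "\<not> (0 \<le> inner \<xi> b \<and> inner \<xi> b \<le> 1)"
        by (auto simp: memc)
      hence "(\<Prod>b\<in>Basis. of_real (indicator {0..1} (inner \<xi> b))) = (0::complex)"
        by (intro prod_zero bexI[of _ b]) auto
      thus ?thesis using False by simp
    qed
    also have "(\<Prod>b\<in>Basis. exp (2 * \<i> * of_real pi * of_real (of_int (n b) * (inner \<xi> b)))) = character \<nu> \<xi>"
    proof -
      have "(\<Prod>b\<in>Basis. exp (2 * \<i> * of_real pi * of_real (of_int (n b) * (inner \<xi> b))))
        = exp (2 * \<i> * of_real pi * of_real (\<Sum>b\<in>Basis. of_int (n b) * (inner \<xi> b)))"
        by (simp add: exp_sum sum_distrib_left)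
      also have "(\<Sum>b\<in>Basis. of_int (n b) * (inner \<xi> b)) = (\<Sum>i\<in>UNIV. of_int (vec_nth \<nu> i) * vec_nth \<xi> i)"
      proof -
        have B: "(Basis :: (real^'d) set) = (\<lambda>i. axis i 1) ` UNIV" by (auto simp: Basis_vec_def)
        show ?thesis unfolding B
          by (subst sum.reindex) (auto simp: inj_on_def axis_eq_axis n_axis inner_axis)
      qed
      finally show ?thesis by (simp add: character_def)
    qed
    finally show ?thesis by (simp add: scaleR_conv_of_real)
  qed
  have "(LINT \<xi>|lebesgue_on unit_cube. character \<nu> \<xi>) = (LINT \<xi>|lborel. (\<Prod>b\<in>Basis. g b (inner \<xi> b)))"
    unfolding comp[symmetric]
    by (rule integral_lebesgue_on_cube) (intro borel_measurable_continuous_onI continuous_intros)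
  also have "\<dots> = (LINT f|(\<Pi>\<^sub>M b\<in>Basis. lborel). (\<Prod>b\<in>Basis. g b (inner (\<Sum>c\<in>Basis. f c *\<^sub>R c) b)))"
    unfolding g_def by (subst lborel_eq, subst integral_distr) auto
  also have "\<dots> = (LINT f|(\<Pi>\<^sub>M b\<in>Basis. lborel). (\<Prod>b\<in>Basis. g b (f b)))"
    by (intro Bochner_Integration.integral_cong refl prod.cong) simp
  also have "\<dots> = (\<Prod>b\<in>Basis. LINT t|lborel. g b t)"
    by (rule product_integral_prod) (simp, unfold g_def, rule integral_exp_unit_interval(2))
  also have "\<dots> = (\<Prod>b\<in>Basis. of_bool (n b = 0))"
    unfolding g_def integral_exp_unit_interval ..
  also have "\<dots> = (\<Prod>i\<in>UNIV. of_bool (vec_nth \<nu> i = 0))"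
  proof -
    have B: "(Basis :: (real^'d) set) = (\<lambda>i. axis i 1) ` UNIV" by (auto simp: Basis_vec_def)
    show ?thesis unfolding B
      by (subst prod.reindex) (auto simp: inj_on_def axis_eq_axis n_axis)
  qed
  also have "\<dots> = of_bool (\<nu> = 0)"
  proof (cases "\<nu> = 0")
    case False
    then obtain i where "vec_nth \<nu> i \<noteq> 0" by (auto simp: Finite_Cartesian_Product.vec_eq_iff)
    hence "(\<Prod>i\<in>UNIV. of_bool (vec_nth \<nu> i = 0)) = (0::complex)" by (intro prod_zero) auto
    thus ?thesis using False by simp
  qed simp
  finally show ?thesis .
qed

section \<open>Orthogonality of characters, Parseval and Bessel\<close>

abbreviation cube_measure :: "(real ^ 'd::finite) measure" where
  "cube_measure \<equiv> lebesgue_on unit_cube"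

lemma integrable_cube:
  fixes f :: "real ^ 'd::finite \<Rightarrow> 'b::euclidean_space"
  shows "continuous_on UNIV f \<Longrightarrow> integrable cube_measure f"
  by (rule continuous_imp_integrable) (rule continuous_on_subset, auto)

lemma measure_unit_cube [simp]: "measure lebesgue (unit_cube :: (real ^ 'd::finite) set) = 1"
proof -
  have "emeasure lborel (unit_cube :: (real ^ 'd) set) = 1"
    by (subst emeasure_lborel_cbox) (auto simp: Basis_vec_def inner_axis intro!: prod.neutral)
  thus ?thesis by (simp add: measure_def)
qed

lemma prob_space_cube: "prob_space (cube_measure :: (real ^ 'd::finite) measure)"
proof
  have "emeasure lborel (unit_cube :: (real ^ 'd) set) = 1"
    by (subst emeasure_lborel_cbox) (auto simp: Basis_vec_def inner_axis intro!: prod.neutral)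
  thus "emeasure cube_measure (space (cube_measure :: (real ^ 'd) measure)) = 1"
    by (simp add: emeasure_restrict_space)
qed

definition fcoeff :: "(real ^ 'd::finite \<Rightarrow> complex) \<Rightarrow> int ^ 'd \<Rightarrow> complex" where
  "fcoeff g \<nu> = (LINT \<xi>|cube_measure. g \<xi> * cnj (character \<nu> \<xi>))"

lemma fourier_coeff_eq: "fourier_coeff p \<nu> x = fcoeff (p x) \<nu>"
proof -
  have "cnj (character \<nu> \<xi>) = exp (- 2 * \<i> * of_real pi * of_real (\<Sum>i\<in>UNIV. of_int (vec_nth \<nu> i) * vec_nth \<xi> i))" for \<xi>
    unfolding cnj_character unfolding character_def by (simp add: sum_negf)
  thus ?thesis by (simp add: fourier_coeff_def fcoeff_def)
qed

lemma fcoeff_diff: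
  assumes "continuous_on UNIV f" "continuous_on UNIV g"
  shows "fcoeff (\<lambda>\<xi>. f \<xi> - g \<xi>) \<nu> = fcoeff f \<nu> - fcoeff g \<nu>"
  unfolding fcoeff_def left_diff_distrib
  by (rule Bochner_Integration.integral_diff; rule integrable_cube) (intro continuous_intros assms)+

lemma fcoeff_cnj: "fcoeff (\<lambda>\<xi>. cnj (g \<xi>)) \<nu> = cnj (fcoeff g (- \<nu>))"
proof -
  have "cnj (fcoeff g (- \<nu>)) = (LINT \<xi>|cube_measure. cnj (g \<xi> * cnj (character (- \<nu>) \<xi>)))"
    unfolding fcoeff_def by (rule Bochner_Integration.integral_cnj[symmetric])
  thus ?thesis by (simp add: fcoeff_def cnj_character)
qed

lemma parseval_polynomial:
  assumes "finite S"
  shows "(LINT \<xi>|cube_measure. (cmod (\<Sum>\<nu>\<in>S. c \<nu> * character \<nu> \<xi>))\<^sup>2) = (\<Sum>\<nu>\<in>S. (cmod (c \<nu>))\<^sup>2)"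
proof -
  have "complex_of_real (LINT \<xi>|cube_measure. (cmod (\<Sum>\<nu>\<in>S. c \<nu> * character \<nu> \<xi>))\<^sup>2)
     = (LINT \<xi>|cube_measure. complex_of_real ((cmod (\<Sum>\<nu>\<in>S. c \<nu> * character \<nu> \<xi>))\<^sup>2))"
    by (rule integral_complex_of_real[symmetric])
  also have "\<dots> = (LINT \<xi>|cube_measure. (\<Sum>\<mu>\<in>S. \<Sum>\<nu>\<in>S. c \<mu> * cnj (c \<nu>) * character (\<mu> - \<nu>) \<xi>))"
    unfolding complex_norm_square cnj_sum sum_product complex_cnj_mult character_diff by (simp add: mult_ac)
  also have "\<dots> = (\<Sum>\<mu>\<in>S. LINT \<xi>|cube_measure. (\<Sum>\<nu>\<in>S. c \<mu> * cnj (c \<nu>) * character (\<mu> - \<nu>) \<xi>))"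
    by (rule Bochner_Integration.integral_sum, rule integrable_cube) (intro continuous_intros)
  also have "\<dots> = (\<Sum>\<mu>\<in>S. \<Sum>\<nu>\<in>S. LINT \<xi>|cube_measure. c \<mu> * cnj (c \<nu>) * character (\<mu> - \<nu>) \<xi>)"
    by (intro sum.cong refl, rule Bochner_Integration.integral_sum, rule integrable_cube) (intro continuous_intros)
  also have "\<dots> = (\<Sum>\<mu>\<in>S. \<Sum>\<nu>\<in>S. if \<nu> = \<mu> then c \<mu> * cnj (c \<nu>) else 0)"
    by (intro sum.cong refl) (auto simp: integral_character)
  also have "\<dots> = complex_of_real (\<Sum>\<nu>\<in>S. (cmod (c \<nu>))\<^sup>2)"
    using assms by (simp add: sum.delta complex_square_sum del: of_real_sum)
  finally show ?thesis by (simp only: of_real_eq_iff)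
qed

text \<open>Pythagoras: the inner product of \<open>g\<close> with its partial Fourier sum is the
  squared norm of that sum.\<close>

lemma projection_error:
  assumes g: "continuous_on UNIV g" and S: "finite S"
  shows "(LINT \<xi>|cube_measure. (cmod ((\<Sum>\<nu>\<in>S. fcoeff g \<nu> * character \<nu> \<xi>) - g \<xi>))\<^sup>2)
       = (LINT \<xi>|cube_measure. (cmod (g \<xi>))\<^sup>2) - (\<Sum>\<nu>\<in>S. (cmod (fcoeff g \<nu>))\<^sup>2)"
proof -
  define P where "P \<xi> = (\<Sum>\<nu>\<in>S. fcoeff g \<nu> * character \<nu> \<xi>)" for \<xi>
  have cP: "continuous_on UNIV P" unfolding P_def by (intro continuous_intros)
  have cross: "(LINT \<xi>|cube_measure. g \<xi> * cnj (P \<xi>)) = of_real (\<Sum>\<nu>\<in>S. (cmod (fcoeff g \<nu>))\<^sup>2)"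
  proof -
    have "(LINT \<xi>|cube_measure. g \<xi> * cnj (P \<xi>)) = (LINT \<xi>|cube_measure. (\<Sum>\<nu>\<in>S. cnj (fcoeff g \<nu>) * (g \<xi> * cnj (character \<nu> \<xi>))))"
      unfolding P_def cnj_sum sum_distrib_left by (simp add: mult_ac)
    also have "\<dots> = (\<Sum>\<nu>\<in>S. LINT \<xi>|cube_measure. cnj (fcoeff g \<nu>) * (g \<xi> * cnj (character \<nu> \<xi>)))"
      by (rule Bochner_Integration.integral_sum, rule integrable_cube) (intro continuous_intros g)
    also have "\<dots> = (\<Sum>\<nu>\<in>S. cnj (fcoeff g \<nu>) * fcoeff g \<nu>)" by (simp add: fcoeff_def)
    also have "\<dots> = of_real (\<Sum>\<nu>\<in>S. (cmod (fcoeff g \<nu>))\<^sup>2)"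
      unfolding complex_square_sum by (simp add: mult.commute)
    finally show ?thesis .
  qed
  have exp: "(cmod (P \<xi> - g \<xi>))\<^sup>2 = (cmod (P \<xi>))\<^sup>2 + (cmod (g \<xi>))\<^sup>2 - 2 * Re (g \<xi> * cnj (P \<xi>))" for \<xi>
    unfolding cmod_power2 by (simp add: power2_eq_square algebra_simps)
  have "(LINT \<xi>|cube_measure. (cmod (P \<xi> - g \<xi>))\<^sup>2) =
     (LINT \<xi>|cube_measure. (cmod (P \<xi>))\<^sup>2) + (LINT \<xi>|cube_measure. (cmod (g \<xi>))\<^sup>2) - (LINT \<xi>|cube_measure. 2 * Re (g \<xi> * cnj (P \<xi>)))"
    unfolding exp
    by (subst Bochner_Integration.integral_diff Bochner_Integration.integral_add;
        (intro integrable_cube continuous_intros g cP refl)?)+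
  also have "(LINT \<xi>|cube_measure. 2 * Re (g \<xi> * cnj (P \<xi>))) = 2 * Re (LINT \<xi>|cube_measure. g \<xi> * cnj (P \<xi>))"
  proof -
    have "(LINT \<xi>|cube_measure. Re (g \<xi> * cnj (P \<xi>))) = Re (LINT \<xi>|cube_measure. g \<xi> * cnj (P \<xi>))"
      by (rule integral_Re) (intro integrable_cube continuous_intros g cP)
    thus ?thesis by (simp only: integral_mult_right_zero)
  qed
  also have "(LINT \<xi>|cube_measure. (cmod (P \<xi>))\<^sup>2) = (\<Sum>\<nu>\<in>S. (cmod (fcoeff g \<nu>))\<^sup>2)"
    unfolding P_def by (rule parseval_polynomial[OF S])
  finally show ?thesis unfolding cross by (simp add: P_def)
qed

lemma bessel:
  assumes "continuous_on UNIV g" "finite S"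
  shows "(\<Sum>\<nu>\<in>S. (cmod (fcoeff g \<nu>))\<^sup>2) \<le> (LINT \<xi>|cube_measure. (cmod (g \<xi>))\<^sup>2)"
proof -
  have "0 \<le> (LINT \<xi>|cube_measure. (cmod ((\<Sum>\<nu>\<in>S. fcoeff g \<nu> * character \<nu> \<xi>) - g \<xi>))\<^sup>2)" by simp
  thus ?thesis unfolding projection_error[OF assms] by simp
qed

section \<open>Dirichlet kernels and Fourier tails of Lipschitz functions\<close>

definition pair_integral :: "(real ^ 'd::finite \<Rightarrow> real ^ 'd \<Rightarrow> 'b::{banach, second_countable_topology}) \<Rightarrow> 'b" where
  "pair_integral F = (LINT \<eta>|cube_measure. LINT \<xi>|cube_measure. F \<xi> \<eta>)"

text \<open>A function of \<xi> - \<eta> with spectrum in \<open>S\<close>. Constant coefficients 1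
  give the Dirichlet kernel of \<open>S\<close>; other coefficients occur after multiplication by a
  difference factor.\<close>

definition shift_kernel :: "(int ^ 'd::finite) set \<Rightarrow> (int ^ 'd \<Rightarrow> complex) \<Rightarrow> real ^ 'd \<Rightarrow> real ^ 'd \<Rightarrow> complex" where
  "shift_kernel S c \<xi> \<eta> = (\<Sum>j\<in>S. c j * (character j \<xi> * cnj (character j \<eta>)))"

lemma continuous_on_shift_kernel:
  "continuous_on UNIV (\<lambda>\<xi>. shift_kernel S c \<xi> \<eta>)" "continuous_on UNIV (\<lambda>\<eta>. shift_kernel S c \<xi> \<eta>)"
  unfolding shift_kernel_def by (intro continuous_intros)+

lemma integral_shift_kernel:
  assumes "finite S"
  shows "(LINT \<xi>|cube_measure. (cmod (shift_kernel S c \<xi> \<eta>))\<^sup>2) = (\<Sum>j\<in>S. (cmod (c j))\<^sup>2)"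
proof -
  have "(LINT \<xi>|cube_measure. (cmod (shift_kernel S c \<xi> \<eta>))\<^sup>2) =
     (LINT \<xi>|cube_measure. (cmod (\<Sum>j\<in>S. (c j * cnj (character j \<eta>)) * character j \<xi>))\<^sup>2)"
    unfolding shift_kernel_def by (simp add: mult_ac)
  also have "\<dots> = (\<Sum>j\<in>S. (cmod (c j * cnj (character j \<eta>)))\<^sup>2)" by (rule parseval_polynomial[OF assms])
  finally show ?thesis by (simp add: norm_mult)
qed

lemma shift_kernel_square:
  "complex_of_real ((cmod (shift_kernel S (\<lambda>_. 1) \<xi> \<eta>))\<^sup>2) =
    (\<Sum>j\<in>S. \<Sum>l\<in>S. character (j - l) \<xi> * cnj (character (j - l) \<eta>))"
  unfolding complex_norm_square shift_kernel_def cnj_sum sum_product character_diff by (simp add: mult_ac)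

text \<open>A finite sum for the inner integral makes it visibly continuous in \<eta> when
  \<open>b\<close> depends continuously on \<eta>, so that iterated integrals can be handled without
  a product measure.\<close>

lemma inner_shift_integral:
  assumes "continuous_on UNIV a"
  shows "(LINT \<xi>|cube_measure. a \<xi> * b * complex_of_real ((cmod (shift_kernel S (\<lambda>_. 1) \<xi> \<eta>))\<^sup>2)) =
    (\<Sum>j\<in>S. \<Sum>l\<in>S. fcoeff a (l - j) * (b * cnj (character (j - l) \<eta>)))"
proof -
  have "(LINT \<xi>|cube_measure. a \<xi> * b * complex_of_real ((cmod (shift_kernel S (\<lambda>_. 1) \<xi> \<eta>))\<^sup>2)) =
    (LINT \<xi>|cube_measure. (\<Sum>j\<in>S. \<Sum>l\<in>S. (a \<xi> * cnj (character (l - j) \<xi>)) * (b * cnj (character (j - l) \<eta>))))"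
    unfolding shift_kernel_square sum_distrib_left character_diff by (simp add: mult_ac)
  also have "\<dots> = (\<Sum>j\<in>S. \<Sum>l\<in>S. (LINT \<xi>|cube_measure. a \<xi> * cnj (character (l - j) \<xi>)) * (b * cnj (character (j - l) \<eta>)))"
    by (rule integral_sum_sum_mult, rule integrable_cube) (intro continuous_intros assms)
  finally show ?thesis unfolding fcoeff_def .
qed

lemma separated_shift_integral:
  assumes "continuous_on UNIV a" "continuous_on UNIV b"
  shows "pair_integral (\<lambda>\<xi> \<eta>. a \<xi> * b \<eta> * complex_of_real ((cmod (shift_kernel S (\<lambda>_. 1) \<xi> \<eta>))\<^sup>2)) =
    (\<Sum>j\<in>S. \<Sum>l\<in>S. fcoeff a (l - j) * fcoeff b (j - l))"
proof -
  have "pair_integral (\<lambda>\<xi> \<eta>. a \<xi> * b \<eta> * complex_of_real ((cmod (shift_kernel S (\<lambda>_. 1) \<xi> \<eta>))\<^sup>2)) =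
    (LINT \<eta>|cube_measure. (\<Sum>j\<in>S. \<Sum>l\<in>S. (b \<eta> * cnj (character (j - l) \<eta>)) * fcoeff a (l - j)))"
    unfolding pair_integral_def inner_shift_integral[OF assms(1)] by (simp add: mult_ac)
  also have "\<dots> = (\<Sum>j\<in>S. \<Sum>l\<in>S. (LINT \<eta>|cube_measure. b \<eta> * cnj (character (j - l) \<eta>)) * fcoeff a (l - j))"
    by (rule integral_sum_sum_mult, rule integrable_cube) (intro continuous_intros assms)
  finally show ?thesis unfolding fcoeff_def[of b] by (simp add: mult.commute)
qed

lemma periodic_int_shift:
  fixes g :: "real ^ 'd::finite \<Rightarrow> 'b"
  assumes "\<And>i \<xi>. g (\<xi> + axis i 1) = g \<xi>"
  shows "g (\<xi> + (\<Sum>i\<in>A. of_int (m i) *\<^sub>R axis i 1)) = g \<xi>"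
proof -
  have nat: "g (\<xi> + of_nat k *\<^sub>R axis i 1) = g \<xi>" for \<xi> i k
  proof (induction k)
    case (Suc k)
    have "g (\<xi> + of_nat (Suc k) *\<^sub>R axis i 1) = g ((\<xi> + of_nat k *\<^sub>R axis i 1) + axis i 1)"
      by (simp add: scaleR_add_left add_ac)
    thus ?case using assms Suc by simp
  qed simp
  have int: "g (\<xi> + of_int k *\<^sub>R axis i 1) = g \<xi>" for \<xi> i k
  proof (cases "k \<ge> 0")
    case True
    thus ?thesis using nat[of \<xi> "nat k" i] by simp
  next
    case False
    have "g ((\<xi> + of_int k *\<^sub>R axis i 1) + of_nat (nat (- k)) *\<^sub>R axis i 1) = g (\<xi> + of_int k *\<^sub>R axis i 1)" by (rule nat)
    thus ?thesis using False by simp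
  qed
  have "finite A" by simp
  thus ?thesis
  proof (induction A arbitrary: \<xi>)
    case (insert i A)
    have "g (\<xi> + (\<Sum>i\<in>insert i A. of_int (m i) *\<^sub>R axis i 1)) = g ((\<xi> + of_int (m i) *\<^sub>R axis i 1) + (\<Sum>i\<in>A. of_int (m i) *\<^sub>R axis i 1))"
      using insert by (simp add: add_ac)
    also have "\<dots> = g \<xi>" unfolding insert.IH by (rule int)
    finally show ?case .
  qed simp
qed

text \<open>The left factor is a chord of the circle, 2 |sin (pi t)|, and the concave sine lies
  above its secant between 0 and pi / 2.\<close>

lemma norm_one_minus_exp_ge:
  assumes "\<bar>t\<bar> \<le> 1 / 2"
  shows "4 * \<bar>t\<bar> \<le> cmod (1 - exp (2 * \<i> * of_real pi * of_real t))"
proof -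
  have "cmod (1 - exp (2 * \<i> * of_real pi * of_real t)) = cmod (exp (\<i> * of_real (2 * pi * t)) - 1)"
    by (subst norm_minus_commute) (simp add: mult_ac)
  hence eq: "cmod (1 - exp (2 * \<i> * of_real pi * of_real t)) = 2 * \<bar>sin (pi * t)\<bar>"
    unfolding dist_exp_i_1 by simp
  have "2 * s \<le> sin (pi * s)" if s: "0 \<le> s" "s \<le> 1 / 2" for s
  proof -
    have "concave_on {0..pi} sin"
      by (rule f''_le0_imp_concave[where f' = cos and f'' = "\<lambda>x. - sin x"]) (auto intro!: derivative_eq_intros sin_ge_zero)
    hence "(1 - 2 * s) * sin 0 + (2 * s) * sin (pi / 2) \<le> sin ((1 - 2 * s) * 0 + (2 * s) * (pi / 2))"
      using s concave_onD[of "{0..pi}" sin "2 * s" 0 "pi / 2"] by simp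
    thus ?thesis by (simp add: mult_ac)
  qed
  from this[of "\<bar>t\<bar>"] have "2 * \<bar>t\<bar> \<le> \<bar>sin (pi * t)\<bar>" using assms by (cases "t \<ge> 0") auto
  thus ?thesis unfolding eq by simp
qed

text \<open>The distance in each coordinate is reduced modulo 1 to at most 1/2 by a lattice
  translation of \<eta>, and is then comparable to a chord.\<close>

lemma periodic_lipschitz:
  fixes g :: "real ^ 'd::finite \<Rightarrow> complex"
  assumes per: "\<And>i \<xi>. g (\<xi> + axis i 1) = g \<xi>"
    and lip: "\<And>\<xi> \<eta>. cmod (g \<xi> - g \<eta>) \<le> L * (\<Sum>i\<in>UNIV. \<bar>vec_nth \<xi> i - vec_nth \<eta> i\<bar>)" and L: "L \<ge> 0"
  shows "cmod (g \<xi> - g \<eta>) \<le> L / 4 * (\<Sum>i\<in>UNIV. cmod (1 - character (axis i 1) \<xi> * cnj (character (axis i 1) \<eta>)))"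
proof -
  define m where "m i = round (vec_nth \<xi> i - vec_nth \<eta> i)" for i
  define \<eta>' where "\<eta>' = \<eta> + (\<Sum>i\<in>UNIV. of_int (m i) *\<^sub>R axis i 1)"
  have comp: "vec_nth \<eta>' i = vec_nth \<eta> i + of_int (m i)" for i
    unfolding \<eta>'_def by (simp add: axis_def if_distrib sum.delta cong: if_cong)
  have "g \<eta>' = g \<eta>" unfolding \<eta>'_def by (rule periodic_int_shift[OF per])
  hence "cmod (g \<xi> - g \<eta>) \<le> L * (\<Sum>i\<in>UNIV. \<bar>vec_nth \<xi> i - vec_nth \<eta>' i\<bar>)" using lip[of \<xi> \<eta>'] by simp
  also have "\<dots> \<le> L * (\<Sum>i\<in>UNIV. cmod (1 - character (axis i 1) \<xi> * cnj (character (axis i 1) \<eta>)) / 4)"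
  proof (intro mult_left_mono sum_mono L)
    fix i :: 'd
    define t where "t = vec_nth \<xi> i - vec_nth \<eta>' i"
    have t: "\<bar>t\<bar> \<le> 1 / 2" unfolding t_def comp m_def
      using of_int_round_abs_le[of "vec_nth \<xi> i - vec_nth \<eta> i"] by (simp add: abs_minus_commute algebra_simps)
    have ch: "character (axis i 1) \<zeta> = exp (2 * \<i> * of_real pi * of_real (vec_nth \<zeta> i))" for \<zeta> :: "real ^ 'd"
    proof -
      have "(\<Sum>j\<in>UNIV. of_int (vec_nth (axis i 1) j) * vec_nth \<zeta> j) = (\<Sum>j\<in>UNIV. if j = i then vec_nth \<zeta> j else 0)"
        by (intro sum.cong) (auto simp: axis_def)
      thus ?thesis unfolding character_def by (simp add: sum.delta)
    qed
    have "character (axis i 1) \<xi> * cnj (character (axis i 1) \<eta>) = exp (2 * \<i> * of_real pi * of_real (vec_nth \<xi> i - vec_nth \<eta> i))"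
      unfolding ch exp_cnj by (simp add: exp_add[symmetric] algebra_simps)
    also have "\<dots> = exp (2 * \<i> * of_real pi * of_real t + 2 * of_int (m i) * of_real pi * \<i>)"
      unfolding t_def comp by (simp add: algebra_simps)
    also have "\<dots> = exp (2 * \<i> * of_real pi * of_real t)" using exp_integer_2pi[of "of_int (m i)"] by (simp add: exp_add)
    finally show "\<bar>vec_nth \<xi> i - vec_nth \<eta>' i\<bar> \<le> cmod (1 - character (axis i 1) \<xi> * cnj (character (axis i 1) \<eta>)) / 4"
      using norm_one_minus_exp_ge[OF t] by (simp add: t_def)
  qed
  finally show ?thesis unfolding sum_divide_distrib[symmetric] by simp
qed

text \<open>
  The left-hand side equals half the double integral of
  \<open>|g \<xi> - g \<eta>|\<^sup>2 |D (\<xi> - \<eta>)|\<^sup>2\<close>, where \<open>D\<close> is the Dirichlet kernel of \<open>S\<close>. For Lipschitz \<open>g\<close>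
  the first factor is absorbed by \<open>|1 - e (\<xi>\<^sub>i - \<eta>\<^sub>i)|\<^sup>2\<close>, and multiplication of \<open>D\<close> by
  \<open>1 - e (\<xi>\<^sub>i - \<eta>\<^sub>i)\<close> leaves only the boundary terms of \<open>S\<close> in direction \<open>i\<close>.
\<close>

lemma block_fourier_tail:
  fixes g :: "real ^ 'd::finite \<Rightarrow> complex" and S :: "(int ^ 'd) set"
  assumes per: "\<And>i \<xi>. g (\<xi> + axis i 1) = g \<xi>" and cont: "continuous_on UNIV g"
    and lip: "\<And>\<xi> \<eta>. cmod (g \<xi> - g \<eta>) \<le> L * (\<Sum>i\<in>UNIV. \<bar>vec_nth \<xi> i - vec_nth \<eta> i\<bar>)" and L: "L \<ge> 0"
    and S: "finite S"
  shows "(\<Sum>j\<in>S. (LINT \<xi>|cube_measure. (cmod (g \<xi>))\<^sup>2) - (\<Sum>l\<in>S. (cmod (fcoeff g (j - l)))\<^sup>2))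
    \<le> L\<^sup>2 * real CARD('d) * (\<Sum>i\<in>UNIV. real (card {j \<in> S. j - axis i 1 \<notin> S} + card {j. j \<notin> S \<and> j - axis i 1 \<in> S}))"
proof -
  define K where "K \<xi> \<eta> = (cmod (shift_kernel S (\<lambda>_. 1) \<xi> \<eta>))\<^sup>2" for \<xi> \<eta>
  define G where "G = (LINT \<xi>|cube_measure. (cmod (g \<xi>))\<^sup>2)"
  define F where "F = (\<Sum>j\<in>S. \<Sum>l\<in>S. (cmod (fcoeff g (j - l)))\<^sup>2)"
  define q where "q \<xi> = complex_of_real ((cmod (g \<xi>))\<^sup>2)" for \<xi>
  have cq: "continuous_on UNIV q" unfolding q_def by (intro continuous_intros cont)
  have cg: "continuous_on UNIV (\<lambda>\<xi>. cnj (g \<xi>))" by (intro continuous_intros cont)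
  have f1: "fcoeff (\<lambda>_. 1) \<nu> = of_bool (\<nu> = 0)" for \<nu> :: "int ^ 'd"
    unfolding fcoeff_def by (simp add: cnj_character integral_character)
  have fq: "fcoeff q 0 = of_real G"
    unfolding fcoeff_def q_def G_def by (subst integral_complex_of_real[symmetric]) simp
  have K: "continuous_on UNIV (\<lambda>\<xi>. K \<xi> \<eta>)" "continuous_on UNIV (\<lambda>\<eta>. K \<xi> \<eta>)" for \<xi> \<eta>
    unfolding K_def by (intro continuous_intros continuous_on_shift_kernel)+
  \<comment> \<open>The constant 1 has only the zero frequency, so only the terms with
    \<open>l = j\<close> survive.\<close>
  have diag: "(\<Sum>j\<in>S. \<Sum>l\<in>S. fcoeff q (l - j) * fcoeff (\<lambda>_. 1) (j - l)) = of_real (card S * G)"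
    "(\<Sum>j\<in>S. \<Sum>l\<in>S. fcoeff (\<lambda>_. 1) (l - j) * fcoeff q (j - l)) = of_real (card S * G)"
  proof -
    have "(\<Sum>j\<in>S. \<Sum>l\<in>S. fcoeff q (l - j) * fcoeff (\<lambda>_. 1) (j - l)) = (\<Sum>j\<in>S. \<Sum>l\<in>S. if l = j then of_real G else 0)"
      by (intro sum.cong refl) (auto simp: f1 fq)
    thus "(\<Sum>j\<in>S. \<Sum>l\<in>S. fcoeff q (l - j) * fcoeff (\<lambda>_. 1) (j - l)) = of_real (card S * G)" using S by (simp add: sum.delta)
    have "(\<Sum>j\<in>S. \<Sum>l\<in>S. fcoeff (\<lambda>_. 1) (l - j) * fcoeff q (j - l)) = (\<Sum>j\<in>S. \<Sum>l\<in>S. if l = j then of_real G else 0)"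
      by (intro sum.cong refl) (auto simp: f1 fq)
    thus "(\<Sum>j\<in>S. \<Sum>l\<in>S. fcoeff (\<lambda>_. 1) (l - j) * fcoeff q (j - l)) = of_real (card S * G)" using S by (simp add: sum.delta)
  qed
  have cross: "(\<Sum>j\<in>S. \<Sum>l\<in>S. fcoeff g (l - j) * fcoeff (\<lambda>\<xi>. cnj (g \<xi>)) (j - l)) = of_real F"
    "(\<Sum>j\<in>S. \<Sum>l\<in>S. fcoeff (\<lambda>\<xi>. cnj (g \<xi>)) (l - j) * fcoeff g (j - l)) = of_real F"
  proof -
    have F': "of_real F = (\<Sum>j\<in>S. \<Sum>l\<in>S. fcoeff g (j - l) * cnj (fcoeff g (j - l)))"
      unfolding F_def of_real_sum by (simp add: complex_norm_square del: of_real_power)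
    show "(\<Sum>j\<in>S. \<Sum>l\<in>S. fcoeff (\<lambda>\<xi>. cnj (g \<xi>)) (l - j) * fcoeff g (j - l)) = of_real F"
      unfolding F' fcoeff_cnj by (simp add: mult.commute)
    show "(\<Sum>j\<in>S. \<Sum>l\<in>S. fcoeff g (l - j) * fcoeff (\<lambda>\<xi>. cnj (g \<xi>)) (j - l)) = of_real F"
      unfolding F' fcoeff_cnj by (subst sum.swap) simp
  qed
  \<comment> \<open>Expanding the square separates the variables: two terms carry the squared
    modulus of \<open>g\<close> in one variable, two are the mixed products.\<close>
  have expand: "complex_of_real ((cmod (g \<xi> - g \<eta>))\<^sup>2 * K \<xi> \<eta>) = q \<xi> * 1 * of_real (K \<xi> \<eta>) + 1 * q \<eta> * of_real (K \<xi> \<eta>)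
     - g \<xi> * cnj (g \<eta>) * of_real (K \<xi> \<eta>) - cnj (g \<xi>) * g \<eta> * of_real (K \<xi> \<eta>)" for \<xi> \<eta>
    unfolding q_def of_real_mult complex_norm_square by (simp add: algebra_simps)
  define I where "I a b \<eta> = (LINT \<xi>|cube_measure. a \<xi> * b \<eta> * complex_of_real (K \<xi> \<eta>))" for a b \<eta>
  have Ieq: "I a b \<eta> = (\<Sum>j\<in>S. \<Sum>l\<in>S. fcoeff a (l - j) * (b \<eta> * cnj (character (j - l) \<eta>)))" if "continuous_on UNIV a" for a b \<eta>
    unfolding I_def K_def by (rule inner_shift_integral[OF that])
  have Icont: "continuous_on UNIV (I a b)" if "continuous_on UNIV a" "continuous_on UNIV b" for a b
    unfolding Ieq[OF that(1)] by (intro continuous_intros that(2))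
  have one: "continuous_on UNIV (\<lambda>_ :: real ^ 'd. 1 :: complex)" by (intro continuous_intros)
  define T where "T \<eta> = (LINT \<xi>|cube_measure. (cmod (g \<xi> - g \<eta>))\<^sup>2 * K \<xi> \<eta>)" for \<eta>
  have Tc: "complex_of_real (T \<eta>) = I q (\<lambda>_. 1) \<eta> + I (\<lambda>_. 1) q \<eta> - I g (\<lambda>\<xi>. cnj (g \<xi>)) \<eta> - I (\<lambda>\<xi>. cnj (g \<xi>)) g \<eta>" for \<eta>
  proof -
    have "complex_of_real (T \<eta>) = (LINT \<xi>|cube_measure. complex_of_real ((cmod (g \<xi> - g \<eta>))\<^sup>2 * K \<xi> \<eta>))"
      unfolding T_def by (rule integral_complex_of_real[symmetric])
    also have "\<dots> = (LINT \<xi>|cube_measure. q \<xi> * 1 * of_real (K \<xi> \<eta>) + 1 * q \<eta> * of_real (K \<xi> \<eta>)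
     - g \<xi> * cnj (g \<eta>) * of_real (K \<xi> \<eta>) - cnj (g \<xi>) * g \<eta> * of_real (K \<xi> \<eta>))" unfolding expand ..
    also have "\<dots> = I q (\<lambda>_. 1) \<eta> + I (\<lambda>_. 1) q \<eta> - I g (\<lambda>\<xi>. cnj (g \<xi>)) \<eta> - I (\<lambda>\<xi>. cnj (g \<xi>)) g \<eta>"
      unfolding I_def
      by (subst Bochner_Integration.integral_diff Bochner_Integration.integral_add;
          (intro integrable_cube continuous_intros cont cq K refl)?)+
    finally show ?thesis .
  qed
  have Tcont: "continuous_on UNIV T"
  proof -
    have "T = (\<lambda>\<eta>. Re (I q (\<lambda>_. 1) \<eta> + I (\<lambda>_. 1) q \<eta> - I g (\<lambda>\<xi>. cnj (g \<xi>)) \<eta> - I (\<lambda>\<xi>. cnj (g \<xi>)) g \<eta>))"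
      unfolding Tc[symmetric] by simp
    thus ?thesis by (simp only:) (intro continuous_intros Icont cq cont cg one)
  qed
  have "complex_of_real (LINT \<eta>|cube_measure. T \<eta>) = (LINT \<eta>|cube_measure. complex_of_real (T \<eta>))"
    by (rule integral_complex_of_real[symmetric])
  also have "\<dots> = (LINT \<eta>|cube_measure. I q (\<lambda>_. 1) \<eta>) + (LINT \<eta>|cube_measure. I (\<lambda>_. 1) q \<eta>)
       - (LINT \<eta>|cube_measure. I g (\<lambda>\<xi>. cnj (g \<xi>)) \<eta>) - (LINT \<eta>|cube_measure. I (\<lambda>\<xi>. cnj (g \<xi>)) g \<eta>)"
    unfolding Tc
    by (subst Bochner_Integration.integral_diff Bochner_Integration.integral_add;
        (intro integrable_cube continuous_intros Icont cq cont cg one refl)?)+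
  also have "\<dots> = complex_of_real (2 * (card S * G - F))"
    using separated_shift_integral[OF cq one, of S] separated_shift_integral[OF one cq, of S]
      separated_shift_integral[OF cont cg, of S] separated_shift_integral[OF cg cont, of S]
    unfolding I_def K_def pair_integral_def diag cross by simp
  finally have dbl: "(LINT \<eta>|cube_measure. T \<eta>) = 2 * (card S * G - F)" by (simp only: of_real_eq_iff)
  define W where "W i \<xi> \<eta> = (1 - character (axis i 1) \<xi> * cnj (character (axis i 1) \<eta>)) * shift_kernel S (\<lambda>_. 1) \<xi> \<eta>" for i :: 'd and \<xi> \<eta>
  \<comment> \<open>The points of \<open>S\<close> that have no predecessor in direction
    \<open>i\<close>, and those just outside \<open>S\<close> that have one. In the difference of
    the kernel and its shift all other terms cancel.\<close>
  define A B where "A i = {j \<in> S. j - axis i 1 \<notin> S}" and "B i = {j. j \<notin> S \<and> j - axis i 1 \<in> S}" for i :: 'd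
  have finB: "finite (B i)" "finite (A i)" for i
  proof -
    have "B i \<subseteq> (\<lambda>j. j + axis i 1) ` S"
    proof
      fix j assume "j \<in> B i"
      hence "j = (j - axis i 1) + axis i 1" "j - axis i 1 \<in> S" by (auto simp: B_def)
      thus "j \<in> (\<lambda>j. j + axis i 1) ` S" by blast
    qed
    thus "finite (B i)" using S finite_subset by blast
    show "finite (A i)" using S by (simp add: A_def)
  qed
  have W: "W i \<xi> \<eta> = shift_kernel (A i \<union> B i) (\<lambda>j. if j \<in> S then 1 else -1) \<xi> \<eta>" for i \<xi> \<eta>
  proof -
    define k where "k j = character j \<xi> * cnj (character j \<eta>)" for j :: "int ^ 'd"
    have "W i \<xi> \<eta> = (\<Sum>j\<in>S. k j) - (\<Sum>j\<in>S. k (j + axis i 1))"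
      unfolding W_def shift_kernel_def k_def left_diff_distrib sum_distrib_left character_add by (simp add: mult_ac sum_subtractf)
    also have "(\<Sum>j\<in>S. k (j + axis i 1)) = (\<Sum>j\<in>(\<lambda>j. j + axis i 1) ` S. k j)"
      by (subst sum.reindex) (auto simp: inj_on_def)
    also have "(\<lambda>j. j + axis i 1) ` S = {j. j - axis i 1 \<in> S}" by (auto simp: image_iff) (metis diff_add_cancel)
    also have "(\<Sum>j\<in>S. k j) = (\<Sum>j\<in>A i. k j) + (\<Sum>j\<in>{j \<in> S. j - axis i 1 \<in> S}. k j)"
      using S by (subst sum.union_disjoint[symmetric]) (auto simp: A_def intro!: sum.cong)
    also have "(\<Sum>j\<in>{j. j - axis i 1 \<in> S}. k j) = (\<Sum>j\<in>B i. k j) + (\<Sum>j\<in>{j \<in> S. j - axis i 1 \<in> S}. k j)"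
      using S finB by (subst sum.union_disjoint[symmetric]) (auto simp: B_def intro!: sum.cong)
    finally have "W i \<xi> \<eta> = (\<Sum>j\<in>A i. k j) - (\<Sum>j\<in>B i. k j)" by simp
    also have "\<dots> = (\<Sum>j\<in>A i. (if j \<in> S then 1 else -1) * k j) + (\<Sum>j\<in>B i. (if j \<in> S then 1 else -1) * k j)"
      unfolding diff_conv_add_uminus sum_negf[symmetric]
      by (intro arg_cong2[where f = "(+)"] sum.cong refl) (auto simp: A_def B_def)
    also have "\<dots> = shift_kernel (A i \<union> B i) (\<lambda>j. if j \<in> S then 1 else -1) \<xi> \<eta>"
      unfolding shift_kernel_def k_def using finB by (subst sum.union_disjoint) (auto simp: A_def B_def)
    finally show ?thesis .
  qed
  have Wint: "(LINT \<xi>|cube_measure. (cmod (W i \<xi> \<eta>))\<^sup>2) = real (card (A i) + card (B i))" for i \<eta>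
  proof -
    have "(LINT \<xi>|cube_measure. (cmod (W i \<xi> \<eta>))\<^sup>2) = (\<Sum>j\<in>A i \<union> B i. (cmod (if j \<in> S then 1 else -1))\<^sup>2)"
      unfolding W by (rule integral_shift_kernel) (use finB in auto)
    also have "\<dots> = (\<Sum>j\<in>A i \<union> B i. 1)" by (intro sum.cong) auto
    also have "\<dots> = real (card (A i) + card (B i))" using finB by (subst card_Un_disjoint[symmetric]) (auto simp: A_def B_def)
    finally show ?thesis .
  qed
  have Wcont: "continuous_on UNIV (\<lambda>\<xi>. W i \<xi> \<eta>)" for i \<eta>
    unfolding W_def by (intro continuous_intros continuous_on_shift_kernel)
  have point: "(cmod (g \<xi> - g \<eta>))\<^sup>2 * K \<xi> \<eta> \<le> L\<^sup>2 / 16 * real CARD('d) * (\<Sum>i\<in>UNIV. (cmod (W i \<xi> \<eta>))\<^sup>2)" for \<xi> \<eta>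
  proof -
    define w where "w i = cmod (1 - character (axis i 1) \<xi> * cnj (character (axis i 1) \<eta>))" for i :: 'd
    have "cmod (g \<xi> - g \<eta>) \<le> L / 4 * (\<Sum>i\<in>UNIV. w i)" unfolding w_def by (rule periodic_lipschitz[OF per lip L])
    hence "(cmod (g \<xi> - g \<eta>))\<^sup>2 \<le> (L / 4 * (\<Sum>i\<in>UNIV. w i))\<^sup>2" by (intro power_mono) auto
    also have "\<dots> = L\<^sup>2 / 16 * (\<Sum>i\<in>UNIV. w i)\<^sup>2" by (simp add: power_mult_distrib power_divide)
    also have "\<dots> \<le> L\<^sup>2 / 16 * (real CARD('d) * (\<Sum>i\<in>UNIV. (w i)\<^sup>2))"
      using sum_squared_le_sum_of_squares[of w "UNIV :: 'd set"] by (intro mult_left_mono) (auto simp: mult.commute)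
    finally have "(cmod (g \<xi> - g \<eta>))\<^sup>2 * K \<xi> \<eta> \<le> L\<^sup>2 / 16 * (real CARD('d) * (\<Sum>i\<in>UNIV. (w i)\<^sup>2)) * K \<xi> \<eta>"
      by (intro mult_right_mono) (auto simp: K_def)
    also have "\<dots> = L\<^sup>2 / 16 * real CARD('d) * (\<Sum>i\<in>UNIV. (w i)\<^sup>2 * K \<xi> \<eta>)"
      unfolding sum_distrib_right[symmetric] by (simp only: mult_ac)
    also have "(\<Sum>i\<in>UNIV. (w i)\<^sup>2 * K \<xi> \<eta>) = (\<Sum>i\<in>UNIV. (cmod (W i \<xi> \<eta>))\<^sup>2)"
      unfolding w_def K_def W_def by (simp add: norm_mult power_mult_distrib)
    finally show ?thesis .
  qed
  define c where "c = L\<^sup>2 / 16 * real CARD('d) * (\<Sum>i\<in>UNIV. real (card (A i) + card (B i)))"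
  have Tle: "T \<eta> \<le> c" for \<eta>
  proof -
    have "T \<eta> \<le> (LINT \<xi>|cube_measure. L\<^sup>2 / 16 * real CARD('d) * (\<Sum>i\<in>UNIV. (cmod (W i \<xi> \<eta>))\<^sup>2))"
      unfolding T_def
      by (rule integral_mono[OF _ _ point]; intro integrable_cube continuous_intros cont K Wcont)
    also have "\<dots> = L\<^sup>2 / 16 * real CARD('d) * (\<Sum>i\<in>UNIV. (LINT \<xi>|cube_measure. (cmod (W i \<xi> \<eta>))\<^sup>2))"
      by (subst integral_mult_right_zero, subst Bochner_Integration.integral_sum)
         (auto intro!: integrable_cube continuous_intros Wcont)
    finally show ?thesis unfolding Wint c_def .
  qed
  interpret prob_space "cube_measure :: (real ^ 'd) measure" by (rule prob_space_cube)
  have "(LINT \<eta>|cube_measure. T \<eta>) \<le> (LINT \<eta>|(cube_measure :: (real ^ 'd) measure). c)"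
    by (rule integral_mono[OF integrable_cube[OF Tcont] _ Tle]) auto
  also have "\<dots> = c" using prob_space by simp
  finally have le: "2 * (card S * G - F) \<le> c" unfolding dbl .
  \<comment> \<open>The factors 1/16 and 1/2 are given up for a simpler bound.\<close>
  define X where "X = L\<^sup>2 * real CARD('d) * (\<Sum>i\<in>UNIV. real (card (A i) + card (B i)))"
  have "c = X / 16" unfolding c_def X_def by simp
  moreover have "X \<ge> 0" unfolding X_def by (intro mult_nonneg_nonneg sum_nonneg) auto
  moreover have "Y \<le> X" if "2 * Y \<le> c" "c = X / 16" "X \<ge> 0" for Y :: real
    using that by linarith
  ultimately have "card S * G - F \<le> X" using le by blast
  thus ?thesis unfolding X_def A_def B_def F_def G_def by (simp add: sum_subtractf)
qed

section \<open>Wave packets\<close>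

context
  fixes G :: "(int ^ 'd::finite) set" and b :: "int ^ 'd \<Rightarrow> 'b"
  assumes finG: "finite G"

begin

definition block :: "int ^ 'd \<Rightarrow> (int ^ 'd) set" where
  "block j = {l \<in> G. b l = b j}"

text \<open>The conjugate character makes a Toeplitz matrix with entries
  \<open>fcoeff g (k - l)\<close> act as multiplication by g \<xi>. A packet depends on
  \<open>j\<close> only through its block, so each block contributes as many equal packets as it has
  points; this multiplicity cancels the squared normalization.\<close>

definition packet :: "int ^ 'd \<Rightarrow> real ^ 'd \<Rightarrow> int ^ 'd \<Rightarrow> complex" where
  "packet j \<xi> l = (if b l = b j then cnj (character l \<xi>) / of_real (sqrt (card (block j))) else 0)"

lemma finite_block [simp]: "finite (block j)"
  using finG by (simp add: block_def)

lemma card_block_pos: "j \<in> G \<Longrightarrow> card (block j) > 0"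
  using finG by (auto simp: block_def card_gt_0_iff)

lemma blockG: "k \<in> block j \<Longrightarrow> k \<in> G"
  by (simp add: block_def)

lemma block_eq: "b l = b j \<Longrightarrow> block l = block j"
  by (simp add: block_def)

lemma sum_over_block: "(\<Sum>l\<in>G. if b l = b j then f l else 0) = (\<Sum>l\<in>block j. f l)"
  unfolding block_def using finG by (simp add: sum.inter_filter)

lemma packet_unit:
  assumes "j \<in> G"
  shows "(\<Sum>l\<in>G. (cmod (packet j \<xi> l))\<^sup>2) = 1"
proof -
  have "(\<Sum>l\<in>G. (cmod (packet j \<xi> l))\<^sup>2) = (\<Sum>l\<in>G. if b l = b j then 1 / real (card (block j)) else 0)"
    by (intro sum.cong refl) (simp add: packet_def norm_divide power_divide)
  also have "\<dots> = 1" unfolding sum_over_block using card_block_pos[OF assms] by (simp add: card_gt_0_iff)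
  finally show ?thesis .
qed

lemma continuous_on_packet: "continuous_on UNIV (\<lambda>\<xi>. packet j \<xi> l)"
proof (cases "b l = b j")
  case True
  hence "(\<lambda>\<xi>. packet j \<xi> l) = (\<lambda>\<xi>. cnj (character l \<xi>) * inverse (of_real (sqrt (card (block j)))))"
    by (simp add: packet_def divide_inverse)
  thus ?thesis by (simp only:) (intro continuous_intros)
qed (simp add: packet_def)

lemma packet_resolution:
  assumes "k \<in> G" "l \<in> G"
  shows "(\<Sum>j\<in>G. LINT \<xi>|cube_measure. packet j \<xi> k * cnj (packet j \<xi> l)) = of_bool (k = l)"
proof -
  have "(LINT \<xi>|cube_measure. packet j \<xi> k * cnj (packet j \<xi> l)) =
      (if b j = b k then of_bool (k = l) / of_nat (card (block k)) else 0)" if "j \<in> G" for j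
  proof (cases "b j = b k \<and> b j = b l")
    case True
    have "(LINT \<xi>|cube_measure. packet j \<xi> k * cnj (packet j \<xi> l))
       = (LINT \<xi>|cube_measure. character (l - k) \<xi> / of_nat (card (block k)))"
      by (intro Bochner_Integration.integral_cong refl)
         (use True block_eq[of j k] in \<open>auto simp: packet_def character_diff simp flip: of_real_mult\<close>)
    thus ?thesis using True by (auto simp: integral_character)
  next
    case False
    hence z: "packet j \<xi> k * cnj (packet j \<xi> l) = 0" for \<xi> by (auto simp: packet_def)
    show ?thesis unfolding z using False by auto
  qed
  hence "(\<Sum>j\<in>G. LINT \<xi>|cube_measure. packet j \<xi> k * cnj (packet j \<xi> l)) =
      (\<Sum>j\<in>G. if b j = b k then of_bool (k = l) / of_nat (card (block k)) else 0)" by (rule sum.cong[OF refl])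
  also have "\<dots> = of_bool (k = l)" unfolding sum_over_block using card_block_pos[OF assms(1)] by (simp add: card_gt_0_iff)
  finally show ?thesis .
qed

text \<open>Row by row: the squared pairing of a row with all packets is evaluated by the resolution
  of the identity.\<close>

lemma packet_hilbert_schmidt:
  "(\<Sum>j\<in>G. LINT \<xi>|cube_measure. (\<Sum>k\<in>G. (cmod (\<Sum>l\<in>G. E k l * packet j \<xi> l))\<^sup>2)) = (\<Sum>k\<in>G. \<Sum>l\<in>G. (cmod (E k l))\<^sup>2)"
proof -
  note [continuous_intros] = continuous_on_packet
  have row: "(\<Sum>j\<in>G. LINT \<xi>|cube_measure. (cmod (\<Sum>l\<in>G. E k l * packet j \<xi> l))\<^sup>2) = (\<Sum>l\<in>G. (cmod (E k l))\<^sup>2)" for k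
  proof -
    have one: "complex_of_real (LINT \<xi>|cube_measure. (cmod (\<Sum>l\<in>G. E k l * packet j \<xi> l))\<^sup>2) =
      (\<Sum>l\<in>G. \<Sum>m\<in>G. (LINT \<xi>|cube_measure. packet j \<xi> l * cnj (packet j \<xi> m)) * (E k l * cnj (E k m)))" for j
    proof -
      have "complex_of_real (LINT \<xi>|cube_measure. (cmod (\<Sum>l\<in>G. E k l * packet j \<xi> l))\<^sup>2) =
        (LINT \<xi>|cube_measure. complex_of_real ((cmod (\<Sum>l\<in>G. E k l * packet j \<xi> l))\<^sup>2))"
        by (rule integral_complex_of_real[symmetric])
      also have "\<dots> = (LINT \<xi>|cube_measure. (\<Sum>l\<in>G. \<Sum>m\<in>G. (packet j \<xi> l * cnj (packet j \<xi> m)) * (E k l * cnj (E k m))))"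
        unfolding complex_norm_square cnj_sum sum_product by (simp add: mult_ac)
      also have "\<dots> = (\<Sum>l\<in>G. \<Sum>m\<in>G. (LINT \<xi>|cube_measure. packet j \<xi> l * cnj (packet j \<xi> m)) * (E k l * cnj (E k m)))"
        by (rule integral_sum_sum_mult, rule integrable_cube) (intro continuous_intros)
      finally show ?thesis .
    qed
    have "complex_of_real (\<Sum>j\<in>G. LINT \<xi>|cube_measure. (cmod (\<Sum>l\<in>G. E k l * packet j \<xi> l))\<^sup>2) =
      (\<Sum>j\<in>G. \<Sum>l\<in>G. \<Sum>m\<in>G. (LINT \<xi>|cube_measure. packet j \<xi> l * cnj (packet j \<xi> m)) * (E k l * cnj (E k m)))"
      unfolding of_real_sum one ..
    also have "\<dots> = (\<Sum>l\<in>G. \<Sum>j\<in>G. \<Sum>m\<in>G. (LINT \<xi>|cube_measure. packet j \<xi> l * cnj (packet j \<xi> m)) * (E k l * cnj (E k m)))"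
      by (rule sum.swap)
    also have "\<dots> = (\<Sum>l\<in>G. \<Sum>m\<in>G. \<Sum>j\<in>G. (LINT \<xi>|cube_measure. packet j \<xi> l * cnj (packet j \<xi> m)) * (E k l * cnj (E k m)))"
      by (intro sum.cong refl sum.swap)
    also have "\<dots> = (\<Sum>l\<in>G. \<Sum>m\<in>G. if m = l then E k l * cnj (E k m) else 0)"
      unfolding sum_distrib_right[symmetric] by (intro sum.cong refl) (auto simp: packet_resolution)
    also have "\<dots> = complex_of_real (\<Sum>l\<in>G. (cmod (E k l))\<^sup>2)"
      unfolding complex_square_sum using finG by (intro sum.cong refl) (simp add: sum.delta)
    finally show ?thesis by (simp only: of_real_eq_iff)
  qed
  have "(\<Sum>j\<in>G. LINT \<xi>|cube_measure. (\<Sum>k\<in>G. (cmod (\<Sum>l\<in>G. E k l * packet j \<xi> l))\<^sup>2)) =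
     (\<Sum>j\<in>G. \<Sum>k\<in>G. LINT \<xi>|cube_measure. (cmod (\<Sum>l\<in>G. E k l * packet j \<xi> l))\<^sup>2)"
    by (intro sum.cong refl Bochner_Integration.integral_sum integrable_cube) (intro continuous_intros)
  also have "\<dots> = (\<Sum>k\<in>G. \<Sum>j\<in>G. LINT \<xi>|cube_measure. (cmod (\<Sum>l\<in>G. E k l * packet j \<xi> l))\<^sup>2)" by (rule sum.swap)
  finally show ?thesis unfolding row .
qed

text \<open>If \<open>g\<close> is constant on blocks, this is block diagonal with a genuine
  Toeplitz matrix in each block: the symbol is frozen there and couplings between blocks are
  dropped.\<close>

definition block_toeplitz :: "(int ^ 'd \<Rightarrow> real ^ 'd \<Rightarrow> complex) \<Rightarrow> int ^ 'd \<Rightarrow> int ^ 'd \<Rightarrow> complex" where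
  "block_toeplitz g k l = (if b k = b l then fcoeff (g k) (k - l) else 0)"

definition block_tail :: "(int ^ 'd \<Rightarrow> real ^ 'd \<Rightarrow> complex) \<Rightarrow> real" where
  "block_tail g = (\<Sum>j\<in>G. (LINT \<xi>|cube_measure. (cmod (g j \<xi>))\<^sup>2) - (\<Sum>l\<in>block j. (cmod (fcoeff (g j) (j - l)))\<^sup>2))"

text \<open>On its block the truncated convolution multiplies the plane wave in row \<open>k\<close>
  by a partial Fourier sum of \<open>g k\<close> instead of \<open>g k\<close>; the defect
  \<open>P k\<close> is a projection error.\<close>

lemma packet_block_toeplitz:
  assumes g: "\<And>j. j \<in> G \<Longrightarrow> continuous_on UNIV (g j)" and gb: "\<And>j l. b j = b l \<Longrightarrow> g j = g l"
  shows "(\<Sum>j\<in>G. LINT \<xi>|cube_measure. (\<Sum>k\<in>G. (cmod ((\<Sum>l\<in>G. block_toeplitz g k l * packet j \<xi> l) - g j \<xi> * packet j \<xi> k))\<^sup>2)) = block_tail g"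
proof -
  define \<tau> where "\<tau> k = (LINT \<xi>|cube_measure. (cmod (g k \<xi>))\<^sup>2) - (\<Sum>l\<in>block k. (cmod (fcoeff (g k) (k - l)))\<^sup>2)" for k
  define D where "D j \<xi> k = (\<Sum>l\<in>G. block_toeplitz g k l * packet j \<xi> l) - g j \<xi> * packet j \<xi> k" for j \<xi> k
  define P where "P k \<xi> = (\<Sum>\<nu>\<in>(\<lambda>l. k - l) ` block k. fcoeff (g k) \<nu> * character \<nu> \<xi>) - g k \<xi>" for k \<xi>
  have D: "(cmod (D j \<xi> k))\<^sup>2 = (if b k = b j then (cmod (P k \<xi>))\<^sup>2 / real (card (block j)) else 0)" if "j \<in> G" "k \<in> G" for j k \<xi>
  proof (cases "b k = b j")
    case False
    hence "(\<Sum>l\<in>G. block_toeplitz g k l * packet j \<xi> l) = 0"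
      by (intro sum.neutral) (auto simp: block_toeplitz_def packet_def)
    thus ?thesis using False by (simp add: D_def packet_def)
  next
    case True
    define s where "s = complex_of_real (sqrt (card (block j)))"
    have "(\<Sum>l\<in>G. block_toeplitz g k l * packet j \<xi> l) = (\<Sum>l\<in>G. if b l = b j then fcoeff (g k) (k - l) * (cnj (character l \<xi>) / s) else 0)"
      by (intro sum.cong refl) (use True in \<open>auto simp: block_toeplitz_def packet_def s_def\<close>)
    also have "\<dots> = (\<Sum>l\<in>block j. fcoeff (g k) (k - l) * (cnj (character l \<xi>) / s))" by (rule sum_over_block)
    also have "\<dots> = (\<Sum>l\<in>block j. cnj (character k \<xi>) / s * (fcoeff (g k) (k - l) * character (k - l) \<xi>))"
    proof (intro sum.cong refl)
      fix l
      have "cnj (character l \<xi>) = cnj (character k \<xi>) * character (k - l) \<xi>"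
        unfolding character_diff by (metis (no_types) character_mult_cnj mult.assoc mult.commute mult.left_neutral)
      thus "fcoeff (g k) (k - l) * (cnj (character l \<xi>) / s) = cnj (character k \<xi>) / s * (fcoeff (g k) (k - l) * character (k - l) \<xi>)"
        by (simp add: mult_ac)
    qed
    also have "\<dots> = cnj (character k \<xi>) / s * (\<Sum>\<nu>\<in>(\<lambda>l. k - l) ` block k. fcoeff (g k) \<nu> * character \<nu> \<xi>)"
      unfolding sum_distrib_left[symmetric] using block_eq[OF True]
      by (subst sum.reindex) (auto simp: inj_on_def)
    finally have "D j \<xi> k = cnj (character k \<xi>) / s * P k \<xi>"
      using True gb[of k j] by (simp add: D_def P_def packet_def s_def algebra_simps)
    thus ?thesis using True by (simp add: norm_mult norm_divide power_mult_distrib power_divide s_def)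
  qed
  have cP: "continuous_on UNIV (P k)" if "k \<in> G" for k
    unfolding P_def by (intro continuous_intros g that)
  have cPd: "continuous_on UNIV (\<lambda>\<xi>. (cmod (P k \<xi>))\<^sup>2 / real (card (block j)))" if "k \<in> block j" for k j
    unfolding divide_inverse by (intro continuous_intros cP blockG[OF that])
  have IP: "(LINT \<xi>|cube_measure. (cmod (P k \<xi>))\<^sup>2) = \<tau> k" if "k \<in> G" for k
    unfolding P_def \<tau>_def using that
    by (subst projection_error) (auto simp: g sum.reindex inj_on_def)
  have "(\<Sum>j\<in>G. LINT \<xi>|cube_measure. (\<Sum>k\<in>G. (cmod (D j \<xi> k))\<^sup>2))
     = (\<Sum>j\<in>G. LINT \<xi>|cube_measure. (\<Sum>k\<in>G. if b k = b j then (cmod (P k \<xi>))\<^sup>2 / real (card (block j)) else 0))"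
    by (intro sum.cong refl Bochner_Integration.integral_cong) (simp add: D)
  also have "\<dots> = (\<Sum>j\<in>G. LINT \<xi>|cube_measure. (\<Sum>k\<in>block j. (cmod (P k \<xi>))\<^sup>2 / real (card (block j))))"
    unfolding sum_over_block ..
  also have "\<dots> = (\<Sum>j\<in>G. \<Sum>k\<in>block j. LINT \<xi>|cube_measure. (cmod (P k \<xi>))\<^sup>2 / real (card (block j)))"
    by (intro sum.cong refl Bochner_Integration.integral_sum integrable_cube cPd)
  also have "\<dots> = (\<Sum>j\<in>G. \<Sum>k\<in>block j. \<tau> k / real (card (block j)))"
    by (intro sum.cong refl) (simp add: IP blockG)
  also have "\<dots> = (\<Sum>j\<in>G. \<Sum>k\<in>G. if b k = b j then \<tau> k / real (card (block j)) else 0)" unfolding sum_over_block ..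
  also have "\<dots> = (\<Sum>k\<in>G. \<Sum>j\<in>G. if b k = b j then \<tau> k / real (card (block j)) else 0)" by (rule sum.swap)
  \<comment> \<open>Each row \<open>k\<close> is met once for every packet of its block, which
    cancels the division by the size of the block.\<close>
  also have "\<dots> = (\<Sum>k\<in>G. \<Sum>j\<in>G. if b j = b k then \<tau> k / real (card (block k)) else 0)"
    by (intro sum.cong refl) (auto dest: block_eq)
  also have "\<dots> = (\<Sum>k\<in>G. \<tau> k)" unfolding sum_over_block
    by (intro sum.cong refl) (use card_block_pos in \<open>force\<close>)
  finally show ?thesis unfolding D_def block_tail_def \<tau>_def .
qed

lemma cnj_block_toeplitz:
  assumes gb: "\<And>j l. b j = b l \<Longrightarrow> g j = g l"
  shows "cnj (block_toeplitz g l k) = block_toeplitz (\<lambda>j \<xi>. cnj (g j \<xi>)) k l"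
  using gb[of k l] by (simp add: block_toeplitz_def fcoeff_cnj)

text \<open>The difference consists of the coefficients of \<open>f - g\<close> and of the
  coefficients of \<open>g\<close> that connect different blocks; Bessel's inequality bounds both,
  row by row.\<close>

lemma block_toeplitz_distance:
  assumes f: "\<And>j. j \<in> G \<Longrightarrow> continuous_on UNIV (f j)" and g: "\<And>j. j \<in> G \<Longrightarrow> continuous_on UNIV (g j)"
  shows "(\<Sum>k\<in>G. \<Sum>l\<in>G. (cmod (fcoeff (f k) (k - l) - block_toeplitz g k l))\<^sup>2)
    \<le> 2 * (\<Sum>j\<in>G. LINT \<xi>|cube_measure. (cmod (f j \<xi> - g j \<xi>))\<^sup>2) + 2 * block_tail g"
  unfolding block_tail_def sum_distrib_left sum.distrib[symmetric]
proof (rule sum_mono)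
  fix k assume k: "k \<in> G"
  define S where "S = (\<lambda>l. k - l) ` G"
  have inj: "inj_on (\<lambda>l. k - l) A" for A by (auto simp: inj_on_def)
  have arith: "w \<le> 2 * x + 2 * (y - z) \<Longrightarrow> x \<le> x' \<Longrightarrow> y \<le> y' \<Longrightarrow> w \<le> 2 * x' + 2 * (y' - z)" for w x y z x' y' :: real
    unfolding right_diff_distrib by linarith
  have sq: "(x + y)\<^sup>2 \<le> 2 * x\<^sup>2 + 2 * y\<^sup>2" for x y :: real
    using sum_squares_bound[of x y] by (simp add: power2_sum)
  have "(cmod (fcoeff (f k) (k - l) - block_toeplitz g k l))\<^sup>2
      \<le> 2 * (cmod (fcoeff (\<lambda>\<xi>. f k \<xi> - g k \<xi>) (k - l)))\<^sup>2 + 2 * (if b l = b k then 0 else (cmod (fcoeff (g k) (k - l)))\<^sup>2)" for l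
  proof -
    have "fcoeff (f k) (k - l) - block_toeplitz g k l =
      fcoeff (\<lambda>\<xi>. f k \<xi> - g k \<xi>) (k - l) + (if b l = b k then 0 else fcoeff (g k) (k - l))"
      unfolding fcoeff_diff[OF f[OF k] g[OF k]] by (simp add: block_toeplitz_def)
    hence "(cmod (fcoeff (f k) (k - l) - block_toeplitz g k l))\<^sup>2
       \<le> (cmod (fcoeff (\<lambda>\<xi>. f k \<xi> - g k \<xi>) (k - l)) + cmod (if b l = b k then 0 else fcoeff (g k) (k - l)))\<^sup>2"
      by (simp only:) (intro power_mono norm_triangle_ineq norm_ge_zero)
    also have "\<dots> \<le> 2 * (cmod (fcoeff (\<lambda>\<xi>. f k \<xi> - g k \<xi>) (k - l)))\<^sup>2 + 2 * (cmod (if b l = b k then 0 else fcoeff (g k) (k - l)))\<^sup>2"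
      by (rule sq)
    finally show ?thesis by (cases "b l = b k") simp_all
  qed
  hence "(\<Sum>l\<in>G. (cmod (fcoeff (f k) (k - l) - block_toeplitz g k l))\<^sup>2)
     \<le> (\<Sum>l\<in>G. 2 * (cmod (fcoeff (\<lambda>\<xi>. f k \<xi> - g k \<xi>) (k - l)))\<^sup>2 + 2 * (if b l = b k then 0 else (cmod (fcoeff (g k) (k - l)))\<^sup>2))"
    by (rule sum_mono)
  also have "\<dots> = 2 * (\<Sum>\<nu>\<in>S. (cmod (fcoeff (\<lambda>\<xi>. f k \<xi> - g k \<xi>) \<nu>))\<^sup>2) + 2 * (\<Sum>l\<in>G. if b l = b k then 0 else (cmod (fcoeff (g k) (k - l)))\<^sup>2)"
    unfolding S_def sum.reindex[OF inj] by (simp add: sum.distrib sum_distrib_left)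
  also have "(\<Sum>l\<in>G. if b l = b k then 0 else (cmod (fcoeff (g k) (k - l)))\<^sup>2) = (\<Sum>l\<in>G. (cmod (fcoeff (g k) (k - l)))\<^sup>2) - (\<Sum>l\<in>block k. (cmod (fcoeff (g k) (k - l)))\<^sup>2)"
    unfolding sum_over_block[symmetric] sum_subtractf[symmetric] by (intro sum.cong) auto
  also have "(\<Sum>l\<in>G. (cmod (fcoeff (g k) (k - l)))\<^sup>2) = (\<Sum>\<nu>\<in>S. (cmod (fcoeff (g k) \<nu>))\<^sup>2)"
    unfolding S_def sum.reindex[OF inj] by simp
  finally have "(\<Sum>l\<in>G. (cmod (fcoeff (f k) (k - l) - block_toeplitz g k l))\<^sup>2)
     \<le> 2 * (\<Sum>\<nu>\<in>S. (cmod (fcoeff (\<lambda>\<xi>. f k \<xi> - g k \<xi>) \<nu>))\<^sup>2) + 2 * ((\<Sum>\<nu>\<in>S. (cmod (fcoeff (g k) \<nu>))\<^sup>2) - (\<Sum>l\<in>block k. (cmod (fcoeff (g k) (k - l)))\<^sup>2))" .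
  moreover have "(\<Sum>\<nu>\<in>S. (cmod (fcoeff (\<lambda>\<xi>. f k \<xi> - g k \<xi>) \<nu>))\<^sup>2) \<le> (LINT \<xi>|cube_measure. (cmod (f k \<xi> - g k \<xi>))\<^sup>2)"
    by (rule bessel[OF continuous_on_diff[OF f[OF k] g[OF k]]]) (use finG in \<open>simp add: S_def\<close>)
  moreover have "(\<Sum>\<nu>\<in>S. (cmod (fcoeff (g k) \<nu>))\<^sup>2) \<le> (LINT \<xi>|cube_measure. (cmod (g k \<xi>))\<^sup>2)"
    by (rule bessel[OF g[OF k]]) (use finG in \<open>simp add: S_def\<close>)
  ultimately show "(\<Sum>l\<in>G. (cmod (fcoeff (f k) (k - l) - block_toeplitz g k l))\<^sup>2)
     \<le> 2 * (LINT \<xi>|cube_measure. (cmod (f k \<xi> - g k \<xi>))\<^sup>2) +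
        2 * ((LINT \<xi>|cube_measure. (cmod (g k \<xi>))\<^sup>2) - (\<Sum>l\<in>block k. (cmod (fcoeff (g k) (k - l)))\<^sup>2))" by (rule arith)
qed

lemma packet_error_aux:
  assumes g: "\<And>j. j \<in> G \<Longrightarrow> continuous_on UNIV (g j)" and gb: "\<And>j l. b j = b l \<Longrightarrow> g j = g l"
  shows "(\<Sum>j\<in>G. LINT \<xi>|cube_measure. (\<Sum>k\<in>G. (cmod ((\<Sum>l\<in>G. A k l * packet j \<xi> l) - g j \<xi> * packet j \<xi> k))\<^sup>2))
    \<le> 2 * (\<Sum>k\<in>G. \<Sum>l\<in>G. (cmod (A k l - block_toeplitz g k l))\<^sup>2) + 2 * block_tail g"
proof -
  note [continuous_intros] = continuous_on_packet
  have sq: "(cmod (x + y))\<^sup>2 \<le> 2 * (cmod x)\<^sup>2 + 2 * (cmod y)\<^sup>2" for x y :: complex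
  proof -
    have "(cmod (x + y))\<^sup>2 \<le> (cmod x + cmod y)\<^sup>2" by (intro power_mono norm_triangle_ineq) auto
    thus ?thesis using sum_squares_bound[of "cmod x" "cmod y"] by (simp add: power2_sum)
  qed
  define U where "U j \<xi> = (\<Sum>k\<in>G. (cmod (\<Sum>l\<in>G. (A k l - block_toeplitz g k l) * packet j \<xi> l))\<^sup>2)" for j \<xi>
  define V where "V j \<xi> = (\<Sum>k\<in>G. (cmod ((\<Sum>l\<in>G. block_toeplitz g k l * packet j \<xi> l) - g j \<xi> * packet j \<xi> k))\<^sup>2)" for j \<xi>
  have cU: "continuous_on UNIV (U j)" for j unfolding U_def by (intro continuous_intros)
  have cV: "continuous_on UNIV (V j)" if "j \<in> G" for j unfolding V_def by (intro continuous_intros g that)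
  have "(LINT \<xi>|cube_measure. (\<Sum>k\<in>G. (cmod ((\<Sum>l\<in>G. A k l * packet j \<xi> l) - g j \<xi> * packet j \<xi> k))\<^sup>2))
      \<le> 2 * (LINT \<xi>|cube_measure. U j \<xi>) + 2 * (LINT \<xi>|cube_measure. V j \<xi>)" if j: "j \<in> G" for j
  proof -
    have "(LINT \<xi>|cube_measure. (\<Sum>k\<in>G. (cmod ((\<Sum>l\<in>G. A k l * packet j \<xi> l) - g j \<xi> * packet j \<xi> k))\<^sup>2))
      \<le> (LINT \<xi>|cube_measure. 2 * U j \<xi> + 2 * V j \<xi>)"
    proof (rule integral_mono)
      show "(\<Sum>k\<in>G. (cmod ((\<Sum>l\<in>G. A k l * packet j \<xi> l) - g j \<xi> * packet j \<xi> k))\<^sup>2) \<le> 2 * U j \<xi> + 2 * V j \<xi>" for \<xi>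
        unfolding U_def V_def sum_distrib_left sum.distrib[symmetric]
      proof (rule sum_mono)
        fix k
        have "(\<Sum>l\<in>G. A k l * packet j \<xi> l) - g j \<xi> * packet j \<xi> k = (\<Sum>l\<in>G. (A k l - block_toeplitz g k l) * packet j \<xi> l) +
           ((\<Sum>l\<in>G. block_toeplitz g k l * packet j \<xi> l) - g j \<xi> * packet j \<xi> k)"
          by (simp add: left_diff_distrib sum_subtractf)
        thus "(cmod ((\<Sum>l\<in>G. A k l * packet j \<xi> l) - g j \<xi> * packet j \<xi> k))\<^sup>2
          \<le> 2 * (cmod (\<Sum>l\<in>G. (A k l - block_toeplitz g k l) * packet j \<xi> l))\<^sup>2 +
             2 * (cmod ((\<Sum>l\<in>G. block_toeplitz g k l * packet j \<xi> l) - g j \<xi> * packet j \<xi> k))\<^sup>2"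
          by (simp only: sq)
      qed
    qed (intro integrable_cube continuous_intros g j cU cV)+
    also have "\<dots> = 2 * (LINT \<xi>|cube_measure. U j \<xi>) + 2 * (LINT \<xi>|cube_measure. V j \<xi>)"
      using integrable_cube[OF cU[of j]] integrable_cube[OF cV[OF j]] by simp
    finally show ?thesis .
  qed
  hence "(\<Sum>j\<in>G. LINT \<xi>|cube_measure. (\<Sum>k\<in>G. (cmod ((\<Sum>l\<in>G. A k l * packet j \<xi> l) - g j \<xi> * packet j \<xi> k))\<^sup>2))
     \<le> (\<Sum>j\<in>G. 2 * (LINT \<xi>|cube_measure. U j \<xi>) + 2 * (LINT \<xi>|cube_measure. V j \<xi>))" by (rule sum_mono)
  also have "\<dots> = 2 * (\<Sum>j\<in>G. LINT \<xi>|cube_measure. U j \<xi>) + 2 * (\<Sum>j\<in>G. LINT \<xi>|cube_measure. V j \<xi>)"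
    by (simp add: sum.distrib sum_distrib_left)
  also have "(\<Sum>j\<in>G. LINT \<xi>|cube_measure. U j \<xi>) = (\<Sum>k\<in>G. \<Sum>l\<in>G. (cmod (A k l - block_toeplitz g k l))\<^sup>2)"
    unfolding U_def by (rule packet_hilbert_schmidt)
  also have "(\<Sum>j\<in>G. LINT \<xi>|cube_measure. V j \<xi>) = block_tail g"
    unfolding V_def by (rule packet_block_toeplitz[OF g gb])
  finally show ?thesis .
qed

text \<open>The second bound is the first one for the adjoint, whose frozen symbols are the
  conjugates. The factors come from repeated use of |x + y|^2 \<le> 2 |x|^2 + 2 |y|^2: the tail is
  counted 8 times through the distance to the block matrix and twice through its action on the
  packets.\<close>

lemma packet_error:
  fixes E :: "int ^ 'd \<Rightarrow> int ^ 'd \<Rightarrow> complex" and T :: real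
  assumes f: "\<And>j. j \<in> G \<Longrightarrow> continuous_on UNIV (f j)"
    and g: "\<And>j. j \<in> G \<Longrightarrow> continuous_on UNIV (g j)" and gb: "\<And>j l. b j = b l \<Longrightarrow> g j = g l"
    and T: "block_tail g \<le> T" "block_tail (\<lambda>j \<xi>. cnj (g j \<xi>)) \<le> T"
  defines "\<Xi> \<equiv> 8 * (\<Sum>j\<in>G. LINT \<xi>|cube_measure. (cmod (f j \<xi> - g j \<xi>))\<^sup>2) + 10 * T + 4 * (\<Sum>k\<in>G. \<Sum>l\<in>G. (cmod (E k l))\<^sup>2)"
  shows "(\<Sum>j\<in>G. LINT \<xi>|cube_measure. (\<Sum>k\<in>G. (cmod ((\<Sum>l\<in>G. (fcoeff (f k) (k - l) + E k l) * packet j \<xi> l) - g j \<xi> * packet j \<xi> k))\<^sup>2)) \<le> \<Xi>"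
    "(\<Sum>j\<in>G. LINT \<xi>|cube_measure. (\<Sum>l\<in>G. (cmod ((\<Sum>k\<in>G. cnj (fcoeff (f k) (k - l) + E k l) * packet j \<xi> k) - cnj (g j \<xi>) * packet j \<xi> l))\<^sup>2)) \<le> \<Xi>"
proof -
  let ?A = "\<lambda>k l. fcoeff (f k) (k - l) + E k l"
  have sq: "(cmod (x + y))\<^sup>2 \<le> 2 * (cmod x)\<^sup>2 + 2 * (cmod y)\<^sup>2" for x y :: complex
  proof -
    have "(cmod (x + y))\<^sup>2 \<le> (cmod x + cmod y)\<^sup>2" by (intro power_mono norm_triangle_ineq) auto
    thus ?thesis using sum_squares_bound[of "cmod x" "cmod y"] by (simp add: power2_sum)
  qed
  have "(\<Sum>k\<in>G. \<Sum>l\<in>G. (cmod (?A k l - block_toeplitz g k l))\<^sup>2)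
     \<le> (\<Sum>k\<in>G. \<Sum>l\<in>G. 2 * (cmod (fcoeff (f k) (k - l) - block_toeplitz g k l))\<^sup>2 + 2 * (cmod (E k l))\<^sup>2)"
    using sq[of "fcoeff (f k) (k - l) - block_toeplitz g k l" "E k l" for k l] by (intro sum_mono) (simp add: algebra_simps)
  also have "\<dots> = 2 * (\<Sum>k\<in>G. \<Sum>l\<in>G. (cmod (fcoeff (f k) (k - l) - block_toeplitz g k l))\<^sup>2) + 2 * (\<Sum>k\<in>G. \<Sum>l\<in>G. (cmod (E k l))\<^sup>2)"
    by (simp add: sum.distrib sum_distrib_left)
  finally have HS: "(\<Sum>k\<in>G. \<Sum>l\<in>G. (cmod (?A k l - block_toeplitz g k l))\<^sup>2) \<le>
     4 * (\<Sum>j\<in>G. LINT \<xi>|cube_measure. (cmod (f j \<xi> - g j \<xi>))\<^sup>2) + 4 * T + 2 * (\<Sum>k\<in>G. \<Sum>l\<in>G. (cmod (E k l))\<^sup>2)"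
    using block_toeplitz_distance[of f g, OF f g] T by linarith
  have "(\<Sum>j\<in>G. LINT \<xi>|cube_measure. (\<Sum>k\<in>G. (cmod ((\<Sum>l\<in>G. ?A k l * packet j \<xi> l) - g j \<xi> * packet j \<xi> k))\<^sup>2))
     \<le> 2 * (\<Sum>k\<in>G. \<Sum>l\<in>G. (cmod (?A k l - block_toeplitz g k l))\<^sup>2) + 2 * block_tail g"
    by (rule packet_error_aux[OF g gb])
  thus "(\<Sum>j\<in>G. LINT \<xi>|cube_measure. (\<Sum>k\<in>G. (cmod ((\<Sum>l\<in>G. ?A k l * packet j \<xi> l) - g j \<xi> * packet j \<xi> k))\<^sup>2)) \<le> \<Xi>"
    using HS T unfolding \<Xi>_def by linarith
  have "(\<Sum>j\<in>G. LINT \<xi>|cube_measure. (\<Sum>l\<in>G. (cmod ((\<Sum>k\<in>G. cnj (?A k l) * packet j \<xi> k) - cnj (g j \<xi>) * packet j \<xi> l))\<^sup>2))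
     \<le> 2 * (\<Sum>l\<in>G. \<Sum>k\<in>G. (cmod (cnj (?A k l) - block_toeplitz (\<lambda>j \<xi>. cnj (g j \<xi>)) l k))\<^sup>2) + 2 * block_tail (\<lambda>j \<xi>. cnj (g j \<xi>))"
  proof (rule packet_error_aux)
    show "continuous_on UNIV (\<lambda>\<xi>. cnj (g j \<xi>))" if "j \<in> G" for j
      by (intro continuous_intros g that)
    show "(\<lambda>\<xi>. cnj (g j \<xi>)) = (\<lambda>\<xi>. cnj (g l \<xi>))" if "b j = b l" for j l
      using gb[OF that] by simp
  qed
  also have "(\<Sum>l\<in>G. \<Sum>k\<in>G. (cmod (cnj (?A k l) - block_toeplitz (\<lambda>j \<xi>. cnj (g j \<xi>)) l k))\<^sup>2) = (\<Sum>k\<in>G. \<Sum>l\<in>G. (cmod (?A k l - block_toeplitz g k l))\<^sup>2)"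
  proof -
    have "cmod (cnj (?A k l) - block_toeplitz (\<lambda>j \<xi>. cnj (g j \<xi>)) l k) = cmod (?A k l - block_toeplitz g k l)" for k l
    proof -
      have "block_toeplitz (\<lambda>j \<xi>. cnj (g j \<xi>)) l k = cnj (block_toeplitz g k l)"
        by (rule cnj_block_toeplitz[OF gb, symmetric])
      hence "cnj (?A k l) - block_toeplitz (\<lambda>j \<xi>. cnj (g j \<xi>)) l k = cnj (?A k l - block_toeplitz g k l)" by simp
      thus ?thesis by (simp only: complex_mod_cnj)
    qed
    thus ?thesis by (simp only:) (rule sum.swap)
  qed
  finally show "(\<Sum>j\<in>G. LINT \<xi>|cube_measure. (\<Sum>l\<in>G. (cmod ((\<Sum>k\<in>G. cnj (?A k l) * packet j \<xi> k) - cnj (g j \<xi>) * packet j \<xi> l))\<^sup>2)) \<le> \<Xi>"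
    using HS T unfolding \<Xi>_def by linarith
qed

end

section \<open>Logarithmic potentials\<close>

text \<open>At 0 the function \<open>powr\<close> returns 0, which would hide the singularity. With
  the value infinity, a finite integral also excludes mass at 0.\<close>

definition singular_powr :: "real \<Rightarrow> real \<Rightarrow> ennreal" where
  "singular_powr s y = (if y = 0 then \<infinity> else ennreal (y powr - s))"

lemma borel_measurable_singular_powr [measurable]: "singular_powr s \<in> borel_measurable borel"
  unfolding singular_powr_def by measurable

lemma half_power: "(1/2::real) ^ m = 2 powr (- real m)"
  by (simp add: powr_minus powr_realpow power_one_over inverse_eq_divide)

text \<open>Dyadic decomposition of the small values of \<open>Y\<close>: when the level is halved,
  the integrand grows by the factor 2^s and the bound on the measure shrinks by 2^(2s), so a
  geometric series remains.\<close>

lemma nn_integral_singular_powr: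
  fixes Y :: "'x \<Rightarrow> real"
  assumes M: "finite_measure M" and Y [measurable]: "Y \<in> borel_measurable M" and Y0: "\<And>x. x \<in> space M \<Longrightarrow> Y x \<ge> 0"
    and s: "s > 0" and t0: "t0 > 0" and C: "C \<ge> 0"
    and le: "\<And>t. 0 \<le> t \<Longrightarrow> t \<le> t0 \<Longrightarrow> measure M {x \<in> space M. Y x \<le> t} \<le> C * t powr (2 * s)"
  shows "(\<integral>\<^sup>+x. singular_powr s (Y x) \<partial>M) \<le> ennreal (t0 powr - s * measure M (space M) + C * t0 powr s * 2 powr s / (1 - 2 powr - s))"
proof -
  interpret finite_measure M by fact
  define a where "a k = t0 powr - s * 2 powr (s * (real k + 1))" for k :: nat
  define S where "S k = {x \<in> space M. Y x \<le> t0 * (1/2) ^ k}" for k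
  have S [measurable]: "S k \<in> sets M" for k unfolding S_def by measurable
  have q: "0 \<le> (2::real) powr - s" "(2::real) powr - s < 1" using powr_less_mono[of "- s" 0 "2::real"] s by auto
  \<comment> \<open>The hypothesis at \<open>t = 0\<close> has right-hand side 0.\<close>
  have zero: "AE x in M. Y x \<noteq> 0"
  proof -
    have "measure M {x \<in> space M. Y x \<le> 0} \<le> 0" using le[of 0] t0 by simp
    hence "emeasure M {x \<in> space M. Y x \<le> 0} = 0" by (simp add: emeasure_eq_measure measure_le_0_iff)
    moreover have "{x \<in> space M. Y x \<le> 0} \<in> sets M" by measurable
    ultimately have "AE x in M. \<not> Y x \<le> 0" by (intro AE_I[of _ _ "{x \<in> space M. Y x \<le> 0}"]) auto
    thus ?thesis by eventually_elim auto
  qed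
  have point: "singular_powr s (Y x) \<le> ennreal (t0 powr - s) + (\<Sum>k. ennreal (a k) * indicator (S k) x)"
    if x: "x \<in> space M" "Y x \<noteq> 0" for x
  proof (cases "Y x > t0")
    case True
    hence "Y x powr - s \<le> t0 powr - s" using s t0 by (intro powr_mono2') auto
    hence "singular_powr s (Y x) \<le> ennreal (t0 powr - s)" using x by (simp add: singular_powr_def ennreal_leI)
    thus ?thesis by (simp add: add_increasing2)
  next
    case False
    have Yp: "Y x > 0" using Y0 x by (simp add: less_le)
    \<comment> \<open>The first dyadic level below \<open>Y x\<close>. It is not level 0, because
      \<open>Y x \<le> t0\<close>; the previous level \<open>k\<close> then lies above
      \<open>Y x\<close> by at most the factor 2.\<close>
    define N where "N = (LEAST m. t0 * (1/2) ^ m < Y x)"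
    have "\<exists>m. (1/2) ^ m < Y x / t0" using real_arch_pow_inv[of "Y x / t0" "1/2"] Yp t0 by auto
    hence "\<exists>m. t0 * (1/2) ^ m < Y x" using t0 by (auto simp: field_simps)
    hence N: "t0 * (1/2) ^ N < Y x" unfolding N_def by (rule LeastI_ex)
    have "N \<noteq> 0" using N False by (intro notI) simp
    then obtain k where k: "N = Suc k" by (cases N) auto
    have "\<not> t0 * (1/2) ^ k < Y x" using not_less_Least[of k "\<lambda>m. t0 * (1/2) ^ m < Y x"] k by (simp add: N_def)
    hence xS: "x \<in> S k" using x by (simp add: S_def)
    have "Y x powr - s \<le> (t0 * (1/2) ^ Suc k) powr - s" using N k s t0 by (intro powr_mono2') auto
    also have "(t0 * (1/2) ^ Suc k) = t0 * 2 powr (- (real k + 1))"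
      unfolding half_power by (simp add: add.commute)
    also have "(t0 * 2 powr (- (real k + 1))) powr - s = a k"
      using t0 by (simp add: a_def powr_mult powr_powr algebra_simps)
    finally have "singular_powr s (Y x) \<le> ennreal (a k) * indicator (S k) x"
      using x xS by (simp add: singular_powr_def ennreal_leI)
    also have "\<dots> \<le> (\<Sum>k. ennreal (a k) * indicator (S k) x)"
    proof -
      define f where "f j = ennreal (a j) * indicator (S j) x" for j
      have "f k \<le> suminf f" using sum_le_suminf[of f "{k}"] by simp
      thus ?thesis unfolding f_def .
    qed
    finally show ?thesis by (simp add: add_increasing)
  qed
  have "(\<integral>\<^sup>+x. singular_powr s (Y x) \<partial>M) \<le> (\<integral>\<^sup>+x. ennreal (t0 powr - s) + (\<Sum>k. ennreal (a k) * indicator (S k) x) \<partial>M)"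
  proof (rule nn_integral_mono_AE)
    show "AE x in M. singular_powr s (Y x) \<le> ennreal (t0 powr - s) + (\<Sum>k. ennreal (a k) * indicator (S k) x)"
      using zero AE_space by eventually_elim (rule point)
  qed
  also have "\<dots> = ennreal (t0 powr - s) * emeasure M (space M) + (\<Sum>k. ennreal (a k) * emeasure M (S k))"
    by (subst nn_integral_add) (auto simp: nn_integral_suminf nn_integral_cmult)
  also have "\<dots> \<le> ennreal (t0 powr - s * measure M (space M)) + (\<Sum>k. ennreal (C * t0 powr s * 2 powr s * (2 powr - s) ^ k))"
  proof (rule add_mono)
    show "ennreal (t0 powr - s) * emeasure M (space M) \<le> ennreal (t0 powr - s * measure M (space M))"
      by (simp add: emeasure_eq_measure ennreal_mult)
    have "ennreal (a k) * emeasure M (S k) \<le> ennreal (C * t0 powr s * 2 powr s * (2 powr - s) ^ k)" for k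
    proof -
      have "t0 * (1/2) ^ k \<le> t0" using t0 by (simp add: power_le_one mult_left_le)
      hence "measure M (S k) \<le> C * (t0 * (1/2) ^ k) powr (2 * s)" unfolding S_def using t0 by (intro le) auto
      also have "t0 * (1/2) ^ k = t0 * 2 powr (- real k)"
        unfolding half_power ..
      also have "(t0 * 2 powr (- real k)) powr (2 * s) = t0 powr (2 * s) * 2 powr (- real k * (2 * s))"
        using t0 by (simp add: powr_mult powr_powr)
      finally have "a k * measure M (S k) \<le> a k * (C * (t0 powr (2 * s) * 2 powr (- real k * (2 * s))))"
        by (intro mult_left_mono) (auto simp: a_def)
      also have "\<dots> = C * (t0 powr - s * t0 powr (2 * s)) * (2 powr (s * (real k + 1)) * 2 powr (- real k * (2 * s)))"
        by (simp add: a_def)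
      also have "t0 powr - s * t0 powr (2 * s) = t0 powr s" by (simp add: powr_add[symmetric])
      also have "2 powr (s * (real k + 1)) * 2 powr (- real k * (2 * s)) = 2 powr s * (2 powr - s) powr real k"
        by (simp add: powr_add[symmetric] powr_powr algebra_simps)
      also have "(2 powr - s) powr real k = (2 powr - s) ^ k" by (simp add: powr_realpow)
      finally show ?thesis by (simp add: emeasure_eq_measure ennreal_mult[symmetric] a_def ennreal_leI mult.assoc)
    qed
    thus "(\<Sum>k. ennreal (a k) * emeasure M (S k)) \<le> (\<Sum>k. ennreal (C * t0 powr s * 2 powr s * (2 powr - s) ^ k))"
      by (intro suminf_le) auto
  qed
  also have "(\<Sum>k. ennreal (C * t0 powr s * 2 powr s * (2 powr - s) ^ k)) = ennreal (C * t0 powr s * 2 powr s / (1 - 2 powr - s))"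
  proof -
    have "(\<lambda>k. C * t0 powr s * 2 powr s * (2 powr - s) ^ k) sums (C * t0 powr s * 2 powr s * (1 / (1 - 2 powr - s)))"
      using q by (intro sums_mult geometric_sums) auto
    thus ?thesis using C q by (intro suminf_ennreal_eq) auto
  qed
  also have "ennreal (t0 powr - s * measure M (space M)) + ennreal (C * t0 powr s * 2 powr s / (1 - 2 powr - s)) =
     ennreal (t0 powr - s * measure M (space M) + C * t0 powr s * 2 powr s / (1 - 2 powr - s))"
    using C q by (intro ennreal_plus[symmetric]) (auto intro!: divide_nonneg_nonneg)
  finally show ?thesis .
qed

text \<open>For \<open>x > 1\<close> the bound ln 2 \<le> 1 / s is absorbed by the -1 in ln y \<le>
  y - 1, taken at \<open>y = x powr s\<close>.\<close>

lemma ln_one_plus_le_powr: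
  fixes x s :: real
  assumes "x \<ge> 0" "0 < s" "s \<le> 1"
  shows "ln (1 + x) \<le> x powr s / s"
proof (cases "x \<le> 1")
  case True
  have "ln (1 + x) \<le> x" using assms by (simp add: ln_add_one_self_le_self)
  also have "x \<le> x powr s"
  proof (cases "x = 0")
    case False
    hence "x powr 1 \<le> x powr s" using True assms by (intro powr_mono') auto
    thus ?thesis using assms by simp
  qed simp
  also have "\<dots> \<le> x powr s / s" using assms mult_left_le[of s "x powr s"] by (simp add: field_simps)
  finally show ?thesis .
next
  case False
  have "ln (1 + x) \<le> ln (2 * x)" using False by simp
  also have "\<dots> = ln 2 + ln x" using False by (intro ln_mult_pos) auto
  also have "ln 2 \<le> (1::real)" using ln_le_minus_one[of "2::real"] by simp
  also have "(1::real) \<le> 1 / s" using assms by simp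
  also have "ln x = ln (x powr s) / s" using False assms by (simp add: ln_powr)
  also have "ln (x powr s) \<le> x powr s - 1" using False by (intro ln_le_minus_one) simp
  finally show ?thesis using assms by (simp add: diff_divide_distrib divide_right_mono)
qed

lemma abs_ln_le_powr:
  fixes y s B :: real
  assumes "0 < y" "y \<le> B" "0 < s"
  shows "\<bar>ln y\<bar> \<le> y powr - s / s + B"
proof (cases "y \<le> 1")
  case True
  have "- (s * ln y) \<le> y powr - s" using ln_le_minus_one[of "y powr - s"] assms by (simp add: ln_powr)
  hence "- ln y \<le> y powr - s / s" using assms by (simp add: field_simps)
  thus ?thesis using True assms by (simp add: abs_if add_increasing2)
next
  case False
  hence "\<bar>ln y\<bar> \<le> y" using ln_le_minus_one[of y] by simp
  thus ?thesis using assms by (simp add: add_increasing)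
qed

lemma integrable_ln_of_singular_powr:
  fixes Y :: "'x \<Rightarrow> real"
  assumes M: "finite_measure M" and [measurable]: "Y \<in> borel_measurable M" and Y0: "AE x in M. 0 \<le> Y x \<and> Y x \<le> B"
    and s: "s > 0" and fin: "(\<integral>\<^sup>+x. singular_powr s (Y x) \<partial>M) < \<infinity>"
  shows "integrable M (\<lambda>x. ln (Y x))" "AE x in M. Y x \<noteq> 0" "integrable M (\<lambda>x. Y x powr - s)"
proof -
  interpret finite_measure M by fact
  have "AE x in M. singular_powr s (Y x) \<noteq> \<infinity>" using fin by (intro nn_integral_PInf_AE) auto
  thus nz: "AE x in M. Y x \<noteq> 0" by eventually_elim (auto simp: singular_powr_def)
  have "(\<integral>\<^sup>+x. ennreal (Y x powr - s) \<partial>M) \<le> (\<integral>\<^sup>+x. singular_powr s (Y x) \<partial>M)"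
    by (intro nn_integral_mono) (auto simp: singular_powr_def)
  hence "(\<integral>\<^sup>+x. ennreal (Y x powr - s) \<partial>M) < \<infinity>" using fin by (rule order.strict_trans1)
  thus ip: "integrable M (\<lambda>x. Y x powr - s)" by (intro integrableI_nonneg) auto
  show "integrable M (\<lambda>x. ln (Y x))"
  proof (rule Bochner_Integration.integrable_bound)
    show "integrable M (\<lambda>x. Y x powr - s / s + B)" using ip by auto
    show "AE x in M. norm (ln (Y x)) \<le> norm (Y x powr - s / s + B)"
      using nz Y0
    proof eventually_elim
      case (elim x)
      hence "\<bar>ln (Y x)\<bar> \<le> Y x powr - s / s + B" using s by (intro abs_ln_le_powr) auto
      thus ?case by simp
    qed
  qed measurable
qed

text \<open>The regularization adds ln (1 + \<tau>^2 / y) with y the squared distance to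
  \<open>z\<close>. This is at most a multiple of a power of \<tau>^2 / y, and the integral of the
  negative power of y is bounded uniformly in \<open>z\<close>.\<close>

lemma log_potential_regularization:
  fixes \<mu> :: "complex measure"
  assumes \<mu>: "prob_space \<mu>" "sets \<mu> = sets borel" and K: "AE u in \<mu>. cmod u \<le> K"
    and \<kappa>: "0 < \<kappa>" "\<kappa> \<le> 1" and t0: "t0 > 0"
    and le: "\<And>z t. 0 \<le> t \<Longrightarrow> t \<le> t0 \<Longrightarrow> measure \<mu> {u. (cmod (u - z))\<^sup>2 \<le> t} \<le> C * t powr \<kappa>"
  shows "AE u in \<mu>. u \<noteq> z" "integrable \<mu> (\<lambda>u. ln (cmod (u - z)))"
    "\<exists>D\<ge>0. \<forall>\<tau>>0. \<forall>z. integrable \<mu> (\<lambda>u. ln (\<tau>\<^sup>2 + (cmod (u - z))\<^sup>2)) \<and>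
       2 * (LINT u|\<mu>. ln (cmod (u - z))) \<le> (LINT u|\<mu>. ln (\<tau>\<^sup>2 + (cmod (u - z))\<^sup>2)) \<and>
       (LINT u|\<mu>. ln (\<tau>\<^sup>2 + (cmod (u - z))\<^sup>2)) \<le> 2 * (LINT u|\<mu>. ln (cmod (u - z))) + D * \<tau> powr \<kappa>"
proof -
  interpret prob_space \<mu> by fact
  have [measurable_cong]: "sets \<mu> = sets borel" by fact
  have sp: "space \<mu> = UNIV" using sets_eq_imp_space_eq[OF \<mu>(2)] by simp
  have fm: "finite_measure \<mu>" by unfold_locales
  \<comment> \<open>Half of the exponent in the level set bound: the other half makes the dyadic
    series converge, and \<tau>^(2s) is the stated rate.\<close>
  define s where "s = \<kappa> / 2"
  have s: "s > 0" "s \<le> 1" using \<kappa> by (auto simp: s_def)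
  define C' where "C' = max C 0"
  define D where "D = t0 powr - s * measure \<mu> (space \<mu>) + C' * t0 powr s * 2 powr s / (1 - 2 powr - s)"
  have bnd: "(\<integral>\<^sup>+u. singular_powr s ((cmod (u - z))\<^sup>2) \<partial>\<mu>) \<le> ennreal D" for z
    unfolding D_def
  proof (rule nn_integral_singular_powr[OF fm])
    fix t :: real assume t: "0 \<le> t" "t \<le> t0"
    have "measure \<mu> {u \<in> space \<mu>. (cmod (u - z))\<^sup>2 \<le> t} \<le> C * t powr (2 * s)" using le[OF t, of z] by (simp add: sp s_def)
    also have "\<dots> \<le> C' * t powr (2 * s)" by (intro mult_right_mono) (auto simp: C'_def)
    finally show "measure \<mu> {u \<in> space \<mu>. (cmod (u - z))\<^sup>2 \<le> t} \<le> C' * t powr (2 * s)" .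
  qed (use s t0 in \<open>auto simp: C'_def\<close>)
  have "(2::real) powr - s < 1" using powr_less_mono[of "- s" 0 "2::real"] s by auto
  hence D0: "D \<ge> 0" unfolding D_def C'_def
    by (intro add_nonneg_nonneg mult_nonneg_nonneg divide_nonneg_nonneg) auto
  have Yb: "AE u in \<mu>. 0 \<le> (cmod (u - z))\<^sup>2 \<and> (cmod (u - z))\<^sup>2 \<le> (K + cmod z)\<^sup>2" for z
    using K
  proof eventually_elim
    case (elim u)
    have "cmod (u - z) \<le> K + cmod z" using elim norm_triangle_ineq4[of u z] by linarith
    thus ?case by (auto intro!: power_mono)
  qed
  have fin: "(\<integral>\<^sup>+u. singular_powr s ((cmod (u - z))\<^sup>2) \<partial>\<mu>) < \<infinity>" for z
    using bnd[of z] by (rule order.strict_trans1) simp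
  have I: "integrable \<mu> (\<lambda>u. ln ((cmod (u - z))\<^sup>2))" "AE u in \<mu>. (cmod (u - z))\<^sup>2 \<noteq> 0" "integrable \<mu> (\<lambda>u. (cmod (u - z))\<^sup>2 powr - s)" for z
    by (rule integrable_ln_of_singular_powr[OF fm _ Yb s(1) fin]; measurable)+
  have nz: "AE u in \<mu>. u \<noteq> z" for z using I(2)[of z] by eventually_elim auto
  show "AE u in \<mu>. u \<noteq> z" by (rule nz)
  have ln2: "AE u in \<mu>. ln ((cmod (u - z))\<^sup>2) = 2 * ln (cmod (u - z))" for z
    using nz[of z] by eventually_elim (simp add: ln_realpow)
  have iln: "integrable \<mu> (\<lambda>u. ln (cmod (u - z)))" for z
  proof -
    have "integrable \<mu> (\<lambda>u. 2 * ln (cmod (u - z)))"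
      by (rule integrable_cong_AE_imp[OF I(1)[of z]]) (use ln2[of z] in \<open>auto elim: eventually_mono\<close>)
    thus ?thesis by simp
  qed
  show "integrable \<mu> (\<lambda>u. ln (cmod (u - z)))" by (rule iln)
  have pw: "LINT u|\<mu>. (cmod (u - z))\<^sup>2 powr - s \<le> D" for z
  proof -
    have "ennreal (LINT u|\<mu>. (cmod (u - z))\<^sup>2 powr - s) = (\<integral>\<^sup>+u. ennreal ((cmod (u - z))\<^sup>2 powr - s) \<partial>\<mu>)"
      by (rule nn_integral_eq_integral[symmetric, OF I(3)]) auto
    also have "\<dots> \<le> (\<integral>\<^sup>+u. singular_powr s ((cmod (u - z))\<^sup>2) \<partial>\<mu>)"
      by (intro nn_integral_mono) (auto simp: singular_powr_def)
    also have "\<dots> \<le> ennreal D" by (rule bnd)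
    finally show ?thesis using D0 by simp
  qed
  show "\<exists>D\<ge>0. \<forall>\<tau>>0. \<forall>z. integrable \<mu> (\<lambda>u. ln (\<tau>\<^sup>2 + (cmod (u - z))\<^sup>2)) \<and>
       2 * (LINT u|\<mu>. ln (cmod (u - z))) \<le> (LINT u|\<mu>. ln (\<tau>\<^sup>2 + (cmod (u - z))\<^sup>2)) \<and>
       (LINT u|\<mu>. ln (\<tau>\<^sup>2 + (cmod (u - z))\<^sup>2)) \<le> 2 * (LINT u|\<mu>. ln (cmod (u - z))) + D * \<tau> powr \<kappa>"
  proof (intro exI[of _ "D / s"] conjI allI impI)
    show "D / s \<ge> 0" using D0 s by simp
    fix \<tau> :: real and z assume \<tau>: "\<tau> > 0"
    have pt: "AE u in \<mu>. 2 * ln (cmod (u - z)) \<le> ln (\<tau>\<^sup>2 + (cmod (u - z))\<^sup>2) \<and>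
       ln (\<tau>\<^sup>2 + (cmod (u - z))\<^sup>2) \<le> 2 * ln (cmod (u - z)) + \<tau> powr \<kappa> / s * (cmod (u - z))\<^sup>2 powr - s"
      using nz[of z]
    proof eventually_elim
      case (elim u)
      define y where "y = (cmod (u - z))\<^sup>2"
      have y: "y > 0" using elim by (simp add: y_def)
      have ly: "ln y = 2 * ln (cmod (u - z))" using elim by (simp add: y_def ln_realpow)
      have "\<tau>\<^sup>2 + y = y * (1 + \<tau>\<^sup>2 / y)" using y by (simp add: field_simps)
      hence "ln (\<tau>\<^sup>2 + y) = ln y + ln (1 + \<tau>\<^sup>2 / y)" using y by (simp add: ln_mult_pos add_pos_nonneg)
      moreover have "ln (1 + \<tau>\<^sup>2 / y) \<le> (\<tau>\<^sup>2 / y) powr s / s" using y s by (intro ln_one_plus_le_powr) auto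
      moreover have "(\<tau>\<^sup>2 / y) powr s = \<tau> powr \<kappa> * y powr - s"
      proof -
        have "\<tau>\<^sup>2 powr s = \<tau> powr \<kappa>" using \<tau> by (simp add: powr_powr s_def flip: powr_numeral)
        thus ?thesis using y \<tau> by (simp add: powr_divide powr_minus_divide)
      qed
      moreover have "ln (1 + \<tau>\<^sup>2 / y) \<ge> 0" using y by simp
      ultimately show ?case unfolding y_def[symmetric] ly[symmetric] by simp
    qed
    have isp: "integrable \<mu> (\<lambda>u. \<tau> powr \<kappa> / s * (cmod (u - z))\<^sup>2 powr - s)"
      by (rule integrable_mult_right[OF I(3)])
    have iu: "integrable \<mu> (\<lambda>u. 2 * ln (cmod (u - z)) + \<tau> powr \<kappa> / s * (cmod (u - z))\<^sup>2 powr - s)"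
      by (rule Bochner_Integration.integrable_add[OF integrable_mult_right[OF iln] isp])
    show il: "integrable \<mu> (\<lambda>u. ln (\<tau>\<^sup>2 + (cmod (u - z))\<^sup>2))"
    proof (rule Bochner_Integration.integrable_bound)
      show "integrable \<mu> (\<lambda>u. \<bar>2 * ln (cmod (u - z))\<bar> + \<bar>2 * ln (cmod (u - z)) + \<tau> powr \<kappa> / s * (cmod (u - z))\<^sup>2 powr - s\<bar>)"
        by (rule Bochner_Integration.integrable_add[OF integrable_abs[OF integrable_mult_right[OF iln]] integrable_abs[OF iu]])
      show "AE u in \<mu>. norm (ln (\<tau>\<^sup>2 + (cmod (u - z))\<^sup>2)) \<le> norm (\<bar>2 * ln (cmod (u - z))\<bar> + \<bar>2 * ln (cmod (u - z)) + \<tau> powr \<kappa> / s * (cmod (u - z))\<^sup>2 powr - s\<bar>)"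
        using pt by eventually_elim (unfold real_norm_def, linarith)
    qed measurable
    have "(LINT u|\<mu>. 2 * ln (cmod (u - z))) \<le> (LINT u|\<mu>. ln (\<tau>\<^sup>2 + (cmod (u - z))\<^sup>2))"
      using iln il pt by (intro integral_mono_AE) (auto elim: eventually_mono)
    thus "2 * (LINT u|\<mu>. ln (cmod (u - z))) \<le> (LINT u|\<mu>. ln (\<tau>\<^sup>2 + (cmod (u - z))\<^sup>2))" by simp
    have "(LINT u|\<mu>. ln (\<tau>\<^sup>2 + (cmod (u - z))\<^sup>2)) \<le> (LINT u|\<mu>. 2 * ln (cmod (u - z)) + \<tau> powr \<kappa> / s * (cmod (u - z))\<^sup>2 powr - s)"
      using il iu pt by (intro integral_mono_AE) (auto elim: eventually_mono)
    also have "\<dots> = 2 * (LINT u|\<mu>. ln (cmod (u - z))) + \<tau> powr \<kappa> / s * (LINT u|\<mu>. (cmod (u - z))\<^sup>2 powr - s)"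
      by (subst Bochner_Integration.integral_add, intro integrable_mult_right iln, intro integrable_mult_right I(3), simp)
    also have "\<tau> powr \<kappa> / s * (LINT u|\<mu>. (cmod (u - z))\<^sup>2 powr - s) \<le> \<tau> powr \<kappa> / s * D"
      using pw s by (intro mult_left_mono) auto
    finally show "(LINT u|\<mu>. ln (\<tau>\<^sup>2 + (cmod (u - z))\<^sup>2)) \<le> 2 * (LINT u|\<mu>. ln (cmod (u - z))) + D / s * \<tau> powr \<kappa>"
      by (simp add: mult.commute)
  qed
qed

section \<open>Circle averages and weak convergence\<close>

text \<open>The mean of \<open>ln (cmod (u - v))\<close> over the circle \<open>cmod v = r\<close>,
  in the closed form given by Jensen's formula.\<close>

definition circle_log :: "real \<Rightarrow> complex \<Rightarrow> real" where
  "circle_log r u = ln (max r (cmod u))"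

section \<open>Averages over multisets and over the vertices of regular polygons\<close>

definition avg :: "complex multiset \<Rightarrow> (complex \<Rightarrow> real) \<Rightarrow> real" where
  "avg \<Lambda> f = (\<Sum>u\<in>#\<Lambda>. f u) / real (size \<Lambda>)"

lemma sum_mset_mono_real: "(\<And>x. x \<in># A \<Longrightarrow> f x \<le> g x) \<Longrightarrow> (\<Sum>x\<in>#A. f x) \<le> (\<Sum>x\<in>#A. g x :: real)"
  by (induction A) (auto intro: add_mono)

lemma avg_mono: "(\<And>u. u \<in># \<Lambda> \<Longrightarrow> f u \<le> g u) \<Longrightarrow> avg \<Lambda> f \<le> avg \<Lambda> g"
  unfolding avg_def by (intro divide_right_mono sum_mset_mono_real) auto

lemma avg_add: "avg \<Lambda> (\<lambda>u. f u + g u) = avg \<Lambda> f + avg \<Lambda> g"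
  by (simp add: avg_def sum_mset.distrib add_divide_distrib)

lemma avg_diff: "avg \<Lambda> (\<lambda>u. f u - g u) = avg \<Lambda> f - avg \<Lambda> g"
proof -
  have "(\<Sum>u\<in>#\<Lambda>. f u - g u) = (\<Sum>u\<in>#\<Lambda>. f u) - (\<Sum>u\<in>#\<Lambda>. g u)" by (induction \<Lambda>) auto
  thus ?thesis by (simp add: avg_def diff_divide_distrib)
qed

lemma avg_cmult: "avg \<Lambda> (\<lambda>u. c * f u) = c * avg \<Lambda> f"
proof -
  have "(\<Sum>u\<in>#\<Lambda>. c * f u) = c * (\<Sum>u\<in>#\<Lambda>. f u)" by (induction \<Lambda>) (auto simp: algebra_simps)
  thus ?thesis by (simp add: avg_def)
qed

lemma avg_const: "\<Lambda> \<noteq> {#} \<Longrightarrow> avg \<Lambda> (\<lambda>_. c) = c"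
  by (simp add: avg_def)

lemma avg_cong: "(\<And>u. u \<in># \<Lambda> \<Longrightarrow> f u = g u) \<Longrightarrow> avg \<Lambda> f = avg \<Lambda> g"
  unfolding avg_def by (metis (mono_tags, lifting) image_mset_cong)

lemma avg_abs: "\<bar>avg \<Lambda> f\<bar> \<le> avg \<Lambda> (\<lambda>u. \<bar>f u\<bar>)"
proof -
  have "\<bar>\<Sum>u\<in>#\<Lambda>. f u\<bar> \<le> (\<Sum>u\<in>#\<Lambda>. \<bar>f u\<bar>)"
    by (induction \<Lambda>) (auto intro: order_trans[OF abs_triangle_ineq] add_mono)
  thus ?thesis by (simp add: avg_def divide_right_mono)
qed

lemma avg_swap: "avg \<Lambda> (\<lambda>u. avg \<Lambda>' (\<lambda>v. f u v)) = avg \<Lambda>' (\<lambda>v. avg \<Lambda> (\<lambda>u. f u v))"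
proof -
  have "(\<Sum>u\<in>#\<Lambda>. \<Sum>v\<in>#\<Lambda>'. f u v) = (\<Sum>v\<in>#\<Lambda>'. \<Sum>u\<in>#\<Lambda>. f u v)"
    by (induction \<Lambda>) (auto simp: sum_mset.distrib)
  moreover have "(\<Sum>u\<in>#A. g u / c) = (\<Sum>u\<in>#A. g u) / c" for A :: "complex multiset" and g and c :: real
    by (induction A) (auto simp: add_divide_distrib)
  ultimately show ?thesis by (simp add: avg_def mult.commute)
qed

lemma avg_integral:
  assumes "\<And>v. v \<in># \<Lambda> \<Longrightarrow> integrable M (f v)"
  shows "integrable M (\<lambda>x. avg \<Lambda> (\<lambda>v. f v x))" "(LINT x|M. avg \<Lambda> (\<lambda>v. f v x)) = avg \<Lambda> (\<lambda>v. LINT x|M. f v x)"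
proof -
  have "integrable M (\<lambda>x. \<Sum>v\<in>#\<Lambda>. f v x) \<and> (LINT x|M. (\<Sum>v\<in>#\<Lambda>. f v x)) = (\<Sum>v\<in>#\<Lambda>. LINT x|M. f v x)"
    using assms by (induction \<Lambda>) auto
  thus "integrable M (\<lambda>x. avg \<Lambda> (\<lambda>v. f v x))" "(LINT x|M. avg \<Lambda> (\<lambda>v. f v x)) = avg \<Lambda> (\<lambda>v. LINT x|M. f v x)"
    by (auto simp: avg_def)
qed

text \<open>The vertices of a regular polygon stand in for the circle. Their product formula makes
  the discrete mean of the logarithms explicit, so that circle means need no integration.\<close>

lemma polygon_nodes:
  assumes "k > 0" "r > 0"
  obtains V :: "complex multiset" where "size V = k" "\<And>v. v \<in># V \<Longrightarrow> cmod v = r"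
    "\<And>x. (\<Prod>v\<in>#V. x - v) = x ^ k - of_real r ^ k"
proof -
  define p where "p = Polynomial.monom 1 k - [:of_real r ^ k :: complex:]"
  have deg: "degree p = k" proof -
    have "degree (Polynomial.monom 1 k + [:- (of_real r ^ k) :: complex:]) = degree (Polynomial.monom (1::complex) k)"
      by (rule degree_add_eq_left) (use assms in \<open>simp add: Polynomial.degree_monom_eq\<close>)
    moreover have "Polynomial.monom 1 k - [:of_real r ^ k:] = Polynomial.monom 1 k + [:- (of_real r ^ k) :: complex:]"
      by (metis diff_conv_add_uminus minus_pCons minus_zero)
    ultimately show ?thesis unfolding p_def by (simp only: Polynomial.degree_monom_eq[OF one_neq_zero])
  qed
  have lc: "lead_coeff p = 1" unfolding deg using assms by (simp add: p_def coeff_pCons split: nat.splits)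
  have ev: "poly p x = x ^ k - of_real r ^ k" for x by (simp add: p_def poly_monom)
  have dec: "(\<Prod>x\<in>#proots p. [:-x, 1:]) = p" using complex_poly_decompose_multiset[of p] lc by simp
  have "cmod v = r" if "v \<in># proots p" for v
  proof -
    have "p \<noteq> 0" using lc by auto
    hence "v ^ k = of_real r ^ k" using that ev[of v] by (simp add: set_count_proots)
    hence "cmod v ^ k = r ^ k" using assms by (metis abs_of_pos norm_of_real norm_power)
    thus ?thesis using assms by (metis norm_ge_zero less_imp_le power_eq_imp_eq_base)
  qed
  moreover have "size (proots p) = k" by (simp add: size_proots_complex deg)
  moreover have "(\<Prod>v\<in>#proots p. x - v) = x ^ k - of_real r ^ k" for x
  proof -
    have "poly (\<Prod>v\<in>#A. [:-v, 1:]) x = (\<Prod>v\<in>#A. x - v)" for A by (induction A) (auto simp: algebra_simps)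
    thus ?thesis using dec ev by metis
  qed
  ultimately show ?thesis using that by blast
qed

lemma avg_ln_nodes:
  assumes "x \<notin># V"
  shows "avg V (\<lambda>v. ln (cmod (x - v))) = ln (cmod (\<Prod>v\<in>#V. x - v)) / real (size V)"
proof -
  have "(\<Sum>v\<in>#V. ln (cmod (x - v))) = ln (cmod (\<Prod>v\<in>#V. x - v)) \<and> (\<Prod>v\<in>#V. x - v) \<noteq> 0"
    using assms by (induction V) (auto simp: norm_mult ln_mult_pos)
  thus ?thesis by (simp add: avg_def)
qed

lemma avg_ln_shifted_nodes:
  assumes "x - w \<notin># V"
  shows "avg V (\<lambda>v. ln (cmod (x - (w + v)))) = ln (cmod (\<Prod>v\<in>#V. (x - w) - v)) / real (size V)"
proof -
  have "x - (w + v) = (x - w) - v" for v by simp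
  thus ?thesis using avg_ln_nodes[OF assms] by (simp only:)
qed

lemma node_iff: "(\<Prod>v\<in>#V. x - v) = 0 \<longleftrightarrow> x \<in># (V :: complex multiset)"
  by (induction V) auto

lemma power_difference_upper:
  fixes x :: complex
  assumes "k > 0" "r > 0" "x ^ k \<noteq> of_real r ^ k"
  shows "ln (cmod (x ^ k - of_real r ^ k)) / real k \<le> circle_log r x + ln 2 / real k"
proof -
  define m where "m = max r (cmod x)"
  have m: "m > 0" using assms by (simp add: m_def)
  have "cmod (x ^ k - of_real r ^ k) \<le> cmod x ^ k + r ^ k"
    using norm_triangle_ineq4[of "x ^ k" "of_real r ^ k"] assms by (simp add: norm_power)
  also have "\<dots> \<le> m ^ k + m ^ k" using assms by (intro add_mono power_mono) (auto simp: m_def)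
  finally have "ln (cmod (x ^ k - of_real r ^ k)) \<le> ln (2 * m ^ k)" using assms m by (subst ln_le_cancel_iff) auto
  also have "\<dots> = ln 2 + real k * ln m" using m by (simp add: ln_mult_pos ln_realpow)
  finally have "ln (cmod (x ^ k - of_real r ^ k)) / real k \<le> (ln 2 + real k * ln m) / real k"
    by (rule divide_right_mono) simp
  thus ?thesis using assms by (simp add: circle_log_def m_def add_divide_distrib)
qed

lemma power_diff_ge:
  fixes a b :: real
  assumes "0 \<le> b" "b \<le> a"
  shows "(a - b) * a ^ k \<le> a ^ Suc k - b ^ Suc k"
proof -
  have "b * b ^ k \<le> b * a ^ k" using assms by (intro mult_left_mono power_mono) auto
  thus ?thesis by (simp add: algebra_simps)
qed

text \<open>Near the circle the bound degenerates, but the defect does not depend on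
  \<open>k\<close> apart from the division by \<open>k\<close>. It comes from a^k - b^k \<ge> (a -
  b) a^(k-1) for the larger number a of \<open>r\<close> and \<open>cmod x\<close>.\<close>

lemma power_difference_lower:
  fixes x :: complex
  assumes "k > 0" "r > 0" "cmod x \<noteq> r"
  shows "ln (cmod (x ^ k - of_real r ^ k)) / real k \<ge> circle_log r x + (ln \<bar>cmod x - r\<bar> - circle_log r x) / real k"
proof -
  define m where "m = max r (cmod x)"
  have m: "m > 0" using assms by (simp add: m_def)
  obtain j where j: "k = Suc j" using assms by (cases k) auto
  have "\<bar>cmod x - r\<bar> * m ^ j \<le> \<bar>cmod x ^ k - r ^ k\<bar>"
  proof (cases "cmod x \<le> r")
    case True
    hence "(r - cmod x) * r ^ j \<le> r ^ k - cmod x ^ k" unfolding j by (intro power_diff_ge) auto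
    thus ?thesis using True by (simp add: m_def abs_if)
  next
    case False
    hence "(cmod x - r) * cmod x ^ j \<le> cmod x ^ k - r ^ k" unfolding j using assms by (intro power_diff_ge) auto
    thus ?thesis using False by (simp add: m_def abs_if)
  qed
  also have "\<dots> \<le> cmod (x ^ k - of_real r ^ k)"
    using norm_triangle_ineq3[of "x ^ k" "of_real r ^ k"] assms by (simp add: norm_power)
  finally have "ln (\<bar>cmod x - r\<bar> * m ^ j) \<le> ln (cmod (x ^ k - of_real r ^ k))"
    using assms m by (intro ln_mono) auto
  moreover have "ln (\<bar>cmod x - r\<bar> * m ^ j) = ln \<bar>cmod x - r\<bar> + real j * ln m"
    using assms m by (simp add: ln_mult_pos ln_realpow)
  ultimately have "(ln \<bar>cmod x - r\<bar> + real j * ln m) / real k \<le> ln (cmod (x ^ k - of_real r ^ k)) / real k"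
    by (intro divide_right_mono) auto
  moreover have "(ln \<bar>cmod x - r\<bar> + real j * ln m) / real k = circle_log r x + (ln \<bar>cmod x - r\<bar> - circle_log r x) / real k"
    unfolding j by (simp add: circle_log_def m_def field_simps)
  ultimately show ?thesis by simp
qed

lemma le_of_le_add_divide:
  fixes a b c :: real
  assumes "\<And>k::nat. k > 0 \<Longrightarrow> a \<le> b + c / real k"
  shows "a \<le> b"
proof (rule LIMSEQ_le)
  show "(\<lambda>k. b + c / real (Suc k)) \<longlonglongrightarrow> b"
    using tendsto_add[OF tendsto_const[of b] LIMSEQ_Suc[OF lim_const_over_n[of c]]] by simp
  show "(\<lambda>k. a) \<longlonglongrightarrow> a" by simp
  show "\<exists>N. \<forall>k\<ge>N. a \<le> b + c / real (Suc k)" using assms[of "Suc k" for k] by blast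
qed

lemma circle_log_mono: "0 < r \<Longrightarrow> r \<le> r' \<Longrightarrow> circle_log r u \<le> circle_log r' u"
  unfolding circle_log_def by (subst ln_le_cancel_iff) auto

lemma circle_log_upper: "0 < r \<Longrightarrow> r \<le> r' \<Longrightarrow> circle_log r' u \<le> circle_log r u + (ln r' - ln r)"
proof -
  assume r: "0 < r" "r \<le> r'"
  have "max r' (cmod u) * r \<le> max r (cmod u) * r'"
  proof (cases "cmod u \<le> r'")
    case True
    have "r' * r \<le> r' * max r (cmod u)" using r by (intro mult_left_mono) auto
    thus ?thesis using True by (simp add: max_def mult.commute)
  next
    case False
    have "cmod u * r \<le> cmod u * r'" using r by (intro mult_left_mono) auto
    thus ?thesis using False r by (simp add: max_def)
  qed
  hence "ln (max r' (cmod u) * r) \<le> ln (max r (cmod u) * r')" using r by (intro ln_mono) (auto intro!: mult_pos_pos simp: less_max_iff_disj)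
  thus ?thesis using r by (simp add: circle_log_def ln_mult_pos less_max_iff_disj)
qed

lemma circle_log_lipschitz:
  assumes "r > 0"
  shows "\<bar>circle_log r u - circle_log r v\<bar> \<le> cmod (u - v) / r"
proof -
  have *: "ln (max r a) - ln (max r b) \<le> \<bar>a - b\<bar> / r" if "a \<ge> 0" "b \<ge> 0" for a b :: real
  proof (cases "max r a \<le> max r b")
    case True
    hence "ln (max r a) \<le> ln (max r b)" using assms by (intro ln_mono) auto
    moreover have "\<bar>a - b\<bar> / r \<ge> 0" using assms by simp
    ultimately show ?thesis by linarith
  next
    case False
    define x where "x = (max r a - max r b) / max r b"
    have x: "x \<ge> 0" "max r a = max r b * (1 + x)" using False assms by (auto simp: x_def field_simps)
    have "ln (max r a) = ln (max r b) + ln (1 + x)"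
      using x assms by (simp only: x(2), subst ln_mult_pos) auto
    moreover have "ln (1 + x) \<le> x" using x by (simp add: ln_add_one_self_le_self)
    moreover have "x \<le> \<bar>a - b\<bar> / r"
      unfolding x_def using False assms by (intro frac_le) auto
    ultimately show ?thesis by linarith
  qed
  have "\<bar>circle_log r u - circle_log r v\<bar> \<le> \<bar>cmod u - cmod v\<bar> / r"
    using *[of "cmod u" "cmod v"] *[of "cmod v" "cmod u"] by (simp add: circle_log_def abs_le_iff abs_minus_commute)
  also have "\<dots> \<le> cmod (u - v) / r" using assms norm_triangle_ineq3[of u v] by (intro divide_right_mono) auto
  finally show ?thesis .
qed

lemma circle_log_bounds:
  assumes "r > 0" "cmod u \<le> B"
  shows "\<bar>circle_log r u\<bar> \<le> \<bar>ln r\<bar> + \<bar>ln (max r B)\<bar>"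
proof -
  have "ln r \<le> circle_log r u" "circle_log r u \<le> ln (max r B)"
    unfolding circle_log_def using assms by (auto intro!: ln_mono)
  thus ?thesis by linarith
qed

lemma borel_measurable_circle_log [measurable]: "circle_log r \<in> borel_measurable borel"
  unfolding circle_log_def by measurable

section \<open>Circle means of the potential of a measure without atoms\<close>

context
  fixes \<mu> :: "complex measure" and K :: real
  assumes \<mu>: "prob_space \<mu>" "sets \<mu> = sets borel"
    and K: "AE u in \<mu>. cmod u \<le> K"
    and nz: "\<And>z. AE u in \<mu>. u \<noteq> z"
    and iln: "\<And>z. integrable \<mu> (\<lambda>u. ln (cmod (u - z)))"

begin

lemma integrable_circle_log: "r > 0 \<Longrightarrow> integrable \<mu> (\<lambda>u. circle_log r (u - w))"
proof -
  assume r: "r > 0"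
  interpret prob_space \<mu> by (rule \<mu>)
  note [measurable_cong] = \<mu>(2)
  show ?thesis
  proof (rule integrable_const_bound)
    show "AE u in \<mu>. norm (circle_log r (u - w)) \<le> \<bar>ln r\<bar> + \<bar>ln (max r (K + cmod w))\<bar>"
      using K
    proof eventually_elim
      case (elim u)
      hence "cmod (u - w) \<le> K + cmod w" using norm_triangle_ineq4[of u w] by linarith
      thus ?case using circle_log_bounds[OF r] by simp
    qed
  qed measurable
qed

lemma integral_mono_circle_log:
  assumes "0 < r" "r \<le> r'"
  shows "(LINT u|\<mu>. circle_log r (u - w)) \<le> (LINT u|\<mu>. circle_log r' (u - w))"
    "(LINT u|\<mu>. circle_log r' (u - w)) \<le> (LINT u|\<mu>. circle_log r (u - w)) + (ln r' - ln r)"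
proof -
  interpret prob_space \<mu> by (rule \<mu>)
  note [measurable_cong] = \<mu>(2)
  note i = integrable_circle_log[OF assms(1), of w] integrable_circle_log[of r' w]
  show "(LINT u|\<mu>. circle_log r (u - w)) \<le> (LINT u|\<mu>. circle_log r' (u - w))"
    using i assms by (intro integral_mono circle_log_mono) auto
  have "(LINT u|\<mu>. circle_log r' (u - w)) \<le> (LINT u|\<mu>. circle_log r (u - w) + (ln r' - ln r))"
    using i assms by (intro integral_mono circle_log_upper Bochner_Integration.integrable_add) auto
  also have "\<dots> = (LINT u|\<mu>. circle_log r (u - w)) + (ln r' - ln r)"
    using i prob_space by (subst Bochner_Integration.integral_add) auto
  finally show "(LINT u|\<mu>. circle_log r' (u - w)) \<le> (LINT u|\<mu>. circle_log r (u - w)) + (ln r' - ln r)" .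
qed

definition potential :: "complex \<Rightarrow> real" where
  "potential z = (LINT u|\<mu>. ln (cmod (u - z)))"

text \<open>Points have measure 0, so the finitely many vertices may be ignored.\<close>

lemma nodes_integral:
  assumes V: "size V = k" "k > 0" "\<And>x. (\<Prod>v\<in>#V. x - v) = x ^ k - of_real r ^ k"
  shows "integrable \<mu> (\<lambda>u. ln (cmod ((u - w) ^ k - of_real r ^ k)) / real k)"
    "avg V (\<lambda>v. potential (w + v)) = (LINT u|\<mu>. ln (cmod ((u - w) ^ k - of_real r ^ k)) / real k)"
    "AE u in \<mu>. (u - w) ^ k \<noteq> of_real r ^ k"
proof -
  note [measurable_cong] = \<mu>(2)
  have nzV: "AE u in \<mu>. \<forall>v\<in>set_mset V. u \<noteq> w + v" using nz by (intro AE_finite_allI) auto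
  have "(u - w) \<in># V \<longleftrightarrow> (u - w) ^ k = of_real r ^ k" for u
    unfolding node_iff[symmetric] V(3) by simp
  thus "AE u in \<mu>. (u - w) ^ k \<noteq> of_real r ^ k"
    using nzV by (auto elim!: eventually_mono) (metis add.commute diff_add_cancel)
  have eq: "AE u in \<mu>. avg V (\<lambda>v. ln (cmod (u - (w + v)))) = ln (cmod ((u - w) ^ k - of_real r ^ k)) / real k"
    using nzV
  proof eventually_elim
    case (elim u)
    hence nV: "u - w \<notin># V" by (metis add.commute diff_add_cancel)
    show ?case unfolding avg_ln_shifted_nodes[OF nV] V(1) V(3) ..
  qed
  note I = avg_integral[of V \<mu> "\<lambda>v u. ln (cmod (u - (w + v)))", OF iln]
  show "integrable \<mu> (\<lambda>u. ln (cmod ((u - w) ^ k - of_real r ^ k)) / real k)"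
    by (rule integrable_cong_AE_imp[OF I(1)]) (use eq in \<open>auto elim: eventually_mono\<close>)
  show "avg V (\<lambda>v. potential (w + v)) = (LINT u|\<mu>. ln (cmod ((u - w) ^ k - of_real r ^ k)) / real k)"
    unfolding potential_def I(2)[symmetric]
    by (rule integral_cong_AE[OF borel_measurable_integrable[OF I(1)] _ eq]) measurable
qed

text \<open>The multiset is given first, so the radius can be moved slightly to avoid the moduli of
  its points. The lower estimate for power differences then has a finite defect on the multiset,
  which vanishes as the number of vertices grows. The vertices used depend on the multiset, hence
  the bound on a whole disc.\<close>

lemma circle_average_upper:
  assumes \<Lambda>: "\<Lambda> \<noteq> {#}" and r: "r > 0" "cmod w + 2 * r \<le> R" and \<eta>: "\<eta> > 0"
    and up: "\<And>z. cmod z \<le> R \<Longrightarrow> z \<notin># \<Lambda> \<Longrightarrow> avg \<Lambda> (\<lambda>u. ln (cmod (u - z))) \<le> potential z + \<eta>"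
  shows "avg \<Lambda> (\<lambda>u. circle_log r (u - w)) \<le> (LINT u|\<mu>. circle_log r (u - w)) + 2 * \<eta>"
proof -
  interpret prob_space \<mu> by (rule \<mu>)
  note [measurable_cong] = \<mu>(2)
  \<comment> \<open>The factor \<open>exp \<eta>\<close> limits the change of
    \<open>circle_log\<close> to \<eta>, and the factor 2 keeps the polygon inside the disc of
    radius \<open>R\<close>.\<close>
  have "r < r * min 2 (exp \<eta>)" using r \<eta> by simp
  hence "infinite ({r<..<r * min 2 (exp \<eta>)} - (\<lambda>u. cmod (u - w)) ` set_mset \<Lambda>)"
    by (intro Diff_infinite_finite) auto
  then obtain r' where "r' \<in> {r<..<r * min 2 (exp \<eta>)} - (\<lambda>u. cmod (u - w)) ` set_mset \<Lambda>"
    using infinite_imp_nonempty by blast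
  hence r': "r < r'" "r' < r * min 2 (exp \<eta>)" "\<And>u. u \<in># \<Lambda> \<Longrightarrow> cmod (u - w) \<noteq> r'" by auto
  have "r * min 2 (exp \<eta>) \<le> r * 2" "r * min 2 (exp \<eta>) \<le> r * exp \<eta>" using r by (auto intro: mult_left_mono)
  hence r2: "r' \<le> 2 * r" "r' \<le> r * exp \<eta>" using r'(2) by linarith+
  hence "ln r' \<le> ln (r * exp \<eta>)" using r r' by (intro ln_mono) auto
  hence lr: "ln r' - ln r \<le> \<eta>" using r by (simp add: ln_mult_pos)
  define d where "d u = ln \<bar>cmod (u - w) - r'\<bar> - circle_log r' (u - w)" for u
  have "avg \<Lambda> (\<lambda>u. circle_log r' (u - w)) \<le> (LINT u|\<mu>. circle_log r' (u - w)) + \<eta> + (ln 2 - avg \<Lambda> d) / real k" if k: "k > 0" for k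
  proof -
    obtain V where V: "size V = k" "\<And>v. v \<in># V \<Longrightarrow> cmod v = r'" "\<And>x. (\<Prod>v\<in>#V. x - v) = x ^ k - of_real r' ^ k"
      using polygon_nodes[OF k, of r'] r r' by auto
    have V0: "V \<noteq> {#}" using V k by auto
    note nI = nodes_integral[OF V(1) k V(3), where w = w]
    have "avg \<Lambda> (\<lambda>u. circle_log r' (u - w) + d u / real k) \<le> avg \<Lambda> (\<lambda>u. ln (cmod ((u - w) ^ k - of_real r' ^ k)) / real k)"
      using r r' k by (intro avg_mono) (auto simp: d_def intro!: power_difference_lower)
    also have "\<dots> = avg \<Lambda> (\<lambda>u. avg V (\<lambda>v. ln (cmod (u - (w + v)))))"
    proof (rule avg_cong)
      fix u assume "u \<in># \<Lambda>"
      hence nV: "u - w \<notin># V" using r' V by auto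
      show "ln (cmod ((u - w) ^ k - of_real r' ^ k)) / real k = avg V (\<lambda>v. ln (cmod (u - (w + v))))"
        unfolding avg_ln_shifted_nodes[OF nV] V(1) V(3) ..
    qed
    also have "\<dots> = avg V (\<lambda>v. avg \<Lambda> (\<lambda>u. ln (cmod (u - (w + v)))))" by (rule avg_swap)
    also have "\<dots> \<le> avg V (\<lambda>v. potential (w + v) + \<eta>)"
    proof (intro avg_mono up)
      fix v assume v: "v \<in># V"
      have "cmod (w + v) \<le> cmod w + r'" using norm_triangle_ineq[of w v] V(2)[OF v] by simp
      thus "cmod (w + v) \<le> R" using r r2 by linarith
      show "w + v \<notin># \<Lambda>" using r'(3)[of "w + v"] V(2)[OF v] by auto
    qed
    also have "\<dots> = (LINT u|\<mu>. ln (cmod ((u - w) ^ k - of_real r' ^ k)) / real k) + \<eta>"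
      using V0 by (simp add: avg_add avg_const nI)
    also have "(LINT u|\<mu>. ln (cmod ((u - w) ^ k - of_real r' ^ k)) / real k) \<le> (LINT u|\<mu>. circle_log r' (u - w) + ln 2 / real k)"
    proof (rule integral_mono_AE[OF nI(1)])
      show "integrable \<mu> (\<lambda>u. circle_log r' (u - w) + ln 2 / real k)"
        using integrable_circle_log[of r' w] r r' by auto
      show "AE u in \<mu>. ln (cmod ((u - w) ^ k - of_real r' ^ k)) / real k \<le> circle_log r' (u - w) + ln 2 / real k"
        using nI(3) k r r' by (auto elim!: eventually_mono intro!: power_difference_upper)
    qed
    also have "\<dots> = (LINT u|\<mu>. circle_log r' (u - w)) + ln 2 / real k"
      using integrable_circle_log[of r' w] r r' prob_space by (subst Bochner_Integration.integral_add) auto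
    finally have "avg \<Lambda> (\<lambda>u. circle_log r' (u - w) + d u / real k) \<le> (LINT u|\<mu>. circle_log r' (u - w)) + ln 2 / real k + \<eta>" by simp
    moreover have "avg \<Lambda> (\<lambda>u. circle_log r' (u - w) + d u / real k) = avg \<Lambda> (\<lambda>u. circle_log r' (u - w)) + avg \<Lambda> d / real k"
      using avg_cmult[of \<Lambda> "1 / real k" d] by (simp add: avg_add)
    ultimately show ?thesis by (simp add: diff_divide_distrib)
  qed
  hence "avg \<Lambda> (\<lambda>u. circle_log r' (u - w)) \<le> (LINT u|\<mu>. circle_log r' (u - w)) + \<eta>" by (rule le_of_le_add_divide)
  moreover have "avg \<Lambda> (\<lambda>u. circle_log r (u - w)) \<le> avg \<Lambda> (\<lambda>u. circle_log r' (u - w))"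
    using r r' by (intro avg_mono circle_log_mono) auto
  moreover have "(LINT u|\<mu>. circle_log r' (u - w)) \<le> (LINT u|\<mu>. circle_log r (u - w)) + \<eta>"
    using integral_mono_circle_log(2)[of r r' w] lr r r' by simp
  ultimately show ?thesis by linarith
qed

text \<open>The measure may charge circles, so the radius is chosen by Fubini: integrated over the
  radius, the singular power has a bound independent of \<open>u\<close>, hence it is integrable in
  \<open>u\<close> for almost every radius.\<close>

lemma good_radius:
  assumes "0 < a" "a < c"
  shows "\<exists>r. a < r \<and> r < c \<and> integrable \<mu> (\<lambda>u. ln \<bar>cmod (u - w) - r\<bar>) \<and> (AE u in \<mu>. cmod (u - w) \<noteq> r)"
proof -
  interpret prob_space \<mu> by (rule \<mu>)
  note [measurable_cong] = \<mu>(2)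
  define I where "I = restrict_space lborel {a<..<c}"
  have fmI: "finite_measure I" unfolding I_def using assms by (intro finite_measureI) (auto simp: emeasure_restrict_space space_restrict_space)
  interpret I: finite_measure I by (rule fmI)
  interpret pair_sigma_finite \<mu> I by unfold_locales
  have mI [measurable_cong]: "sets I = sets (restrict_space borel {a<..<c})" unfolding I_def by (intro sets_restrict_space_cong) simp
  have idI [measurable]: "(\<lambda>r. r) \<in> borel_measurable I" unfolding I_def by (intro measurable_restrict_space1) simp
  \<comment> \<open>The constant of \<open>nn_integral_singular_powr\<close> with exponent 1/2,
    threshold 1 and \<open>C = 2\<close>, since an interval of radius t has length 2 t.\<close>
  define D where "D = 1 powr - (1/2) * measure I (space I) + 2 * 1 powr (1/2) * 2 powr (1/2) / (1 - 2 powr - (1/2 :: real))"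
  have inner: "(\<integral>\<^sup>+r. singular_powr (1/2) \<bar>x - r\<bar> \<partial>I) \<le> ennreal D" for x :: real
    unfolding D_def
  proof (rule nn_integral_singular_powr[OF fmI])
    fix t :: real assume t: "0 \<le> t" "t \<le> 1"
    have "emeasure I {r \<in> space I. \<bar>x - r\<bar> \<le> t} = emeasure lborel {r \<in> {a<..<c}. \<bar>x - r\<bar> \<le> t}"
      unfolding I_def by (subst emeasure_restrict_space) (auto simp: space_restrict_space)
    also have "\<dots> \<le> emeasure lborel {x - t..x + t}" by (intro emeasure_mono) auto
    also have "\<dots> = ennreal (2 * t)" using t by simp
    finally have "measure I {r \<in> space I. \<bar>x - r\<bar> \<le> t} \<le> 2 * t" using t by (simp add: I.emeasure_eq_measure)
    thus "measure I {r \<in> space I. \<bar>x - r\<bar> \<le> t} \<le> 2 * t powr (2 * (1/2))" using t by simp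
  qed auto
  have "(\<integral>\<^sup>+r. \<integral>\<^sup>+u. singular_powr (1/2) \<bar>cmod (u - w) - r\<bar> \<partial>\<mu> \<partial>I) = (\<integral>\<^sup>+u. \<integral>\<^sup>+r. singular_powr (1/2) \<bar>cmod (u - w) - r\<bar> \<partial>I \<partial>\<mu>)"
    by (rule Fubini') measurable
  also have "\<dots> \<le> (\<integral>\<^sup>+u. ennreal D \<partial>\<mu>)" by (intro nn_integral_mono inner)
  also have "\<dots> < \<infinity>" by (simp add: emeasure_space_1)
  finally have "(\<integral>\<^sup>+r. \<integral>\<^sup>+u. singular_powr (1/2) \<bar>cmod (u - w) - r\<bar> \<partial>\<mu> \<partial>I) \<noteq> \<infinity>" by simp
  hence ae: "AE r in I. (\<integral>\<^sup>+u. singular_powr (1/2) \<bar>cmod (u - w) - r\<bar> \<partial>\<mu>) \<noteq> \<infinity>"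
    by (intro nn_integral_PInf_AE) measurable
  have "emeasure I (space I) \<noteq> 0" unfolding I_def using assms by (simp add: emeasure_restrict_space space_restrict_space)
  then obtain r where r: "r \<in> space I" "(\<integral>\<^sup>+u. singular_powr (1/2) \<bar>cmod (u - w) - r\<bar> \<partial>\<mu>) \<noteq> \<infinity>"
  proof -
    have "\<exists>r\<in>space I. (\<integral>\<^sup>+u. singular_powr (1/2) \<bar>cmod (u - w) - r\<bar> \<partial>\<mu>) \<noteq> \<infinity>"
    proof (rule ccontr)
      assume "\<not> ?thesis"
      hence "AE r in I. False" using ae AE_space by (auto elim!: eventually_elim2)
      hence "space I \<in> null_sets I" using AE_iff_null[of I "\<lambda>_. False"] by simp
      thus False using \<open>emeasure I (space I) \<noteq> 0\<close> by auto
    qed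
    thus ?thesis using that by blast
  qed
  have rr: "a < r" "r < c" using r(1) by (auto simp: I_def space_restrict_space)
  have "AE u in \<mu>. 0 \<le> \<bar>cmod (u - w) - r\<bar> \<and> \<bar>cmod (u - w) - r\<bar> \<le> K + cmod w + \<bar>r\<bar>"
    using K
  proof eventually_elim
    case (elim u)
    have "cmod (u - w) \<le> K + cmod w" using elim norm_triangle_ineq4[of u w] by linarith
    moreover have "cmod (u - w) \<ge> 0" by simp
    ultimately show ?case by linarith
  qed
  hence "integrable \<mu> (\<lambda>u. ln \<bar>cmod (u - w) - r\<bar>)" "AE u in \<mu>. \<bar>cmod (u - w) - r\<bar> \<noteq> 0"
    using integrable_ln_of_singular_powr[of \<mu> "\<lambda>u. \<bar>cmod (u - w) - r\<bar>" _ "1/2"] r finite_measure_axioms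
    by (auto simp: less_top)
  thus ?thesis using rr by (intro exI[of _ r]) (auto elim: eventually_mono)
qed

text \<open>The test points must not depend on the multiset, so the radius and the number of
  vertices are chosen for the measure alone. Compared with the upper bound the two estimates for
  power differences change roles: the degenerate one is integrated against the fixed measure, the
  uniform one is applied to the multiset.\<close>

lemma circle_average_lower:
  assumes r: "r > 0" and \<eta>: "\<eta> > 0"
  shows "\<exists>Z. finite Z \<and> (\<forall>\<Lambda>. \<Lambda> \<noteq> {#} \<longrightarrow> (\<forall>z\<in>Z. z \<notin># \<Lambda> \<and> avg \<Lambda> (\<lambda>u. ln (cmod (u - z))) \<ge> potential z - \<eta>) \<longrightarrow>
     avg \<Lambda> (\<lambda>u. circle_log r (u - w)) \<ge> (LINT u|\<mu>. circle_log r (u - w)) - 4 * \<eta>)"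
proof -
  interpret prob_space \<mu> by (rule \<mu>)
  note [measurable_cong] = \<mu>(2)
  have "r < r * exp \<eta>" using r \<eta> by simp
  then obtain r' where r': "r < r'" "r' < r * exp \<eta>" "integrable \<mu> (\<lambda>u. ln \<bar>cmod (u - w) - r'\<bar>)" "AE u in \<mu>. cmod (u - w) \<noteq> r'"
    using good_radius[OF r] by blast
  have "ln r' \<le> ln (r * exp \<eta>)" using r r' by (intro ln_mono) auto
  hence lr: "ln r' - ln r \<le> \<eta>" using r by (simp add: ln_mult_pos)
  define d where "d u = ln \<bar>cmod (u - w) - r'\<bar> - circle_log r' (u - w)" for u
  have ic: "integrable \<mu> (\<lambda>u. circle_log r' (u - w))" using r r' by (intro integrable_circle_log) auto
  have id: "integrable \<mu> d" unfolding d_def using r' ic by auto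
  \<comment> \<open>Both polygon errors together; \<open>k\<close> is fixed so large that
    \<open>E / k\<close> is at most \<eta>.\<close>
  define E where "E = \<bar>LINT u|\<mu>. d u\<bar> + ln 2"
  obtain k :: nat where k: "real k > E / \<eta>" using reals_Archimedean2 by blast
  have E0: "E > 0" unfolding E_def by (simp add: add_nonneg_pos)
  have k0: "k > 0" using k E0 \<eta> by (metis divide_pos_pos gr0I less_asym of_nat_0)
  have kE: "E / real k \<le> \<eta>" using k k0 \<eta> by (simp add: field_simps)
  obtain V where V: "size V = k" "\<And>v. v \<in># V \<Longrightarrow> cmod v = r'" "\<And>x. (\<Prod>v\<in>#V. x - v) = x ^ k - of_real r' ^ k"
    using polygon_nodes[OF k0, of r'] r r' by auto
  have V0: "V \<noteq> {#}" using V k0 by auto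
  note nI = nodes_integral[OF V(1) k0 V(3), where w = w]
  show ?thesis
  proof (intro exI[of _ "(\<lambda>v. w + v) ` set_mset V"] conjI allI impI)
    fix \<Lambda> :: "complex multiset"
    assume \<Lambda>: "\<Lambda> \<noteq> {#}" and lo: "\<forall>z\<in>(\<lambda>v. w + v) ` set_mset V. z \<notin># \<Lambda> \<and> avg \<Lambda> (\<lambda>u. ln (cmod (u - z))) \<ge> potential z - \<eta>"
    have "(LINT u|\<mu>. circle_log r' (u - w)) + (LINT u|\<mu>. d u) / real k = (LINT u|\<mu>. circle_log r' (u - w) + d u / real k)"
      using ic id by simp
    also have "\<dots> \<le> (LINT u|\<mu>. ln (cmod ((u - w) ^ k - of_real r' ^ k)) / real k)"
    proof (rule integral_mono_AE[OF _ nI(1)])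
      show "integrable \<mu> (\<lambda>u. circle_log r' (u - w) + d u / real k)" using ic id by auto
      show "AE u in \<mu>. circle_log r' (u - w) + d u / real k \<le> ln (cmod ((u - w) ^ k - of_real r' ^ k)) / real k"
        using r'(4) k0 r r' by (auto elim!: eventually_mono simp: d_def intro!: power_difference_lower)
    qed
    also have "\<dots> = avg V (\<lambda>v. potential (w + v))" by (simp add: nI)
    also have "\<dots> \<le> avg V (\<lambda>v. avg \<Lambda> (\<lambda>u. ln (cmod (u - (w + v)))) + \<eta>)"
      using lo by (intro avg_mono) (auto simp: algebra_simps)
    also have "\<dots> = avg \<Lambda> (\<lambda>u. avg V (\<lambda>v. ln (cmod (u - (w + v))))) + \<eta>"
      using V0 by (simp add: avg_add avg_const avg_swap[of V \<Lambda>])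
    also have "avg \<Lambda> (\<lambda>u. avg V (\<lambda>v. ln (cmod (u - (w + v))))) \<le> avg \<Lambda> (\<lambda>u. circle_log r' (u - w) + ln 2 / real k)"
    proof (rule avg_mono)
      fix u assume u: "u \<in># \<Lambda>"
      have nV: "u - w \<notin># V" using lo u by (metis add.commute diff_add_cancel image_eqI)
      hence "(u - w) ^ k \<noteq> of_real r' ^ k" unfolding node_iff[symmetric] V(3) by simp
      hence "ln (cmod ((u - w) ^ k - of_real r' ^ k)) / real k \<le> circle_log r' (u - w) + ln 2 / real k"
        using k0 r r' by (intro power_difference_upper) auto
      thus "avg V (\<lambda>v. ln (cmod (u - (w + v)))) \<le> circle_log r' (u - w) + ln 2 / real k"
        unfolding avg_ln_shifted_nodes[OF nV] V(1) V(3) .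
    qed
    also have "\<dots> = avg \<Lambda> (\<lambda>u. circle_log r' (u - w)) + ln 2 / real k" using \<Lambda> by (simp add: avg_add avg_const)
    also have "avg \<Lambda> (\<lambda>u. circle_log r' (u - w)) \<le> avg \<Lambda> (\<lambda>u. circle_log r (u - w) + (ln r' - ln r))"
      using r r' by (intro avg_mono circle_log_upper) auto
    also have "\<dots> = avg \<Lambda> (\<lambda>u. circle_log r (u - w)) + (ln r' - ln r)" using \<Lambda> by (simp add: avg_add avg_const)
    finally have "(LINT u|\<mu>. circle_log r' (u - w)) + (LINT u|\<mu>. d u) / real k
       \<le> avg \<Lambda> (\<lambda>u. circle_log r (u - w)) + (ln r' - ln r) + ln 2 / real k + \<eta>" by simp
    moreover have "(LINT u|\<mu>. circle_log r (u - w)) \<le> (LINT u|\<mu>. circle_log r' (u - w))"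
      using r r' by (intro integral_mono_circle_log) auto
    moreover have "- (E / real k) \<le> (LINT u|\<mu>. d u) / real k - ln 2 / real k"
      unfolding E_def diff_divide_distrib[symmetric] minus_divide_left by (intro divide_right_mono) auto
    ultimately show "avg \<Lambda> (\<lambda>u. circle_log r (u - w)) \<ge> (LINT u|\<mu>. circle_log r (u - w)) - 4 * \<eta>"
      using lr kE \<eta> by linarith
  qed simp
qed

end

context
  fixes \<mu> :: "complex measure" and K :: real
  assumes \<mu>: "prob_space \<mu>" "sets \<mu> = sets borel"
    and K: "AE u in \<mu>. cmod u \<le> K"
    and nz: "\<And>z. AE u in \<mu>. u \<noteq> z"
    and iln: "\<And>z. integrable \<mu> (\<lambda>u. ln (cmod (u - z)))"

begin

text \<open>
  The functions \<open>circle_log (2 * s) - circle_log s\<close> are continuous bumps supported in discs of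
  radius \<open>2 * s\<close>; testing empirical measures against all their translates amounts to testing the
  circle averages of the potentials, and convolution with a bump approximates any test function.
\<close>

theorem weak_convergence_criterion:
  fixes f :: "complex \<Rightarrow> real"
  assumes f: "continuous_on UNIV f" and B: "\<And>u. \<bar>f u\<bar> \<le> B" and \<epsilon>: "\<epsilon> > 0"
  shows "\<exists>Z R \<eta>. finite Z \<and> \<eta> > 0 \<and> (\<forall>\<Lambda>. \<Lambda> \<noteq> {#} \<longrightarrow>
    (\<forall>z. cmod z \<le> R \<longrightarrow> z \<notin># \<Lambda> \<longrightarrow> avg \<Lambda> (\<lambda>u. ln (cmod (u - z))) \<le> potential \<mu> z + \<eta>) \<longrightarrow>
    (\<forall>z\<in>Z. z \<notin># \<Lambda> \<and> avg \<Lambda> (\<lambda>u. ln (cmod (u - z))) \<ge> potential \<mu> z - \<eta>) \<longrightarrow>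
    \<bar>avg \<Lambda> f - (LINT u|\<mu>. f u)\<bar> < \<epsilon>)"
proof -
  interpret prob_space \<mu> by (rule \<mu>)
  note [measurable_cong] = \<mu>(2)
  have mf [measurable]: "f \<in> borel_measurable borel" using f by (rule borel_measurable_continuous_onI)
  have B0: "B \<ge> 0" using B[of 0] by linarith
  define K1 where "K1 = max K 1"
  have K1: "K1 \<ge> 1" "AE u in \<mu>. cmod u \<le> K1" using K by (auto simp: K1_def elim: eventually_mono)
  \<comment> \<open>Smoothing is compared with \<open>f\<close> on the disc of radius
    \<open>3 * K1\<close>, and the bumps have radius \<open>2 * s \<le> 1\<close>.\<close>
  define R0 where "R0 = 3 * K1 + 1"
  have "uniformly_continuous_on (cball 0 R0) f"
    by (rule compact_uniformly_continuous[OF continuous_on_subset[OF f]]) auto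
  then obtain \<delta> where \<delta>: "\<delta> > 0" "\<And>z w. z \<in> cball 0 R0 \<Longrightarrow> w \<in> cball 0 R0 \<Longrightarrow> dist w z < \<delta> \<Longrightarrow> dist (f w) (f z) < \<epsilon> / 6"
    unfolding uniformly_continuous_on_def using \<epsilon> by (metis divide_pos_pos zero_less_numeral)
  define s where "s = min (\<delta> / 2) (1 / 2)"
  have s: "s > 0" "2 * s \<le> \<delta>" "2 * s \<le> 1" using \<delta> by (auto simp: s_def)
  define h where "h u = circle_log (2 * s) u - circle_log s u" for u
  have mh [measurable]: "h \<in> borel_measurable borel" unfolding h_def by measurable
  have h0: "h u \<ge> 0" for u unfolding h_def using circle_log_mono[of s "2 * s" u] s by simp
  have hl: "h u \<le> ln 2" for u
    unfolding h_def using circle_log_upper[of s "2 * s" u] s by (simp add: ln_mult_pos)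
  have hz: "h u = 0" if "cmod u \<ge> 2 * s" for u using that s by (simp add: h_def circle_log_def max_def)
  have hi: "h u = ln 2" if "cmod u \<le> s" for u using that s by (simp add: h_def circle_log_def max_def ln_mult_pos)
  have hsym: "h (u - w) = h (w - u)" for u w by (simp add: h_def circle_log_def norm_minus_commute)
  have hlip: "\<bar>h u - h v\<bar> \<le> 3 / 2 * (cmod (u - v) / s)" for u v
  proof -
    have "cmod (u - v) / (2 * s) = 1 / 2 * (cmod (u - v) / s)" by simp
    thus ?thesis using circle_log_lipschitz[of "2 * s" u v] circle_log_lipschitz[of s u v] s unfolding h_def by linarith
  qed
  have ind: "integrable lborel (indicat_real (cball (0::complex) a))" for a
    by (rule integrable_real_indicator) (simp, rule emeasure_lborel_cball_finite)
  have ih: "integrable lborel h"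
  proof (rule Bochner_Integration.integrable_bound)
    show "integrable lborel (\<lambda>w. (ln 2 :: real) * indicator (cball (0::complex) (2 * s)) w)"
      by (rule integrable_mult_right[OF ind])
    show "AE w in lborel. norm (h w) \<le> norm ((ln 2 :: real) * indicator (cball (0::complex) (2 * s)) w)"
    proof (rule AE_I2)
      fix w
      show "norm (h w) \<le> norm ((ln 2 :: real) * indicator (cball (0::complex) (2 * s)) w)"
        using h0[of w] hl[of w] hz[of w] by (cases "cmod w \<le> 2 * s") auto
    qed
  qed (use mh in simp)
  define c where "c = (LINT w|lborel. h w)"
  have c0: "c > 0"
  proof -
    have "0 < ln 2 * measure lborel (cball (0::complex) s)"
      using s content_cball_pos[of s "0::complex"] by simp
    also have "\<dots> = (LINT w|lborel. ln 2 * indicator (cball (0::complex) s) w)" by simp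
    also have "\<dots> \<le> c" unfolding c_def
      by (rule integral_mono[OF integrable_mult_right[OF ind] ih]) (auto simp: indicator_def h0 hi)
    finally show ?thesis .
  qed
  have shift: "integrable lborel (\<lambda>w. h (z - w))" "(LINT w|lborel. h (z - w)) = c" for z
  proof -
    have D: "lborel = distr lborel borel ((+) (- z))" by (rule lborel_distr_plus[symmetric])
    have "integrable (distr lborel borel ((+) (- z))) h" using ih D by simp
    hence "integrable lborel (\<lambda>w. h (- z + w))" by (subst (asm) integrable_distr_eq) auto
    thus "integrable lborel (\<lambda>w. h (z - w))" by (simp add: hsym[of z])
    have "c = (LINT w|distr lborel borel ((+) (- z)). h w)" unfolding c_def using D by simp
    also have "\<dots> = (LINT w|lborel. h (- z + w))" by (subst integral_distr) auto
    finally show "(LINT w|lborel. h (z - w)) = c" by (simp add: hsym[of z])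
  qed
  define V where "V = measure lborel (cball (0::complex) R0)"
  have fV: "emeasure lborel (cball (0::complex) R0) < \<infinity>" by (rule emeasure_lborel_cball_finite)
  have V0: "V \<ge> 0" by (simp add: V_def)
  \<comment> \<open>Chosen so that the points far from the origin, \<open>4 * B * \<eta>\<close>,
    and the comparison of the smoothed averages, \<open>9 * B * V / c * \<eta>\<close>, use at most
    half of \<epsilon>. The summand 1 keeps the denominator positive.\<close>
  define \<eta> where "\<eta> = \<epsilon> / (2 * (4 * B + 9 * B * V / c + 1))"
  have den: "4 * B + 9 * B * V / c \<ge> 0" using B0 V0 c0 by simp
  have \<eta>: "\<eta> > 0" using \<epsilon> den unfolding \<eta>_def by (intro divide_pos_pos) auto
  have \<eta>e: "(4 * B + 9 * B * V / c) * \<eta> \<le> \<epsilon> / 2"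
  proof -
    have "(4 * B + 9 * B * V / c) * \<eta> \<le> (4 * B + 9 * B * V / c + 1) * \<eta>" using \<eta> by (intro mult_right_mono) auto
    also have "\<dots> = \<epsilon> / 2"
    proof -
      have X: "y * (\<epsilon> / (2 * y)) = \<epsilon> / 2" if "y > 0" for y using that by simp
      show ?thesis unfolding \<eta>_def by (rule X) (use den in simp)
    qed
    finally show ?thesis .
  qed
  \<comment> \<open>Circles of radius \<open>2 * s\<close> about points of the disc of radius
    \<open>R0\<close>, with the doubled radius that \<open>circle_average_upper\<close> asks
    for.\<close>
  define R where "R = R0 + 4 * s"
  \<comment> \<open>Lower bounds are available at finitely many points only, so the translates of
    the bump are tested on a finite net; its mesh is tuned to the Lipschitz constant
    \<open>3 / (2 * s)\<close> of \<open>h\<close>.\<close>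
  obtain W :: "complex set" where W: "finite W" "W \<subseteq> cball 0 R0" "cball 0 R0 \<subseteq> (\<Union>w\<in>W. ball w (\<eta> * s))"
  proof -
    have cov: "cball (0::complex) R0 \<subseteq> (\<Union>w\<in>cball 0 R0. ball w (\<eta> * s))" using \<eta> s by (intro subsetI UN_I) auto
    obtain W :: "complex set" where "W \<subseteq> cball 0 R0" "finite W" "cball 0 R0 \<subseteq> (\<Union>w\<in>W. ball w (\<eta> * s))"
      by (rule compactE_image[OF compact_cball open_ball cov]) blast
    thus ?thesis using that by blast
  qed
  have "\<forall>r w. \<exists>Z. r > 0 \<longrightarrow> finite Z \<and> (\<forall>\<Lambda>. \<Lambda> \<noteq> {#} \<longrightarrow> (\<forall>z\<in>Z. z \<notin># \<Lambda> \<and> avg \<Lambda> (\<lambda>u. ln (cmod (u - z))) \<ge> potential \<mu> z - \<eta>) \<longrightarrow>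
     avg \<Lambda> (\<lambda>u. circle_log r (u - w)) \<ge> (LINT u|\<mu>. circle_log r (u - w)) - 4 * \<eta>)"
    using circle_average_lower[OF \<mu> K nz iln _ \<eta>] by blast
  then obtain Zl where Zl: "\<And>r w. r > 0 \<Longrightarrow> finite (Zl r w)"
    "\<And>r w \<Lambda>. r > 0 \<Longrightarrow> \<Lambda> \<noteq> {#} \<Longrightarrow> (\<forall>z\<in>Zl r w. z \<notin># \<Lambda> \<and> avg \<Lambda> (\<lambda>u. ln (cmod (u - z))) \<ge> potential \<mu> z - \<eta>) \<Longrightarrow>
     avg \<Lambda> (\<lambda>u. circle_log r (u - w)) \<ge> (LINT u|\<mu>. circle_log r (u - w)) - 4 * \<eta>"
    by metis
  define Z where "Z = (\<Union>w\<in>W. Zl s w \<union> Zl (2 * s) w)"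
  have finZ: "finite Z" unfolding Z_def using W(1) Zl(1) s by auto
  have ih\<mu>: "integrable \<mu> (\<lambda>u. h (u - w))" for w
    unfolding h_def using s by (intro Bochner_Integration.integrable_diff integrable_circle_log[OF \<mu> K nz iln]) auto
  \<comment> \<open>The integrand of the convolution of the truncated \<open>f\<close> with the
    bump; dividing by the mass \<open>c\<close> gives the smoothed function
    \<open>F\<close>.\<close>
  define g where "g z w = indicator (cball 0 R0) w * (f w * h (z - w))" for z w :: complex
  have [measurable]: "cball (0::complex) R0 \<in> sets borel" by (intro borel_closed closed_cball)
  have mg [measurable]: "(\<lambda>(z, w). g z w) \<in> borel_measurable (borel \<Otimes>\<^sub>M borel)"
    unfolding g_def split_beta by measurable
  have gB: "\<bar>g z w\<bar> \<le> B * h (z - w)" for z w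
    unfolding g_def using B[of w] h0[of "z - w"] B0 by (auto simp: indicator_def abs_mult intro!: mult_right_mono)
  have ig: "integrable lborel (g z)" for z
  proof (rule Bochner_Integration.integrable_bound)
    show "integrable lborel (\<lambda>w. B * h (z - w))" using shift by simp
    have "g z \<in> borel_measurable borel" unfolding g_def by measurable
    thus "g z \<in> borel_measurable lborel" by simp
    show "AE w in lborel. norm (g z w) \<le> norm (B * h (z - w))"
      using gB by (auto intro!: AE_I2 order_trans[OF gB])
  qed
  define F where "F z = (LINT w|lborel. g z w) / c" for z
  have FB: "\<bar>F z\<bar> \<le> B" for z
  proof -
    have "\<bar>LINT w|lborel. g z w\<bar> \<le> (LINT w|lborel. B * h (z - w))"
      using ig gB shift by (intro order_trans[OF integral_abs_bound] integral_mono) auto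
    thus ?thesis using c0 shift[of z] by (simp add: F_def abs_divide field_simps)
  qed
  have Ff: "\<bar>F z - f z\<bar> \<le> \<epsilon> / 6" if z: "cmod z \<le> 3 * K1" for z
  proof -
    have pw: "\<bar>g z w - f z * h (z - w)\<bar> \<le> \<epsilon> / 6 * h (z - w)" for w
    proof (cases "cmod (z - w) < 2 * s")
      case False
      thus ?thesis using hz[of "z - w"] by (simp add: g_def)
    next
      case True
      have "cmod w \<le> cmod z + cmod (z - w)" by (metis norm_triangle_sub norm_minus_commute add.commute)
      hence w: "w \<in> cball 0 R0" "z \<in> cball 0 R0" using True s z by (auto simp: R0_def)
      have "dist (f w) (f z) < \<epsilon> / 6" using \<delta>(2)[OF w(2,1)] True s by (simp add: dist_norm norm_minus_commute)
      hence "\<bar>f w - f z\<bar> * h (z - w) \<le> \<epsilon> / 6 * h (z - w)" using h0 by (intro mult_right_mono) (auto simp: dist_real_def)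
      moreover have "g z w - f z * h (z - w) = (f w - f z) * h (z - w)" using w by (simp add: g_def algebra_simps)
      ultimately show ?thesis using h0[of "z - w"] by (simp add: abs_mult)
    qed
    have "c * (F z - f z) = (LINT w|lborel. g z w - f z * h (z - w))"
      using ig shift c0 by (simp add: F_def algebra_simps)
    also have "\<bar>\<dots>\<bar> \<le> (LINT w|lborel. \<epsilon> / 6 * h (z - w))"
      using ig shift pw by (intro order_trans[OF integral_abs_bound] integral_mono) auto
    also have "\<dots> = \<epsilon> / 6 * c" using shift by simp
    finally have "c * \<bar>F z - f z\<bar> \<le> c * (\<epsilon> / 6)" using c0 by (simp add: abs_mult mult.commute)
    thus ?thesis using c0 by simp
  qed
  interpret pair_sigma_finite \<mu> "lborel :: complex measure" by unfold_locales
  have igp: "integrable (\<mu> \<Otimes>\<^sub>M lborel) (\<lambda>(z, w). g z w)"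
  proof (rule Fubini_integrable)
    show "(\<lambda>(z, w). g z w) \<in> borel_measurable (\<mu> \<Otimes>\<^sub>M lborel)" by measurable
    show "integrable \<mu> (\<lambda>z. LINT w|lborel. norm (case (z, w) of (z, w) \<Rightarrow> g z w))"
    proof (rule integrable_const_bound[of _ "B * c"])
      show "AE z in \<mu>. norm (LINT w|lborel. norm (case (z, w) of (z, w) \<Rightarrow> g z w)) \<le> B * c"
      proof (rule AE_I2)
        fix z
        have "(LINT w|lborel. norm (g z w)) \<le> (LINT w|lborel. B * h (z - w))"
          using ig gB shift by (intro integral_mono) auto
        thus "norm (LINT w|lborel. norm (case (z, w) of (z, w) \<Rightarrow> g z w)) \<le> B * c" using shift[of z] by simp
      qed
    qed measurable
    show "AE z in \<mu>. integrable lborel (\<lambda>w. case (z, w) of (z, w) \<Rightarrow> g z w)" using ig by simp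
  qed
  have iF: "integrable \<mu> F"
    unfolding F_def using integrable_fst[OF igp] by simp
  have F\<mu>: "(LINT z|\<mu>. F z) = (LINT w|lborel. indicator (cball 0 R0) w * (f w * (LINT z|\<mu>. h (z - w)))) / c"
  proof -
    have "(LINT z|\<mu>. F z) = (LINT z|\<mu>. LINT w|lborel. g z w) / c" unfolding F_def by simp
    also have "(LINT z|\<mu>. LINT w|lborel. g z w) = (LINT w|lborel. LINT z|\<mu>. g z w)"
      using Fubini_integral[of g] igp by simp
    finally show ?thesis unfolding g_def by simp
  qed
  have snd: "integrable lborel (\<lambda>w. LINT z|\<mu>. g z w)" using integrable_snd[OF igp] by simp
  show ?thesis
  proof (rule exI[of _ Z], rule exI[of _ R], rule exI[of _ \<eta>], intro conjI allI impI)
    show "finite Z" by (rule finZ)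
    show "\<eta> > 0" by (rule \<eta>)
  next
    fix \<Lambda> :: "complex multiset"
    assume \<Lambda>: "\<Lambda> \<noteq> {#}"
      and up: "\<forall>z. cmod z \<le> R \<longrightarrow> z \<notin># \<Lambda> \<longrightarrow> avg \<Lambda> (\<lambda>u. ln (cmod (u - z))) \<le> potential \<mu> z + \<eta>"
      and lo: "\<forall>z\<in>Z. z \<notin># \<Lambda> \<and> avg \<Lambda> (\<lambda>u. ln (cmod (u - z))) \<ge> potential \<mu> z - \<eta>"
    note upper = circle_average_upper[OF \<mu> K nz iln \<Lambda> _ _ \<eta>, of _ _ R]
    define \<Delta> where "\<Delta> w = avg \<Lambda> (\<lambda>u. h (u - w)) - (LINT u|\<mu>. h (u - w))" for w
    have net: "\<bar>\<Delta> w\<bar> \<le> 6 * \<eta>" if w: "w \<in> W" for w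
    proof -
      have "cmod w \<le> R0" using w W by auto
      hence u1: "avg \<Lambda> (\<lambda>u. circle_log (2 * s) (u - w)) \<le> (LINT u|\<mu>. circle_log (2 * s) (u - w)) + 2 * \<eta>"
        and u2: "avg \<Lambda> (\<lambda>u. circle_log s (u - w)) \<le> (LINT u|\<mu>. circle_log s (u - w)) + 2 * \<eta>"
        using up s by (auto intro!: upper simp: R_def)
      have l1: "avg \<Lambda> (\<lambda>u. circle_log (2 * s) (u - w)) \<ge> (LINT u|\<mu>. circle_log (2 * s) (u - w)) - 4 * \<eta>"
        using lo w s by (intro Zl(2) \<Lambda>) (auto simp: Z_def)
      have l2: "avg \<Lambda> (\<lambda>u. circle_log s (u - w)) \<ge> (LINT u|\<mu>. circle_log s (u - w)) - 4 * \<eta>"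
        using lo w s by (intro Zl(2) \<Lambda>) (auto simp: Z_def)
      have "(LINT u|\<mu>. h (u - w)) = (LINT u|\<mu>. circle_log (2 * s) (u - w)) - (LINT u|\<mu>. circle_log s (u - w))"
        unfolding h_def using s by (intro Bochner_Integration.integral_diff integrable_circle_log[OF \<mu> K nz iln]) auto
      hence "\<Delta> w = (avg \<Lambda> (\<lambda>u. circle_log (2 * s) (u - w)) - (LINT u|\<mu>. circle_log (2 * s) (u - w)))
         - (avg \<Lambda> (\<lambda>u. circle_log s (u - w)) - (LINT u|\<mu>. circle_log s (u - w)))"
        unfolding \<Delta>_def by (simp add: h_def avg_diff)
      thus ?thesis using u1 u2 l1 l2 by linarith
    qed
    \<comment> \<open>6 \<eta> at the nearest point of the net, and 3/2 \<eta> for each of the two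
      averages when moving there.\<close>
    have all: "\<bar>\<Delta> w\<bar> \<le> 9 * \<eta>" if wR: "w \<in> cball 0 R0" for w
    proof -
      obtain w' where w': "w' \<in> W" "dist w' w < \<eta> * s" using subsetD[OF W(3) wR] by auto
      have close: "\<bar>h (u - w) - h (u - w')\<bar> \<le> 3 / 2 * \<eta>" for u
      proof -
        have "cmod ((u - w) - (u - w')) \<le> \<eta> * s" using w' by (simp add: dist_norm norm_minus_commute)
        hence "cmod ((u - w) - (u - w')) / s \<le> \<eta>" using s by (simp add: field_simps)
        thus ?thesis using hlip[of "u - w" "u - w'"] by linarith
      qed
      have "\<bar>avg \<Lambda> (\<lambda>u. h (u - w)) - avg \<Lambda> (\<lambda>u. h (u - w'))\<bar> \<le> avg \<Lambda> (\<lambda>u. \<bar>h (u - w) - h (u - w')\<bar>)"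
        unfolding avg_diff[symmetric] by (rule avg_abs)
      also have "\<dots> \<le> avg \<Lambda> (\<lambda>_. 3 / 2 * \<eta>)" by (intro avg_mono close)
      finally have a: "\<bar>avg \<Lambda> (\<lambda>u. h (u - w)) - avg \<Lambda> (\<lambda>u. h (u - w'))\<bar> \<le> 3 / 2 * \<eta>" using \<Lambda> by (simp add: avg_const)
      have "\<bar>(LINT u|\<mu>. h (u - w)) - (LINT u|\<mu>. h (u - w'))\<bar> = \<bar>LINT u|\<mu>. h (u - w) - h (u - w')\<bar>"
        using ih\<mu> by simp
      also have "\<dots> \<le> (LINT u|\<mu>. 3 / 2 * \<eta>)"
        using ih\<mu> close by (intro order_trans[OF integral_abs_bound] integral_mono) auto
      finally have b: "\<bar>(LINT u|\<mu>. h (u - w)) - (LINT u|\<mu>. h (u - w'))\<bar> \<le> 3 / 2 * \<eta>" using prob_space by simp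
      show ?thesis using a b net[OF w'(1)] unfolding \<Delta>_def by linarith
    qed
    \<comment> \<open>Tightness follows from the upper bounds alone: on the support of the measure
      \<open>circle_log K1\<close> has its least value \<open>ln K1\<close>, and outside radius
      \<open>3 * K1\<close> it exceeds this value by at least ln 3 \<ge> 1.\<close>
    have tail: "avg \<Lambda> (\<lambda>u. indicator {u. cmod u > 3 * K1} u) \<le> 2 * \<eta>"
    proof -
      have "avg \<Lambda> (\<lambda>u. circle_log K1 (u - 0)) \<le> (LINT u|\<mu>. circle_log K1 (u - 0)) + 2 * \<eta>"
        using up s K1 by (intro upper) (auto simp: R_def R0_def)
      also have "(LINT u|\<mu>. circle_log K1 (u - 0)) = (LINT u|\<mu>. ln K1)"
        by (rule integral_cong_AE) (use K1 in \<open>auto elim!: eventually_mono simp: circle_log_def max_def\<close>)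
      finally have "avg \<Lambda> (\<lambda>u. circle_log K1 u) \<le> ln K1 + 2 * \<eta>" using prob_space by simp
      moreover have "avg \<Lambda> (\<lambda>u. ln K1 + indicator {u. cmod u > 3 * K1} u) \<le> avg \<Lambda> (\<lambda>u. circle_log K1 u)"
      proof (rule avg_mono)
        fix u
        show "ln K1 + indicator {u. cmod u > 3 * K1} u \<le> circle_log K1 u"
        proof (cases "cmod u > 3 * K1")
          case True
          have "(1::real) \<le> ln 3" using exp_le by (simp add: ln_ge_iff)
          moreover have "ln (3 * K1) \<le> ln (max K1 (cmod u))" using True K1 by (intro ln_mono) auto
          ultimately show ?thesis using True K1 by (simp add: circle_log_def ln_mult_pos)
        next
          case False
          thus ?thesis using K1 by (auto simp: circle_log_def intro!: ln_mono)
        qed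
      qed
      ultimately show ?thesis using \<Lambda> by (simp add: avg_add avg_const)
    qed
    have avgF: "avg \<Lambda> F = (LINT w|lborel. indicator (cball 0 R0) w * (f w * avg \<Lambda> (\<lambda>u. h (u - w)))) / c"
      and iav: "integrable lborel (\<lambda>w. indicator (cball 0 R0) w * (f w * avg \<Lambda> (\<lambda>u. h (u - w))))"
    proof -
      have eq: "avg \<Lambda> (\<lambda>u. g u w) = indicator (cball 0 R0) w * (f w * avg \<Lambda> (\<lambda>u. h (u - w)))" for w
        unfolding g_def by (simp add: avg_cmult)
      have "avg \<Lambda> F = (1 / c) * avg \<Lambda> (\<lambda>u. LINT w|lborel. g u w)"
        unfolding avg_cmult[symmetric] F_def by simp
      also have "avg \<Lambda> (\<lambda>u. LINT w|lborel. g u w) = (LINT w|lborel. avg \<Lambda> (\<lambda>u. g u w))"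
        by (rule avg_integral(2)[symmetric]) (rule ig)
      finally show "avg \<Lambda> F = (LINT w|lborel. indicator (cball 0 R0) w * (f w * avg \<Lambda> (\<lambda>u. h (u - w)))) / c"
        unfolding eq by simp
      show "integrable lborel (\<lambda>w. indicator (cball 0 R0) w * (f w * avg \<Lambda> (\<lambda>u. h (u - w))))"
        unfolding eq[symmetric] by (rule avg_integral(1)) (rule ig)
    qed
    have mid: "\<bar>avg \<Lambda> F - (LINT z|\<mu>. F z)\<bar> \<le> 9 * B * V / c * \<eta>"
    proof -
      have i2: "integrable lborel (\<lambda>w. indicator (cball 0 R0) w * (f w * (LINT z|\<mu>. h (z - w))))"
        using snd unfolding g_def by simp
      have "c * (avg \<Lambda> F - (LINT z|\<mu>. F z)) = (LINT w|lborel. indicator (cball 0 R0) w * (f w * avg \<Lambda> (\<lambda>u. h (u - w))))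
          - (LINT w|lborel. indicator (cball 0 R0) w * (f w * (LINT z|\<mu>. h (z - w))))"
        unfolding avgF F\<mu> using c0 by (simp add: right_diff_distrib)
      also have "\<dots> = (LINT w|lborel. indicator (cball 0 R0) w * (f w * avg \<Lambda> (\<lambda>u. h (u - w))) - indicator (cball 0 R0) w * (f w * (LINT z|\<mu>. h (z - w))))"
        by (rule Bochner_Integration.integral_diff[symmetric, OF iav i2])
      also have "\<bar>\<dots>\<bar> \<le> (LINT w|lborel. indicator (cball (0::complex) R0) w * (B * (9 * \<eta>)))"
      proof (intro order_trans[OF integral_abs_bound] integral_mono)
        fix w
        have "\<bar>f w\<bar> * \<bar>\<Delta> w\<bar> \<le> B * (9 * \<eta>)" if "w \<in> cball 0 R0"
          using B[of w] all[OF that] B0 by (intro mult_mono) auto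
        thus "\<bar>indicator (cball 0 R0) w * (f w * avg \<Lambda> (\<lambda>u. h (u - w))) - indicator (cball 0 R0) w * (f w * (LINT z|\<mu>. h (z - w)))\<bar>
           \<le> indicator (cball 0 R0) w * (B * (9 * \<eta>))"
          by (simp add: indicator_def \<Delta>_def abs_mult[symmetric] right_diff_distrib)
      next
        show "integrable lborel (\<lambda>w. indicat_real (cball (0::complex) R0) w * (B * (9 * \<eta>)))"
          by (rule integrable_mult_left[OF ind])
      next
        show "integrable lborel (\<lambda>w. \<bar>indicator (cball 0 R0) w * (f w * avg \<Lambda> (\<lambda>u. h (u - w))) - indicator (cball 0 R0) w * (f w * (LINT z|\<mu>. h (z - w)))\<bar>)"
          by (intro integrable_abs Bochner_Integration.integrable_diff iav i2)
      qed
      also have "\<dots> = V * (B * (9 * \<eta>))" using fV by (simp add: V_def)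
      finally have "c * \<bar>avg \<Lambda> F - (LINT z|\<mu>. F z)\<bar> \<le> V * (B * (9 * \<eta>))" using c0 by (simp add: abs_mult)
      thus ?thesis using c0 by (simp add: field_simps)
    qed
    have left: "\<bar>avg \<Lambda> f - avg \<Lambda> F\<bar> \<le> \<epsilon> / 6 + 4 * B * \<eta>"
    proof -
      have "\<bar>avg \<Lambda> f - avg \<Lambda> F\<bar> \<le> avg \<Lambda> (\<lambda>u. \<bar>f u - F u\<bar>)" unfolding avg_diff[symmetric] by (rule avg_abs)
      also have "\<dots> \<le> avg \<Lambda> (\<lambda>u. \<epsilon> / 6 + 2 * B * indicator {u. cmod u > 3 * K1} u)"
      proof (rule avg_mono)
        fix u
        show "\<bar>f u - F u\<bar> \<le> \<epsilon> / 6 + 2 * B * indicator {u. cmod u > 3 * K1} u"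
          using Ff[of u] B[of u] FB[of u] \<epsilon> by (cases "cmod u > 3 * K1") (auto simp: abs_if split: if_splits)
      qed
      also have "\<dots> = \<epsilon> / 6 + 2 * B * avg \<Lambda> (\<lambda>u. indicator {u. cmod u > 3 * K1} u)"
        by (simp only: avg_add avg_cmult avg_const[OF \<Lambda>])
      also have "\<dots> \<le> \<epsilon> / 6 + 2 * B * (2 * \<eta>)" using tail B0 by (intro add_left_mono mult_left_mono) auto
      finally show ?thesis by simp
    qed
    have right: "\<bar>(LINT z|\<mu>. F z) - (LINT z|\<mu>. f z)\<bar> \<le> \<epsilon> / 6"
    proof -
      have if1: "integrable \<mu> f" by (rule integrable_const_bound[of _ B]) (use B in auto)
      have "\<bar>(LINT z|\<mu>. F z) - (LINT z|\<mu>. f z)\<bar> = \<bar>LINT z|\<mu>. F z - f z\<bar>" using iF if1 by simp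
      also have "\<dots> \<le> (LINT z|\<mu>. \<bar>F z - f z\<bar>)" by (rule integral_abs_bound)
      also have "\<dots> \<le> (LINT z|\<mu>. \<epsilon> / 6)"
      proof (rule integral_mono_AE)
        show "AE z in \<mu>. \<bar>F z - f z\<bar> \<le> \<epsilon> / 6" using K1(2)
        proof eventually_elim
          case (elim z)
          thus ?case using K1(1) by (intro Ff) linarith
        qed
      qed (use iF if1 in auto)
      finally show ?thesis using prob_space by simp
    qed
    have "4 * B * \<eta> + 9 * B * V / c * \<eta> \<le> \<epsilon> / 2" using \<eta>e by (simp add: algebra_simps)
    thus "\<bar>avg \<Lambda> f - (LINT u|\<mu>. f u)\<bar> < \<epsilon>" using left mid right \<epsilon> by linarith
  qed
qed

end

section \<open>Piecewise Hoelder symbols\<close>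

lemma hoelder_normD:
  assumes "hoelder_norm \<rho> S h \<le> ennreal C" "C \<ge> 0"
  shows "x \<in> S \<Longrightarrow> cmod (h x) \<le> C"
    and "x \<in> S \<Longrightarrow> y \<in> S \<Longrightarrow> cmod (h x - h y) \<le> C * dist x y powr \<rho>"
proof -
  assume x: "x \<in> S"
  have "ennreal (cmod (h x)) \<le> (SUP x\<in>S. ennreal (norm (h x)))" using x by (rule SUP_upper)
  also have "\<dots> \<le> hoelder_norm \<rho> S h" unfolding hoelder_norm_def by (simp add: add_increasing2)
  finally show "cmod (h x) \<le> C" using assms by (metis ennreal_le_iff order_trans)
next
  assume xy: "x \<in> S" "y \<in> S"
  show "cmod (h x - h y) \<le> C * dist x y powr \<rho>"
  proof (cases "x = y")
    case False
    have "ennreal (norm (h x - h y) / dist x y powr \<rho>) \<le> (SUP (x, y)\<in>{(x, y). x \<in> S \<and> y \<in> S \<and> x \<noteq> y}.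
        ennreal (norm (h x - h y) / dist x y powr \<rho>))"
      by (rule SUP_upper2[of "(x, y)"]) (use xy False in auto)
    also have "\<dots> \<le> hoelder_norm \<rho> S h" unfolding hoelder_norm_def by (simp add: add_increasing)
    finally have "norm (h x - h y) / dist x y powr \<rho> \<le> C" using assms by (metis ennreal_le_iff order_trans)
    thus ?thesis using False by (simp add: field_simps)
  qed (use assms in simp)
qed

lemma lipschitz_of_partials:
  fixes g :: "real ^ 'd::finite \<Rightarrow> complex"
  assumes diff: "\<And>\<xi>. g differentiable (at \<xi>)" and C: "\<And>i \<xi>. cmod (partial i g \<xi>) \<le> C"
  shows "cmod (g \<xi> - g \<eta>) \<le> C * real CARD('d) * (\<Sum>i\<in>UNIV. \<bar>vec_nth \<xi> i - vec_nth \<eta> i\<bar>)"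
proof -
  have C0: "C \<ge> 0" using C[of undefined 0] norm_ge_zero order_trans by blast
  obtain D where D: "\<And>\<xi>. (g has_derivative D \<xi>) (at \<xi>)" using diff unfolding differentiable_def by metis
  have part: "D \<xi> (axis i 1) = partial i g \<xi>" for \<xi> i
  proof -
    have "((\<lambda>t. \<xi> + t *\<^sub>R axis i 1) has_derivative (\<lambda>t. t *\<^sub>R axis i 1)) (at (0::real))"
      by (auto intro!: derivative_eq_intros)
    moreover have "(g has_derivative D \<xi>) (at (\<xi> + 0 *\<^sub>R axis i 1))" using D by simp
    ultimately have "((\<lambda>t. g (\<xi> + t *\<^sub>R axis i 1)) has_derivative (\<lambda>t. D \<xi> (t *\<^sub>R axis i 1))) (at 0)"
      by (rule has_derivative_compose)
    moreover have "D \<xi> (t *\<^sub>R axis i 1) = t *\<^sub>R D \<xi> (axis i 1)" for t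
      by (rule linear_scale[OF has_derivative_linear[OF D]])
    ultimately have "((\<lambda>t. g (\<xi> + t *\<^sub>R axis i 1)) has_vector_derivative D \<xi> (axis i 1)) (at 0)"
      unfolding has_vector_derivative_def by simp
    thus ?thesis unfolding partial_def by (rule vector_derivative_at[symmetric])
  qed
  have on: "onorm (D \<xi>) \<le> C * real CARD('d)" for \<xi>
  proof (rule onorm_bound)
    fix v :: "real ^ 'd"
    have lin: "linear (D \<xi>)" using has_derivative_linear[OF D] .
    have "v = (\<Sum>i\<in>UNIV. vec_nth v i *\<^sub>R axis i 1)"
      using basis_expansion[of v] by (simp add: scalar_mult_eq_scaleR)
    hence "D \<xi> v = (\<Sum>i\<in>UNIV. vec_nth v i *\<^sub>R partial i g \<xi>)"
      by (metis (no_types, lifting) lin linear_scale linear_sum part sum.cong)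
    also have "cmod \<dots> \<le> (\<Sum>i\<in>(UNIV::'d set). norm v * C)"
    proof (rule order_trans[OF norm_sum sum_mono])
      fix i
      show "norm (vec_nth v i *\<^sub>R partial i g \<xi>) \<le> norm v * C"
        unfolding norm_scaleR using C[of i \<xi>] component_le_norm_cart[of v i] by (intro mult_mono) auto
    qed
    finally show "norm (D \<xi> v) \<le> C * real CARD('d) * norm v" by (simp add: mult_ac)
  qed (use C0 in simp)
  have "norm (g \<xi> - g \<eta>) \<le> C * real CARD('d) * norm (\<xi> - \<eta>)"
    by (rule differentiable_bound[of UNIV _ D]) (use D on in auto)
  also have "\<dots> \<le> C * real CARD('d) * (\<Sum>i\<in>UNIV. \<bar>vec_nth (\<xi> - \<eta>) i\<bar>)"
    using C0 norm_le_l1_cart[of "\<xi> - \<eta>"] by (intro mult_left_mono) auto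
  finally show ?thesis by simp
qed

text \<open>One constant serves the finitely many pieces. The continuity bounds are confined to
  points inside a piece, because on its boundary the symbol may differ from the extension that
  carries the Hoelder estimates.\<close>

lemma pw_symbol_bounds:
  fixes p :: "real ^ 'd::finite \<Rightarrow> real ^ 'd \<Rightarrow> complex"
  assumes p: "pw_symbol \<rho> \<U> p"
  shows "\<exists>C\<ge>0. (\<forall>x\<in>unit_cube. \<forall>\<xi>. cmod (p x \<xi>) \<le> C) \<and>
    (\<forall>U\<in>\<U>. \<forall>x\<in>U. \<forall>y\<in>U. \<forall>\<xi>. cmod (p x \<xi> - p y \<xi>) \<le> C * dist x y powr \<rho>) \<and>
    (\<forall>U\<in>\<U>. \<forall>x\<in>U. \<forall>\<xi> \<eta>. cmod (p x \<xi> - p x \<eta>) \<le> C * (\<Sum>i\<in>UNIV. \<bar>vec_nth \<xi> i - vec_nth \<eta> i\<bar>))"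
proof -
  have fin: "finite \<U>" using p by (simp add: pw_symbol_def)
  have "bounded {p x \<xi> | x \<xi>. x \<in> unit_cube}" using p unfolding pw_symbol_def by (elim conjE)
  then obtain K where K': "\<forall>z\<in>{p x \<xi> | x \<xi>. x \<in> unit_cube}. norm z \<le> K" unfolding bounded_iff ..
  have K: "cmod (p x \<xi>) \<le> K" if "x \<in> unit_cube" for x \<xi> using that by (intro bspec[OF K'] CollectI exI[of _ x] exI[of _ \<xi>] conjI refl)
  have "\<exists>C\<ge>0. (\<forall>x\<in>U. \<forall>y\<in>U. \<forall>\<xi>. cmod (p x \<xi> - p y \<xi>) \<le> C * dist x y powr \<rho>) \<and>
    (\<forall>x\<in>U. \<forall>\<xi> \<eta>. cmod (p x \<xi> - p x \<eta>) \<le> C * (\<Sum>i\<in>UNIV. \<bar>vec_nth \<xi> i - vec_nth \<eta> i\<bar>))" if U: "U \<in> \<U>" for U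
  proof -
    have "\<forall>U\<in>\<U>. \<exists>g. (\<forall>x\<in>closure U. torus_smooth (g x)) \<and> (\<forall>x\<in>U. \<forall>\<xi>. g x \<xi> = p x \<xi>) \<and>
        (\<forall>is. \<exists>C>0. \<forall>\<xi>. hoelder_norm \<rho> (closure U) (\<lambda>x. partials is (g x) \<xi>) \<le> ennreal C)"
      using p unfolding pw_symbol_def by (elim conjE)
    from bspec[OF this U] obtain g where g: "\<forall>x\<in>closure U. torus_smooth (g x)" "\<forall>x\<in>U. \<forall>\<xi>. g x \<xi> = p x \<xi>"
      "\<forall>is. \<exists>C>0. \<forall>\<xi>. hoelder_norm \<rho> (closure U) (\<lambda>x. partials is (g x) \<xi>) \<le> ennreal C"
      by (elim exE conjE)
    obtain c where c': "\<forall>is. c is > 0 \<and> (\<forall>\<xi>. hoelder_norm \<rho> (closure U) (\<lambda>x. partials is (g x) \<xi>) \<le> ennreal (c is))"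
      using choice[OF g(3)] ..
    have c: "\<And>is. c is > 0" "\<And>is \<xi>. hoelder_norm \<rho> (closure U) (\<lambda>x. partials is (g x) \<xi>) \<le> ennreal (c is)"
      using c' by simp_all
    have gx: "g x = p x" if "x \<in> U" for x using g(2) that by auto
    define C where "C = c [] + (\<Sum>i\<in>UNIV. c [i]) * real CARD('d)"
    have ci: "c [i] \<le> (\<Sum>i\<in>UNIV. c [i])" for i using c(1) by (intro member_le_sum) (auto simp: less_imp_le)
    have Cn: "C \<ge> c []" "C \<ge> (\<Sum>i\<in>UNIV. c [i]) * real CARD('d)" "C \<ge> 0"
      using c(1) by (auto simp: C_def less_imp_le intro!: mult_nonneg_nonneg sum_nonneg add_nonneg_nonneg)
    show ?thesis
    proof (intro exI[of _ C] conjI ballI allI Cn)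
      fix x y \<xi> assume xy: "x \<in> U" "y \<in> U"
      have "cmod (partials [] (g x) \<xi> - partials [] (g y) \<xi>) \<le> c [] * dist x y powr \<rho>"
        by (rule hoelder_normD(2)[OF c(2)]) (use xy c(1) closure_subset in \<open>auto simp: less_imp_le\<close>)
      also have "\<dots> \<le> C * dist x y powr \<rho>" using Cn by (intro mult_right_mono) auto
      finally show "cmod (p x \<xi> - p y \<xi>) \<le> C * dist x y powr \<rho>" using xy by (simp add: gx)
    next
      fix x \<xi> \<eta> assume x: "x \<in> U"
      have xc: "x \<in> closure U" using x closure_subset by blast
      have sm: "torus_smooth (p x)" using g(1) xc gx[OF x] by auto
      have "cmod (partial i (p x) \<zeta>) \<le> (\<Sum>i\<in>UNIV. c [i])" for i \<zeta>
      proof -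
        have "cmod (partials [i] (g x) \<zeta>) \<le> c [i]"
          by (rule hoelder_normD(1)[OF c(2) _ xc]) (use c(1) in \<open>auto simp: less_imp_le\<close>)
        thus ?thesis using ci[of i] gx[OF x] by simp
      qed
      moreover have "p x differentiable (at \<zeta>)" for \<zeta> using sm unfolding torus_smooth_def by (metis partials.simps(1))
      ultimately have "cmod (p x \<xi> - p x \<eta>) \<le> (\<Sum>i\<in>UNIV. c [i]) * real CARD('d) * (\<Sum>i\<in>UNIV. \<bar>vec_nth \<xi> i - vec_nth \<eta> i\<bar>)"
        by (intro lipschitz_of_partials)
      also have "\<dots> \<le> C * (\<Sum>i\<in>UNIV. \<bar>vec_nth \<xi> i - vec_nth \<eta> i\<bar>)"
        using Cn by (intro mult_right_mono sum_nonneg) auto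
      finally show "cmod (p x \<xi> - p x \<eta>) \<le> C * (\<Sum>i\<in>UNIV. \<bar>vec_nth \<xi> i - vec_nth \<eta> i\<bar>)" .
    qed
  qed
  hence "\<forall>U\<in>\<U>. \<exists>C. C \<ge> 0 \<and> (\<forall>x\<in>U. \<forall>y\<in>U. \<forall>\<xi>. cmod (p x \<xi> - p y \<xi>) \<le> C * dist x y powr \<rho>) \<and>
    (\<forall>x\<in>U. \<forall>\<xi> \<eta>. cmod (p x \<xi> - p x \<eta>) \<le> C * (\<Sum>i\<in>UNIV. \<bar>vec_nth \<xi> i - vec_nth \<eta> i\<bar>))" by blast
  from bchoice[OF this] obtain c where c': "\<forall>U\<in>\<U>. c U \<ge> 0 \<and> (\<forall>x\<in>U. \<forall>y\<in>U. \<forall>\<xi>. cmod (p x \<xi> - p y \<xi>) \<le> c U * dist x y powr \<rho>) \<and>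
    (\<forall>x\<in>U. \<forall>\<xi> \<eta>. cmod (p x \<xi> - p x \<eta>) \<le> c U * (\<Sum>i\<in>UNIV. \<bar>vec_nth \<xi> i - vec_nth \<eta> i\<bar>))" ..
  have c: "\<And>U. U \<in> \<U> \<Longrightarrow> c U \<ge> 0"
    "\<And>U x y \<xi>. U \<in> \<U> \<Longrightarrow> x \<in> U \<Longrightarrow> y \<in> U \<Longrightarrow> cmod (p x \<xi> - p y \<xi>) \<le> c U * dist x y powr \<rho>"
    "\<And>U x \<xi> \<eta>. U \<in> \<U> \<Longrightarrow> x \<in> U \<Longrightarrow> cmod (p x \<xi> - p x \<eta>) \<le> c U * (\<Sum>i\<in>UNIV. \<bar>vec_nth \<xi> i - vec_nth \<eta> i\<bar>)"
    using c' by simp_all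
  define C where "C = \<bar>K\<bar> + (\<Sum>U\<in>\<U>. c U)"
  have cC: "c U \<le> C" if "U \<in> \<U>" for U
    unfolding C_def using member_le_sum[of U \<U> c] c(1) fin that by (simp add: add_increasing)
  have C0: "C \<ge> 0" "K \<le> C" using sum_nonneg[of \<U> c] c(1) by (auto simp: C_def)
  show ?thesis
  proof (intro exI[of _ C] conjI ballI allI C0)
    show "cmod (p x \<xi>) \<le> C" if "x \<in> unit_cube" for x \<xi> using K[OF that] C0 by (meson order_trans)
    show "cmod (p x \<xi> - p y \<xi>) \<le> C * dist x y powr \<rho>" if "U \<in> \<U>" "x \<in> U" "y \<in> U" for U x y \<xi>
      using c(2)[OF that, of \<xi>] mult_right_mono[OF cC[OF that(1)], of "dist x y powr \<rho>"] by simp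
    show "cmod (p x \<xi> - p x \<eta>) \<le> C * (\<Sum>i\<in>UNIV. \<bar>vec_nth \<xi> i - vec_nth \<eta> i\<bar>)" if "U \<in> \<U>" "x \<in> U" for U x \<xi> \<eta>
      using c(3)[OF that, of \<xi> \<eta>] mult_right_mono[OF cC[OF that(1)], of "\<Sum>i\<in>UNIV. \<bar>vec_nth \<xi> i - vec_nth \<eta> i\<bar>"]
      by (simp add: sum_nonneg)
  qed
qed

lemma torus_smooth_continuous: "torus_smooth g \<Longrightarrow> continuous_on UNIV g"
proof -
  assume "torus_smooth g"
  hence "g differentiable (at \<xi>)" for \<xi> unfolding torus_smooth_def by (metis partials.simps(1))
  hence "g differentiable_on UNIV" by (simp add: differentiable_on_def)
  thus ?thesis by (rule differentiable_imp_continuous_on)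
qed

lemma torus_smooth_periodic: "torus_smooth g \<Longrightarrow> g (\<xi> + axis i 1) = g \<xi>"
  by (simp add: torus_smooth_def)

section \<open>Geometry of the pieces and a Borel representative of the symbol\<close>

context
  fixes \<rho> :: real and \<U> :: "(real ^ 'd::finite) set set" and p :: "real ^ 'd \<Rightarrow> real ^ 'd \<Rightarrow> complex"
  assumes p: "pw_symbol \<rho> \<U> p"

begin

lemma pieces: "finite \<U>" "disjoint \<U>" "U \<in> \<U> \<Longrightarrow> openin (top_of_set unit_cube) U" "closure (\<Union>\<U>) = unit_cube"
  "x \<in> unit_cube \<Longrightarrow> torus_smooth (p x)"
  using p unfolding pw_symbol_def by auto

lemma piece_subset: "U \<in> \<U> \<Longrightarrow> U \<subseteq> unit_cube"
  using openin_imp_subset[OF pieces(3)] .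

text \<open>The closures of finitely many pieces cover the cube, and a relatively open piece differs
  from its closure only by its relative frontier.\<close>

lemma cube_pieces: "x \<in> unit_cube \<Longrightarrow> x \<notin> singular_set \<U> \<Longrightarrow> \<exists>U\<in>\<U>. x \<in> U"
proof -
  assume x: "x \<in> unit_cube" "x \<notin> singular_set \<U>"
  have "closure (\<Union>\<U>) \<subseteq> (\<Union>U\<in>\<U>. closure U)"
    using closure_subset by (intro closure_minimal closed_UN pieces(1)) auto
  hence "x \<in> (\<Union>U\<in>\<U>. closure U)" using x(1) unfolding pieces(4) by blast
  then obtain U where U: "U \<in> \<U>" "x \<in> closure U" by blast
  have "x \<notin> top_of_set unit_cube frontier_of U" using x U unfolding singular_set_def by blast
  moreover have "top_of_set unit_cube frontier_of U = top_of_set unit_cube closure_of U - U"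
    unfolding frontier_of_def using interior_of_openin[OF pieces(3)[OF U(1)]] by simp
  moreover have "x \<in> top_of_set unit_cube closure_of U"
    unfolding closure_of_subtopology using U x piece_subset[OF U(1)] by (simp add: Int_absorb1)
  ultimately show ?thesis using U by blast
qed

text \<open>A connected set that meets a piece without meeting its frontier is contained in
  it.\<close>

lemma ball_in_piece:
  assumes x: "x \<in> unit_cube" "r > 0" and S: "ball x r \<inter> singular_set \<U> = {}"
  shows "\<exists>U\<in>\<U>. ball x r \<inter> unit_cube \<subseteq> U"
proof -
  have "x \<notin> singular_set \<U>" using S x centre_in_ball by blast
  then obtain U where U: "U \<in> \<U>" "x \<in> U" using cube_pieces x by blast
  have "connected (ball x r \<inter> unit_cube)" by (intro convex_connected convex_Int convex_ball convex_box)
  hence c: "connectedin (top_of_set unit_cube) (ball x r \<inter> unit_cube)" by (simp add: connectedin_subtopology)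
  have "ball x r \<inter> unit_cube \<subseteq> U"
  proof (rule ccontr)
    assume "\<not> ?thesis"
    hence "(ball x r \<inter> unit_cube) - U \<noteq> {}" by auto
    moreover have "(ball x r \<inter> unit_cube) \<inter> U \<noteq> {}" using U x centre_in_ball by blast
    ultimately have "(ball x r \<inter> unit_cube) \<inter> top_of_set unit_cube frontier_of U \<noteq> {}"
      using connectedin_Int_frontier_of[OF c] by blast
    thus False using S U(1) unfolding singular_set_def by blast
  qed
  thus ?thesis using U by blast
qed

lemma singular_set_subset: "singular_set \<U> \<subseteq> unit_cube"
  unfolding singular_set_def using frontier_of_subset_topspace[of "top_of_set unit_cube"] by fastforce

lemma sumset_ball: "{u + v | u v. u \<in> S \<and> v \<in> ball 0 r} = (\<Union>u\<in>S. ball u r)" for S :: "(real ^ 'd) set"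
proof (intro equalityI subsetI)
  fix x assume "x \<in> (\<Union>u\<in>S. ball u r)"
  then obtain u where "u \<in> S" "dist u x < r" by auto
  thus "x \<in> {u + v | u v. u \<in> S \<and> v \<in> ball 0 r}"
    by (intro CollectI exI[of _ u] exI[of _ "x - u"]) (auto simp: dist_norm norm_minus_commute)
next
  fix x assume "x \<in> {u + v | u v. u \<in> S \<and> v \<in> ball 0 r}"
  then obtain u v where "x = u + v" "u \<in> S" "norm v < r" by auto
  thus "x \<in> (\<Union>u\<in>S. ball u r)" by (intro UN_I[of u]) (auto simp: dist_norm)
qed

lemma sumset_ball_lmeasurable: "{u + v | u v. u \<in> S \<and> v \<in> ball 0 r} \<inter> unit_cube \<in> lmeasurable" for S :: "(real ^ 'd) set"
  unfolding sumset_ball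
proof (rule bounded_set_imp_lmeasurable)
  show "bounded ((\<Union>u\<in>S. ball u r) \<inter> unit_cube)" by (intro bounded_Int) auto
  have "open (\<Union>u\<in>S. ball u r)" by (intro open_UN ballI open_ball)
  thus "(\<Union>u\<in>S. ball u r) \<inter> unit_cube \<in> sets lebesgue" by (intro sets.Int) (auto intro: sets_completionI_sets)
qed

text \<open>Let \<open>r\<close> tend to 0 in (A1); the set is compact, hence measurable.\<close>

lemma singular_set_negligible:
  assumes "0 < \<kappa>"
    "(\<lambda>r. measure lebesgue ({u + v | u v. u \<in> singular_set \<U> \<and> v \<in> ball 0 r} \<inter> unit_cube)) \<in> O[at_right 0](\<lambda>r. r powr \<kappa>)"
  shows "negligible (singular_set \<U>)"
proof -
  obtain c where c: "\<forall>\<^sub>F r in at_right 0. norm (measure lebesgue ({u + v | u v. u \<in> singular_set \<U> \<and> v \<in> ball 0 r} \<inter> unit_cube)) \<le> c * norm (r powr \<kappa>)"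
    using assms(2) landau_o.bigE by blast
  have closed: "closed (singular_set \<U>)"
  proof -
    have "closedin (top_of_set unit_cube) (top_of_set unit_cube frontier_of U)" for U :: "(real ^ 'd) set" by (rule closedin_frontier_of)
    hence "closed (top_of_set unit_cube frontier_of U)" for U :: "(real ^ 'd) set" by (rule closedin_closed_trans) (rule closed_cbox)
    thus ?thesis unfolding singular_set_def using pieces(1) by (intro closed_UN) auto
  qed
  have lm: "singular_set \<U> \<in> lmeasurable"
    using closed singular_set_subset bounded_subset[OF bounded_cbox] by (intro lmeasurable_compact) (auto simp: compact_eq_bounded_closed)
  have le: "\<forall>\<^sub>F r in at_right 0. measure lebesgue (singular_set \<U>) \<le> c * r powr \<kappa>"
    using c eventually_at_right_less[of 0]
  proof eventually_elim
    case (elim r)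
    have "singular_set \<U> \<subseteq> {u + v | u v. u \<in> singular_set \<U> \<and> v \<in> ball 0 r} \<inter> unit_cube"
      unfolding sumset_ball using singular_set_subset elim by auto
    hence "measure lebesgue (singular_set \<U>) \<le> measure lebesgue ({u + v | u v. u \<in> singular_set \<U> \<and> v \<in> ball 0 r} \<inter> unit_cube)"
      using lm sumset_ball_lmeasurable by (intro measure_mono_fmeasurable) auto
    thus ?case using elim by simp
  qed
  have lim: "((\<lambda>r. c * r powr \<kappa>) \<longlongrightarrow> c * 0) (at_right 0)"
  proof (intro tendsto_mult tendsto_const)
    have "((\<lambda>r::real. r powr \<kappa>) \<longlongrightarrow> 0 powr \<kappa>) (at_right 0)"
      using assms(1) eventually_at_right_less[of "0::real"]
      by (intro tendsto_powr2 tendsto_const tendsto_ident_at) (auto elim: eventually_mono)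
    thus "((\<lambda>r::real. r powr \<kappa>) \<longlongrightarrow> 0) (at_right 0)" by simp
  qed
  have "measure lebesgue (singular_set \<U>) \<le> c * 0"
    by (rule tendsto_lowerbound[OF lim le]) simp
  hence "measure lebesgue (singular_set \<U>) = 0" by (simp add: measure_le_0_iff)
  thus ?thesis using lm by (simp add: negligible_iff_measure0)
qed

text \<open>A Borel version of the symbol, which is arbitrary over the singular set.\<close>

definition regular_symbol :: "(real ^ 'd) \<times> (real ^ 'd) \<Rightarrow> complex" where
  "regular_symbol = (\<lambda>(x, \<xi>). \<Sum>U\<in>\<U>. indicator (U \<times> UNIV) (x, \<xi>) *\<^sub>R p x \<xi>)"

lemma regular_symbol_eq: "U \<in> \<U> \<Longrightarrow> x \<in> U \<Longrightarrow> regular_symbol (x, \<xi>) = p x \<xi>"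
proof -
  assume U: "U \<in> \<U>" "x \<in> U"
  have "regular_symbol (x, \<xi>) = (\<Sum>V\<in>\<U>. if V = U then p x \<xi> else 0)"
    unfolding regular_symbol_def split using pieces(2) U
    by (intro sum.cong refl) (auto simp: indicator_def disjoint_def)
  thus ?thesis using U pieces(1) by (simp add: sum.delta)
qed

lemma regular_symbol_bound:
  assumes "\<And>x \<xi>. x \<in> unit_cube \<Longrightarrow> cmod (p x \<xi>) \<le> K" "K \<ge> 0"
  shows "cmod (regular_symbol y) \<le> K"
proof -
  obtain x \<xi> where y: "y = (x, \<xi>)" by (cases y)
  show ?thesis
  proof (cases "\<exists>U\<in>\<U>. x \<in> U")
    case True
    thus ?thesis using regular_symbol_eq assms piece_subset unfolding y by (metis subsetD)
  next
    case False
    hence "regular_symbol y = 0" unfolding y regular_symbol_def split by (intro sum.neutral) auto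
    thus ?thesis using assms by simp
  qed
qed

text \<open>On each piece times the torus the symbol is jointly continuous, by the Hoelder bound in
  x and the Lipschitz bound in \<xi>; a relatively open piece of the cube is a Borel set.\<close>

lemma borel_measurable_regular_symbol:
  assumes \<rho>: "\<rho> > 0"
  shows "regular_symbol \<in> borel_measurable borel"
proof -
  obtain C where C0: "C \<ge> 0" and C': "\<forall>U\<in>\<U>. \<forall>x\<in>U. \<forall>y\<in>U. \<forall>\<xi>. cmod (p x \<xi> - p y \<xi>) \<le> C * dist x y powr \<rho>"
    "\<forall>U\<in>\<U>. \<forall>x\<in>U. \<forall>\<xi> \<eta>. cmod (p x \<xi> - p x \<eta>) \<le> C * (\<Sum>i\<in>UNIV. \<bar>vec_nth \<xi> i - vec_nth \<eta> i\<bar>)"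
    using pw_symbol_bounds[OF p] by (elim exE conjE)
  have C: "\<And>U x y \<xi>. U \<in> \<U> \<Longrightarrow> x \<in> U \<Longrightarrow> y \<in> U \<Longrightarrow> cmod (p x \<xi> - p y \<xi>) \<le> C * dist x y powr \<rho>"
    "\<And>U x \<xi> \<eta>. U \<in> \<U> \<Longrightarrow> x \<in> U \<Longrightarrow> cmod (p x \<xi> - p x \<eta>) \<le> C * (\<Sum>i\<in>UNIV. \<bar>vec_nth \<xi> i - vec_nth \<eta> i\<bar>)"
    using C' by simp_all
  have "(\<lambda>y. indicator (U \<times> UNIV) y *\<^sub>R (case y of (x, \<xi>) \<Rightarrow> p x \<xi>)) \<in> borel_measurable borel" if U: "U \<in> \<U>" for U
  proof (rule borel_measurable_continuous_on_indicator)
    obtain T where T: "open T" "U = unit_cube \<inter> T" using pieces(3)[OF U] by (auto simp: openin_open)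
    have "U \<times> UNIV = (unit_cube \<times> UNIV) \<inter> (T \<times> (UNIV :: (real ^ 'd) set))" using T by auto
    also have "\<dots> \<in> sets borel" using T(1) by (intro sets.Int borel_closed borel_open closed_Times open_Times) auto
    finally show "U \<times> UNIV \<in> sets (borel :: ((real ^ 'd) \<times> (real ^ 'd)) measure)" .
    show "continuous_on (U \<times> UNIV) (\<lambda>y. case y of (x, \<xi>) \<Rightarrow> p x \<xi>)"
      unfolding continuous_on_def
    proof
      fix y assume y: "y \<in> U \<times> (UNIV :: (real ^ 'd) set)"
      define E where "E w = C * dist (fst w) (fst y) powr \<rho> + C * (\<Sum>i\<in>UNIV. \<bar>vec_nth (snd w) i - vec_nth (snd y) i\<bar>)" for w :: "(real ^ 'd) \<times> (real ^ 'd)"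
      have "(E \<longlongrightarrow> C * dist (fst y) (fst y) powr \<rho> + C * (\<Sum>i\<in>UNIV. \<bar>vec_nth (snd y) i - vec_nth (snd y) i\<bar>)) (at y within U \<times> UNIV)"
        unfolding E_def using \<rho> by (intro tendsto_intros tendsto_powr2) auto
      hence E0: "(E \<longlongrightarrow> 0) (at y within U \<times> UNIV)" using \<rho> by simp
      have "norm ((case w of (x, \<xi>) \<Rightarrow> p x \<xi>) - (case y of (x, \<xi>) \<Rightarrow> p x \<xi>)) \<le> E w" if "w \<in> U \<times> UNIV" for w
      proof -
        have "cmod (p (fst w) (snd w) - p (fst y) (snd y)) \<le> cmod (p (fst w) (snd w) - p (fst y) (snd w)) + cmod (p (fst y) (snd w) - p (fst y) (snd y))"
          by (rule order_trans[OF _ norm_triangle_ineq]) simp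
        also have "\<dots> \<le> E w" unfolding E_def using U y that by (intro add_mono C) auto
        finally show ?thesis by (simp add: split_beta)
      qed
      hence "\<forall>\<^sub>F w in at y within U \<times> UNIV. norm ((case w of (x, \<xi>) \<Rightarrow> p x \<xi>) - (case y of (x, \<xi>) \<Rightarrow> p x \<xi>)) \<le> E w"
        by (auto simp: eventually_at_filter)
      hence "((\<lambda>w. (case w of (x, \<xi>) \<Rightarrow> p x \<xi>) - (case y of (x, \<xi>) \<Rightarrow> p x \<xi>)) \<longlongrightarrow> 0) (at y within U \<times> UNIV)"
        by (rule Lim_null_comparison) (rule E0)
      thus "((\<lambda>y. case y of (x, \<xi>) \<Rightarrow> p x \<xi>) \<longlongrightarrow> (case y of (x, \<xi>) \<Rightarrow> p x \<xi>)) (at y within U \<times> UNIV)"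
        by (rule Lim_null[THEN iffD2])
    qed
  qed
  hence "(\<lambda>y. \<Sum>U\<in>\<U>. indicator (U \<times> UNIV) y *\<^sub>R (case y of (x, \<xi>) \<Rightarrow> p x \<xi>)) \<in> borel_measurable borel"
    by (intro borel_measurable_sum) auto
  also have "(\<lambda>y. \<Sum>U\<in>\<U>. indicator (U \<times> UNIV) y *\<^sub>R (case y of (x, \<xi>) \<Rightarrow> p x \<xi>)) = regular_symbol"
    unfolding regular_symbol_def by (simp add: fun_eq_iff split_beta)
  finally show ?thesis .
qed

end

section \<open>Riemann sums over the grid\<close>

lemma AE_off_lattice:
  assumes "N \<ge> 1"
  shows "AE x in (cube_measure :: (real ^ 'd::finite) measure). \<forall>i. \<forall>k::int. real N * vec_nth x i \<noteq> of_int k"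
proof -
  have "AE x in (lebesgue :: (real ^ 'd) measure). real N * vec_nth x i \<noteq> of_int k" for i and k :: int
  proof -
    have "{x :: real ^ 'd. vec_nth x i = of_int k / real N} \<in> null_sets lebesgue"
      using negligible_standard_hyperplane[of "axis i (1::real) :: real ^ 'd" "of_int k / real N"]
      by (simp add: inner_axis axis_in_Basis_iff negligible_iff_null_sets)
    from AE_not_in[OF this] show ?thesis
    proof eventually_elim
      case (elim x)
      thus ?case using assms by (auto simp: field_simps)
    qed
  qed
  hence "AE x in (lebesgue :: (real ^ 'd) measure). \<forall>i. \<forall>k::int. real N * vec_nth x i \<noteq> of_int k"
    unfolding AE_all_countable by (intro allI)
  thus ?thesis by (subst AE_restrict_space_iff) (auto elim: eventually_mono)
qed

text \<open>Grid indices run from 1 to \<open>N\<close>, so a cell is labelled by its upper corner,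
  hence the ceiling.\<close>

definition cell_index :: "nat \<Rightarrow> real ^ 'd::finite \<Rightarrow> int ^ 'd" where
  "cell_index N x = (\<chi> i. \<lceil>real N * vec_nth x i\<rceil>)"

definition sample_point :: "nat \<Rightarrow> int ^ 'd::finite \<Rightarrow> real ^ 'd" where
  "sample_point N j = (\<chi> i. of_int (vec_nth j i) / of_nat N)"

lemma sample_point_in_cube: "N \<ge> 1 \<Longrightarrow> j \<in> grid N \<Longrightarrow> sample_point N j \<in> unit_cube"
proof -
  assume N: "N \<ge> 1" and j: "j \<in> grid N"
  have "0 \<le> real_of_int (vec_nth j i) / real N \<and> real_of_int (vec_nth j i) / real N \<le> 1" for i
  proof -
    have "1 \<le> vec_nth j i" "vec_nth j i \<le> int N" using j by (auto simp: grid_def)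
    hence "0 \<le> real_of_int (vec_nth j i)" "real_of_int (vec_nth j i) \<le> real N"
      by linarith+
    thus ?thesis using N by (simp add: divide_le_eq)
  qed
  thus ?thesis by (simp add: sample_point_def mem_box_cart)
qed

lemma dist_le_of_components:
  fixes x y :: "real ^ 'd::finite"
  assumes "\<And>i. \<bar>vec_nth x i - vec_nth y i\<bar> \<le> s"
  shows "dist x y \<le> real CARD('d) * s"
proof -
  have "dist x y \<le> (\<Sum>i\<in>UNIV. \<bar>vec_nth (x - y) i\<bar>)" unfolding dist_norm by (rule norm_le_l1_cart)
  also have "\<dots> \<le> (\<Sum>i\<in>(UNIV::'d set). s)" using assms by (intro sum_mono) auto
  finally show ?thesis by simp
qed

lemma dist_cell_index:
  assumes "N \<ge> 1"
  shows "dist (sample_point N (cell_index N x)) (x :: real ^ 'd::finite) \<le> real CARD('d) * (1 / real N)"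
proof (rule dist_le_of_components)
  fix i
  have "real_of_int \<lceil>real N * vec_nth x i\<rceil> - real N * vec_nth x i \<le> 1" "real_of_int \<lceil>real N * vec_nth x i\<rceil> - real N * vec_nth x i \<ge> 0"
    by linarith+
  moreover have "vec_nth (sample_point N (cell_index N x)) i - vec_nth x i = (real_of_int \<lceil>real N * vec_nth x i\<rceil> - real N * vec_nth x i) / real N"
    using assms by (simp add: sample_point_def cell_index_def field_simps)
  ultimately show "\<bar>vec_nth (sample_point N (cell_index N x)) i - vec_nth x i\<bar> \<le> 1 / real N"
    using assms by (simp add: divide_right_mono)
qed

lemma card_vec_set: "card {n :: 'a ^ 'd::finite. \<forall>i. vec_nth n i \<in> A i} = (\<Prod>i\<in>UNIV. card (A i))"
proof -
  have "bij_betw vec_lambda (PiE UNIV A) {n :: 'a ^ 'd. \<forall>i. vec_nth n i \<in> A i}"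
    by (rule bij_betwI[of _ _ _ vec_nth]) auto
  hence "card {n :: 'a ^ 'd. \<forall>i. vec_nth n i \<in> A i} = card (PiE UNIV A)" by (metis bij_betw_same_card)
  thus ?thesis by (simp add: card_PiE)
qed

lemma finite_vec_set: "(\<And>i. finite (A i)) \<Longrightarrow> finite {n :: 'a ^ 'd::finite. \<forall>i. vec_nth n i \<in> A i}"
proof -
  assume A: "\<And>i. finite (A i)"
  have "{n :: 'a ^ 'd. \<forall>i. vec_nth n i \<in> A i} \<subseteq> vec_lambda ` (PiE UNIV A)"
  proof
    fix n :: "'a ^ 'd" assume "n \<in> {n. \<forall>i. vec_nth n i \<in> A i}"
    hence "vec_nth n \<in> PiE UNIV A" by auto
    thus "n \<in> vec_lambda ` (PiE UNIV A)" by (metis image_eqI vec_nth_inverse)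
  qed
  thus ?thesis using A by (meson finite_PiE finite_class.finite_UNIV finite_imageI finite_subset)
qed

lemma grid_eq: "grid N = {n :: int ^ 'd::finite. \<forall>i. vec_nth n i \<in> {1..int N}}"
  by (auto simp: grid_def)

lemma finite_grid [simp]: "finite (grid N :: (int ^ 'd::finite) set)"
  unfolding grid_eq by (rule finite_vec_set) simp

lemma card_grid: "card (grid N :: (int ^ 'd::finite) set) = N ^ CARD('d)"
  unfolding grid_eq card_vec_set by simp

text \<open>The cells are closed and share faces, so the sum reduces to a single value only off the
  lattice hyperplanes; these form a null set.\<close>

definition grid_step :: "nat \<Rightarrow> (int ^ 'd::finite \<Rightarrow> real) \<Rightarrow> real ^ 'd \<Rightarrow> real" where
  "grid_step N F x = (\<Sum>j\<in>grid N. F j * indicator (cbox (\<chi> i. (of_int (vec_nth j i) - 1) / of_nat N) (sample_point N j)) x)"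

lemma grid_step_integral:
  fixes F :: "int ^ 'd::finite \<Rightarrow> real"
  assumes N: "N \<ge> 1"
  shows "integrable cube_measure (grid_step N F)"
    "(LINT x|cube_measure. grid_step N F x) = (\<Sum>j\<in>grid N. F j) / real (N ^ CARD('d))"
proof -
  define c where "c j = cbox (\<chi> i. (of_int (vec_nth j i) - 1) / of_nat N) (sample_point N j)" for j :: "int ^ 'd"
  interpret prob_space "cube_measure :: (real ^ 'd) measure" by (rule prob_space_cube)
  have sets: "c j \<in> sets cube_measure" "c j \<subseteq> unit_cube" if j: "j \<in> grid N" for j
  proof -
    show "c j \<subseteq> unit_cube"
    proof
      fix x assume x: "x \<in> c j"
      have s: "vec_nth (sample_point N j) i \<le> 1" for i
        using sample_point_in_cube[OF N j] by (simp add: mem_box_cart)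
      have "0 \<le> vec_nth x i \<and> vec_nth x i \<le> 1" for i
      proof -
        have "1 \<le> vec_nth j i" using j by (auto simp: grid_def)
        hence "0 \<le> (real_of_int (vec_nth j i) - 1) / real N" by simp
        moreover have "(real_of_int (vec_nth j i) - 1) / real N \<le> vec_nth x i" "vec_nth x i \<le> vec_nth (sample_point N j) i"
          using x by (auto simp: c_def mem_box_cart)
        ultimately show ?thesis using s[of i] by linarith
      qed
      thus "x \<in> unit_cube" by (simp add: mem_box_cart)
    qed
    thus "c j \<in> sets cube_measure" by (subst sets_restrict_space_iff) (auto simp: c_def)
  qed
  have m: "measure cube_measure (c j) = 1 / real (N ^ CARD('d))" if j: "j \<in> grid N" for j
  proof -
    have "measure cube_measure (c j) = measure lebesgue (c j)"
      using sets[OF j] by (intro measure_restrict_space) auto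
    also have "\<dots> = (\<Prod>i\<in>(UNIV::'d set). vec_nth (sample_point N j) i - (real_of_int (vec_nth j i) - 1) / real N)"
      unfolding c_def
    proof (subst measure_completion)
      have "cbox (\<chi> i. (real_of_int (vec_nth j i) - 1) / real N) (sample_point N j) \<noteq> {}"
        by (auto simp: interval_ne_empty_cart sample_point_def divide_right_mono)
      from content_cbox_cart[OF this]
      show "measure lborel (cbox (\<chi> i. (real_of_int (vec_nth j i) - 1) / real N) (sample_point N j)) =
        (\<Prod>i\<in>(UNIV::'d set). vec_nth (sample_point N j) i - (real_of_int (vec_nth j i) - 1) / real N)" by simp
    qed simp
    also have "\<dots> = (\<Prod>i\<in>(UNIV::'d set). 1 / real N)"
      by (rule prod.cong) (auto simp: sample_point_def diff_divide_distrib)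
    finally show ?thesis by (simp add: power_one_over)
  qed
  have i: "integrable cube_measure (\<lambda>x. F j * indicator (c j) x :: real)" if "j \<in> grid N" for j
    using sets(1)[OF that] by (intro integrable_mult_right integrable_real_indicator) (auto simp: emeasure_eq_measure)
  have gs: "grid_step N F = (\<lambda>x. \<Sum>j\<in>grid N. F j * indicator (c j) x)" by (simp add: grid_step_def c_def fun_eq_iff)
  show "integrable cube_measure (grid_step N F)"
    unfolding gs using i by (intro Bochner_Integration.integrable_sum) auto
  have "(LINT x|cube_measure. grid_step N F x) = (\<Sum>j\<in>grid N. LINT x|cube_measure. F j * indicator (c j) x)"
    unfolding gs using i by (intro Bochner_Integration.integral_sum) auto
  also have "\<dots> = (\<Sum>j\<in>grid N. F j * (1 / real (N ^ CARD('d))))"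
  proof (intro sum.cong refl)
    fix j :: "int ^ 'd" assume j: "j \<in> grid N"
    have "c j \<inter> space cube_measure = c j" using sets(2)[OF j] by auto
    thus "(LINT x|cube_measure. F j * indicator (c j) x) = F j * (1 / real (N ^ CARD('d)))"
      using m[OF j] by simp
  qed
  finally show "(LINT x|cube_measure. grid_step N F x) = (\<Sum>j\<in>grid N. F j) / real (N ^ CARD('d))"
    by (simp add: sum_divide_distrib)
qed

lemma grid_step_cell:
  fixes x :: "real ^ 'd::finite"
  assumes N: "N \<ge> 1" and x: "x \<in> unit_cube" and off: "\<forall>i. \<forall>k::int. real N * vec_nth x i \<noteq> of_int k"
  shows "cell_index N x \<in> grid N" "grid_step N F x = F (cell_index N x)"
proof -
  have b: "0 \<le> vec_nth x i" "vec_nth x i \<le> 1" for i using x by (auto simp: mem_box_cart)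
  have "1 \<le> \<lceil>real N * vec_nth x i\<rceil> \<and> \<lceil>real N * vec_nth x i\<rceil> \<le> int N" for i
  proof -
    have "real N * vec_nth x i \<noteq> 0" using off by (metis of_int_0)
    moreover have "0 \<le> real N * vec_nth x i" using b(1)[of i] by simp
    ultimately have "0 < real N * vec_nth x i" by linarith
    moreover have "real N * vec_nth x i \<le> real N" using b(2)[of i] by (simp add: mult_left_le)
    ultimately show ?thesis by linarith
  qed
  thus g: "cell_index N x \<in> grid N" by (simp add: grid_def cell_index_def)
  have "indicator (cbox (\<chi> i. (of_int (vec_nth j i) - 1) / of_nat N) (sample_point N j)) x = (if j = cell_index N x then 1 else 0 :: real)" for j
  proof -
    have "x \<in> cbox (\<chi> i. (of_int (vec_nth j i) - 1) / of_nat N) (sample_point N j) \<longleftrightarrow>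
      (\<forall>i. real_of_int (vec_nth j i) - 1 \<le> real N * vec_nth x i \<and> real N * vec_nth x i \<le> real_of_int (vec_nth j i))"
      using N by (simp add: mem_box_cart sample_point_def field_simps)
    also have "\<dots> \<longleftrightarrow> (\<forall>i. \<lceil>real N * vec_nth x i\<rceil> = vec_nth j i)"
    proof (intro iff_allI)
      fix i
      have "real N * vec_nth x i \<noteq> real_of_int (vec_nth j i - 1)" using off by blast
      thus "(real_of_int (vec_nth j i) - 1 \<le> real N * vec_nth x i \<and> real N * vec_nth x i \<le> real_of_int (vec_nth j i)) \<longleftrightarrow> \<lceil>real N * vec_nth x i\<rceil> = vec_nth j i"
        by (auto simp: ceiling_eq_iff less_le)
    qed
    also have "\<dots> \<longleftrightarrow> j = cell_index N x" by (auto simp: cell_index_def Finite_Cartesian_Product.vec_eq_iff)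
    finally show ?thesis by (simp only: indicator_def of_bool_def)
  qed
  hence "grid_step N F x = (\<Sum>j\<in>grid N. if j = cell_index N x then F j else 0)"
    unfolding grid_step_def by (intro sum.cong) auto
  thus "grid_step N F x = F (cell_index N x)" using g by (simp add: sum.delta')
qed

lemma cube_times_cube: "(unit_cube :: (real ^ 'd::finite) set) \<times> (unit_cube :: (real ^ 'd) set) = cbox (0, 0) (1, 1)"
  by (simp add: cbox_Pair_eq)

lemma emeasure_cube_times_cube:
  "emeasure lborel ((unit_cube :: (real ^ 'd::finite) set) \<times> (unit_cube :: (real ^ 'd) set)) = 1"
proof -
  have "emeasure lborel (unit_cube :: (real ^ 'd) set) = 1"
    by (subst emeasure_lborel_cbox) (auto simp: Basis_vec_def inner_axis intro!: prod.neutral)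
  thus ?thesis unfolding lborel_prod[symmetric] by (subst lborel.emeasure_pair_measure_Times) auto
qed

lemma prob_space_phase: "prob_space (phase_measure :: ((real ^ 'd::finite) \<times> (real ^ 'd)) measure)"
proof
  have "unit_cube \<times> unit_cube \<in> sets (borel :: ((real ^ 'd) \<times> (real ^ 'd)) measure)" unfolding cube_times_cube by simp
  thus "emeasure phase_measure (space (phase_measure :: ((real ^ 'd) \<times> (real ^ 'd)) measure)) = 1"
    unfolding phase_measure_def using emeasure_cube_times_cube
    by (simp add: emeasure_restrict_space)
qed

text \<open>Lebesgue measure on the product is a completion and not a product measure. For a Borel
  integrand everything is moved to \<open>lborel\<close>, where Fubini applies.\<close>

lemma phase_integral:
  fixes H :: "(real ^ 'd::finite) \<times> (real ^ 'd) \<Rightarrow> real"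
  assumes H: "H \<in> borel_measurable borel" and B: "\<And>y. \<bar>H y\<bar> \<le> B"
  shows "integrable cube_measure (\<lambda>x. LINT \<xi>|cube_measure. H (x, \<xi>))"
    "(LINT y|phase_measure. H y) = (LINT x|cube_measure. LINT \<xi>|cube_measure. H (x, \<xi>))"
proof -
  let ?S = "unit_cube :: (real ^ 'd) set"
  have S: "?S \<times> ?S \<in> sets borel" unfolding cube_times_cube by simp
  define H' where "H' y = indicator (?S \<times> ?S) y *\<^sub>R H y" for y
  have mH': "H' \<in> borel_measurable borel" unfolding H'_def using H S by measurable
  have intH': "integrable lborel H'"
  proof (rule Bochner_Integration.integrable_bound)
    show "integrable lborel (\<lambda>y. B * indicator (?S \<times> ?S) y)"
      using S emeasure_cube_times_cube[where 'd = 'd] by (intro integrable_mult_right integrable_real_indicator) auto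
    show "AE y in lborel. norm (H' y) \<le> norm (B * indicator (?S \<times> ?S) y)"
    proof (rule AE_I2)
      fix y show "norm (H' y) \<le> norm (B * indicator (?S \<times> ?S) y)"
        using B[of y] by (simp add: H'_def indicator_def)
    qed
  qed (use mH' in simp)
  have e1: "(LINT y|phase_measure. H y) = (LINT y|lborel. H' y)"
  proof -
    have "(LINT y|phase_measure. H y) = (LINT y|lebesgue. H' y)"
      unfolding phase_measure_def H'_def using S by (intro integral_restrict_space) auto
    also have "\<dots> = (LINT y|lborel. H' y)" using mH' by (intro integral_completion) simp
    finally show ?thesis .
  qed
  have slice: "(\<lambda>\<xi>. H (x, \<xi>)) \<in> borel_measurable borel" for x
    using H by (rule measurable_compose[rotated]) (simp add: borel_measurable_continuous_onI continuous_on_Pair)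
  define I where "I x = (LINT \<xi>|cube_measure. H (x, \<xi>))" for x
  have I: "I x = (LINT \<xi>|lborel. indicator ?S \<xi> *\<^sub>R H (x, \<xi>))" for x
    unfolding I_def by (rule integral_lebesgue_on_cube[OF slice])
  have HI: "(LINT \<xi>|lborel. H' (x, \<xi>)) = indicator ?S x * I x" for x
    unfolding I H'_def indicator_times by (simp add: mult.assoc)
  have intH2: "integrable (lborel \<Otimes>\<^sub>M lborel) H'" using intH' by (simp add: lborel_prod)
  have mI: "I \<in> borel_measurable borel"
  proof -
    have "(\<lambda>y. indicator ?S (snd y) *\<^sub>R H y) \<in> borel_measurable (borel \<Otimes>\<^sub>M borel)"
    proof (rule borel_measurable_scaleR)
      have "indicat_real ?S \<in> borel_measurable borel" by (rule borel_measurable_indicator) simp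
      thus "(\<lambda>y. indicat_real ?S (snd y)) \<in> borel_measurable ((borel :: (real ^ 'd) measure) \<Otimes>\<^sub>M borel)"
        by (rule measurable_compose[OF measurable_snd])
      show "H \<in> borel_measurable (borel \<Otimes>\<^sub>M borel)" unfolding borel_prod by (rule H)
    qed
    moreover have "(\<lambda>(x, \<xi>). indicator ?S \<xi> *\<^sub>R H (x, \<xi>)) = (\<lambda>y. indicator ?S (snd y) *\<^sub>R H y)"
      by (simp add: fun_eq_iff)
    moreover have "sets ((borel :: (real ^ 'd) measure) \<Otimes>\<^sub>M (lborel :: (real ^ 'd) measure)) = sets (borel \<Otimes>\<^sub>M borel)"
      by (intro sets_pair_measure_cong) auto
    ultimately have "(\<lambda>(x, \<xi>). indicator ?S \<xi> *\<^sub>R H (x, \<xi>)) \<in> borel_measurable ((borel :: (real ^ 'd) measure) \<Otimes>\<^sub>M lborel)"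
      by (metis measurable_cong_sets)
    thus ?thesis unfolding I[abs_def] by (rule lborel.borel_measurable_lebesgue_integral)
  qed
  have "integrable lborel (\<lambda>x. indicator ?S x * I x)"
    using lborel_pair.integrable_fst'[OF intH2] unfolding HI .
  thus "integrable cube_measure (\<lambda>x. LINT \<xi>|cube_measure. H (x, \<xi>))"
    unfolding I_def[symmetric] using mI by (simp add: integrable_restrict_space integrable_completion)
  have "(LINT y|lborel. H' y) = (LINT x|lborel. indicator ?S x * I x)"
    using lborel_pair.integral_fst'[OF intH2] unfolding HI by (simp add: lborel_prod)
  also have "\<dots> = (LINT x|cube_measure. I x)"
    using integral_lebesgue_on_cube[OF mI] by simp
  finally show "(LINT y|phase_measure. H y) = (LINT x|cube_measure. LINT \<xi>|cube_measure. H (x, \<xi>))"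
    using e1 unfolding I_def by simp
qed

lemma cube_integral_diff_le:
  fixes f g :: "real ^ 'd::finite \<Rightarrow> real"
  assumes "continuous_on UNIV f" "continuous_on UNIV g" "\<And>\<xi>. \<bar>f \<xi> - g \<xi>\<bar> \<le> M"
  shows "\<bar>(LINT \<xi>|cube_measure. f \<xi>) - (LINT \<xi>|cube_measure. g \<xi>)\<bar> \<le> M"
proof -
  interpret prob_space "cube_measure :: (real ^ 'd) measure" by (rule prob_space_cube)
  note i = integrable_cube[OF assms(1)] integrable_cube[OF assms(2)]
  have "\<bar>(LINT \<xi>|cube_measure. f \<xi>) - (LINT \<xi>|cube_measure. g \<xi>)\<bar> = \<bar>LINT \<xi>|cube_measure. f \<xi> - g \<xi>\<bar>"
    using i by simp
  also have "\<dots> \<le> (LINT \<xi>|cube_measure. \<bar>f \<xi> - g \<xi>\<bar>)" by (rule integral_abs_bound)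
  also have "\<dots> \<le> (LINT \<xi>|(cube_measure :: (real ^ 'd) measure). M)"
    using i assms(3) by (intro integral_mono) auto
  finally show ?thesis using prob_space by simp
qed

section \<open>The distribution of the symbol and its Riemann sums\<close>

context
  fixes \<rho> :: real and \<U> :: "(real ^ 'd::finite) set set" and p :: "real ^ 'd \<Rightarrow> real ^ 'd \<Rightarrow> complex" and C :: real
  assumes p: "pw_symbol \<rho> \<U> p" and \<rho>: "\<rho> > 0"
    and null: "negligible (singular_set \<U>)" and C: "C \<ge> 0"
    and bound: "\<And>x \<xi>. x \<in> unit_cube \<Longrightarrow> cmod (p x \<xi>) \<le> C"
    and hoelder: "\<And>U x y \<xi>. U \<in> \<U> \<Longrightarrow> x \<in> U \<Longrightarrow> y \<in> U \<Longrightarrow> cmod (p x \<xi> - p y \<xi>) \<le> C * dist x y powr \<rho>"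

begin

lemma AE_cube_regular: "AE x in cube_measure. x \<notin> singular_set \<U>"
proof -
  have "AE x in lebesgue. x \<notin> singular_set \<U>"
    using null by (intro AE_not_in) (simp add: negligible_iff_null_sets)
  thus ?thesis by (subst AE_restrict_space_iff) (auto elim: eventually_mono)
qed

text \<open>A Borel null set containing the singular set has a product measurable cylinder, whose
  measure Fubini computes.\<close>

lemma negligible_singular_cylinder: "negligible (singular_set \<U> \<times> (UNIV :: (real ^ 'd) set))"
proof -
  have "singular_set \<U> \<in> null_sets lebesgue" using null by (simp add: negligible_iff_null_sets)
  then obtain T where T: "T \<in> null_sets lborel" "singular_set \<U> \<subseteq> T"
    unfolding null_sets_completion_iff2 by (elim bexE)
  have "T \<times> (UNIV :: (real ^ 'd) set) \<in> null_sets (lborel \<Otimes>\<^sub>M lborel)"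
    using T(1) by (auto simp: null_sets_def lborel.emeasure_pair_measure_Times)
  hence "T \<times> (UNIV :: (real ^ 'd) set) \<in> null_sets lebesgue"
    unfolding lborel_prod by (rule null_sets_completionI)
  hence "negligible (T \<times> (UNIV :: (real ^ 'd) set))" by (simp add: negligible_iff_null_sets)
  thus ?thesis by (rule negligible_subset) (use T(2) in auto)
qed

lemma regular_symbol_off_singular:
  "x \<in> unit_cube \<Longrightarrow> x \<notin> singular_set \<U> \<Longrightarrow> regular_symbol \<U> p (x, \<xi>) = p x \<xi>"
  using cube_pieces[OF p] regular_symbol_eq[OF p] by metis

lemma AE_phase_regular: "AE y in phase_measure. (case y of (x, \<xi>) \<Rightarrow> p x \<xi>) = regular_symbol \<U> p y"
proof -
  have "AE y in lebesgue. y \<notin> singular_set \<U> \<times> (UNIV :: (real ^ 'd) set)"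
    using negligible_singular_cylinder by (intro AE_not_in) (simp add: negligible_iff_null_sets)
  hence "AE y in lebesgue. y \<in> unit_cube \<times> unit_cube \<longrightarrow> (case y of (x, \<xi>) \<Rightarrow> p x \<xi>) = regular_symbol \<U> p y"
  proof eventually_elim
    case (elim y)
    obtain x \<xi> where "y = (x, \<xi>)" by (cases y)
    thus ?case using elim regular_symbol_off_singular[of x \<xi>] by auto
  qed
  thus ?thesis unfolding phase_measure_def
    by (subst AE_restrict_space_iff) (auto simp: cube_times_cube)
qed

text \<open>A preimage is a Borel set of the regular representative, up to a subset of a negligible
  cylinder; completeness of the measure accepts this subset.\<close>

lemma symbol_measurable: "(\<lambda>(x, \<xi>). p x \<xi>) \<in> borel_measurable phase_measure"
proof (rule measurableI)
  fix A :: "complex set" assume A: "A \<in> sets borel"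
  let ?S = "(unit_cube :: (real ^ 'd) set) \<times> (unit_cube :: (real ^ 'd) set)"
  let ?Z = "singular_set \<U> \<times> (UNIV :: (real ^ 'd) set)"
  have S: "?S \<in> sets lebesgue" unfolding cube_times_cube by simp
  have 1: "regular_symbol \<U> p -` A \<in> sets lebesgue"
  proof -
    have "regular_symbol \<U> p -` A \<inter> space borel \<in> sets borel"
      by (rule measurable_sets[OF borel_measurable_regular_symbol[OF p \<rho>] A])
    thus ?thesis by (auto intro: sets_completionI_sets)
  qed
  have 2: "?Z \<in> sets lebesgue" "(\<lambda>(x, \<xi>). p x \<xi>) -` A \<inter> ?S \<inter> ?Z \<in> sets lebesgue"
    by (rule negligible_imp_sets[OF negligible_singular_cylinder])
       (rule negligible_imp_sets[OF negligible_subset[OF negligible_singular_cylinder]], rule Int_lower2)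
  have "(\<lambda>(x, \<xi>). p x \<xi>) -` A \<inter> ?S = (regular_symbol \<U> p -` A \<inter> ?S - ?Z) \<union> ((\<lambda>(x, \<xi>). p x \<xi>) -` A \<inter> ?S \<inter> ?Z)"
  proof (rule Set.set_eqI)
    fix y :: "(real ^ 'd) \<times> (real ^ 'd)"
    obtain x \<xi> where y: "y = (x, \<xi>)" by (cases y)
    show "y \<in> (\<lambda>(x, \<xi>). p x \<xi>) -` A \<inter> ?S \<longleftrightarrow> y \<in> (regular_symbol \<U> p -` A \<inter> ?S - ?Z) \<union> ((\<lambda>(x, \<xi>). p x \<xi>) -` A \<inter> ?S \<inter> ?Z)"
    proof (cases "x \<in> unit_cube \<and> x \<notin> singular_set \<U>")
      case True
      hence "regular_symbol \<U> p (x, \<xi>) = p x \<xi>" by (intro regular_symbol_off_singular) simp_all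
      thus ?thesis using True unfolding y by simp
    next
      case False
      thus ?thesis unfolding y by auto
    qed
  qed
  also have "\<dots> \<in> sets lebesgue" by (rule sets.Un[OF sets.Diff[OF sets.Int[OF 1 S] 2(1)] 2(2)])
  finally have X: "(\<lambda>(x, \<xi>). p x \<xi>) -` A \<inter> ?S \<in> sets lebesgue" .
  have sp: "space phase_measure = ?S" by (auto simp: phase_measure_def space_restrict_space)
  show "(\<lambda>(x, \<xi>). p x \<xi>) -` A \<inter> space phase_measure \<in> sets phase_measure"
    unfolding sp unfolding phase_measure_def using S X by (simp add: sets_restrict_space_iff)
qed auto

definition symbol_law :: "complex measure" where
  "symbol_law = distr phase_measure borel (\<lambda>(x, \<xi>). p x \<xi>)"

lemma symbol_law_prob: "prob_space symbol_law" "sets symbol_law = sets borel"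
  unfolding symbol_law_def using prob_space.prob_space_distr[OF prob_space_phase symbol_measurable] by auto

lemma symbol_law_bound: "AE u in symbol_law. cmod u \<le> C"
  unfolding symbol_law_def
proof (subst AE_distr_iff[OF symbol_measurable])
  show "{x \<in> space borel. cmod x \<le> C} \<in> sets borel" by measurable
  show "AE x in phase_measure. cmod (case x of (x, \<xi>) \<Rightarrow> p x \<xi>) \<le> C"
    by (rule AE_I2) (auto simp: phase_measure_def space_restrict_space bound)
qed

lemma symbol_law_measure:
  "measure symbol_law {u. (cmod (u - z))\<^sup>2 \<le> t} = measure phase_measure {(x, \<xi>) \<in> unit_cube \<times> unit_cube. (cmod (p x \<xi> - z))\<^sup>2 \<le> t}"
proof -
  have "{u. (cmod (u - z))\<^sup>2 \<le> t} \<in> sets borel" by measurable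
  from measure_distr[OF symbol_measurable this]
  have "measure symbol_law {u. (cmod (u - z))\<^sup>2 \<le> t} = measure phase_measure ((\<lambda>(x, \<xi>). p x \<xi>) -` {u. (cmod (u - z))\<^sup>2 \<le> t} \<inter> space phase_measure)"
    unfolding symbol_law_def .
  also have "(\<lambda>(x, \<xi>). p x \<xi>) -` {u. (cmod (u - z))\<^sup>2 \<le> t} \<inter> space phase_measure = {(x, \<xi>) \<in> unit_cube \<times> unit_cube. (cmod (p x \<xi> - z))\<^sup>2 \<le> t}"
    unfolding phase_measure_def by (simp add: space_restrict_space set_eq_iff conj_ac)
  finally show ?thesis .
qed

definition bad_points :: "nat \<Rightarrow> real \<Rightarrow> (int ^ 'd) set" where
  "bad_points N r = {j \<in> grid N. ball (sample_point N j) r \<inter> singular_set \<U> \<noteq> {}}"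

text \<open>Points are counted by the volume of their cells: a cell has diameter less than
  \<open>r\<close>, so the cell of a bad point lies within \<open>2 * r\<close> of the singular
  set.\<close>

lemma card_bad_points:
  assumes N: "N \<ge> 1" and r: "real CARD('d) / real N < r"
  shows "real (card (bad_points N r)) \<le>
    real (N ^ CARD('d)) * measure lebesgue ({u + v | u v. u \<in> singular_set \<U> \<and> v \<in> ball 0 (2 * r)} \<inter> unit_cube)"
proof -
  let ?T = "{u + v | u v. u \<in> singular_set \<U> \<and> v \<in> ball 0 (2 * r)} \<inter> unit_cube"
  have T: "?T \<in> lmeasurable" by (rule sumset_ball_lmeasurable[OF p])
  hence Ts: "?T \<in> sets cube_measure" by (subst sets_restrict_space_iff) auto
  interpret prob_space "cube_measure :: (real ^ 'd) measure" by (rule prob_space_cube)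
  have "real (card (bad_points N r)) / real (N ^ CARD('d)) = (LINT x|cube_measure. grid_step N (\<lambda>j. of_bool (j \<in> bad_points N r)) x)"
  proof -
    have "grid N \<inter> bad_points N r = bad_points N r" by (auto simp: bad_points_def)
    thus ?thesis unfolding grid_step_integral(2)[OF N] by (simp add: sum.inter_restrict[symmetric] of_bool_def)
  qed
  also have "\<dots> \<le> (LINT x|cube_measure. indicator ?T x)"
  proof (rule integral_mono_AE)
    show "integrable cube_measure (indicat_real ?T)" using Ts by (intro integrable_real_indicator) (auto simp: emeasure_eq_measure)
    show "AE x in cube_measure. grid_step N (\<lambda>j. of_bool (j \<in> bad_points N r)) x \<le> indicat_real ?T x"
      using AE_off_lattice[OF N] AE_space
    proof eventually_elim
      case (elim x)
      have x: "x \<in> unit_cube" using elim by simp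
      have "x \<in> ?T" if bad: "cell_index N x \<in> bad_points N r"
      proof -
        obtain u where u: "u \<in> singular_set \<U>" "dist (sample_point N (cell_index N x)) u < r"
          using bad by (auto simp: bad_points_def)
        have "dist (sample_point N (cell_index N x)) x < r" using dist_cell_index[OF N, of x] r by simp
        hence "dist u x < 2 * r" using u(2) dist_triangle3[of u x "sample_point N (cell_index N x)"] by linarith
        hence "x \<in> (\<Union>u\<in>singular_set \<U>. ball u (2 * r))" using u(1) by auto
        thus ?thesis using x by (simp only: sumset_ball[OF p] Int_iff)
      qed
      thus ?case using grid_step_cell(2)[OF N x elim(1), of "\<lambda>j. of_bool (j \<in> bad_points N r)"] by (auto simp: indicator_def)
    qed
  qed (rule grid_step_integral(1)[OF N])
  also have "\<dots> = measure lebesgue ?T"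
  proof -
    have "?T \<inter> space cube_measure = ?T" by auto
    hence "(LINT x|cube_measure. indicat_real ?T x) = measure cube_measure ?T" by simp
    also have "\<dots> = measure lebesgue ?T" by (intro measure_restrict_space) auto
    finally show ?thesis .
  qed
  finally show ?thesis using N by (simp add: divide_le_eq mult.commute)
qed

lemma good_point_piece:
  assumes N: "N \<ge> 1" and j: "j \<in> grid N" "j \<notin> bad_points N r" and r: "r > 0"
  shows "\<exists>U\<in>\<U>. ball (sample_point N j) r \<inter> unit_cube \<subseteq> U"
  using j r by (intro ball_in_piece[OF p] sample_point_in_cube N) (auto simp: bad_points_def)

text \<open>The map \<open>a\<close> allows sampling at another grid point nearby, later the corner
  of a block. A point of a cell and the sample assigned to it are both within \<open>r\<close> of
  the cell's own grid point; unless that point is bad, a single piece contains them and the Hoelder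
  bound applies at distance \<open>2 * r\<close>.\<close>

lemma symbol_riemann_sum:
  fixes \<Phi> :: "complex \<Rightarrow> real" and a :: "int ^ 'd \<Rightarrow> int ^ 'd"
  assumes N: "N \<ge> 1" and r: "real CARD('d) / real N < r"
    and a: "\<And>j. j \<in> grid N \<Longrightarrow> a j \<in> grid N" "\<And>j. j \<in> grid N \<Longrightarrow> dist (sample_point N j) (sample_point N (a j)) < r"
    and \<Phi>: "\<And>w w'. \<bar>\<Phi> w - \<Phi> w'\<bar> \<le> L * cmod (w - w')" and L: "L \<ge> 0"
  shows "\<bar>(\<Sum>j\<in>grid N. LINT \<xi>|cube_measure. \<Phi> (p (sample_point N (a j)) \<xi>)) / real (N ^ CARD('d)) - (LINT u|symbol_law. \<Phi> u)\<bar>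
    \<le> L * (C * (2 * r) powr \<rho> + 2 * C * (real (card (bad_points N r)) / real (N ^ CARD('d))))"
proof -
  interpret prob_space "cube_measure :: (real ^ 'd) measure" by (rule prob_space_cube)
  let ?q = "regular_symbol \<U> p"
  have r0: "r > 0" using r by (rule le_less_trans[rotated]) simp
  have c\<Phi>: "continuous_on UNIV \<Phi>"
  proof (rule lipschitz_on_continuous_on)
    show "L-lipschitz_on UNIV \<Phi>" using \<Phi> L by (intro lipschitz_onI) (auto simp: dist_norm)
  qed
  hence m\<Phi>: "\<Phi> \<in> borel_measurable borel" by (rule borel_measurable_continuous_onI)
  have mq: "?q \<in> borel_measurable borel" by (rule borel_measurable_regular_symbol[OF p \<rho>])
  have bq: "\<bar>\<Phi> (?q y)\<bar> \<le> \<bar>\<Phi> 0\<bar> + L * C" for y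
  proof -
    have "L * cmod (?q y) \<le> L * C" using regular_symbol_bound[OF p bound C] L by (intro mult_left_mono) auto
    thus ?thesis using \<Phi>[of "?q y" 0] by simp
  qed
  have mH: "(\<lambda>y. \<Phi> (?q y)) \<in> borel_measurable borel" by (rule measurable_compose[OF mq m\<Phi>])
  define I where "I x = (LINT \<xi>|cube_measure. \<Phi> (?q (x, \<xi>)))" for x
  define F where "F j = (LINT \<xi>|cube_measure. \<Phi> (p (sample_point N (a j)) \<xi>))" for j
  have iI: "integrable cube_measure I" unfolding I_def by (rule phase_integral(1)[OF mH bq])
  have law: "(LINT u|symbol_law. \<Phi> u) = (LINT x|cube_measure. I x)"
  proof -
    have "(LINT u|symbol_law. \<Phi> u) = (LINT y|phase_measure. \<Phi> (case y of (x, \<xi>) \<Rightarrow> p x \<xi>))"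
      unfolding symbol_law_def by (rule integral_distr[OF symbol_measurable m\<Phi>])
    also have "\<dots> = (LINT y|phase_measure. \<Phi> (?q y))"
    proof (rule integral_cong_AE)
      show "(\<lambda>y. \<Phi> (case y of (x, \<xi>) \<Rightarrow> p x \<xi>)) \<in> borel_measurable phase_measure"
        by (rule measurable_compose[OF symbol_measurable m\<Phi>])
      show "(\<lambda>y. \<Phi> (?q y)) \<in> borel_measurable phase_measure"
        unfolding phase_measure_def using mH by (intro measurable_restrict_space1 measurable_completion) simp
      show "AE y in phase_measure. \<Phi> (case y of (x, \<xi>) \<Rightarrow> p x \<xi>) = \<Phi> (?q y)"
        using AE_phase_regular by eventually_elim simp
    qed
    also have "\<dots> = (LINT x|cube_measure. I x)" unfolding I_def by (rule phase_integral(2)[OF mH bq])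
    finally show ?thesis .
  qed
  have cp: "continuous_on UNIV (\<lambda>\<xi>. \<Phi> (p x \<xi>))" if "x \<in> unit_cube" for x
    using continuous_on_compose2[OF c\<Phi> torus_smooth_continuous[OF pieces(5)[OF p that]]] by simp
  define J where "J = (\<lambda>j. of_bool (j \<in> bad_points N r) :: real)"
  have pt: "AE x in cube_measure. \<bar>grid_step N F x - I x\<bar> \<le> L * (C * (2 * r) powr \<rho> + 2 * C * grid_step N J x)"
    using AE_off_lattice[OF N] AE_cube_regular AE_space
  proof eventually_elim
    case (elim x)
    have x: "x \<in> unit_cube" using elim by simp
    note cell = grid_step_cell[OF N x elim(1)]
    define y where "y = sample_point N (a (cell_index N x))"
    have y: "y \<in> unit_cube" unfolding y_def using cell(1) a(1) N by (intro sample_point_in_cube)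
    have qx: "?q (x, \<xi>) = p x \<xi>" for \<xi> using regular_symbol_off_singular[OF x elim(2)] .
    have d: "cmod (p y \<xi> - p x \<xi>) \<le> C * (2 * r) powr \<rho> + 2 * C * J (cell_index N x)" for \<xi>
    proof (cases "cell_index N x \<in> bad_points N r")
      case True
      have "cmod (p y \<xi> - p x \<xi>) \<le> 2 * C"
        using norm_triangle_ineq4[of "p y \<xi>" "p x \<xi>"] bound[OF x, of \<xi>] bound[OF y, of \<xi>] by linarith
      thus ?thesis using True C by (simp add: J_def add_increasing)
    next
      case False
      obtain U where U: "U \<in> \<U>" "ball (sample_point N (cell_index N x)) r \<inter> unit_cube \<subseteq> U"
        using good_point_piece[OF N cell(1) False r0] by blast
      have dx: "dist (sample_point N (cell_index N x)) x < r" using dist_cell_index[OF N, of x] r by simp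
      have dy: "dist (sample_point N (cell_index N x)) y < r" unfolding y_def by (rule a(2)[OF cell(1)])
      have xU: "x \<in> U" and yU: "y \<in> U" using x y dx dy by (auto intro!: subsetD[OF U(2)])
      have "cmod (p y \<xi> - p x \<xi>) \<le> C * dist y x powr \<rho>" by (rule hoelder[OF U(1) yU xU])
      also have "\<dots> \<le> C * (2 * r) powr \<rho>"
        using dx dy dist_triangle3[of y x "sample_point N (cell_index N x)"] C \<rho>
        by (intro mult_left_mono powr_mono2) auto
      finally show ?thesis using False by (simp add: J_def)
    qed
    have "\<bar>F (cell_index N x) - I x\<bar> \<le> L * (C * (2 * r) powr \<rho> + 2 * C * J (cell_index N x))"
      unfolding F_def I_def qx y_def[symmetric]
    proof (rule cube_integral_diff_le[OF cp[OF y] cp[OF x]])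
      fix \<xi>
      have "\<bar>\<Phi> (p y \<xi>) - \<Phi> (p x \<xi>)\<bar> \<le> L * cmod (p y \<xi> - p x \<xi>)" by (rule \<Phi>)
      also have "\<dots> \<le> L * (C * (2 * r) powr \<rho> + 2 * C * J (cell_index N x))" by (rule mult_left_mono[OF d L])
      finally show "\<bar>\<Phi> (p y \<xi>) - \<Phi> (p x \<xi>)\<bar> \<le> L * (C * (2 * r) powr \<rho> + 2 * C * J (cell_index N x))" .
    qed
    thus ?case by (simp add: cell(2))
  qed
  note iF = grid_step_integral(1)[OF N, of F] and iJ = grid_step_integral(1)[OF N, of J]
  have "\<bar>(LINT x|cube_measure. grid_step N F x) - (LINT x|cube_measure. I x)\<bar> = \<bar>LINT x|cube_measure. grid_step N F x - I x\<bar>"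
    using iF iI by simp
  also have "\<dots> \<le> (LINT x|cube_measure. \<bar>grid_step N F x - I x\<bar>)" by (rule integral_abs_bound)
  also have "\<dots> \<le> (LINT x|cube_measure. L * (C * (2 * r) powr \<rho> + 2 * C * grid_step N J x))"
    by (rule integral_mono_AE[OF _ _ pt]) (use iF iI iJ in auto)
  also have "\<dots> = L * (C * (2 * r) powr \<rho> + 2 * C * (LINT x|cube_measure. grid_step N J x))"
    using iJ prob_space by simp
  also have "(LINT x|cube_measure. grid_step N J x) = real (card (bad_points N r)) / real (N ^ CARD('d))"
  proof -
    have "grid N \<inter> bad_points N r = bad_points N r" by (auto simp: bad_points_def)
    thus ?thesis unfolding grid_step_integral(2)[OF N] J_def by (simp add: sum.inter_restrict[symmetric] of_bool_def)
  qed
  finally show ?thesis unfolding law grid_step_integral(2)[OF N] F_def .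
qed

end

section \<open>Blocks of the grid\<close>

lemma card_grid_slice:
  assumes "T \<subseteq> {1..int N}"
  shows "card {j \<in> (grid N :: (int ^ 'd::finite) set). vec_nth j i \<in> T} = card T * N ^ (CARD('d) - 1)"
proof -
  have "{j \<in> (grid N :: (int ^ 'd) set). vec_nth j i \<in> T} = {j. \<forall>k. vec_nth j k \<in> (if k = i then T else {1..int N})}"
  proof (intro Set.set_eqI iffI)
    fix j :: "int ^ 'd" assume "j \<in> {j. \<forall>k. vec_nth j k \<in> (if k = i then T else {1..int N})}"
    hence j: "vec_nth j k \<in> (if k = i then T else {1..int N})" for k by blast
    have "1 \<le> vec_nth j k \<and> vec_nth j k \<le> int N" for k
      using j[of k] assms by (cases "k = i") auto
    thus "j \<in> {j \<in> grid N. vec_nth j i \<in> T}" using j[of i] by (simp add: grid_def)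
  qed (simp add: grid_def)
  hence "card {j \<in> (grid N :: (int ^ 'd) set). vec_nth j i \<in> T} = (\<Prod>k\<in>(UNIV::'d set). card (if k = i then T else {1..int N}))"
    by (simp only: card_vec_set)
  also have "\<dots> = card T * (\<Prod>k\<in>(UNIV::'d set) - {i}. card (if k = i then T else {1..int N}))"
    by (subst prod.remove[of UNIV i]) auto
  also have "(\<Prod>k\<in>(UNIV::'d set) - {i}. card (if k = i then T else {1..int N})) = (\<Prod>k\<in>(UNIV::'d set) - {i}. N)"
    by (rule prod.cong) auto
  also have "\<dots> = N ^ (CARD('d) - 1)" by simp
  finally show ?thesis .
qed

text \<open>Indices start at 1, so the first coordinates of blocks are the numbers congruent to 1
  modulo \<open>m\<close>.\<close>

lemma card_block_starts:
  assumes "m \<ge> 1"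
  shows "card {t \<in> {1..int N}. int m dvd t - 1} \<le> N div m + 1"
proof -
  have "{t \<in> {1..int N}. int m dvd t - 1} \<subseteq> (\<lambda>q. int q * int m + 1) ` {..N div m}"
  proof
    fix t assume "t \<in> {t \<in> {1..int N}. int m dvd t - 1}"
    hence t: "1 \<le> t" "t \<le> int N" "int m dvd t - 1" by auto
    define q where "q = nat ((t - 1) div int m)"
    have "(t - 1) div int m \<ge> 0" using t assms by (simp add: pos_imp_zdiv_nonneg_iff)
    hence q: "int q = (t - 1) div int m" by (simp add: q_def)
    moreover have "(t - 1) div int m \<le> int N div int m" using t assms by (intro zdiv_mono1) auto
    ultimately have "q \<le> N div m" by (simp add: zdiv_int[symmetric])
    moreover have "t = int q * int m + 1" using t(3) q by simp
    ultimately show "t \<in> (\<lambda>q. int q * int m + 1) ` {..N div m}" by blast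
  qed
  from card_mono[OF _ this] card_image_le[of "{..N div m}" "\<lambda>q. int q * int m + 1"] show ?thesis
    by simp
qed

text \<open>The last block may be cut off by the edge of the grid, so \<open>N\<close> counts as an
  end even if \<open>m\<close> does not divide it.\<close>

lemma card_block_ends:
  assumes "m \<ge> 1"
  shows "card {t \<in> {1..int N}. t = int N \<or> int m dvd t} \<le> N div m + 1"
proof -
  have "{t \<in> {1..int N}. t = int N \<or> int m dvd t} \<subseteq> insert (int N) ((\<lambda>q. int q * int m) ` {1..N div m})"
  proof
    fix t assume t: "t \<in> {t \<in> {1..int N}. t = int N \<or> int m dvd t}"
    show "t \<in> insert (int N) ((\<lambda>q. int q * int m) ` {1..N div m})"
    proof (cases "t = int N")
      case False
      hence t: "1 \<le> t" "t \<le> int N" "int m dvd t" using t by auto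
      define q where "q = nat (t div int m)"
      have "t div int m \<ge> 0" using t assms by (simp add: pos_imp_zdiv_nonneg_iff)
      hence q: "int q = t div int m" by (simp add: q_def)
      moreover have "t div int m \<le> int N div int m" using t assms by (intro zdiv_mono1) auto
      ultimately have "q \<le> N div m" by (simp add: zdiv_int[symmetric])
      moreover have tq: "t = int q * int m" using t(3) q by simp
      moreover have "q \<ge> 1" using tq t(1) by (cases q) auto
      ultimately show ?thesis by auto
    qed simp
  qed
  hence "card {t \<in> {1..int N}. t = int N \<or> int m dvd t} \<le> card (insert (int N) ((\<lambda>q. int q * int m) ` {1..N div m}))"
    by (intro card_mono) auto
  also have "\<dots> \<le> Suc (card ((\<lambda>q. int q * int m) ` {1..N div m}))" by (rule card_insert_le_m1) auto
  also have "\<dots> \<le> N div m + 1" using card_image_le[of "{1..N div m}" "\<lambda>q. int q * int m"] by simp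
  finally show ?thesis .
qed

definition block_index :: "nat \<Rightarrow> int ^ 'd::finite \<Rightarrow> int ^ 'd" where
  "block_index m j = (\<chi> i. (vec_nth j i - 1) div int m)"

text \<open>The lower corner is a safe common sample point: it belongs to the grid even for a block
  that is cut off at the upper edge.\<close>

definition block_corner :: "nat \<Rightarrow> int ^ 'd::finite \<Rightarrow> int ^ 'd" where
  "block_corner m j = (\<chi> i. (vec_nth j i - 1) div int m * int m + 1)"

lemma block_corner_cong: "block_index m j = block_index m l \<Longrightarrow> block_corner m j = block_corner m l"
  by (simp add: block_index_def block_corner_def Finite_Cartesian_Product.vec_eq_iff)

lemma block_corner_bounds:
  assumes "m \<ge> 1"
  shows "vec_nth (block_corner m j) i \<le> vec_nth j i" "vec_nth j i < vec_nth (block_corner m j) i + int m"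
proof -
  have "(vec_nth j i - 1) div int m * int m + (vec_nth j i - 1) mod int m = vec_nth j i - 1" by simp
  moreover have "0 \<le> (vec_nth j i - 1) mod int m" "(vec_nth j i - 1) mod int m < int m" using assms by simp_all
  ultimately show "vec_nth (block_corner m j) i \<le> vec_nth j i" "vec_nth j i < vec_nth (block_corner m j) i + int m"
    unfolding block_corner_def vec_lambda_beta by linarith+
qed

lemma block_corner_grid:
  assumes "m \<ge> 1" "j \<in> grid N"
  shows "block_corner m j \<in> grid N"
proof -
  have "1 \<le> vec_nth (block_corner m j) i" for i
  proof -
    have "1 \<le> vec_nth j i" using assms(2) by (simp add: grid_def)
    hence "0 \<le> (vec_nth j i - 1) div int m" using assms(1) by (simp add: pos_imp_zdiv_nonneg_iff)
    thus ?thesis by (simp add: block_corner_def)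
  qed
  moreover have "vec_nth (block_corner m j) i \<le> int N" for i
    using block_corner_bounds(1)[OF assms(1), of j i] assms(2) by (auto simp: grid_def intro: order_trans)
  ultimately show ?thesis by (simp add: grid_def)
qed

lemma dist_block_corner:
  assumes "m \<ge> 1" "N \<ge> 1"
  shows "dist (sample_point N j) (sample_point N (block_corner m j) :: real ^ 'd::finite) \<le> real CARD('d) * (real m / real N)"
proof (rule dist_le_of_components)
  fix i
  have "\<bar>real_of_int (vec_nth j i) - real_of_int (vec_nth (block_corner m j) i)\<bar> \<le> real m"
    using block_corner_bounds[OF assms(1), of j i] by linarith
  hence "\<bar>real_of_int (vec_nth j i) - real_of_int (vec_nth (block_corner m j) i)\<bar> / real N \<le> real m / real N"
    by (rule divide_right_mono) simp
  thus "\<bar>vec_nth (sample_point N j) i - vec_nth (sample_point N (block_corner m j)) i\<bar> \<le> real m / real N"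
    using assms by (simp add: sample_point_def diff_divide_distrib[symmetric] abs_divide)
qed

lemma pred_div_eq:
  fixes x m :: int
  assumes "m > 0" "\<not> m dvd x"
  shows "(x - 1) div m = x div m"
proof -
  have r: "x mod m \<noteq> 0" "0 \<le> x mod m" "x mod m < m" using assms by (auto simp: dvd_eq_mod_eq_0)
  have "x - 1 = (x mod m - 1) + m * (x div m)" by simp
  hence "(x - 1) div m = (x mod m - 1) div m + x div m" using assms(1) by (metis add.commute div_mult_self2 less_irrefl)
  moreover have "(x mod m - 1) div m = 0" using r by (intro div_pos_pos_trivial) linarith+
  ultimately show ?thesis by simp
qed

lemma block_lower_boundary:
  fixes j :: "int ^ 'd::finite"
  assumes m: "m \<ge> 1" and j: "j \<in> grid N" and out: "j - axis i 1 \<notin> grid N \<or> block_index m (j - axis i 1) \<noteq> block_index m j"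
  shows "int m dvd vec_nth j i - 1"
proof (rule ccontr)
  assume n: "\<not> int m dvd vec_nth j i - 1"
  have "vec_nth j i \<noteq> 1" using n by auto
  moreover have jb: "1 \<le> vec_nth j k" "vec_nth j k \<le> int N" for k using j by (auto simp: grid_def)
  ultimately have j1: "vec_nth j i \<ge> 2" using jb(1)[of i] by linarith
  have c: "vec_nth (j - axis i 1) k = (if k = i then vec_nth j i - 1 else vec_nth j k)" for k
    by (simp add: axis_def)
  have "j - axis i 1 \<in> grid N"
    unfolding grid_def mem_Collect_eq c using jb j1 by (auto intro: order_trans[of _ "vec_nth j i"])
  moreover have "block_index m (j - axis i 1) = block_index m j"
    unfolding block_index_def c Finite_Cartesian_Product.vec_eq_iff
    using pred_div_eq[OF _ n] m by simp
  ultimately show False using out by blast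
qed

lemma block_upper_boundary:
  fixes j :: "int ^ 'd::finite"
  assumes m: "m \<ge> 1" and j: "j \<in> grid N" and out: "j + axis i 1 \<notin> grid N \<or> block_index m (j + axis i 1) \<noteq> block_index m j"
  shows "vec_nth j i = int N \<or> int m dvd vec_nth j i"
proof (rule ccontr)
  assume "\<not> ?thesis"
  hence n: "vec_nth j i \<noteq> int N" "\<not> int m dvd vec_nth j i" by auto
  have jb: "1 \<le> vec_nth j k" "vec_nth j k \<le> int N" for k using j by (auto simp: grid_def)
  have j1: "vec_nth j i + 1 \<le> int N" using jb(2)[of i] n(1) by linarith
  have c: "vec_nth (j + axis i 1) k = (if k = i then vec_nth j i + 1 else vec_nth j k)" for k
    by (simp add: axis_def)
  have "1 \<le> vec_nth j i + 1" using jb(1)[of i] by linarith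
  hence "j + axis i 1 \<in> grid N"
    unfolding grid_def mem_Collect_eq c using jb j1 by auto
  moreover have "block_index m (j + axis i 1) = block_index m j"
    unfolding block_index_def c Finite_Cartesian_Product.vec_eq_iff
    using pred_div_eq[OF _ n(2)] m by simp
  ultimately show False using out by blast
qed

text \<open>A block with at least one good point has a Lipschitz symbol, common to all its points,
  and \<open>block_fourier_tail\<close> bounds its tail by its boundary. In any other block every
  point is bad and contributes at most \<open>K\<^sup>2\<close>. Summed over the blocks, the
  boundaries fill a fraction of order 1/m of the grid.\<close>

lemma block_tail_bound:
  fixes g :: "int ^ 'd::finite \<Rightarrow> real ^ 'd \<Rightarrow> complex" and Bad :: "(int ^ 'd) set"
  assumes N: "N \<ge> 1" and m: "m \<ge> 1" "m \<le> N"
    and cont: "\<And>j. j \<in> grid N \<Longrightarrow> continuous_on UNIV (g j)"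
    and gb: "\<And>j l. block_index m j = block_index m l \<Longrightarrow> g j = g l"
    and K: "\<And>j \<xi>. j \<in> grid N \<Longrightarrow> cmod (g j \<xi>) \<le> K" and L: "L \<ge> 0"
    and per: "\<And>j i \<xi>. j \<in> grid N \<Longrightarrow> g j (\<xi> + axis i 1) = g j \<xi>"
    and lip: "\<And>j \<xi> \<eta>. j \<in> grid N \<Longrightarrow> j \<notin> Bad \<Longrightarrow> cmod (g j \<xi> - g j \<eta>) \<le> L * (\<Sum>i\<in>UNIV. \<bar>vec_nth \<xi> i - vec_nth \<eta> i\<bar>)"
    and Bad: "Bad \<subseteq> grid N"
  shows "block_tail (grid N) (block_index m) g \<le> 4 * L\<^sup>2 * (real CARD('d))\<^sup>2 * real (N ^ CARD('d)) / real m + K\<^sup>2 * real (card Bad)"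
proof -
  let ?G = "grid N :: (int ^ 'd) set" and ?b = "block_index m :: int ^ 'd \<Rightarrow> int ^ 'd"
  interpret prob_space "cube_measure :: (real ^ 'd) measure" by (rule prob_space_cube)
  have fin: "finite ?G" by simp
  define S where "S \<beta> = {j \<in> ?G. ?b j = \<beta>}" for \<beta>
  define t where "t j = (LINT \<xi>|cube_measure. (cmod (g j \<xi>))\<^sup>2) - (\<Sum>l\<in>S (?b j). (cmod (fcoeff (g j) (j - l)))\<^sup>2)" for j
  define P where "P i j \<longleftrightarrow> int m dvd vec_nth j i - 1" for i and j :: "int ^ 'd"
  define P' where "P' i j \<longleftrightarrow> vec_nth j i = int N \<or> int m dvd vec_nth j i" for i and j :: "int ^ 'd"
  \<comment> \<open>Weights carried by single points, so that the bounds for the blocks add up to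
    counts over the whole grid: \<open>P\<close> and \<open>P'\<close> mark the lower and upper
    faces of blocks.\<close>
  define w where "w j = L\<^sup>2 * real CARD('d) * (\<Sum>i\<in>UNIV. of_bool (P i j) + of_bool (P' i j)) + K\<^sup>2 * of_bool (j \<in> Bad)" for j
  have Sfin: "finite (S \<beta>)" for \<beta> using fin by (simp add: S_def)
  have cnt: "(\<Sum>j\<in>A. of_bool (Q j) :: real) = real (card {j \<in> A. Q j})" if "finite A" for A :: "(int ^ 'd) set" and Q
  proof -
    have "{j \<in> A. Q j} = A \<inter> {j. Q j}" by auto
    thus ?thesis using that by (simp add: sum_of_bool_eq)
  qed
  have loc: "(\<Sum>j\<in>S \<beta>. t j) \<le> (\<Sum>j\<in>S \<beta>. w j)" for \<beta>
  proof (cases "S \<beta> \<subseteq> Bad")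
    case True
    have "t j \<le> w j" if j: "j \<in> S \<beta>" for j
    proof -
      have jG: "j \<in> ?G" using j by (simp add: S_def)
      have "(LINT \<xi>|cube_measure. (cmod (g j \<xi>))\<^sup>2) \<le> (LINT \<xi>|(cube_measure :: (real ^ 'd) measure). K\<^sup>2)"
      proof (rule integral_mono)
        show "integrable cube_measure (\<lambda>\<xi>. (cmod (g j \<xi>))\<^sup>2)"
          by (intro integrable_cube continuous_intros cont jG)
        show "(cmod (g j \<xi>))\<^sup>2 \<le> K\<^sup>2" for \<xi> using K[OF jG, of \<xi>] by (intro power_mono) auto
      qed simp
      also have "\<dots> = K\<^sup>2" using prob_space by simp
      finally have "t j \<le> K\<^sup>2" unfolding t_def
        using sum_nonneg[of "S (?b j)" "\<lambda>l. (cmod (fcoeff (g j) (j - l)))\<^sup>2"] by simp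
      also have "\<dots> \<le> w j"
      proof -
        have "0 \<le> L\<^sup>2 * real CARD('d) * (\<Sum>i\<in>UNIV. of_bool (P i j) + of_bool (P' i j))"
          by (intro mult_nonneg_nonneg sum_nonneg) auto
        thus ?thesis using True j by (auto simp: w_def)
      qed
      finally show ?thesis .
    qed
    thus ?thesis by (rule sum_mono)
  next
    case False
    then obtain j0 where j0: "j0 \<in> S \<beta>" "j0 \<notin> Bad" by blast
    have j0G: "j0 \<in> ?G" "?b j0 = \<beta>" using j0 by (auto simp: S_def)
    define g0 where "g0 = g j0"
    have gS: "g j = g0" if "j \<in> S \<beta>" for j using gb[of j j0] that j0G by (auto simp: S_def g0_def)
    have "(\<Sum>j\<in>S \<beta>. t j) = (\<Sum>j\<in>S \<beta>. (LINT \<xi>|cube_measure. (cmod (g0 \<xi>))\<^sup>2) - (\<Sum>l\<in>S \<beta>. (cmod (fcoeff g0 (j - l)))\<^sup>2))"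
    proof (rule sum.cong[OF refl])
      fix j assume "j \<in> S \<beta>"
      moreover hence "?b j = \<beta>" by (simp add: S_def)
      ultimately show "t j = (LINT \<xi>|cube_measure. (cmod (g0 \<xi>))\<^sup>2) - (\<Sum>l\<in>S \<beta>. (cmod (fcoeff g0 (j - l)))\<^sup>2)"
        by (simp add: t_def gS)
    qed
    also have "\<dots> \<le> L\<^sup>2 * real CARD('d) * (\<Sum>i\<in>UNIV. real (card {j \<in> S \<beta>. j - axis i 1 \<notin> S \<beta>} + card {j. j \<notin> S \<beta> \<and> j - axis i 1 \<in> S \<beta>}))"
      unfolding g0_def by (rule block_fourier_tail[OF per[OF j0G(1)] cont[OF j0G(1)] lip[OF j0G(1) j0(2)] L Sfin])
    also have "\<dots> \<le> L\<^sup>2 * real CARD('d) * (\<Sum>i\<in>UNIV. (\<Sum>j\<in>S \<beta>. of_bool (P i j)) + (\<Sum>j\<in>S \<beta>. of_bool (P' i j)))"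
    proof (intro mult_left_mono sum_mono)
      fix i :: 'd
      have "{j \<in> S \<beta>. j - axis i 1 \<notin> S \<beta>} \<subseteq> {j \<in> S \<beta>. P i j}"
        using block_lower_boundary[OF m(1)] by (auto simp: S_def P_def)
      hence 1: "card {j \<in> S \<beta>. j - axis i 1 \<notin> S \<beta>} \<le> card {j \<in> S \<beta>. P i j}" using Sfin by (intro card_mono) auto
      have "{j. j \<notin> S \<beta> \<and> j - axis i 1 \<in> S \<beta>} \<subseteq> (\<lambda>k. k + axis i 1) ` {j \<in> S \<beta>. P' i j}"
      proof
        fix j assume j: "j \<in> {j. j \<notin> S \<beta> \<and> j - axis i 1 \<in> S \<beta>}"
        have "P' i (j - axis i 1)"
          using block_upper_boundary[OF m(1), of "j - axis i 1" N i] j by (auto simp: S_def P'_def)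
        thus "j \<in> (\<lambda>k. k + axis i 1) ` {j \<in> S \<beta>. P' i j}"
          using j by (intro image_eqI[of _ _ "j - axis i 1"]) auto
      qed
      hence "card {j. j \<notin> S \<beta> \<and> j - axis i 1 \<in> S \<beta>} \<le> card ((\<lambda>k. k + axis i 1) ` {j \<in> S \<beta>. P' i j})"
        using Sfin by (intro card_mono) auto
      also have "\<dots> \<le> card {j \<in> S \<beta>. P' i j}" using Sfin by (intro card_image_le) auto
      finally show "real (card {j \<in> S \<beta>. j - axis i 1 \<notin> S \<beta>} + card {j. j \<notin> S \<beta> \<and> j - axis i 1 \<in> S \<beta>})
          \<le> (\<Sum>j\<in>S \<beta>. of_bool (P i j)) + (\<Sum>j\<in>S \<beta>. of_bool (P' i j))"
        unfolding cnt[OF Sfin] using 1 by simp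
    qed simp
    also have "\<dots> = (\<Sum>j\<in>S \<beta>. L\<^sup>2 * real CARD('d) * (\<Sum>i\<in>UNIV. of_bool (P i j) + of_bool (P' i j)))"
      unfolding sum_distrib_left[symmetric] sum.distrib[symmetric] by (subst sum.swap) simp
    also have "\<dots> \<le> (\<Sum>j\<in>S \<beta>. w j)" unfolding w_def by (intro sum_mono) simp
    finally show ?thesis .
  qed
  have bt: "block_tail ?G ?b g = (\<Sum>j\<in>?G. t j)"
    unfolding block_tail_def[OF fin] block_def[OF fin] t_def S_def ..
  have "(\<Sum>j\<in>?G. t j) = (\<Sum>\<beta>\<in>?b ` ?G. \<Sum>j\<in>S \<beta>. t j)"
    unfolding S_def by (rule sum.group[symmetric]) auto
  also have "\<dots> \<le> (\<Sum>\<beta>\<in>?b ` ?G. \<Sum>j\<in>S \<beta>. w j)" by (intro sum_mono loc)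
  also have "\<dots> = (\<Sum>j\<in>?G. w j)" unfolding S_def by (rule sum.group) auto
  also have "\<dots> = L\<^sup>2 * real CARD('d) * (\<Sum>i\<in>UNIV. real (card {j \<in> ?G. P i j}) + real (card {j \<in> ?G. P' i j})) + K\<^sup>2 * real (card Bad)"
  proof -
    have "{j \<in> ?G. j \<in> Bad} = Bad" using Bad by auto
    hence "(\<Sum>j\<in>?G. of_bool (j \<in> Bad) :: real) = real (card Bad)" using cnt[OF fin, of "\<lambda>j. j \<in> Bad"] by simp
    moreover have "(\<Sum>j\<in>?G. \<Sum>i\<in>UNIV. of_bool (P i j) + of_bool (P' i j)) = (\<Sum>i\<in>UNIV. real (card {j \<in> ?G. P i j}) + real (card {j \<in> ?G. P' i j}))"
      unfolding cnt[OF fin, symmetric] sum.distrib[symmetric] by (rule sum.swap)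
    ultimately show ?thesis unfolding w_def sum.distrib sum_distrib_left[symmetric] by (simp add: sum.distrib)
  qed
  also have "\<dots> \<le> L\<^sup>2 * real CARD('d) * (real CARD('d) * (4 * real (N ^ CARD('d)) / real m)) + K\<^sup>2 * real (card Bad)"
  proof (intro add_right_mono mult_left_mono)
    \<comment> \<open>Since \<open>m \<le> N\<close>, the additional block in
      \<open>N div m + 1\<close> costs at most a factor 2; the lower and the upper faces together
      give the 4.\<close>
    have slice: "real (card {j \<in> ?G. vec_nth j i \<in> T}) \<le> 2 * real (N ^ CARD('d)) / real m"
      if T: "T \<subseteq> {1..int N}" "card T \<le> N div m + 1" for T and i :: 'd
    proof -
      have c1: "CARD('d) = Suc (CARD('d) - 1)" by simp
      have Nm: "real (N div m) \<le> real N / real m" "1 \<le> real N / real m"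
      proof -
        have "real (N div m) * real m \<le> real N"
          unfolding of_nat_mult[symmetric] by (rule of_nat_mono) (rule div_times_less_eq_dividend)
        thus "real (N div m) \<le> real N / real m" using m by (simp add: le_divide_eq)
      qed (use m in simp)
      have "real (card {j \<in> ?G. vec_nth j i \<in> T}) \<le> real ((N div m + 1) * N ^ (CARD('d) - 1))"
        unfolding card_grid_slice[OF T(1)] using T(2) by (intro of_nat_mono mult_right_mono) auto
      also have "\<dots> \<le> (2 * (real N / real m)) * real (N ^ (CARD('d) - 1))"
        unfolding of_nat_mult using Nm by (intro mult_right_mono) auto
      also have "\<dots> = 2 * (real N * real N ^ (CARD('d) - 1)) / real m" by simp
      also have "real N * real N ^ (CARD('d) - 1) = real (N ^ CARD('d))" by (simp only: of_nat_power power_Suc[symmetric] c1[symmetric])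
      finally show ?thesis .
    qed
    have "real (card {j \<in> ?G. P i j}) + real (card {j \<in> ?G. P' i j}) \<le> 4 * real (N ^ CARD('d)) / real m" for i
    proof -
      have e: "{j \<in> ?G. P i j} = {j \<in> ?G. vec_nth j i \<in> {t \<in> {1..int N}. int m dvd t - 1}}"
        "{j \<in> ?G. P' i j} = {j \<in> ?G. vec_nth j i \<in> {t \<in> {1..int N}. t = int N \<or> int m dvd t}}"
        by (auto simp: P_def P'_def grid_def)
      have "real (card {j \<in> ?G. P i j}) \<le> 2 * real (N ^ CARD('d)) / real m"
        unfolding e using card_block_starts[OF m(1)] by (intro slice) auto
      moreover have "real (card {j \<in> ?G. P' i j}) \<le> 2 * real (N ^ CARD('d)) / real m"
        unfolding e using card_block_ends[OF m(1)] by (intro slice) auto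
      ultimately show ?thesis by simp
    qed
    hence "(\<Sum>i\<in>(UNIV::'d set). real (card {j \<in> ?G. P i j}) + real (card {j \<in> ?G. P' i j})) \<le> (\<Sum>i\<in>(UNIV::'d set). 4 * real (N ^ CARD('d)) / real m)"
      by (rule sum_mono)
    thus "(\<Sum>i\<in>(UNIV::'d set). real (card {j \<in> ?G. P i j}) + real (card {j \<in> ?G. P' i j})) \<le> real CARD('d) * (4 * real (N ^ CARD('d)) / real m)"
      by simp
  qed simp
  also have "L\<^sup>2 * real CARD('d) * (real CARD('d) * (4 * real (N ^ CARD('d)) / real m)) = 4 * L\<^sup>2 * (real CARD('d))\<^sup>2 * real (N ^ CARD('d)) / real m"
    by (simp add: power2_eq_square)
  finally show ?thesis unfolding bt .
qed

section \<open>Log-determinants of matrices indexed by the grid\<close>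

lemma borel_measurable_cube:
  "f \<in> borel_measurable borel \<Longrightarrow> f \<in> borel_measurable (cube_measure :: (real ^ 'd::finite) measure)"
  by (intro measurable_restrict_space1 measurable_completion) simp

text \<open>The parameter \<open>z\<close> is subtracted both from the matrix and from the
  approximate eigenvalue, so it cancels in the packet errors; this is why the bound does not depend
  on \<open>z\<close>.\<close>

lemma symbol_log_det:
  fixes f g :: "int ^ 'd::finite \<Rightarrow> real ^ 'd \<Rightarrow> complex" and b :: "int ^ 'd \<Rightarrow> 'b" and G :: "(int ^ 'd) set"
  assumes fin: "finite G" and bij: "bij_betw e {..<n} G" and B: "B \<in> carrier_mat n n"
    and entries: "\<And>k l. k < n \<Longrightarrow> l < n \<Longrightarrow> B $$ (k, l) = fcoeff (f (e k)) (e k - e l) + E (e k) (e l)"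
    and svd: "svd n (B - z \<cdot>\<^sub>m 1\<^sub>m n) u h"
    and f: "\<And>j. j \<in> G \<Longrightarrow> continuous_on UNIV (f j)"
    and g: "\<And>j. j \<in> G \<Longrightarrow> continuous_on UNIV (g j)" and gb: "\<And>j l. b j = b l \<Longrightarrow> g j = g l"
    and K: "\<And>j \<xi>. j \<in> G \<Longrightarrow> cmod (g j \<xi>) \<le> K"
    and T: "block_tail G b g \<le> T" "block_tail G b (\<lambda>j \<xi>. cnj (g j \<xi>)) \<le> T"
    and \<eta>: "8 * (\<Sum>j\<in>G. LINT \<xi>|cube_measure. (cmod (f j \<xi> - g j \<xi>))\<^sup>2) + 10 * T + 4 * (\<Sum>k\<in>G. \<Sum>l\<in>G. (cmod (E k l))\<^sup>2) \<le> real n * \<eta>\<^sup>2"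
      "\<eta> > 0" and \<tau>: "\<tau> > 0"
  shows "\<bar>(\<Sum>i<n. ln (\<tau>\<^sup>2 + h i)) - (\<Sum>j\<in>G. LINT \<xi>|cube_measure. ln (\<tau>\<^sup>2 + (cmod (g j \<xi> - z))\<^sup>2))\<bar> \<le> 2 * real n * \<eta> / \<tau>"
proof -
  interpret prob_space "cube_measure :: (real ^ 'd) measure" by (rule prob_space_cube)
  have eG: "e k \<in> G" if "k < n" for k using bij_betwE[OF bij] that by simp
  have re: "(\<Sum>k<n. F (e k)) = (\<Sum>k\<in>G. F k)" for F :: "int ^ 'd \<Rightarrow> 'c::comm_monoid_add"
    by (rule sum.reindex_bij_betw[OF bij])
  have ent: "(B - z \<cdot>\<^sub>m 1\<^sub>m n) $$ (k, l) = B $$ (k, l) - z * of_bool (l = k)" if "k < n" "l < n" for k l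
    using that B by auto
  let ?A = "\<lambda>k l. fcoeff (f k) (k - l) + E k l"
  have col: "(\<Sum>l<n. (B - z \<cdot>\<^sub>m 1\<^sub>m n) $$ (k, l) * packet G b j \<xi> (e l)) - (g j \<xi> - z) * packet G b j \<xi> (e k)
     = (\<Sum>l\<in>G. ?A (e k) l * packet G b j \<xi> l) - g j \<xi> * packet G b j \<xi> (e k)" if k: "k < n" for k j \<xi>
  proof -
    have "(\<Sum>l<n. (B - z \<cdot>\<^sub>m 1\<^sub>m n) $$ (k, l) * packet G b j \<xi> (e l))
      = (\<Sum>l<n. ?A (e k) (e l) * packet G b j \<xi> (e l) - (if l = k then z * packet G b j \<xi> (e k) else 0))"
      by (rule sum.cong[OF refl]) (use k in \<open>auto simp: ent entries left_diff_distrib\<close>)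
    also have "\<dots> = (\<Sum>l\<in>G. ?A (e k) l * packet G b j \<xi> l) - z * packet G b j \<xi> (e k)"
      unfolding sum_subtractf re[of "\<lambda>l. ?A (e k) l * packet G b j \<xi> l"] using k by (simp add: sum.delta)
    finally show ?thesis by (simp add: left_diff_distrib)
  qed
  have row: "(\<Sum>k<n. cnj ((B - z \<cdot>\<^sub>m 1\<^sub>m n) $$ (k, l)) * packet G b j \<xi> (e k)) - cnj (g j \<xi> - z) * packet G b j \<xi> (e l)
     = (\<Sum>k\<in>G. cnj (?A k (e l)) * packet G b j \<xi> k) - cnj (g j \<xi>) * packet G b j \<xi> (e l)" if l: "l < n" for l j \<xi>
  proof -
    have "(\<Sum>k<n. cnj ((B - z \<cdot>\<^sub>m 1\<^sub>m n) $$ (k, l)) * packet G b j \<xi> (e k))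
      = (\<Sum>k<n. cnj (?A (e k) (e l)) * packet G b j \<xi> (e k) - (if k = l then cnj z * packet G b j \<xi> (e l) else 0))"
      by (rule sum.cong[OF refl]) (use l in \<open>auto simp: ent entries left_diff_distrib\<close>)
    also have "\<dots> = (\<Sum>k\<in>G. cnj (?A k (e l)) * packet G b j \<xi> k) - cnj z * packet G b j \<xi> (e l)"
      unfolding sum_subtractf re[of "\<lambda>k. cnj (?A k (e l)) * packet G b j \<xi> k"] using l by (simp add: sum.delta)
    finally show ?thesis by (simp add: left_diff_distrib)
  qed
  note err = packet_error[OF fin f g gb T, where E = E]
  show ?thesis
  proof (rule frame_log_det[OF svd, where \<phi> = "\<lambda>j \<xi> k. packet G b j \<xi> (e k)" and K = "K + cmod z"])
    show "finite_measure (cube_measure :: (real ^ 'd) measure)" by unfold_locales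
    show "(\<lambda>\<xi>. packet G b j \<xi> (e k)) \<in> borel_measurable cube_measure" for j k
      by (intro borel_measurable_cube borel_measurable_continuous_onI continuous_on_packet[OF fin])
    show "(\<lambda>\<xi>. g j \<xi> - z) \<in> borel_measurable cube_measure" if "j \<in> G" for j
      by (intro borel_measurable_cube borel_measurable_continuous_onI continuous_on_diff continuous_on_const g that)
    show "cmod (g j \<xi> - z) \<le> K + cmod z" if "j \<in> G" for j \<xi>
      using norm_triangle_ineq4[of "g j \<xi>" z] K[OF that, of \<xi>] by linarith
    show "(\<Sum>k<n. (cmod (packet G b j \<xi> (e k)))\<^sup>2) = 1" if "j \<in> G" for j \<xi>
      unfolding re[of "\<lambda>k. (cmod (packet G b j \<xi> k))\<^sup>2"] by (rule packet_unit[OF fin that])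
    show "(\<Sum>j\<in>G. LINT \<xi>|cube_measure. packet G b j \<xi> (e k) * cnj (packet G b j \<xi> (e l))) = of_bool (k = l)" if "k < n" "l < n" for k l
      unfolding packet_resolution[OF fin eG[OF that(1)] eG[OF that(2)]]
      using bij_betw_imp_inj_on[OF bij] that by (auto simp: inj_on_def)
    show "(\<Sum>j\<in>G. LINT \<xi>|cube_measure. (\<Sum>k<n. (cmod ((\<Sum>l<n. (B - z \<cdot>\<^sub>m 1\<^sub>m n) $$ (k, l) * packet G b j \<xi> (e l)) - (g j \<xi> - z) * packet G b j \<xi> (e k)))\<^sup>2)) \<le> real n * \<eta>\<^sup>2"
    proof -
      have "(\<Sum>k<n. (cmod ((\<Sum>l<n. (B - z \<cdot>\<^sub>m 1\<^sub>m n) $$ (k, l) * packet G b j \<xi> (e l)) - (g j \<xi> - z) * packet G b j \<xi> (e k)))\<^sup>2)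
        = (\<Sum>k\<in>G. (cmod ((\<Sum>l\<in>G. ?A k l * packet G b j \<xi> l) - g j \<xi> * packet G b j \<xi> k))\<^sup>2)" for j \<xi>
        unfolding re[of "\<lambda>k. (cmod ((\<Sum>l\<in>G. ?A k l * packet G b j \<xi> l) - g j \<xi> * packet G b j \<xi> k))\<^sup>2", symmetric]
        by (rule sum.cong[OF refl]) (simp only: col lessThan_iff)
      thus ?thesis using order_trans[OF err(1) \<eta>(1)] by (simp only:)
    qed
    show "(\<Sum>j\<in>G. LINT \<xi>|cube_measure. (\<Sum>l<n. (cmod ((\<Sum>k<n. cnj ((B - z \<cdot>\<^sub>m 1\<^sub>m n) $$ (k, l)) * packet G b j \<xi> (e k)) - cnj (g j \<xi> - z) * packet G b j \<xi> (e l)))\<^sup>2)) \<le> real n * \<eta>\<^sup>2"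
    proof -
      have "(\<Sum>l<n. (cmod ((\<Sum>k<n. cnj ((B - z \<cdot>\<^sub>m 1\<^sub>m n) $$ (k, l)) * packet G b j \<xi> (e k)) - cnj (g j \<xi> - z) * packet G b j \<xi> (e l)))\<^sup>2)
        = (\<Sum>l\<in>G. (cmod ((\<Sum>k\<in>G. cnj (?A k l) * packet G b j \<xi> k) - cnj (g j \<xi>) * packet G b j \<xi> l))\<^sup>2)" for j \<xi>
        unfolding re[of "\<lambda>l. (cmod ((\<Sum>k\<in>G. cnj (?A k l) * packet G b j \<xi> k) - cnj (g j \<xi>) * packet G b j \<xi> l))\<^sup>2", symmetric]
        by (rule sum.cong[OF refl]) (simp only: row lessThan_iff)
      thus ?thesis using order_trans[OF err(2) \<eta>(1)] by (simp only:)
    qed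
  qed (use fin \<tau> \<eta>(2) in auto)
qed

section \<open>Regularized log-determinants of the perturbed matrix\<close>

text \<open>With \<open>s\<close> the square root of the value at \<open>b \<le> a\<close>, the
  value at \<open>a\<close> is at most \<open>(s + (a - b))\<^sup>2\<close>, because
  \<open>b \<le> s\<close>.\<close>

lemma ln_square_shift_lipschitz:
  fixes a b \<tau> :: real
  assumes "\<tau> > 0" "a \<ge> 0" "b \<ge> 0"
  shows "\<bar>ln (\<tau>\<^sup>2 + a\<^sup>2) - ln (\<tau>\<^sup>2 + b\<^sup>2)\<bar> \<le> 2 / \<tau> * \<bar>a - b\<bar>"
proof -
  have *: "ln (\<tau>\<^sup>2 + a\<^sup>2) - ln (\<tau>\<^sup>2 + b\<^sup>2) \<le> 2 / \<tau> * (a - b)" if "b \<le> a" "b \<ge> 0" for a b :: real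
  proof -
    define s where "s = sqrt (\<tau>\<^sup>2 + b\<^sup>2)"
    have pos: "\<tau>\<^sup>2 + x\<^sup>2 > 0" for x using assms(1) by (intro add_pos_nonneg) auto
    have s: "s\<^sup>2 = \<tau>\<^sup>2 + b\<^sup>2" "s > 0" using pos[of b] by (simp_all add: s_def)
    have sb: "s \<ge> b" "s \<ge> \<tau>" using that assms(1) by (auto simp: s_def intro!: real_le_rsqrt)
    have "b * (a - b) \<le> s * (a - b)" using sb that by (intro mult_right_mono) auto
    hence "\<tau>\<^sup>2 + a\<^sup>2 \<le> (s + (a - b))\<^sup>2" unfolding power2_sum s by (simp add: power2_eq_square algebra_simps)
    hence "ln (\<tau>\<^sup>2 + a\<^sup>2) \<le> ln ((s + (a - b))\<^sup>2)" using pos by (intro ln_mono) auto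
    also have "\<dots> = 2 * ln (s * (1 + (a - b) / s))" using s that by (simp add: ln_realpow distrib_left)
    also have "\<dots> = 2 * ln s + 2 * ln (1 + (a - b) / s)"
    proof -
      have "1 + (a - b) / s > 0" using s that by (intro add_pos_nonneg) auto
      thus ?thesis using s by (simp add: ln_mult_pos)
    qed
    also have "2 * ln s = ln (\<tau>\<^sup>2 + b\<^sup>2)" unfolding s(1)[symmetric] using s(2) by (simp add: ln_realpow)
    also have "ln (1 + (a - b) / s) \<le> (a - b) / s" using s that by (intro ln_add_one_self_le_self) auto
    also have "(a - b) / s \<le> (a - b) / \<tau>" using sb that assms(1) s by (intro divide_left_mono) auto
    finally show ?thesis by simp
  qed
  show ?thesis
  proof (cases "b \<le> a")
    case True
    hence "ln (\<tau>\<^sup>2 + b\<^sup>2) \<le> ln (\<tau>\<^sup>2 + a\<^sup>2)" using assms by (intro ln_mono add_left_mono power_mono add_pos_nonneg) auto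
    thus ?thesis using *[OF True] assms True by simp
  next
    case False
    hence "ln (\<tau>\<^sup>2 + a\<^sup>2) \<le> ln (\<tau>\<^sup>2 + b\<^sup>2)" using assms by (intro ln_mono add_left_mono power_mono add_pos_nonneg) auto
    thus ?thesis using *[of a b] assms False by simp
  qed
qed

context
  fixes \<rho> :: real and \<U> :: "(real ^ 'd::finite) set set" and p :: "real ^ 'd \<Rightarrow> real ^ 'd \<Rightarrow> complex" and C :: real
  assumes p: "pw_symbol \<rho> \<U> p" and \<rho>: "\<rho> > 0"
    and null: "negligible (singular_set \<U>)" and C: "C \<ge> 0"
    and bound: "\<And>x \<xi>. x \<in> unit_cube \<Longrightarrow> cmod (p x \<xi>) \<le> C"
    and hoelder: "\<And>U x y \<xi>. U \<in> \<U> \<Longrightarrow> x \<in> U \<Longrightarrow> y \<in> U \<Longrightarrow> cmod (p x \<xi> - p y \<xi>) \<le> C * dist x y powr \<rho>"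
    and lip: "\<And>U x \<xi> \<eta>. U \<in> \<U> \<Longrightarrow> x \<in> U \<Longrightarrow> cmod (p x \<xi> - p x \<eta>) \<le> C * (\<Sum>i\<in>UNIV. \<bar>vec_nth \<xi> i - vec_nth \<eta> i\<bar>)"

begin

text \<open>All sources of error are measured by one small number \<open>X\<close>: the Fourier
  tail, the variation of the symbol over a block, the fraction of bad points, and the squared
  Hilbert-Schmidt norm of \<open>D\<close> per dimension. The packet errors are controlled in mean
  square, hence \<open>sqrt X\<close> in the result.\<close>

lemma symbol_matrix_log_det:
  fixes e :: "nat \<Rightarrow> int ^ 'd" and D :: "complex mat"
  assumes N: "N \<ge> 1" and e: "bij_betw e {..<N ^ CARD('d)} (grid N)"
    and m: "m \<ge> 1" "m \<le> N" and r: "real CARD('d) / real N < r" "real CARD('d) * (real m / real N) < r"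
    and X: "0 < X" "X \<le> 1" "1 / real m \<le> X" "C * (2 * r) powr \<rho> \<le> c1 * X"
    and bad: "real (card (bad_points \<U> N r)) \<le> real (N ^ CARD('d)) * (b1 * X)"
    and D: "D \<in> carrier_mat (N ^ CARD('d)) (N ^ CARD('d))"
      "(\<Sum>k<N ^ CARD('d). \<Sum>l<N ^ CARD('d). (cmod (D $$ (k, l)))\<^sup>2) \<le> real (N ^ CARD('d)) * (c2 * X)"
    and svd: "svd (N ^ CARD('d)) (symbol_matrix N e p + D - z \<cdot>\<^sub>m 1\<^sub>m (N ^ CARD('d))) u h"
    and \<tau>: "\<tau> > 0" and nonneg: "b1 \<ge> 0" "c1 \<ge> 0" "c2 \<ge> 0"
  shows "\<bar>(\<Sum>i<N ^ CARD('d). ln (\<tau>\<^sup>2 + h i)) / real (N ^ CARD('d)) - (LINT u|symbol_law p. ln (\<tau>\<^sup>2 + (cmod (u - z))\<^sup>2))\<bar>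
    \<le> (2 * sqrt (8 * (c1\<^sup>2 + 4 * C\<^sup>2 * b1) + 10 * (4 * C\<^sup>2 * (real CARD('d))\<^sup>2 + C\<^sup>2 * b1) + 4 * c2 + 1) + 2 * c1 + 4 * C * b1) * sqrt X / \<tau>"
proof -
  define n where "n = N ^ CARD('d)"
  have n0: "real n > 0" using N by (simp add: n_def)
  let ?G = "grid N :: (int ^ 'd) set"
  interpret prob_space "cube_measure :: (real ^ 'd) measure" by (rule prob_space_cube)
  note ctx = p \<rho> null C bound hoelder
  have r0: "r > 0" using r(1) by (rule le_less_trans[rotated]) simp
  define Bad where "Bad = bad_points \<U> N r"
  have "bad_points \<U> N r = {j \<in> ?G. ball (sample_point N j) r \<inter> singular_set \<U> \<noteq> {}}"
    by (rule bad_points_def[OF ctx]) assumption+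
  hence BadG: "Bad \<subseteq> ?G" unfolding Bad_def by auto
  \<comment> \<open>\<open>f\<close> is the symbol that the matrix really samples in its rows;
    \<open>g\<close> is frozen at the corner of each block.\<close>
  define f where "f j = p (sample_point N j)" for j
  define g where "g j = p (sample_point N (block_corner m j))" for j
  have inc: "sample_point N j \<in> unit_cube" "sample_point N (block_corner m j) \<in> unit_cube" if "j \<in> ?G" for j
    using that N by (auto intro!: sample_point_in_cube block_corner_grid m)
  have sm: "torus_smooth (f j)" "torus_smooth (g j)" if "j \<in> ?G" for j
    unfolding f_def g_def using pieces(5)[OF p inc(1)[OF that]] pieces(5)[OF p inc(2)[OF that]] .
  have cont: "continuous_on UNIV (f j)" "continuous_on UNIV (g j)" if "j \<in> ?G" for j
    using sm[OF that] by (auto intro: torus_smooth_continuous)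
  have gK: "cmod (g j \<xi>) \<le> C" "cmod (f j \<xi>) \<le> C" if "j \<in> ?G" for j \<xi>
    unfolding g_def f_def using bound inc that by auto
  have gb: "g j = g l" if "block_index m j = block_index m l" for j l
    using block_corner_cong[OF that] by (simp add: g_def)
  have dj: "dist (sample_point N j) (sample_point N (block_corner m j)) < r" for j :: "int ^ 'd"
    using dist_block_corner[OF m(1) N, of j] r(2) by simp
  have good: "\<exists>U\<in>\<U>. sample_point N j \<in> U \<and> sample_point N (block_corner m j) \<in> U" if j: "j \<in> ?G" "j \<notin> Bad" for j
  proof -
    have "\<exists>U\<in>\<U>. ball (sample_point N j) r \<inter> unit_cube \<subseteq> U"
      by (rule good_point_piece[OF ctx N j(1) j(2)[unfolded Bad_def] r0]) assumption+
    then obtain U where U: "U \<in> \<U>" "ball (sample_point N j) r \<inter> unit_cube \<subseteq> U" by blast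
    have "sample_point N j \<in> U" "sample_point N (block_corner m j) \<in> U"
      using inc[OF j(1)] dj[of j] r0 by (auto intro!: subsetD[OF U(2)])
    thus ?thesis using U(1) by blast
  qed
  have glip: "cmod (g j \<xi> - g j \<eta>) \<le> C * (\<Sum>i\<in>UNIV. \<bar>vec_nth \<xi> i - vec_nth \<eta> i\<bar>)" if "j \<in> ?G" "j \<notin> Bad" for j \<xi> \<eta>
    using good[OF that] lip unfolding g_def by blast
  have fg: "cmod (f j \<xi> - g j \<xi>) \<le> c1 * X" if j: "j \<in> ?G" "j \<notin> Bad" for j \<xi>
  proof -
    obtain U where U: "U \<in> \<U>" "sample_point N j \<in> U" "sample_point N (block_corner m j) \<in> U" using good[OF j] by blast
    have "cmod (f j \<xi> - g j \<xi>) \<le> C * dist (sample_point N j) (sample_point N (block_corner m j)) powr \<rho>"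
      unfolding f_def g_def by (rule hoelder[OF U])
    also have "\<dots> \<le> C * (2 * r) powr \<rho>" using dj[of j] r0 C \<rho> by (intro mult_left_mono powr_mono2) auto
    finally show ?thesis using X(4) by simp
  qed
  have X2: "X\<^sup>2 \<le> X" using X by (simp add: power2_eq_square mult_left_le)
  have cardG: "card ?G = n" by (simp add: card_grid n_def)
  have badn: "real (card Bad) \<le> real n * (b1 * X)" using bad by (simp add: Bad_def n_def)
  have S1: "(\<Sum>j\<in>?G. LINT \<xi>|cube_measure. (cmod (f j \<xi> - g j \<xi>))\<^sup>2) \<le> real n * ((c1\<^sup>2 + 4 * C\<^sup>2 * b1) * X)"
  proof -
    have "(LINT \<xi>|cube_measure. (cmod (f j \<xi> - g j \<xi>))\<^sup>2) \<le> (c1 * X)\<^sup>2 + 4 * C\<^sup>2 * of_bool (j \<in> Bad)" if j: "j \<in> ?G" for j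
    proof -
      have pw: "(cmod (f j \<xi> - g j \<xi>))\<^sup>2 \<le> (c1 * X)\<^sup>2 + 4 * C\<^sup>2 * of_bool (j \<in> Bad)" for \<xi>
      proof (cases "j \<in> Bad")
        case True
        have "cmod (f j \<xi> - g j \<xi>) \<le> 2 * C" using norm_triangle_ineq4[of "f j \<xi>" "g j \<xi>"] gK[OF j, of \<xi>] by linarith
        hence "(cmod (f j \<xi> - g j \<xi>))\<^sup>2 \<le> (2 * C)\<^sup>2" by (intro power_mono) auto
        thus ?thesis using True by (simp add: power_mult_distrib add_increasing)
      next
        case False
        have "(cmod (f j \<xi> - g j \<xi>))\<^sup>2 \<le> (c1 * X)\<^sup>2" using fg[OF j False, of \<xi>] by (intro power_mono) auto
        thus ?thesis using False by simp
      qed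
      have "(LINT \<xi>|cube_measure. (cmod (f j \<xi> - g j \<xi>))\<^sup>2) \<le> (LINT \<xi>|(cube_measure :: (real ^ 'd) measure). (c1 * X)\<^sup>2 + 4 * C\<^sup>2 * of_bool (j \<in> Bad))"
      proof (rule integral_mono)
        show "integrable cube_measure (\<lambda>\<xi>. (cmod (f j \<xi> - g j \<xi>))\<^sup>2)"
          by (intro integrable_cube continuous_intros cont j)
      qed (use pw in auto)
      thus ?thesis using prob_space by simp
    qed
    hence "(\<Sum>j\<in>?G. LINT \<xi>|cube_measure. (cmod (f j \<xi> - g j \<xi>))\<^sup>2) \<le> (\<Sum>j\<in>?G. (c1 * X)\<^sup>2 + 4 * C\<^sup>2 * of_bool (j \<in> Bad))" by (rule sum_mono)
    also have "\<dots> = real n * (c1 * X)\<^sup>2 + 4 * C\<^sup>2 * real (card Bad)"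
    proof -
      have "?G \<inter> {j. j \<in> Bad} = Bad" using BadG by auto
      thus ?thesis by (simp add: sum.distrib sum_distrib_left[symmetric] sum_of_bool_eq cardG)
    qed
    also have "\<dots> \<le> real n * (c1\<^sup>2 * X) + 4 * C\<^sup>2 * (real n * (b1 * X))"
      using badn X2 by (intro add_mono mult_left_mono) (auto simp: power_mult_distrib mult_left_mono)
    finally show ?thesis by (simp add: algebra_simps)
  qed
  define T where "T = 4 * C\<^sup>2 * (real CARD('d))\<^sup>2 * real (N ^ CARD('d)) / real m + C\<^sup>2 * real (card Bad)"
  have T1: "block_tail ?G (block_index m) g \<le> T" unfolding T_def
    by (rule block_tail_bound[OF N m _ gb _ C _ glip BadG]) (auto simp: cont gK torus_smooth_periodic sm)
  have T2: "block_tail ?G (block_index m) (\<lambda>j \<xi>. cnj (g j \<xi>)) \<le> T" unfolding T_def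
  proof (rule block_tail_bound[OF N m _ _ _ C _ _ BadG])
    show "continuous_on UNIV (\<lambda>\<xi>. cnj (g j \<xi>))" if "j \<in> ?G" for j by (intro continuous_on_cnj cont that)
    show "cmod (cnj (g j \<xi>) - cnj (g j \<eta>)) \<le> C * (\<Sum>i\<in>UNIV. \<bar>vec_nth \<xi> i - vec_nth \<eta> i\<bar>)" if "j \<in> ?G" "j \<notin> Bad" for j \<xi> \<eta>
      using glip[OF that, of \<xi> \<eta>] by (simp only: complex_cnj_diff[symmetric] complex_mod_cnj)
  qed (auto simp: gK torus_smooth_periodic sm dest: gb)
  have Tn: "T \<le> real n * ((4 * C\<^sup>2 * (real CARD('d))\<^sup>2 + C\<^sup>2 * b1) * X)"
  proof -
    have "4 * C\<^sup>2 * (real CARD('d))\<^sup>2 * real n * (1 / real m) \<le> 4 * C\<^sup>2 * (real CARD('d))\<^sup>2 * real n * X"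
      using X(3) by (intro mult_left_mono) auto
    moreover have "C\<^sup>2 * real (card Bad) \<le> C\<^sup>2 * (real n * (b1 * X))" using badn by (intro mult_left_mono) auto
    ultimately show ?thesis unfolding T_def n_def[symmetric] by (simp add: algebra_simps)
  qed
  \<comment> \<open>The perturbation is given by numerical indices, the packets live on the grid;
    \<open>iv\<close> transports \<open>D\<close> to the grid.\<close>
  define iv where "iv = the_inv_into {..<n} e"
  have e': "bij_betw e {..<n} ?G" using e by (simp add: n_def)
  have iv: "iv (e k) = k" if "k < n" for k
    unfolding iv_def using bij_betw_imp_inj_on[OF e'] that by (intro the_inv_into_f_f) auto
  define E where "E k l = D $$ (iv k, iv l)" for k l
  have re: "(\<Sum>k\<in>?G. F k) = (\<Sum>k<n. F (e k))" for F :: "int ^ 'd \<Rightarrow> real"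
    by (rule sum.reindex_bij_betw[OF e', symmetric])
  have En: "(\<Sum>k\<in>?G. \<Sum>l\<in>?G. (cmod (E k l))\<^sup>2) \<le> real n * (c2 * X)"
  proof -
    have "(\<Sum>k\<in>?G. \<Sum>l\<in>?G. (cmod (E k l))\<^sup>2) = (\<Sum>k<n. \<Sum>l<n. (cmod (D $$ (k, l)))\<^sup>2)"
      unfolding re by (intro sum.cong refl) (simp add: E_def iv)
    thus ?thesis using D(2) by (simp add: n_def)
  qed
  \<comment> \<open>The three contributions of \<open>packet_error\<close> with their factors; the
    summand 1 makes \<eta> positive.\<close>
  define A0 where "A0 = 8 * (c1\<^sup>2 + 4 * C\<^sup>2 * b1) + 10 * (4 * C\<^sup>2 * (real CARD('d))\<^sup>2 + C\<^sup>2 * b1) + 4 * c2 + 1"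
  have A0: "A0 \<ge> 1" unfolding A0_def using nonneg by (simp add: add_nonneg_nonneg)
  define \<eta> where "\<eta> = sqrt (A0 * X)"
  have \<eta>: "\<eta> > 0" "\<eta>\<^sup>2 = A0 * X" using A0 X by (auto simp: \<eta>_def)
  have main: "8 * (\<Sum>j\<in>?G. LINT \<xi>|cube_measure. (cmod (f j \<xi> - g j \<xi>))\<^sup>2) + 10 * T + 4 * (\<Sum>k\<in>?G. \<Sum>l\<in>?G. (cmod (E k l))\<^sup>2) \<le> real n * \<eta>\<^sup>2"
  proof -
    have "8 * (\<Sum>j\<in>?G. LINT \<xi>|cube_measure. (cmod (f j \<xi> - g j \<xi>))\<^sup>2) + 10 * T + 4 * (\<Sum>k\<in>?G. \<Sum>l\<in>?G. (cmod (E k l))\<^sup>2)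
      \<le> 8 * (real n * ((c1\<^sup>2 + 4 * C\<^sup>2 * b1) * X)) + 10 * (real n * ((4 * C\<^sup>2 * (real CARD('d))\<^sup>2 + C\<^sup>2 * b1) * X)) + 4 * (real n * (c2 * X))"
      by (intro add_mono mult_left_mono S1 Tn En) auto
    also have "\<dots> \<le> real n * \<eta>\<^sup>2" unfolding \<eta>(2) A0_def using n0 X(1) by (simp add: algebra_simps)
    finally show ?thesis .
  qed
  have Sc: "symbol_matrix N e p \<in> carrier_mat n n" by (simp add: symbol_matrix_def n_def)
  have frame: "\<bar>(\<Sum>i<n. ln (\<tau>\<^sup>2 + h i)) - (\<Sum>j\<in>?G. LINT \<xi>|cube_measure. ln (\<tau>\<^sup>2 + (cmod (g j \<xi> - z))\<^sup>2))\<bar> \<le> 2 * real n * \<eta> / \<tau>"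
  proof (rule symbol_log_det[OF finite_grid e' _ _ _ cont(1) cont(2) gb gK(1) T1 T2 main \<eta>(1) \<tau>])
    show "symbol_matrix N e p + D \<in> carrier_mat n n" using Sc D(1) by (simp add: n_def)
    show "(symbol_matrix N e p + D) $$ (k, l) = fcoeff (f (e k)) (e k - e l) + E (e k) (e l)" if "k < n" "l < n" for k l
    proof -
      have "symbol_matrix N e p $$ (k, l) = fcoeff (f (e k)) (e k - e l)"
        using that by (simp add: symbol_matrix_def n_def f_def fourier_coeff_eq sample_point_def)
      thus ?thesis using that D(1) by (simp add: E_def iv n_def)
    qed
    show "svd n (symbol_matrix N e p + D - z \<cdot>\<^sub>m 1\<^sub>m n) u h" using svd by (simp add: n_def)
  qed
  have riemann: "\<bar>(\<Sum>j\<in>?G. LINT \<xi>|cube_measure. ln (\<tau>\<^sup>2 + (cmod (p (sample_point N (block_corner m j)) \<xi> - z))\<^sup>2)) / real (N ^ CARD('d)) - (LINT u|symbol_law p. ln (\<tau>\<^sup>2 + (cmod (u - z))\<^sup>2))\<bar>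
    \<le> 2 / \<tau> * (C * (2 * r) powr \<rho> + 2 * C * (real (card (bad_points \<U> N r)) / real (N ^ CARD('d))))"
  proof (rule symbol_riemann_sum[OF ctx N r(1)])
    show "\<bar>ln (\<tau>\<^sup>2 + (cmod (w - z))\<^sup>2) - ln (\<tau>\<^sup>2 + (cmod (w' - z))\<^sup>2)\<bar> \<le> 2 / \<tau> * cmod (w - w')" for w w'
    proof -
      have "\<bar>ln (\<tau>\<^sup>2 + (cmod (w - z))\<^sup>2) - ln (\<tau>\<^sup>2 + (cmod (w' - z))\<^sup>2)\<bar> \<le> 2 / \<tau> * \<bar>cmod (w - z) - cmod (w' - z)\<bar>"
        by (rule ln_square_shift_lipschitz[OF \<tau>]) auto
      also have "\<dots> \<le> 2 / \<tau> * cmod (w - w')"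
        using norm_triangle_ineq3[of "w - z" "w' - z"] \<tau> by (intro mult_left_mono) auto
      finally show ?thesis .
    qed
  qed (use block_corner_grid[OF m(1)] dj \<tau> in auto)
  define S where "S = (\<Sum>j\<in>?G. LINT \<xi>|cube_measure. ln (\<tau>\<^sup>2 + (cmod (g j \<xi> - z))\<^sup>2))"
  define I where "I = (LINT u|symbol_law p. ln (\<tau>\<^sup>2 + (cmod (u - z))\<^sup>2))"
  define H where "H = (\<Sum>i<n. ln (\<tau>\<^sup>2 + h i))"
  have sX: "sqrt X \<ge> X" using X by (simp add: real_le_rsqrt X2)
  have a: "\<bar>H / real n - S / real n\<bar> \<le> 2 * \<eta> / \<tau>"
  proof -
    have "\<bar>H - S\<bar> / real n \<le> (2 * real n * \<eta> / \<tau>) / real n"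
      using frame unfolding H_def S_def by (intro divide_right_mono) auto
    thus ?thesis using n0 by (simp add: diff_divide_distrib[symmetric])
  qed
  have b: "\<bar>S / real n - I\<bar> \<le> 2 / \<tau> * (c1 * X + 2 * C * (b1 * X))"
  proof -
    have "real (card Bad) / real n \<le> b1 * X" using badn n0 by (simp add: divide_le_eq mult.commute)
    hence "2 / \<tau> * (C * (2 * r) powr \<rho> + 2 * C * (real (card Bad) / real n)) \<le> 2 / \<tau> * (c1 * X + 2 * C * (b1 * X))"
      using X(4) C \<tau> by (intro mult_left_mono add_mono) auto
    thus ?thesis using riemann unfolding S_def I_def g_def Bad_def n_def by linarith
  qed
  have "2 * \<eta> / \<tau> + 2 / \<tau> * (c1 * X + 2 * C * (b1 * X)) = (2 * sqrt A0 * sqrt X + (2 * c1 + 4 * C * b1) * X) / \<tau>"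
    by (simp add: \<eta>_def real_sqrt_mult add_divide_distrib algebra_simps)
  also have "\<dots> \<le> (2 * sqrt A0 * sqrt X + (2 * c1 + 4 * C * b1) * sqrt X) / \<tau>"
    using sX nonneg C \<tau> by (intro divide_right_mono add_left_mono mult_left_mono) auto
  also have "\<dots> = (2 * sqrt A0 + 2 * c1 + 4 * C * b1) * sqrt X / \<tau>" by (simp add: algebra_simps)
  finally have "\<bar>H / real n - I\<bar> \<le> (2 * sqrt A0 + 2 * c1 + 4 * C * b1) * sqrt X / \<tau>" using a b by linarith
  thus ?thesis unfolding H_def I_def A0_def n_def .
qed

end

text \<open>Blocks of side about sqrt N and the radius \<open>r\<close> of order N^(-1/2) make every
  error a power of N. The statement is deterministic: randomness enters through a bound on
  \<open>max_sv Q\<close> only.\<close>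

lemma log_det_asymptotics:
  fixes \<rho> \<kappa>1 \<kappa>3 \<kappa>4 \<delta>0 :: real
    and \<U> :: "(real ^ 'd::finite) set set"
    and p :: "real ^ 'd \<Rightarrow> real ^ 'd \<Rightarrow> complex"
    and e :: "nat \<Rightarrow> nat \<Rightarrow> int ^ 'd" and R :: "nat \<Rightarrow> complex mat"
  assumes \<rho>: "0 < \<rho>" and symbol: "pw_symbol \<rho> \<U> p"
    and enum: "\<And>N. N \<ge> 1 \<Longrightarrow> bij_betw (e N) {..<N ^ CARD('d)} (grid N)"
    and A1: "0 < \<kappa>1"
      "(\<lambda>r. measure lebesgue ({u + v | u v. u \<in> singular_set \<U> \<and> v \<in> ball 0 r} \<inter> unit_cube))
         \<in> O[at_right 0](\<lambda>r. r powr \<kappa>1)"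
    and delta0: "0 < \<delta>0"
    and R: "\<And>N. N \<ge> 1 \<Longrightarrow> R N \<in> carrier_mat (N ^ CARD('d)) (N ^ CARD('d))"
    and kappa4: "0 < \<kappa>4"
    and R_rank: "(\<lambda>N. real (vec_space.rank (N ^ CARD('d)) (R N))) \<in> O(\<lambda>N. real N powr (real CARD('d) - \<kappa>4))"
    and R_norm: "(\<lambda>N. max_sv (R N)) \<in> O(\<lambda>N. 1)"
  shows "\<exists>A c. A \<ge> 0 \<and> c > 0 \<and> (\<forall>\<^sub>F N in sequentially. \<forall>Q z \<tau> u h.
    Q \<in> carrier_mat (N ^ CARD('d)) (N ^ CARD('d)) \<longrightarrow> max_sv Q \<le> real N powr (\<kappa>3 + \<delta>0 / 2) \<longrightarrow> \<tau> > 0 \<longrightarrow>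
    svd (N ^ CARD('d)) (symbol_matrix N (e N) p + R N + complex_of_real (real N powr (- (\<kappa>3 + \<delta>0))) \<cdot>\<^sub>m Q - z \<cdot>\<^sub>m 1\<^sub>m (N ^ CARD('d))) u h \<longrightarrow>
    \<bar>(\<Sum>i<N ^ CARD('d). ln (\<tau>\<^sup>2 + h i)) / real (N ^ CARD('d)) - (LINT u|symbol_law p. ln (\<tau>\<^sup>2 + (cmod (u - z))\<^sup>2))\<bar>
      \<le> A * real N powr - c / \<tau>)"
proof -
  have null: "negligible (singular_set \<U>)" by (rule singular_set_negligible[OF symbol A1])
  obtain C where C: "C \<ge> 0" and C': "\<forall>x\<in>unit_cube. \<forall>\<xi>. cmod (p x \<xi>) \<le> C"
    "\<forall>U\<in>\<U>. \<forall>x\<in>U. \<forall>y\<in>U. \<forall>\<xi>. cmod (p x \<xi> - p y \<xi>) \<le> C * dist x y powr \<rho>"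
    "\<forall>U\<in>\<U>. \<forall>x\<in>U. \<forall>\<xi> \<eta>. cmod (p x \<xi> - p x \<eta>) \<le> C * (\<Sum>i\<in>UNIV. \<bar>vec_nth \<xi> i - vec_nth \<eta> i\<bar>)"
    using pw_symbol_bounds[OF symbol] by (elim exE conjE)
  have bound: "\<And>x \<xi>. x \<in> unit_cube \<Longrightarrow> cmod (p x \<xi>) \<le> C"
    and hoelder: "\<And>U x y \<xi>. U \<in> \<U> \<Longrightarrow> x \<in> U \<Longrightarrow> y \<in> U \<Longrightarrow> cmod (p x \<xi> - p y \<xi>) \<le> C * dist x y powr \<rho>"
    and lip: "\<And>U x \<xi> \<eta>. U \<in> \<U> \<Longrightarrow> x \<in> U \<Longrightarrow> cmod (p x \<xi> - p x \<eta>) \<le> C * (\<Sum>i\<in>UNIV. \<bar>vec_nth \<xi> i - vec_nth \<eta> i\<bar>)"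
    using C' by simp_all
  note ctx = symbol \<rho> null C bound hoelder
  let ?d = "real CARD('d)"
  have d1: "?d \<ge> 1" by simp
  obtain C1 where C1: "C1 > 0" "\<forall>\<^sub>F r in at_right 0. norm (measure lebesgue ({u + v | u v. u \<in> singular_set \<U> \<and> v \<in> ball 0 r} \<inter> unit_cube)) \<le> C1 * norm (r powr \<kappa>1)"
    using A1(2) landau_o.bigE by blast
  obtain r1 where r1: "r1 > 0" "\<And>r. 0 < r \<Longrightarrow> r < r1 \<Longrightarrow> measure lebesgue ({u + v | u v. u \<in> singular_set \<U> \<and> v \<in> ball 0 r} \<inter> unit_cube) \<le> C1 * r powr \<kappa>1"
    using C1(2) unfolding eventually_at_right_field by auto
  obtain cR where cR: "cR > 0" "\<forall>\<^sub>F N in sequentially. norm (real (vec_space.rank (N ^ CARD('d)) (R N))) \<le> cR * norm (real N powr (?d - \<kappa>4))"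
    using R_rank landau_o.bigE by blast
  obtain cS where cS: "cS > 0" "\<forall>\<^sub>F N in sequentially. norm (max_sv (R N)) \<le> cS * norm (1::real)"
    using R_norm landau_o.bigE by blast
  \<comment> \<open>One entry for each error: the bad points and the Hoelder variation at radius
    N^(-1/2) give \<open>\<kappa>1 / 2\<close> and \<open>\<rho> / 2\<close>, the Fourier tail 1/2,
    the low rank part \<open>\<kappa>4\<close>, and the scaled matrix \<open>Q\<close> gives
    \<open>\<delta>0\<close>.\<close>
  define c0 where "c0 = min (min (\<kappa>1 / 2) (\<rho> / 2)) (min (1 / 2) (min \<kappa>4 \<delta>0))"
  have c0: "c0 > 0" "c0 \<le> \<kappa>1 / 2" "c0 \<le> \<rho> / 2" "c0 \<le> 1 / 2" "c0 \<le> \<kappa>4" "c0 \<le> \<delta>0"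
    unfolding c0_def using A1(1) \<rho> kappa4 delta0 by simp_all
  define b1 where "b1 = C1 * (8 * ?d) powr \<kappa>1"
  define c1 where "c1 = C * (8 * ?d) powr \<rho>"
  define c2 where "c2 = 2 * (cR * cS\<^sup>2) + 2"
  have nonneg: "b1 \<ge> 0" "c1 \<ge> 0" "c2 \<ge> 0" unfolding b1_def c1_def c2_def using C1(1) C cR(1) by auto
  define A where "A = 2 * sqrt (8 * (c1\<^sup>2 + 4 * C\<^sup>2 * b1) + 10 * (4 * C\<^sup>2 * ?d\<^sup>2 + C\<^sup>2 * b1) + 4 * c2 + 1) + 2 * c1 + 4 * C * b1"
  have A: "A \<ge> 0" unfolding A_def using nonneg C by (intro add_nonneg_nonneg mult_nonneg_nonneg real_sqrt_ge_zero) auto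
  have small: "\<forall>\<^sub>F N in sequentially. (8 * ?d) * real N powr - (1 / 2) < r1"
  proof -
    have "(\<lambda>N. (8 * ?d) * real N powr - (1 / 2)) \<longlonglongrightarrow> (8 * ?d) * 0"
      by (intro tendsto_mult tendsto_const tendsto_neg_powr filterlim_real_sequentially) simp
    from order_tendstoD(2)[OF this, of r1] r1(1) show ?thesis by simp
  qed
  show ?thesis
  proof (rule exI[of _ A], rule exI[of _ "c0 / 2"], intro conjI)
    show "A \<ge> 0" by (rule A)
    show "c0 / 2 > 0" using c0 by simp
    show "\<forall>\<^sub>F N in sequentially. \<forall>Q z \<tau> u h.
      Q \<in> carrier_mat (N ^ CARD('d)) (N ^ CARD('d)) \<longrightarrow> max_sv Q \<le> real N powr (\<kappa>3 + \<delta>0 / 2) \<longrightarrow> \<tau> > 0 \<longrightarrow>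
      svd (N ^ CARD('d)) (symbol_matrix N (e N) p + R N + complex_of_real (real N powr (- (\<kappa>3 + \<delta>0))) \<cdot>\<^sub>m Q - z \<cdot>\<^sub>m 1\<^sub>m (N ^ CARD('d))) u h \<longrightarrow>
      \<bar>(\<Sum>i<N ^ CARD('d). ln (\<tau>\<^sup>2 + h i)) / real (N ^ CARD('d)) - (LINT u|symbol_law p. ln (\<tau>\<^sup>2 + (cmod (u - z))\<^sup>2))\<bar>
        \<le> A * real N powr - (c0 / 2) / \<tau>"
      \<comment> \<open>From 4 on, sqrt N is at least 2, which gives both
        \<open>m \<le> 2 * sqrt N\<close> and \<open>m \<le> N\<close> for the rounded block side
        \<open>m\<close>.\<close>
      using cR(2) cS(2) small eventually_ge_at_top[of 4]
    proof eventually_elim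
      case (elim N)
      have N: "N \<ge> 1" "real N \<ge> 4" using elim by auto
      define n where "n = N ^ CARD('d)"
      have n0: "n > 0" using N by (simp add: n_def)
      have nN: "real n = real N powr ?d" using N by (simp add: n_def powr_realpow)
      define X where "X = real N powr - c0"
      have mono: "real N powr - a \<le> X" if "a \<ge> c0" for a unfolding X_def using N that by (intro powr_mono) auto
      have X: "0 < X" "X \<le> 1"
      proof -
        show "0 < X" using N by (simp add: X_def)
        have "real N powr - c0 \<le> real N powr 0" using N c0 by (intro powr_mono) auto
        thus "X \<le> 1" using N by (simp add: X_def)
      qed
      have sq: "real N powr - (1 / 2) = 1 / sqrt (real N)" by (simp only: powr_minus_divide powr_half_sqrt[OF of_nat_0_le_iff])
      define m where "m = nat \<lceil>sqrt (real N)\<rceil>"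
      have s2: "sqrt (real N) \<ge> 2" using N by (intro real_le_rsqrt) auto
      have sN: "sqrt (real N) * sqrt (real N) = real N" by simp
      have m: "sqrt (real N) \<le> real m" "real m < sqrt (real N) + 1" unfolding m_def using s2 by linarith+
      have m2: "real m \<le> 2 * sqrt (real N)" using m s2 by linarith
      have "2 * sqrt (real N) \<le> sqrt (real N) * sqrt (real N)" using s2 by (intro mult_right_mono) auto
      hence mN: "m \<le> N" "m \<ge> 1" using m2 m s2 sN by linarith+
      \<comment> \<open>Blocks have diameter at most \<open>2 * d / sqrt N\<close>; twice this value
        gives the strict inequality required of \<open>r\<close>.\<close>
      define r where "r = (4 * ?d) * real N powr - (1 / 2)"
      have r2: "2 * r = (8 * ?d) * real N powr - (1 / 2)" by (simp add: r_def)
      have rpos: "r > 0" unfolding r_def using d1 N by (intro mult_pos_pos) auto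
      have rm: "?d * (real m / real N) < r"
      proof -
        have "real m / real N \<le> 2 * sqrt (real N) / real N" using m2 by (intro divide_right_mono) auto
        also have "\<dots> = 2 * (1 / sqrt (real N))"
        proof -
          have "2 * s / (s * s) = 2 * (1 / s)" if "s \<noteq> 0" for s :: real using that by simp
          moreover have "sqrt (real N) \<noteq> 0" using s2 by linarith
          ultimately have "2 * sqrt (real N) / (sqrt (real N) * sqrt (real N)) = 2 * (1 / sqrt (real N))" by blast
          thus ?thesis unfolding sN .
        qed
        finally have "?d * (real m / real N) \<le> ?d * (2 * real N powr - (1 / 2))" unfolding sq using d1 by (intro mult_left_mono) auto
        also have "\<dots> = r / 2" by (simp add: r_def)
        finally show ?thesis using rpos by linarith
      qed
      have rd: "?d / real N < r"
      proof -
        have "?d * (1 / real N) \<le> ?d * (real m / real N)" using mN by (intro mult_left_mono divide_right_mono) auto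
        thus ?thesis using rm by simp
      qed
      have powr2: "(2 * r) powr a = (8 * ?d) powr a * real N powr - (a / 2)" for a
        unfolding r2 using d1 by (subst powr_mult) (auto simp: powr_powr)
      have Xm: "1 / real m \<le> X"
      proof -
        have "1 / real m \<le> 1 / sqrt (real N)" using m s2 by (intro divide_left_mono mult_pos_pos) linarith+
        thus ?thesis using mono[of "1 / 2"] c0 unfolding sq by linarith
      qed
      have Xc: "C * (2 * r) powr \<rho> \<le> c1 * X"
        unfolding powr2 c1_def using mono[of "\<rho> / 2"] c0 C by (auto simp: mult.assoc intro!: mult_left_mono)
      have bad: "real (card (bad_points \<U> N r)) \<le> real (N ^ CARD('d)) * (b1 * X)"
      proof -
        have le: "real (card (bad_points \<U> N r)) \<le> real (N ^ CARD('d)) *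
          measure lebesgue ({u + v | u v. u \<in> singular_set \<U> \<and> v \<in> ball 0 (2 * r)} \<inter> unit_cube)"
          by (rule card_bad_points[OF ctx N(1) rd]) assumption+
        have "measure lebesgue ({u + v | u v. u \<in> singular_set \<U> \<and> v \<in> ball 0 (2 * r)} \<inter> unit_cube) \<le> C1 * (2 * r) powr \<kappa>1"
          using elim rpos by (intro r1(2)) (auto simp: r2)
        also have "\<dots> \<le> b1 * X"
          unfolding powr2 b1_def using mono[of "\<kappa>1 / 2"] c0 C1 by (auto simp: mult.assoc intro!: mult_left_mono)
        finally show ?thesis by (intro order_trans[OF le] mult_left_mono) auto
      qed
      show ?case
      proof (intro allI impI)
        fix Q z \<tau> u h
        assume Q: "Q \<in> carrier_mat (N ^ CARD('d)) (N ^ CARD('d))" "max_sv Q \<le> real N powr (\<kappa>3 + \<delta>0 / 2)" and \<tau>: "(\<tau>::real) > 0"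
          and svd: "svd (N ^ CARD('d)) (symbol_matrix N (e N) p + R N + complex_of_real (real N powr (- (\<kappa>3 + \<delta>0))) \<cdot>\<^sub>m Q - z \<cdot>\<^sub>m 1\<^sub>m (N ^ CARD('d))) u h"
        define \<delta> where "\<delta> = real N powr (- (\<kappa>3 + \<delta>0))"
        define D where "D = R N + complex_of_real \<delta> \<cdot>\<^sub>m Q"
        have Dc: "D \<in> carrier_mat n n" "R N \<in> carrier_mat n n" "Q \<in> carrier_mat n n"
          using Q(1) R[OF N(1)] by (auto simp: D_def n_def)
        have HSR: "(\<Sum>k<n. \<Sum>l<n. (cmod (R N $$ (k, l)))\<^sup>2) \<le> real n * (cR * cS\<^sup>2 * X)"
        proof -
          obtain u' h' where s: "svd n (R N) u' h'" using svd_exists[OF Dc(2)] by blast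
          have sv: "max_sv (R N) \<ge> 0" by (rule svd_max(2)[OF s n0])
          have "(\<Sum>k<n. \<Sum>l<n. (cmod (R N $$ (k, l)))\<^sup>2) \<le> real (vec_space.rank n (R N)) * (max_sv (R N))\<^sup>2"
            by (rule svd_hilbert_schmidt_rank[OF s Dc(2) n0])
          also have "\<dots> \<le> (cR * real N powr (?d - \<kappa>4)) * cS\<^sup>2"
            using elim sv cR(1) by (intro mult_mono power_mono) (auto simp: n_def)
          also have "real N powr (?d - \<kappa>4) = real n * real N powr - \<kappa>4" unfolding nN powr_add[symmetric] by simp
          also have "(cR * (real n * real N powr - \<kappa>4)) * cS\<^sup>2 \<le> (cR * (real n * X)) * cS\<^sup>2"
            using mono[of \<kappa>4] c0 cR(1) by (intro mult_right_mono mult_left_mono) auto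
          finally show ?thesis by (simp add: mult_ac)
        qed
        have HSQ: "(\<Sum>k<n. \<Sum>l<n. (cmod (complex_of_real \<delta> * Q $$ (k, l)))\<^sup>2) \<le> real n * X"
        proof -
          obtain u' h' where s: "svd n Q u' h'" using svd_exists[OF Dc(3)] by blast
          have sv: "max_sv Q \<ge> 0" by (rule svd_max(2)[OF s n0])
          have "(\<Sum>k<n. \<Sum>l<n. (cmod (complex_of_real \<delta> * Q $$ (k, l)))\<^sup>2) = \<delta>\<^sup>2 * (\<Sum>k<n. \<Sum>l<n. (cmod (Q $$ (k, l)))\<^sup>2)"
            by (simp add: norm_mult power_mult_distrib sum_distrib_left)
          also have "\<dots> = \<delta>\<^sup>2 * (\<Sum>i<n. h' i)" by (simp add: svd_hilbert_schmidt[OF s])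
          also have "\<dots> \<le> \<delta>\<^sup>2 * (\<Sum>i<n. (max_sv Q)\<^sup>2)" using svd_max(1)[OF s n0] by (intro mult_left_mono sum_mono) auto
          also have "\<dots> = real n * (\<delta> * max_sv Q)\<^sup>2" by (simp add: power_mult_distrib)
          also have "\<dots> \<le> real n * (\<delta> * real N powr (\<kappa>3 + \<delta>0 / 2))\<^sup>2"
            using Q(2) sv by (intro mult_left_mono power_mono) (auto simp: \<delta>_def)
          \<comment> \<open>Half of \<open>\<delta>0\<close> is reserved for Markov's inequality on
            \<open>max_sv Q\<close>; the other half is squared here.\<close>
          also have "(\<delta> * real N powr (\<kappa>3 + \<delta>0 / 2))\<^sup>2 = real N powr - \<delta>0"
            unfolding \<delta>_def powr_add[symmetric] power2_eq_square by simp
          also have "real n * real N powr - \<delta>0 \<le> real n * X" using mono[of \<delta>0] c0 by (intro mult_left_mono) auto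
          finally show ?thesis .
        qed
        have HSD: "(\<Sum>k<n. \<Sum>l<n. (cmod (D $$ (k, l)))\<^sup>2) \<le> real n * (c2 * X)"
        proof -
          have sqs: "(cmod (a + b))\<^sup>2 \<le> 2 * (cmod a)\<^sup>2 + 2 * (cmod b)\<^sup>2" for a b :: complex
          proof -
            have "(cmod (a + b))\<^sup>2 \<le> (cmod a + cmod b)\<^sup>2" by (intro power_mono norm_triangle_ineq) auto
            thus ?thesis using sum_squares_bound[of "cmod a" "cmod b"] by (simp add: power2_sum)
          qed
          have "(\<Sum>k<n. \<Sum>l<n. (cmod (D $$ (k, l)))\<^sup>2) \<le> (\<Sum>k<n. \<Sum>l<n. 2 * (cmod (R N $$ (k, l)))\<^sup>2 + 2 * (cmod (complex_of_real \<delta> * Q $$ (k, l)))\<^sup>2)"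
          proof (intro sum_mono)
            fix k l assume "k \<in> {..<n}" "l \<in> {..<n}"
            hence "D $$ (k, l) = R N $$ (k, l) + complex_of_real \<delta> * Q $$ (k, l)" using Dc by (simp add: D_def)
            thus "(cmod (D $$ (k, l)))\<^sup>2 \<le> 2 * (cmod (R N $$ (k, l)))\<^sup>2 + 2 * (cmod (complex_of_real \<delta> * Q $$ (k, l)))\<^sup>2"
              by (simp only: sqs)
          qed
          also have "\<dots> = 2 * (\<Sum>k<n. \<Sum>l<n. (cmod (R N $$ (k, l)))\<^sup>2) + 2 * (\<Sum>k<n. \<Sum>l<n. (cmod (complex_of_real \<delta> * Q $$ (k, l)))\<^sup>2)"
            by (simp only: sum.distrib sum_distrib_left)
          also have "\<dots> \<le> 2 * (real n * (cR * cS\<^sup>2 * X)) + 2 * (real n * X)" using HSR HSQ by linarith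
          finally show ?thesis by (simp add: c2_def algebra_simps)
        qed
        have assoc: "symbol_matrix N (e N) p + R N + complex_of_real \<delta> \<cdot>\<^sub>m Q = symbol_matrix N (e N) p + D"
          unfolding D_def by (rule assoc_add_mat[of _ n n]) (use Dc in \<open>auto simp: symbol_matrix_def n_def\<close>)
        have "sqrt X = real N powr - (c0 / 2)" by (rule real_sqrt_unique) (simp_all add: X_def power2_eq_square powr_add[symmetric])
        moreover have "\<bar>(\<Sum>i<N ^ CARD('d). ln (\<tau>\<^sup>2 + h i)) / real (N ^ CARD('d)) - (LINT u|symbol_law p. ln (\<tau>\<^sup>2 + (cmod (u - z))\<^sup>2))\<bar>
          \<le> A * sqrt X / \<tau>"
          unfolding A_def
          by (rule symbol_matrix_log_det[OF ctx lip N(1) enum[OF N(1)] mN(2,1) rd rm X Xm Xc bad Dc(1)[unfolded n_def]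
              HSD[unfolded n_def] svd[folded \<delta>_def, unfolded assoc] \<tau> nonneg])
        ultimately show "\<bar>(\<Sum>i<N ^ CARD('d). ln (\<tau>\<^sup>2 + h i)) / real (N ^ CARD('d)) - (LINT u|symbol_law p. ln (\<tau>\<^sup>2 + (cmod (u - z))\<^sup>2))\<bar>
          \<le> A * real N powr - (c0 / 2) / \<tau>" by simp
      qed
    qed
  qed
qed

section \<open>Eigenvalues and the smallest singular value\<close>

lemma sum_mset_count:
  fixes f :: "'a \<Rightarrow> real"
  assumes "finite S" "set_mset \<Lambda> \<subseteq> S"
  shows "(\<Sum>u\<in>#\<Lambda>. f u) = (\<Sum>a\<in>S. real (count \<Lambda> a) * f a)"
  using assms(2)
proof (induction \<Lambda>)
  case (add x A)
  have "(\<Sum>a\<in>S. real (count (add_mset x A) a) * f a) = (\<Sum>a\<in>S. (if a = x then f a else 0) + real (count A a) * f a)"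
    by (rule sum.cong[OF refl]) (simp add: algebra_simps)
  also have "\<dots> = f x + (\<Sum>a\<in>S. real (count A a) * f a)"
    using add.prems assms(1) by (simp add: sum.distrib sum.delta)
  finally show ?case using add by simp
qed simp

lemma proots_char_poly:
  assumes B: "B \<in> carrier_mat n n" and n: "n > 0"
  shows "size (proots (char_poly B)) = n"
    "z \<in># proots (char_poly B) \<longleftrightarrow> det (B - z \<cdot>\<^sub>m 1\<^sub>m n) = 0"
    "z \<notin># proots (char_poly B) \<Longrightarrow>
       avg (proots (char_poly B)) (\<lambda>u. ln (cmod (u - z))) = ln (cmod (det (B - z \<cdot>\<^sub>m 1\<^sub>m n))) / real n"
proof -
  define \<Lambda> where "\<Lambda> = proots (char_poly B)"
  note dm = degree_monic_char_poly[OF B]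
  have nz: "char_poly B \<noteq> 0" using dm n by auto
  show size: "size (proots (char_poly B)) = n" using dm by (simp add: size_proots_complex)
  have "- (char_matrix B z) = (- 1) \<cdot>\<^sub>m (B - z \<cdot>\<^sub>m 1\<^sub>m n)"
    using B by (intro eq_matI) (auto simp: char_matrix_def)
  hence ev: "poly (char_poly B) z = (- 1) ^ n * det (B - z \<cdot>\<^sub>m 1\<^sub>m n)"
    using B by (simp add: char_poly_matrix[OF B] det_smult)
  thus mem: "z \<in># proots (char_poly B) \<longleftrightarrow> det (B - z \<cdot>\<^sub>m 1\<^sub>m n) = 0"
    using nz by (simp add: set_count_proots)
  assume z: "z \<notin># proots (char_poly B)"
  have dec: "(\<Prod>x\<in>#\<Lambda>. [:-x, 1:]) = char_poly B"
    using complex_poly_decompose_multiset[of "char_poly B"] dm by (simp add: \<Lambda>_def)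
  have "poly (\<Prod>x\<in>#A. [:-x, 1:]) z = (\<Prod>x\<in>#A. z - x)" for A
    by (induction A) (auto simp: left_diff_distrib)
  hence pr: "(\<Prod>x\<in>#\<Lambda>. z - x) = (- 1) ^ n * det (B - z \<cdot>\<^sub>m 1\<^sub>m n)" using dec ev by metis
  have "avg \<Lambda> (\<lambda>u. ln (cmod (u - z))) = avg \<Lambda> (\<lambda>u. ln (cmod (z - u)))" by (simp only: norm_minus_commute)
  also have "\<dots> = ln (cmod (\<Prod>x\<in>#\<Lambda>. z - x)) / real (size \<Lambda>)"
    using z by (intro avg_ln_nodes) (simp add: \<Lambda>_def)
  finally show "avg (proots (char_poly B)) (\<lambda>u. ln (cmod (u - z))) = ln (cmod (det (B - z \<cdot>\<^sub>m 1\<^sub>m n))) / real n"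
    unfolding pr using size by (simp add: \<Lambda>_def norm_mult norm_power)
qed

lemma integral_spectral_measure:
  assumes B: "B \<in> carrier_mat n n" and n: "n > 0" and f: "f \<in> borel_measurable borel"
  shows "(LINT u|spectral_measure B. f u) = avg (proots (char_poly B)) f"
proof -
  define \<Lambda> where "\<Lambda> = proots (char_poly B)"
  have ne: "\<Lambda> \<noteq> {#}" using proots_char_poly(1)[OF B n] n by (auto simp: \<Lambda>_def)
  have "(LINT u|spectral_measure B. f u) = (LINT u|measure_pmf (pmf_of_multiset \<Lambda>). f u)"
    unfolding spectral_measure_def \<Lambda>_def[symmetric] by (rule integral_distr) (use f in auto)
  also have "\<dots> = (\<Sum>a\<in>set_mset \<Lambda>. f a * pmf (pmf_of_multiset \<Lambda>) a)"
    by (rule integral_measure_pmf_real) (use ne in auto)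
  also have "\<dots> = (\<Sum>a\<in>set_mset \<Lambda>. real (count \<Lambda> a) * f a) / real (size \<Lambda>)"
    using ne by (simp add: sum_divide_distrib mult.commute)
  also have "\<dots> = avg \<Lambda> f" unfolding avg_def by (subst sum_mset_count[of "set_mset \<Lambda>"]) auto
  finally show ?thesis unfolding \<Lambda>_def .
qed

section \<open>Measurability of the smallest singular value\<close>

lemma borel_measurable_det:
  fixes A :: "'w \<Rightarrow> complex mat"
  assumes "\<And>\<omega>. \<omega> \<in> space M \<Longrightarrow> A \<omega> \<in> carrier_mat n n"
    and "\<And>i j. i < n \<Longrightarrow> j < n \<Longrightarrow> (\<lambda>\<omega>. A \<omega> $$ (i, j)) \<in> borel_measurable M"
  shows "(\<lambda>\<omega>. det (A \<omega>)) \<in> borel_measurable M"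
proof -
  have "(\<lambda>\<omega>. \<Sum>p\<in>{p. p permutes {0..<n}}. signof p * (\<Prod>i = 0..<n. A \<omega> $$ (i, p i))) \<in> borel_measurable M"
  proof (intro borel_measurable_sum borel_measurable_times borel_measurable_const borel_measurable_prod)
    fix p i assume "p \<in> {p. p permutes {0..<n}}" "i \<in> {0..<n}"
    hence "i < n" "p i < n" using permutes_in_image[of p "{0..<n}" i] by auto
    thus "(\<lambda>\<omega>. A \<omega> $$ (i, p i)) \<in> borel_measurable M" by (rule assms(2))
  qed
  thus ?thesis by (subst measurable_cong[OF det_def'[OF assms(1)]])
qed

text \<open>An existence statement over a continuum becomes one with countable quantifiers:
  rationals are dense in the interval, and by compactness arbitrarily small values force a
  zero.\<close>

lemma exists_root_iff_small_values:
  fixes g :: "real \<Rightarrow> complex"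
  assumes g: "continuous_on {0..s} g" and s: "s > 0"
  shows "(\<exists>t\<in>{0..s}. g t = 0) \<longleftrightarrow> (\<forall>k::nat. \<exists>q::rat. of_rat q \<in> {0..s} \<and> cmod (g (of_rat q)) < 1 / real (Suc k))"
proof
  assume "\<exists>t\<in>{0..s}. g t = 0"
  then obtain t where t: "t \<in> {0..s}" "g t = 0" by blast
  show "\<forall>k::nat. \<exists>q::rat. of_rat q \<in> {0..s} \<and> cmod (g (of_rat q)) < 1 / real (Suc k)"
  proof
    fix k :: nat
    have "\<forall>\<epsilon>>0. \<exists>d>0. \<forall>x\<in>{0..s}. dist x t < d \<longrightarrow> dist (g x) (g t) < \<epsilon>"
      using g t(1) unfolding continuous_on_iff by (rule bspec)
    hence "\<exists>d>0. \<forall>x\<in>{0..s}. dist x t < d \<longrightarrow> dist (g x) (g t) < 1 / real (Suc k)"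
      by (elim allE[of _ "1 / real (Suc k)"]) simp
    then obtain d where d: "d > 0" "\<And>x. x \<in> {0..s} \<Longrightarrow> dist x t < d \<Longrightarrow> dist (g x) (g t) < 1 / real (Suc k)"
      by blast
    have "max 0 (t - d) < min s (t + d)" using t d(1) s by auto
    then obtain q where q: "max 0 (t - d) < of_rat q" "of_rat q < min s (t + d)" using of_rat_dense by blast
    hence "of_rat q \<in> {0..s}" "dist (of_rat q) t < d" by (auto simp: dist_real_def)
    thus "\<exists>q::rat. of_rat q \<in> {0..s} \<and> cmod (g (of_rat q)) < 1 / real (Suc k)" using d(2)[of "of_rat q"] t(2) by auto
  qed
next
  assume small: "\<forall>k::nat. \<exists>q::rat. of_rat q \<in> {0..s} \<and> cmod (g (of_rat q)) < 1 / real (Suc k)"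
  have "continuous_on {0..s} (\<lambda>t. cmod (g t))" using g by (rule continuous_on_norm)
  moreover have "{0..s} \<noteq> {}" using s by simp
  ultimately obtain t where t: "t \<in> {0..s}" "\<And>x. x \<in> {0..s} \<Longrightarrow> cmod (g t) \<le> cmod (g x)"
    using continuous_attains_inf[OF compact_Icc] by blast
  have "g t = 0"
  proof (rule ccontr)
    assume "g t \<noteq> 0"
    hence "cmod (g t) > 0" by simp
    then obtain k where k: "1 / real (Suc k) < cmod (g t)" using nat_approx_posE by (metis of_nat_Suc)
    obtain q :: rat where "of_rat q \<in> {0..s}" "cmod (g (of_rat q)) < 1 / real (Suc k)" using small by blast
    thus False using t(2)[of "of_rat q"] k by linarith
  qed
  thus "\<exists>t\<in>{0..s}. g t = 0" using t(1) by blast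
qed

text \<open>The squared singular values are the roots t of the determinant of the positive matrix
  shifted by -t. Small determinants at rational shifts express the event through polynomials in the
  entries and their conjugates.\<close>

lemma min_sv_le_iff:
  assumes A: "A \<in> carrier_mat n n" and n: "n > 0" and c: "c > 0"
  shows "min_sv A \<le> c \<longleftrightarrow> (\<forall>k::nat. \<exists>q::rat. of_rat q \<in> {0..c\<^sup>2} \<and>
    cmod (det ((- complex_of_real (of_rat q)) \<cdot>\<^sub>m 1\<^sub>m n + mat_adjoint A * A)) < 1 / real (Suc k))"
proof -
  obtain u h where svd: "svd n A u h" using svd_exists[OF A] by blast
  define g where "g t = (\<Prod>i<n. - complex_of_real t + of_real (h i))" for t
  have g: "det ((- complex_of_real t) \<cdot>\<^sub>m 1\<^sub>m n + mat_adjoint A * A) = g t" for t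
    unfolding g_def by (rule svd_det_shift[OF svd])
  have root: "g t = 0 \<longleftrightarrow> (\<exists>i<n. h i = t)" for t
  proof -
    have "- complex_of_real t + complex_of_real (h i) = 0 \<longleftrightarrow> h i = t" for i
      by (metis add.commute add_uminus_conv_diff of_real_eq_iff right_minus_eq)
    thus ?thesis by (auto simp: g_def)
  qed
  have "min_sv A \<le> c \<longleftrightarrow> (\<exists>t\<in>{0..c\<^sup>2}. g t = 0)"
  proof
    assume le: "min_sv A \<le> c"
    obtain i where i: "i < n" "min_sv A = sqrt (h i)" using svd_min(3)[OF svd n] by blast
    have hi: "h i \<ge> 0" by (rule svd_nonneg[OF svd i(1)])
    have "(sqrt (h i))\<^sup>2 \<le> c\<^sup>2" using le i(2) hi by (intro power_mono) auto
    thus "\<exists>t\<in>{0..c\<^sup>2}. g t = 0" using hi i(1) by (intro bexI[of _ "h i"]) (auto simp: root)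
  next
    assume "\<exists>t\<in>{0..c\<^sup>2}. g t = 0"
    then obtain i where i: "i < n" "h i \<le> c\<^sup>2" by (auto simp: root)
    have "(min_sv A)\<^sup>2 \<le> c\<^sup>2" using svd_min(1)[OF svd n i(1)] i(2) by simp
    thus "min_sv A \<le> c" using c by (meson less_imp_le power2_le_imp_le)
  qed
  also have "\<dots> \<longleftrightarrow> (\<forall>k::nat. \<exists>q::rat. of_rat q \<in> {0..c\<^sup>2} \<and> cmod (g (of_rat q)) < 1 / real (Suc k))"
    using c by (intro exists_root_iff_small_values) (auto simp: g_def intro!: continuous_on_prod continuous_on_add continuous_on_diff continuous_on_minus continuous_on_of_real continuous_on_const continuous_on_id)
  finally show ?thesis unfolding g .
qed

lemma mat_adjoint_mult_index:
  assumes X: "X \<in> carrier_mat n n" and ij: "i < n" "j < n"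
  shows "(mat_adjoint X * X) $$ (i, j) = (\<Sum>k<n. cnj (X $$ (k, i)) * X $$ (k, j))"
proof -
  note dims = carrier_matD[OF X] carrier_matD[OF mat_adjoint_carrier[OF X]]
  have "(mat_adjoint X * X) $$ (i, j) = scalar_prod (row (mat_adjoint X) i) (col X j)"
    using ij dims by simp
  also have "\<dots> = (\<Sum>k<n. vec_index (row (mat_adjoint X) i) k * vec_index (col X j) k)"
    using dims by (simp add: scalar_prod_def atLeast0LessThan)
  also have "\<dots> = (\<Sum>k<n. cnj (X $$ (k, i)) * X $$ (k, j))"
    using ij dims by (intro sum.cong refl) (simp add: mat_adjoint_index[OF X])
  finally show ?thesis .
qed

text \<open>The union bound needs genuine events, since \<open>measure\<close> is 0 on sets outside
  the sigma-algebra.\<close>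

lemma min_sv_event_measurable:
  assumes Q: "random_matrix M n Q" and A: "A \<in> carrier_mat n n" and n: "n > 0" and c: "c > 0"
  shows "{\<omega> \<in> space M. min_sv (A + Q \<omega>) \<le> c} \<in> sets M"
proof -
  have Qc: "Q \<omega> \<in> carrier_mat n n" if "\<omega> \<in> space M" for \<omega> using Q that by (auto simp: random_matrix_def)
  have mQ: "(\<lambda>\<omega>. Q \<omega> $$ (i, j)) \<in> borel_measurable M" if "i < n" "j < n" for i j using Q that by (auto simp: random_matrix_def)
  have ent: "((- complex_of_real t) \<cdot>\<^sub>m 1\<^sub>m n + mat_adjoint (A + Q \<omega>) * (A + Q \<omega>)) $$ (i, j) =
      - complex_of_real t * of_bool (i = j) + (\<Sum>k<n. cnj (A $$ (k, i) + Q \<omega> $$ (k, i)) * (A $$ (k, j) + Q \<omega> $$ (k, j)))"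
    if w: "\<omega> \<in> space M" and ij: "i < n" "j < n" for \<omega> i j t
  proof -
    have AQ: "A + Q \<omega> \<in> carrier_mat n n" using A Qc[OF w] by simp
    have ad: "mat_adjoint (A + Q \<omega>) \<in> carrier_mat n n" by (rule mat_adjoint_carrier[OF AQ])
    have "(mat_adjoint (A + Q \<omega>) * (A + Q \<omega>)) $$ (i, j) = (\<Sum>k<n. cnj ((A + Q \<omega>) $$ (k, i)) * (A + Q \<omega>) $$ (k, j))"
      by (rule mat_adjoint_mult_index[OF AQ ij])
    also have "\<dots> = (\<Sum>k<n. cnj (A $$ (k, i) + Q \<omega> $$ (k, i)) * (A $$ (k, j) + Q \<omega> $$ (k, j)))"
      using ij A Qc[OF w] by (intro sum.cong refl) auto
    finally show ?thesis using ij AQ ad by auto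
  qed
  have meas: "(\<lambda>\<omega>. det ((- complex_of_real t) \<cdot>\<^sub>m 1\<^sub>m n + mat_adjoint (A + Q \<omega>) * (A + Q \<omega>))) \<in> borel_measurable M" for t
  proof (rule borel_measurable_det)
    show "(- complex_of_real t) \<cdot>\<^sub>m 1\<^sub>m n + mat_adjoint (A + Q \<omega>) * (A + Q \<omega>) \<in> carrier_mat n n" if "\<omega> \<in> space M" for \<omega>
    proof -
      have "A + Q \<omega> \<in> carrier_mat n n" using A Qc[OF that] by simp
      thus ?thesis using mat_adjoint_carrier[of "A + Q \<omega>" n] by auto
    qed
    show "(\<lambda>\<omega>. ((- complex_of_real t) \<cdot>\<^sub>m 1\<^sub>m n + mat_adjoint (A + Q \<omega>) * (A + Q \<omega>)) $$ (i, j)) \<in> borel_measurable M" if "i < n" "j < n" for i j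
    proof (subst measurable_cong[OF ent[OF _ that]])
      show "(\<lambda>\<omega>. - complex_of_real t * of_bool (i = j) + (\<Sum>k<n. cnj (A $$ (k, i) + Q \<omega> $$ (k, i)) * (A $$ (k, j) + Q \<omega> $$ (k, j)))) \<in> borel_measurable M"
        using that mQ by (intro borel_measurable_add borel_measurable_const borel_measurable_sum borel_measurable_times borel_measurable_cnj) auto
    qed
  qed
  have "{\<omega> \<in> space M. min_sv (A + Q \<omega>) \<le> c} = {\<omega> \<in> space M. \<forall>k::nat. \<exists>q::rat. of_rat q \<in> {0..c\<^sup>2} \<and>
     cmod (det ((- complex_of_real (of_rat q)) \<cdot>\<^sub>m 1\<^sub>m n + mat_adjoint (A + Q \<omega>) * (A + Q \<omega>))) < 1 / real (Suc k)}"
    by (rule Collect_cong, rule conj_cong[OF refl], rule min_sv_le_iff[OF _ n c]) (use A Qc in simp)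
  also have "\<dots> \<in> sets M"
  proof (intro sets.sets_Collect_countable_All sets.sets_Collect_countable_Ex sets.sets_Collect_conj sets.sets_Collect_const)
    fix k :: nat and q :: rat
    have "(\<lambda>\<omega>. cmod (det ((- complex_of_real (of_rat q)) \<cdot>\<^sub>m 1\<^sub>m n + mat_adjoint (A + Q \<omega>) * (A + Q \<omega>)))) \<in> borel_measurable M"
      by (rule measurable_compose[OF meas borel_measurable_norm])
    thus "{\<omega> \<in> space M. cmod (det ((- complex_of_real (of_rat q)) \<cdot>\<^sub>m 1\<^sub>m n + mat_adjoint (A + Q \<omega>) * (A + Q \<omega>))) < 1 / real (Suc k)} \<in> sets M"
      by (intro borel_measurable_less borel_measurable_const)
  qed
  finally show ?thesis .
qed

text \<open>
  Singular values below \<open>\<tau>\<close> are rare, since each of them contributes a large amount to the difference of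
  the log-determinants regularized at \<open>\<tau>'\<close> and at \<open>\<tau>\<close>; a lower bound \<open>s\<close> then limits what they can
  take away from the determinant itself.
\<close>

lemma log_shift_comparison:
  fixes h s \<tau> \<tau>' c :: real
  assumes s: "0 < s" "s \<le> h" and \<tau>: "0 < \<tau>" "2 * \<tau>\<^sup>2 \<le> \<tau>'\<^sup>2" and c: "c \<ge> 3"
    and le: "ln (1 + \<tau>\<^sup>2 / s) \<le> c * ln (\<tau>'\<^sup>2 / (2 * \<tau>\<^sup>2))"
  shows "ln (\<tau>\<^sup>2 + h) - ln h \<le> c * (ln (\<tau>'\<^sup>2 + h) - ln (\<tau>\<^sup>2 + h)) + \<tau>\<^sup>2 / \<tau>'\<^sup>2"
proof -
  have t2: "\<tau>\<^sup>2 > 0" using \<tau> by simp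
  hence tp: "\<tau>'\<^sup>2 > 0" "\<tau>\<^sup>2 \<le> \<tau>'\<^sup>2" using \<tau>(2) by linarith+
  have h: "h > 0" using s by linarith
  have nz: "\<tau>\<^sup>2 + h \<noteq> 0" "\<tau>'\<^sup>2 + h \<noteq> 0" "h \<noteq> 0" using h t2 tp by linarith+
  have e1: "ln (\<tau>\<^sup>2 + h) - ln h = ln (1 + \<tau>\<^sup>2 / h)"
  proof -
    have "1 + \<tau>\<^sup>2 / h = (\<tau>\<^sup>2 + h) / h" using h by (simp add: add_divide_distrib)
    thus ?thesis using nz by (simp add: ln_div)
  qed
  have e2: "ln (\<tau>'\<^sup>2 + h) - ln (\<tau>\<^sup>2 + h) = ln ((\<tau>'\<^sup>2 + h) / (\<tau>\<^sup>2 + h))"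
    using nz by (simp add: ln_div)
  have q0: "\<tau>\<^sup>2 / \<tau>'\<^sup>2 \<ge> 0" using tp t2 by simp
  have d0: "0 \<le> ln (\<tau>'\<^sup>2 + h) - ln (\<tau>\<^sup>2 + h)" using h t2 tp by (simp add: ln_mono add_pos_pos)
  consider "h \<le> \<tau>\<^sup>2" | "\<tau>\<^sup>2 < h" "h < \<tau>'\<^sup>2" | "\<tau>'\<^sup>2 \<le> h" by linarith
  thus ?thesis
  proof cases
    case 1
    \<comment> \<open>For small \<open>h\<close> the loss is at most ln (1 + \<tau>^2 / s), while
      the difference of the regularized logarithms is at least ln (\<tau>'^2 / (2 \<tau>^2));
      hypothesis \<open>le\<close> is the exchange rate.\<close>
    have "\<tau>\<^sup>2 / h \<le> \<tau>\<^sup>2 / s" using s h t2 by (intro divide_left_mono) auto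
    hence "ln (1 + \<tau>\<^sup>2 / h) \<le> ln (1 + \<tau>\<^sup>2 / s)" using h t2 by (intro ln_mono) (auto intro!: add_pos_pos)
    also note le
    also have "c * ln (\<tau>'\<^sup>2 / (2 * \<tau>\<^sup>2)) \<le> c * ln ((\<tau>'\<^sup>2 + h) / (\<tau>\<^sup>2 + h))"
    proof (intro mult_left_mono ln_mono)
      show "0 < \<tau>'\<^sup>2 / (2 * \<tau>\<^sup>2)" using tp t2 by simp
      show "\<tau>'\<^sup>2 / (2 * \<tau>\<^sup>2) \<le> (\<tau>'\<^sup>2 + h) / (\<tau>\<^sup>2 + h)" using 1 h t2 tp by (intro frac_le) auto
    qed (use c h tp t2 in \<open>auto intro!: divide_pos_pos add_pos_pos\<close>)
    finally show ?thesis unfolding e1 e2 using q0 by linarith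
  next
    case 2
    have "\<tau>\<^sup>2 / h \<le> 1" unfolding divide_le_eq_1_pos[OF h] using 2(1) by simp
    moreover have "0 \<le> \<tau>\<^sup>2 / h" by (rule divide_nonneg_pos[OF zero_le_power2 h])
    ultimately have "ln (1 + \<tau>\<^sup>2 / h) \<le> ln 2" by (intro ln_mono) linarith+
    \<comment> \<open>In the middle range the loss is at most ln 2 and the regularized logarithms
      differ by at least ln (4/3); hence the requirement \<open>c \<ge> 3\<close>.\<close>
    also have "ln 2 \<le> 3 * ln (4 / 3 :: real)"
    proof -
      have "ln 2 \<le> ln ((4 / 3 :: real) ^ 3)" by (intro ln_mono) (auto simp: power3_eq_cube)
      thus ?thesis by (simp add: ln_realpow)
    qed
    also have "3 * ln (4 / 3 :: real) \<le> c * ln ((\<tau>'\<^sup>2 + h) / (\<tau>\<^sup>2 + h))"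
    proof (intro mult_mono ln_mono)
      have "4 * (\<tau>\<^sup>2 + h) \<le> 3 * (\<tau>'\<^sup>2 + h)" unfolding distrib_left using 2 \<tau>(2) by linarith
      thus "4 / 3 \<le> (\<tau>'\<^sup>2 + h) / (\<tau>\<^sup>2 + h)" using h t2 by (simp add: pos_le_divide_eq add_pos_pos)
    qed (use c in auto)
    finally show ?thesis unfolding e1 e2 using q0 by linarith
  next
    case 3
    have "ln (1 + \<tau>\<^sup>2 / h) \<le> \<tau>\<^sup>2 / h" using h t2 by (intro ln_add_one_self_le_self) auto
    also have "\<dots> \<le> \<tau>\<^sup>2 / \<tau>'\<^sup>2" using 3 t2 by (intro divide_left_mono mult_pos_pos h tp(1)) auto
    finally have "ln (1 + \<tau>\<^sup>2 / h) \<le> \<tau>\<^sup>2 / \<tau>'\<^sup>2" .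
    moreover have "0 \<le> c * (ln (\<tau>'\<^sup>2 + h) - ln (\<tau>\<^sup>2 + h))" using d0 c by (intro mult_nonneg_nonneg) auto
    ultimately show ?thesis unfolding e1 by linarith
  qed
qed

text \<open>The norm is at most the Hilbert-Schmidt norm. The loss of a factor \<open>n\<close> is
  harmless where only polynomial growth is asked for.\<close>

lemma max_sv_le_entries:
  assumes A: "A \<in> carrier_mat n n" and n: "n > 0" and b: "b \<ge> 0"
    and le: "\<And>k l. k < n \<Longrightarrow> l < n \<Longrightarrow> cmod (A $$ (k, l)) \<le> b"
  shows "max_sv A \<le> real n * b"
proof -
  obtain u h where svd: "svd n A u h" using svd_exists[OF A] by blast
  obtain i where i: "i < n" "max_sv A = sqrt (h i)" using svd_max(3)[OF svd n] by blast
  have "h i \<le> (\<Sum>i<n. h i)" using i svd_nonneg[OF svd] by (intro member_le_sum) auto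
  also have "\<dots> = (\<Sum>k<n. \<Sum>l<n. (cmod (A $$ (k, l)))\<^sup>2)" by (rule svd_hilbert_schmidt[OF svd, symmetric])
  also have "\<dots> \<le> (\<Sum>k<n. \<Sum>l<n. b\<^sup>2)" using le by (intro sum_mono power_mono) auto
  also have "\<dots> = (real n * b)\<^sup>2" by (simp add: power_mult_distrib power2_eq_square)
  finally show ?thesis unfolding i(2) using b by (intro real_le_lsqrt) auto
qed

lemma entry_le_max_sv:
  assumes A: "A \<in> carrier_mat n n" and n: "n > 0" and kl: "k < n" "l < n"
  shows "cmod (A $$ (k, l)) \<le> max_sv A"
proof -
  obtain u h where svd: "svd n A u h" using svd_exists[OF A] by blast
  have d: "(\<Sum>j<n. A $$ (k', j) * of_bool (j = l)) = A $$ (k', l)" for k'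
  proof -
    have "(\<Sum>j<n. A $$ (k', j) * of_bool (j = l)) = (\<Sum>j<n. if j = l then A $$ (k', j) else 0)"
      by (rule sum.cong) auto
    thus ?thesis using kl by simp
  qed
  have o: "(\<Sum>j<n. (cmod (of_bool (j = l)))\<^sup>2) = 1"
  proof -
    have "(\<Sum>j<n. (cmod (of_bool (j = l)))\<^sup>2) = (\<Sum>j<n. if j = l then 1 else 0)" by (rule sum.cong) auto
    thus ?thesis using kl by simp
  qed
  have "(cmod (A $$ (k, l)))\<^sup>2 \<le> (\<Sum>k'<n. (cmod (A $$ (k', l)))\<^sup>2)" using kl by (intro member_le_sum) auto
  also have "\<dots> \<le> (max_sv A)\<^sup>2" using svd_norm_le[OF svd n, of "\<lambda>j. of_bool (j = l)"] unfolding d o by simp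
  finally show ?thesis using svd_max(2)[OF svd n] by (meson power2_le_imp_le)
qed

lemma fcoeff_bound:
  fixes g :: "real ^ 'd::finite \<Rightarrow> complex"
  assumes "continuous_on UNIV g" "\<And>\<xi>. cmod (g \<xi>) \<le> K"
  shows "cmod (fcoeff g \<nu>) \<le> K"
proof -
  interpret prob_space "cube_measure :: (real ^ 'd) measure" by (rule prob_space_cube)
  have "cmod (fcoeff g \<nu>) \<le> (LINT \<xi>|cube_measure. cmod (g \<xi> * cnj (character \<nu> \<xi>)))"
    unfolding fcoeff_def by (rule integral_norm_bound)
  also have "\<dots> \<le> (LINT \<xi>|(cube_measure :: (real ^ 'd) measure). K)"
  proof (rule integral_mono)
    show "integrable cube_measure (\<lambda>\<xi>. cmod (g \<xi> * cnj (character \<nu> \<xi>)))"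
      by (intro integrable_cube continuous_on_norm continuous_on_mult continuous_on_cnj continuous_on_character assms)
    show "cmod (g \<xi> * cnj (character \<nu> \<xi>)) \<le> K" for \<xi> using assms(2)[of \<xi>] by (simp add: norm_mult)
  qed simp
  finally show ?thesis using prob_space by simp
qed

lemma symbol_matrix_entry_bound:
  assumes p: "pw_symbol \<rho> \<U> p" and N: "N \<ge> 1" and e: "\<And>k. k < N ^ CARD('d::finite) \<Longrightarrow> e k \<in> (grid N :: (int ^ 'd) set)"
    and C: "\<And>x \<xi>. x \<in> unit_cube \<Longrightarrow> cmod (p x \<xi>) \<le> C"
    and kl: "k < N ^ CARD('d)" "l < N ^ CARD('d)"
  shows "cmod (symbol_matrix N e p $$ (k, l)) \<le> C"
proof -
  have x: "sample_point N (e k) \<in> unit_cube" by (rule sample_point_in_cube[OF N e[OF kl(1)]])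
  have "symbol_matrix N e p $$ (k, l) = fcoeff (p (sample_point N (e k))) (e k - e l)"
    using kl by (simp add: symbol_matrix_def fourier_coeff_eq sample_point_def)
  thus ?thesis using fcoeff_bound[OF torus_smooth_continuous[OF pieces(5)[OF p x]] C[OF x]] by simp
qed

text \<open>The upper bound needs only the fixed scale \<tau>'. For the lower bound the determinant
  is compared with the regularization at a scale \<tau> that is a power of N, and the loss is
  charged to the difference between the scales \<tau> and \<tau>', which is small by
  \<open>reg\<close>. The rate \<open>C\<close> of this exchange does not depend on N.\<close>

lemma potential_close:
  fixes I :: "real \<Rightarrow> complex \<Rightarrow> real" and U :: "complex \<Rightarrow> real"
  assumes reg: "\<And>\<tau> z. \<tau> > 0 \<Longrightarrow> 2 * U z \<le> I \<tau> z" "\<And>\<tau> z. \<tau> > 0 \<Longrightarrow> I \<tau> z \<le> 2 * U z + D * \<tau> powr \<kappa>"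
    and D: "D \<ge> 0" and \<kappa>: "\<kappa> > 0" and A: "A \<ge> 0" and c: "c > 0" and q: "q > 0" and \<eta>: "\<eta> > 0"
  shows "\<forall>\<^sub>F N in sequentially. \<forall>n h z. n > 0 \<longrightarrow> (\<forall>i<n. h i > 0) \<longrightarrow>
    (\<forall>\<tau>>0. \<bar>(\<Sum>i<n. ln (\<tau>\<^sup>2 + h i)) / real n - I \<tau> z\<bar> \<le> A * real N powr - c / \<tau>) \<longrightarrow>
    (\<Sum>i<n. ln (h i)) / (2 * real n) \<le> U z + \<eta> \<and>
    ((\<forall>i<n. real N powr - q \<le> h i) \<longrightarrow> U z - \<eta> \<le> (\<Sum>i<n. ln (h i)) / (2 * real n))"
proof -
  \<comment> \<open>With \<open>\<tau> = N powr - \<gamma>\<close> the error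
    \<open>N powr - c / \<tau>\<close> is again \<open>N powr - \<gamma>\<close>.\<close>
  define \<gamma> where "\<gamma> = c / 2"
  have \<gamma>: "\<gamma> > 0" using c by (simp add: \<gamma>_def)
  \<comment> \<open>The value 3 is demanded by \<open>log_shift_comparison\<close>. The quotient
    compares logarithms: for large N, the loss at the smallest singular value is at most 2 q ln N,
    and the distance between the scales is at least \<gamma> ln N.\<close>
  define C where "C = max 3 (2 * q / \<gamma>)"
  have C: "C \<ge> 3" "C * \<gamma> \<ge> 2 * q" using \<gamma> by (auto simp: C_def max_mult_distrib_right)
  \<comment> \<open>The value of \<open>\<tau>' powr \<kappa>\<close>, chosen so that
    \<open>C\<close> times the regularization error at \<tau>' is at most \<open>\<eta> / 2\<close>;
    \<open>D + 1\<close> avoids division by 0.\<close>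
  define x0 where "x0 = \<eta> / (2 * C * (D + 1))"
  have x0: "x0 > 0" using \<eta> C D by (simp add: x0_def)
  define \<tau>' where "\<tau>' = x0 powr (1 / \<kappa>)"
  have \<tau>': "\<tau>' > 0" using x0 by (simp add: \<tau>'_def)
  have tk: "\<tau>' powr \<kappa> = x0" unfolding \<tau>'_def powr_powr using \<kappa> x0 by simp
  have CD: "C * (D * \<tau>' powr \<kappa>) \<le> \<eta> / 2"
  proof -
    have "a * (\<eta> / (2 * a * b)) * b = \<eta> / 2" if "a \<noteq> 0" "b \<noteq> 0" for a b :: real using that by simp
    from this[of C "D + 1"] have "C * x0 * (D + 1) = \<eta> / 2" using C D by (simp add: x0_def)
    moreover have "C * x0 * (D + 1) = C * (D * x0) + C * x0" by (simp add: algebra_simps)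
    moreover have "0 \<le> C * x0" using C x0 by simp
    ultimately show ?thesis unfolding tk by linarith
  qed
  have Dk0: "0 \<le> D * \<tau>' powr \<kappa>" using D by simp
  have D1: "D * \<tau>' powr \<kappa> \<le> \<eta> / 2"
    using CD mult_right_mono[OF C(1) Dk0] Dk0 by linarith
  have pw: "(\<lambda>N. real N powr - a) \<longlonglongrightarrow> 0" if "a > 0" for a
    using that by (intro tendsto_neg_powr filterlim_real_sequentially) simp
  have "(\<lambda>N. A * real N powr - c / \<tau>') \<longlonglongrightarrow> A * 0 / \<tau>'"
    using \<tau>' by (intro tendsto_divide tendsto_mult tendsto_const pw c) simp
  hence ev1: "\<forall>\<^sub>F N in sequentially. A * real N powr - c / \<tau>' < \<eta> / 2"
    using \<eta> by (intro order_tendstoD(2)) auto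
  have l2: "(\<lambda>N. 2 * (real N powr - \<gamma>)\<^sup>2) \<longlonglongrightarrow> 2 * 0\<^sup>2" by (intro tendsto_mult tendsto_const tendsto_power pw \<gamma>)
  have ev2: "\<forall>\<^sub>F N in sequentially. 2 * (real N powr - \<gamma>)\<^sup>2 < \<tau>'\<^sup>2"
    by (rule order_tendstoD(2)[OF l2]) (use \<tau>' in simp)
  have "(\<lambda>N. A * real N powr - \<gamma> + C * (A * real N powr - \<gamma> + A * real N powr - c / \<tau>') + (real N powr - \<gamma>)\<^sup>2 / \<tau>'\<^sup>2)
     \<longlonglongrightarrow> A * 0 + C * (A * 0 + A * 0 / \<tau>') + 0\<^sup>2 / \<tau>'\<^sup>2"
    using \<tau>' by (intro tendsto_add tendsto_divide tendsto_mult tendsto_const tendsto_power pw c \<gamma>) auto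
  hence ev3: "\<forall>\<^sub>F N in sequentially. A * real N powr - \<gamma> + C * (A * real N powr - \<gamma> + A * real N powr - c / \<tau>') + (real N powr - \<gamma>)\<^sup>2 / \<tau>'\<^sup>2 < \<eta>"
    using \<eta> by (intro order_tendstoD(2)) auto
  have "filterlim (\<lambda>N. ln (real N)) at_top sequentially"
    by (rule filterlim_compose[OF ln_at_top filterlim_real_sequentially])
  \<comment> \<open>The two thresholds say that \<open>\<tau>'\<^sup>2 / 2\<close> is at least
    \<open>N powr - \<gamma>\<close> and that 2 is at most \<open>N powr q\<close>.\<close>
  hence ev4: "\<forall>\<^sub>F N in sequentially. max (- ln (\<tau>'\<^sup>2 / 2) / \<gamma>) (ln 2 / q) \<le> ln (real N)"
    unfolding filterlim_at_top by blast
  show ?thesis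
    using ev1 ev2 ev3 ev4 eventually_ge_at_top[of 1]
  proof eventually_elim
    case (elim N)
    have N: "real N \<ge> 1" using elim by simp
    define \<tau> where "\<tau> = real N powr - \<gamma>"
    have \<tau>: "\<tau> > 0" using N by (simp add: \<tau>_def)
    have \<tau>1: "\<tau>\<^sup>2 \<le> 1"
    proof -
      have "\<tau> \<le> real N powr 0" unfolding \<tau>_def using N \<gamma> by (intro powr_mono) auto
      thus ?thesis using N \<tau> by (simp add: power_le_one)
    qed
    have a1: "A * real N powr - c / \<tau> = A * real N powr - \<gamma>"
    proof -
      have "real N powr - c / real N powr - \<gamma> = real N powr - \<gamma>"
        unfolding powr_diff[symmetric] by (simp add: \<gamma>_def)
      thus ?thesis by (simp only: \<tau>_def times_divide_eq_right[symmetric])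
    qed
    have logs: "ln (1 + \<tau>\<^sup>2 / real N powr - q) \<le> C * ln (\<tau>'\<^sup>2 / (2 * \<tau>\<^sup>2))"
    proof -
      define L where "L = ln (real N)"
      have L: "- ln (\<tau>'\<^sup>2 / 2) \<le> \<gamma> * L" "ln 2 \<le> q * L" "L \<ge> 0"
      proof -
        have m: "- ln (\<tau>'\<^sup>2 / 2) / \<gamma> \<le> L" "ln 2 / q \<le> L"
          using elim(4) unfolding max.bounded_iff L_def by (rule conjunct1, rule conjunct2)
        show "- ln (\<tau>'\<^sup>2 / 2) \<le> \<gamma> * L" using m(1) unfolding pos_divide_le_eq[OF \<gamma>] by (simp only: mult.commute)
        show "ln 2 \<le> q * L" using m(2) unfolding pos_divide_le_eq[OF q] by (simp only: mult.commute)
        show "L \<ge> 0" using N by (simp add: L_def)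
      qed
      have Nq: "real N powr q \<ge> 1" using N q by (intro ge_one_powr_ge_zero) auto
      have "1 + \<tau>\<^sup>2 / real N powr - q = 1 + \<tau>\<^sup>2 * real N powr q" by (simp only: powr_minus_divide) simp
      also have "\<dots> \<le> 2 * real N powr q" using Nq mult_right_mono[OF \<tau>1, of "real N powr q"] by simp
      finally have "ln (1 + \<tau>\<^sup>2 / real N powr - q) \<le> ln (2 * real N powr q)"
        using \<tau> N by (intro ln_mono) (auto intro!: add_pos_nonneg)
      also have "\<dots> = ln 2 + ln (real N powr q)" using N by (intro ln_mult_pos) simp_all
      also have "ln (real N powr q) = q * L" unfolding L_def by simp
      also have "ln 2 + q * L \<le> 2 * q * L" using L(2) by linarith
      also have "\<dots> \<le> C * \<gamma> * L" using C(2) L(3) by (rule mult_right_mono)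
      also have "\<dots> \<le> C * (ln (\<tau>'\<^sup>2 / 2) + 2 * (\<gamma> * L))"
        unfolding mult.assoc using C(1) L(1) by (intro mult_left_mono) linarith+
      also have "ln (\<tau>'\<^sup>2 / 2) + 2 * (\<gamma> * L) = ln (\<tau>'\<^sup>2 / (2 * \<tau>\<^sup>2))"
      proof -
        have "ln (a / (2 * b)) = ln (a / 2) - ln b" if "a > 0" "b > 0" for a b :: real
          using that by (simp add: ln_div ln_mult_pos)
        hence "ln (\<tau>'\<^sup>2 / (2 * \<tau>\<^sup>2)) = ln (\<tau>'\<^sup>2 / 2) - ln (\<tau>\<^sup>2)"
          using \<tau> \<tau>' zero_less_power by blast
        also have "ln (\<tau>\<^sup>2) = 2 * ln \<tau>" using \<tau> by (simp add: ln_realpow)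
        also have "ln \<tau> = - \<gamma> * L" unfolding \<tau>_def L_def by simp
        finally show ?thesis by simp
      qed
      finally show ?thesis .
    qed
    show ?case
    proof (intro allI impI)
      fix n :: nat and h :: "nat \<Rightarrow> real" and z
      assume n: "n > 0" and h: "\<forall>i<n. h i > 0"
        and app: "\<forall>\<tau>>0. \<bar>(\<Sum>i<n. ln (\<tau>\<^sup>2 + h i)) / real n - I \<tau> z\<bar> \<le> A * real N powr - c / \<tau>"
      define E where "E t = (\<Sum>i<n. ln (t\<^sup>2 + h i)) / real n" for t :: real
      define E0 where "E0 = (\<Sum>i<n. ln (h i)) / real n"
      have avg: "(\<Sum>i<n. ln (h i)) / (2 * real n) = E0 / 2" by (simp add: E0_def)
      have b': "\<bar>E \<tau>' - I \<tau>' z\<bar> \<le> A * real N powr - c / \<tau>'" using app \<tau>' by (simp add: E_def)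
      have b: "\<bar>E \<tau> - I \<tau> z\<bar> \<le> A * real N powr - \<gamma>" using app \<tau> unfolding a1[symmetric] by (simp add: E_def)
      have "E0 \<le> E \<tau>'" unfolding E0_def E_def
        using h by (intro divide_right_mono sum_mono ln_mono) auto
      hence up: "E0 / 2 \<le> U z + \<eta>" using b' reg(2)[OF \<tau>', of z] D1 elim(1) \<eta> by linarith
      have low: "U z - \<eta> \<le> E0 / 2" if hq: "\<forall>i<n. real N powr - q \<le> h i"
      proof -
        have "(\<Sum>i<n. ln (\<tau>\<^sup>2 + h i) - ln (h i)) \<le> (\<Sum>i<n. C * (ln (\<tau>'\<^sup>2 + h i) - ln (\<tau>\<^sup>2 + h i)) + \<tau>\<^sup>2 / \<tau>'\<^sup>2)"
        proof (rule sum_mono)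
          fix i assume "i \<in> {..<n}"
          thus "ln (\<tau>\<^sup>2 + h i) - ln (h i) \<le> C * (ln (\<tau>'\<^sup>2 + h i) - ln (\<tau>\<^sup>2 + h i)) + \<tau>\<^sup>2 / \<tau>'\<^sup>2"
            using hq N elim(2) logs C(1) \<tau> by (intro log_shift_comparison[of "real N powr - q"]) (auto simp: \<tau>_def)
        qed
        hence "(\<Sum>i<n. ln (\<tau>\<^sup>2 + h i)) - (\<Sum>i<n. ln (h i)) \<le> C * ((\<Sum>i<n. ln (\<tau>'\<^sup>2 + h i)) - (\<Sum>i<n. ln (\<tau>\<^sup>2 + h i))) + real n * (\<tau>\<^sup>2 / \<tau>'\<^sup>2)"
          by (simp add: sum_subtractf sum.distrib sum_distrib_left[symmetric])
        hence "((\<Sum>i<n. ln (\<tau>\<^sup>2 + h i)) - (\<Sum>i<n. ln (h i))) / real n \<le> (C * ((\<Sum>i<n. ln (\<tau>'\<^sup>2 + h i)) - (\<Sum>i<n. ln (\<tau>\<^sup>2 + h i))) + real n * (\<tau>\<^sup>2 / \<tau>'\<^sup>2)) / real n"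
          by (rule divide_right_mono) simp
        also have "\<dots> = C * (E \<tau>' - E \<tau>) + \<tau>\<^sup>2 / \<tau>'\<^sup>2"
          unfolding E_def using n by (simp add: add_divide_distrib diff_divide_distrib[symmetric])
        finally have cmp: "E \<tau> - E0 \<le> C * (E \<tau>' - E \<tau>) + \<tau>\<^sup>2 / \<tau>'\<^sup>2" by (simp add: E_def E0_def diff_divide_distrib)
        have "E \<tau>' - E \<tau> \<le> D * \<tau>' powr \<kappa> + (A * real N powr - \<gamma> + A * real N powr - c / \<tau>')"
          using b b' reg(1)[OF \<tau>, of z] reg(2)[OF \<tau>', of z] by linarith
        hence "C * (E \<tau>' - E \<tau>) \<le> C * (D * \<tau>' powr \<kappa> + (A * real N powr - \<gamma> + A * real N powr - c / \<tau>'))"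
          using C(1) by (intro mult_left_mono) auto
        also have "\<dots> = C * (D * \<tau>' powr \<kappa>) + C * (A * real N powr - \<gamma> + A * real N powr - c / \<tau>')" by (rule distrib_left)
        finally have "E0 \<ge> E \<tau> - (C * (D * \<tau>' powr \<kappa>) + C * (A * real N powr - \<gamma> + A * real N powr - c / \<tau>')) - \<tau>\<^sup>2 / \<tau>'\<^sup>2"
          using cmp by linarith
        moreover have "E \<tau> \<ge> 2 * U z - A * real N powr - \<gamma>" using b reg(1)[OF \<tau>, of z] by linarith
        ultimately show ?thesis using CD elim(3) \<eta> unfolding \<tau>_def[symmetric] by linarith
      qed
      show "(\<Sum>i<n. ln (h i)) / (2 * real n) \<le> U z + \<eta> \<and>
        ((\<forall>i<n. real N powr - q \<le> h i) \<longrightarrow> U z - \<eta> \<le> (\<Sum>i<n. ln (h i)) / (2 * real n))"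
        unfolding avg using up low by blast
    qed
  qed
qed

text \<open>\<open>h i\<close> is the squared norm of the image of the unit vector
  \<open>u i\<close>, and \<open>X\<close> shrinks no vector by more than its smallest singular
  value.\<close>

lemma scaled_svd_lower:
  assumes X: "X \<in> carrier_mat n n" and n: "n > 0" and svd: "svd n B u h"
    and B: "B = complex_of_real \<delta> \<cdot>\<^sub>m X" and i: "i < n"
  shows "(\<delta> * min_sv X)\<^sup>2 \<le> h i"
proof -
  obtain u' h' where svd': "svd n X u' h'" using svd_exists[OF X] by blast
  have "(min_sv X)\<^sup>2 \<le> (\<Sum>k<n. (cmod (\<Sum>l<n. X $$ (k, l) * u i l))\<^sup>2)"
    using svd_norm_ge[OF svd' n, of "u i"] svd_unit[OF svd i] by simp
  hence "\<delta>\<^sup>2 * (min_sv X)\<^sup>2 \<le> \<delta>\<^sup>2 * (\<Sum>k<n. (cmod (\<Sum>l<n. X $$ (k, l) * u i l))\<^sup>2)" by (intro mult_left_mono) auto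
  also have "\<dots> = (\<Sum>k<n. (cmod (\<Sum>l<n. B $$ (k, l) * u i l))\<^sup>2)"
  proof -
    have eq: "(\<Sum>l<n. B $$ (k, l) * u i l) = complex_of_real \<delta> * (\<Sum>l<n. X $$ (k, l) * u i l)" if "k < n" for k
      unfolding sum_distrib_left B using that X by (intro sum.cong) (auto simp: mult.assoc)
    show ?thesis unfolding sum_distrib_left[of "\<delta>\<^sup>2"]
    proof (intro sum.cong refl)
      fix k assume "k \<in> {..<n}"
      hence k: "k < n" by simp
      show "\<delta>\<^sup>2 * (cmod (\<Sum>l<n. X $$ (k, l) * u i l))\<^sup>2 = (cmod (\<Sum>l<n. B $$ (k, l) * u i l))\<^sup>2"
        unfolding eq[OF k] norm_mult power_mult_distrib by simp
    qed
  qed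
  also have "\<dots> = h i" by (rule svd_image_norm[OF svd i])
  finally show ?thesis by (simp add: power_mult_distrib)
qed

lemma svd_log_det:
  assumes svd: "svd n B u h" and det: "det B \<noteq> 0"
  shows "\<forall>i<n. h i > 0" "ln (cmod (det B)) / real n = (\<Sum>i<n. ln (h i)) / (2 * real n)"
proof -
  have "(\<Prod>i<n. h i) \<noteq> 0"
  proof
    assume "(\<Prod>i<n. h i) = 0"
    hence "(cmod (det B))\<^sup>2 = 0" using svd_det[OF svd] by simp
    thus False using det by simp
  qed
  hence "h i \<noteq> 0" if "i < n" for i using that by auto
  thus pos: "\<forall>i<n. h i > 0" using svd_nonneg[OF svd] by (auto simp: less_le)
  have "2 * ln (cmod (det B)) = ln ((cmod (det B))\<^sup>2)" using det by (simp add: ln_realpow)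
  also have "\<dots> = (\<Sum>i<n. ln (h i))" unfolding svd_det[OF svd] by (rule ln_prod) (use pos in auto)
  finally have "(\<Sum>i<n. ln (h i)) = 2 * ln (cmod (det B))" by simp
  thus "ln (cmod (det B)) / real n = (\<Sum>i<n. ln (h i)) / (2 * real n)" by simp
qed

text \<open>This brings the shifted matrix into the form to which (A3-ii) applies: a scalar times
  the sum of a deterministic matrix and the random one.\<close>

lemma shift_scaled_sum:
  fixes \<delta> :: real
  assumes "S \<in> carrier_mat n n" "Q \<in> carrier_mat n n" "\<delta> \<noteq> 0"
  shows "S + complex_of_real \<delta> \<cdot>\<^sub>m Q - z \<cdot>\<^sub>m 1\<^sub>m n
    = complex_of_real \<delta> \<cdot>\<^sub>m (complex_of_real (1 / \<delta>) \<cdot>\<^sub>m (S - z \<cdot>\<^sub>m 1\<^sub>m n) + Q)"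
  using assms by (intro eq_matI) (auto simp: algebra_simps)

theorem corollary1p3:
  fixes \<rho> \<kappa>1 \<kappa>2 \<kappa>3 \<kappa>4 \<delta>0 :: real
    and \<U> :: "(real ^ 'd::finite) set set"
    and p :: "real ^ 'd \<Rightarrow> real ^ 'd \<Rightarrow> complex"
    and e :: "nat \<Rightarrow> nat \<Rightarrow> int ^ 'd"
    and M :: "nat \<Rightarrow> 'w measure"
    and Q :: "nat \<Rightarrow> 'w \<Rightarrow> complex mat"
    and R :: "nat \<Rightarrow> complex mat"
  assumes rho: "0 < \<rho>" "\<rho> \<le> 1"
    and symbol: "pw_symbol \<rho> \<U> p"
    and enum: "\<And>N. N \<ge> 1 \<Longrightarrow> bij_betw (e N) {..<N ^ CARD('d)} (grid N)"
    and A1: "0 < \<kappa>1" "\<kappa>1 \<le> 1"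
      "(\<lambda>r. measure lebesgue ({u + v | u v. u \<in> singular_set \<U> \<and> v \<in> ball 0 r} \<inter> unit_cube))
         \<in> O[at_right 0](\<lambda>r. r powr \<kappa>1)"
    and A2: "0 < \<kappa>2" "\<kappa>2 \<le> 1"
      "\<exists>C. \<exists>t0>0. \<forall>z. \<forall>t\<in>{0..t0}.
         measure phase_measure {(x, \<xi>) \<in> unit_cube \<times> unit_cube. (cmod (p x \<xi> - z))\<^sup>2 \<le> t}
           \<le> C * t powr \<kappa>2"
    and prob: "\<And>N. N \<ge> 1 \<Longrightarrow> prob_space (M N)"
    and random: "\<And>N. N \<ge> 1 \<Longrightarrow> random_matrix (M N) (N ^ CARD('d)) (Q N)"
    and A3_i: "0 < \<kappa>3"
      "\<And>N. N \<ge> 1 \<Longrightarrow> integrable (M N) (\<lambda>\<omega>. max_sv (Q N \<omega>))"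
      "(\<lambda>N. LINT \<omega>|M N. max_sv (Q N \<omega>)) \<in> O(\<lambda>N. real N powr \<kappa>3)"
    and A3_ii: "\<forall>\<theta>>0. \<exists>\<beta>>0. \<forall>A :: nat \<Rightarrow> complex mat.
      (\<forall>N\<ge>1. A N \<in> carrier_mat (N ^ CARD('d)) (N ^ CARD('d))) \<longrightarrow>
      (\<lambda>N. max_sv (A N)) \<in> O(\<lambda>N. real N powr \<theta>) \<longrightarrow>
      (\<lambda>N. measure (M N) {\<omega> \<in> space (M N). min_sv (A N + Q N \<omega>) \<le> real N powr (-\<beta>)})
        \<longlonglongrightarrow> 0"
    and delta0: "0 < \<delta>0"
    and R: "\<And>N. N \<ge> 1 \<Longrightarrow> R N \<in> carrier_mat (N ^ CARD('d)) (N ^ CARD('d))"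
    and kappa4: "0 < \<kappa>4" "\<kappa>4 \<le> real CARD('d)"
    and R_rank: "(\<lambda>N. real (vec_space.rank (N ^ CARD('d)) (R N)))
      \<in> O(\<lambda>N. real N powr (real CARD('d) - \<kappa>4))"
    and R_norm: "(\<lambda>N. max_sv (R N)) \<in> O(\<lambda>N. 1)"
  shows "weakly_conv_in_prob M
    (\<lambda>N \<omega>. spectral_measure
       (symbol_matrix N (e N) p + R N +
        complex_of_real (real N powr (- (\<kappa>3 + \<delta>0))) \<cdot>\<^sub>m Q N \<omega>))
    (distr phase_measure borel (\<lambda>(x, \<xi>). p x \<xi>))"
proof -
  have null: "negligible (singular_set \<U>)" by (rule singular_set_negligible[OF symbol A1(1,3)])
  obtain C where C: "C \<ge> 0" and C': "\<forall>x\<in>unit_cube. \<forall>\<xi>. cmod (p x \<xi>) \<le> C"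
    "\<forall>U\<in>\<U>. \<forall>x\<in>U. \<forall>y\<in>U. \<forall>\<xi>. cmod (p x \<xi> - p y \<xi>) \<le> C * dist x y powr \<rho>"
    using pw_symbol_bounds[OF symbol] by (elim exE conjE)
  have bound: "\<And>x \<xi>. x \<in> unit_cube \<Longrightarrow> cmod (p x \<xi>) \<le> C"
    and hoelder: "\<And>U x y \<xi>. U \<in> \<U> \<Longrightarrow> x \<in> U \<Longrightarrow> y \<in> U \<Longrightarrow> cmod (p x \<xi> - p y \<xi>) \<le> C * dist x y powr \<rho>"
    using C' by simp_all
  note ctx = symbol rho(1) null C bound hoelder
  define \<mu> where "\<mu> = symbol_law p"
  have law: "distr phase_measure borel (\<lambda>(x, \<xi>). p x \<xi>) = \<mu>"
    unfolding \<mu>_def by (rule symbol_law_def[OF ctx, symmetric]) assumption+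
  have \<mu>: "prob_space \<mu>" unfolding \<mu>_def by (rule symbol_law_prob(1)[OF ctx]) assumption+
  have \<mu>s: "sets \<mu> = sets borel" unfolding \<mu>_def by (rule symbol_law_prob(2)[OF ctx]) assumption+
  have \<mu>K: "AE u in \<mu>. cmod u \<le> C" unfolding \<mu>_def by (rule symbol_law_bound[OF ctx]) assumption+
  obtain C2 t0 where t0: "t0 > 0" and le': "\<forall>z. \<forall>t\<in>{0..t0}.
         measure phase_measure {(x, \<xi>) \<in> unit_cube \<times> unit_cube. (cmod (p x \<xi> - z))\<^sup>2 \<le> t} \<le> C2 * t powr \<kappa>2"
    using A2(3) by (elim exE conjE)
  have le: "measure \<mu> {u. (cmod (u - z))\<^sup>2 \<le> t} \<le> C2 * t powr \<kappa>2" if "0 \<le> t" "t \<le> t0" for z t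
  proof -
    have "measure \<mu> {u. (cmod (u - z))\<^sup>2 \<le> t} = measure phase_measure {(x, \<xi>) \<in> unit_cube \<times> unit_cube. (cmod (p x \<xi> - z))\<^sup>2 \<le> t}"
      unfolding \<mu>_def by (rule symbol_law_measure[OF ctx]) assumption+
    thus ?thesis using le' that by simp
  qed
  have nz: "AE u in \<mu>. u \<noteq> z" for z
    by (rule log_potential_regularization(1)[OF \<mu> \<mu>s \<mu>K A2(1,2) t0 le])
  have iln: "integrable \<mu> (\<lambda>u. ln (cmod (u - z)))" for z
    by (rule log_potential_regularization(2)[OF \<mu> \<mu>s \<mu>K A2(1,2) t0 le])
  have pot: "potential \<mu> z = (LINT u|\<mu>. ln (cmod (u - z)))" for z
    by (rule potential_def[OF \<mu> \<mu>s \<mu>K nz iln])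
  have "\<exists>D\<ge>0. \<forall>\<tau>>0. \<forall>z. integrable \<mu> (\<lambda>u. ln (\<tau>\<^sup>2 + (cmod (u - z))\<^sup>2)) \<and>
       2 * (LINT u|\<mu>. ln (cmod (u - z))) \<le> (LINT u|\<mu>. ln (\<tau>\<^sup>2 + (cmod (u - z))\<^sup>2)) \<and>
       (LINT u|\<mu>. ln (\<tau>\<^sup>2 + (cmod (u - z))\<^sup>2)) \<le> 2 * (LINT u|\<mu>. ln (cmod (u - z))) + D * \<tau> powr \<kappa>2"
    by (rule log_potential_regularization(3)[OF \<mu> \<mu>s \<mu>K A2(1,2) t0 le])
  then obtain D where D: "D \<ge> 0" and D': "\<forall>\<tau>>0. \<forall>z. integrable \<mu> (\<lambda>u. ln (\<tau>\<^sup>2 + (cmod (u - z))\<^sup>2)) \<and>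
       2 * (LINT u|\<mu>. ln (cmod (u - z))) \<le> (LINT u|\<mu>. ln (\<tau>\<^sup>2 + (cmod (u - z))\<^sup>2)) \<and>
       (LINT u|\<mu>. ln (\<tau>\<^sup>2 + (cmod (u - z))\<^sup>2)) \<le> 2 * (LINT u|\<mu>. ln (cmod (u - z))) + D * \<tau> powr \<kappa>2"
    by (elim exE conjE)
  define I where "I \<tau> z = (LINT u|\<mu>. ln (\<tau>\<^sup>2 + (cmod (u - z))\<^sup>2))" for \<tau> z
  have reg: "2 * potential \<mu> z \<le> I \<tau> z" "I \<tau> z \<le> 2 * potential \<mu> z + D * \<tau> powr \<kappa>2" if "\<tau> > 0" for \<tau> z
    using D' that unfolding I_def pot by simp_all
  have "\<exists>A c. A \<ge> 0 \<and> c > 0 \<and> (\<forall>\<^sub>F N in sequentially. \<forall>Q z \<tau> u h.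
    Q \<in> carrier_mat (N ^ CARD('d)) (N ^ CARD('d)) \<longrightarrow> max_sv Q \<le> real N powr (\<kappa>3 + \<delta>0 / 2) \<longrightarrow> \<tau> > 0 \<longrightarrow>
    svd (N ^ CARD('d)) (symbol_matrix N (e N) p + R N + complex_of_real (real N powr (- (\<kappa>3 + \<delta>0))) \<cdot>\<^sub>m Q - z \<cdot>\<^sub>m 1\<^sub>m (N ^ CARD('d))) u h \<longrightarrow>
    \<bar>(\<Sum>i<N ^ CARD('d). ln (\<tau>\<^sup>2 + h i)) / real (N ^ CARD('d)) - I \<tau> z\<bar> \<le> A * real N powr - c / \<tau>)"
    unfolding I_def \<mu>_def
    by (rule log_det_asymptotics[OF rho(1) symbol enum A1(1,3) delta0 R kappa4(1) R_rank R_norm, of \<kappa>3]) assumption+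
  then obtain A c where A: "A \<ge> 0" and c: "c > 0" and asym: "\<forall>\<^sub>F N in sequentially. \<forall>Q z \<tau> u h.
    Q \<in> carrier_mat (N ^ CARD('d)) (N ^ CARD('d)) \<longrightarrow> max_sv Q \<le> real N powr (\<kappa>3 + \<delta>0 / 2) \<longrightarrow> \<tau> > 0 \<longrightarrow>
    svd (N ^ CARD('d)) (symbol_matrix N (e N) p + R N + complex_of_real (real N powr (- (\<kappa>3 + \<delta>0))) \<cdot>\<^sub>m Q - z \<cdot>\<^sub>m 1\<^sub>m (N ^ CARD('d))) u h \<longrightarrow>
    \<bar>(\<Sum>i<N ^ CARD('d). ln (\<tau>\<^sup>2 + h i)) / real (N ^ CARD('d)) - I \<tau> z\<bar> \<le> A * real N powr - c / \<tau>"
    by (elim exE conjE)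
  obtain cS where cS: "cS > 0" "\<forall>\<^sub>F N in sequentially. norm (max_sv (R N)) \<le> cS * norm (1::real)"
    using R_norm landau_o.bigE by blast
  obtain cQ where cQ: "cQ > 0" "\<forall>\<^sub>F N in sequentially. norm (LINT \<omega>|M N. max_sv (Q N \<omega>)) \<le> cQ * norm (real N powr \<kappa>3)"
    using A3_i(3) landau_o.bigE by blast
  define \<delta> where "\<delta> N = real N powr (- (\<kappa>3 + \<delta>0))" for N
  have \<delta>: "\<delta> N > 0" if "N \<ge> 1" for N using that by (simp add: \<delta>_def)
  define S where "S N = symbol_matrix N (e N) p + R N" for N
  have Sc: "S N \<in> carrier_mat (N ^ CARD('d)) (N ^ CARD('d))" if "N \<ge> 1" for N
    using R[OF that] by (simp add: S_def symbol_matrix_def)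
  have Qc: "Q N \<omega> \<in> carrier_mat (N ^ CARD('d)) (N ^ CARD('d))" if "N \<ge> 1" "\<omega> \<in> space (M N)" for N \<omega>
    using random[OF that(1)] that(2) by (simp add: random_matrix_def)
  have npos: "N ^ CARD('d) > 0" if "N \<ge> 1" for N :: nat using that by simp
  define B where "B N \<omega> = S N + complex_of_real (\<delta> N) \<cdot>\<^sub>m Q N \<omega>" for N \<omega>
  define AN where "AN z N = complex_of_real (1 / \<delta> N) \<cdot>\<^sub>m (S N - z \<cdot>\<^sub>m 1\<^sub>m (N ^ CARD('d)))" for z N
  have ANc: "AN z N \<in> carrier_mat (N ^ CARD('d)) (N ^ CARD('d))" if "N \<ge> 1" for z N
    unfolding AN_def by (intro smult_carrier_mat minus_carrier_mat one_carrier_mat)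
  \<comment> \<open>The inverse of \<delta> contributes \<open>\<kappa>3 + \<delta>0\<close>, and
    the passage from bounded entries to the norm of a matrix of size N^d contributes the
    dimension.\<close>
  define \<theta> where "\<theta> = real CARD('d) + \<kappa>3 + \<delta>0"
  have \<theta>: "\<theta> > 0" unfolding \<theta>_def using A3_i(1) delta0 by (intro add_pos_pos) auto
  have ANO: "(\<lambda>N. max_sv (AN z N)) \<in> O(\<lambda>N. real N powr \<theta>)" for z
  proof (rule bigoI)
    show "\<forall>\<^sub>F N in sequentially. norm (max_sv (AN z N)) \<le> (C + cS + cmod z) * norm (real N powr \<theta>)"
      using cS(2) eventually_ge_at_top[of 1]
    proof eventually_elim
      case (elim N)
      let ?n = "N ^ CARD('d)"
      have N: "N \<ge> 1" by fact
      have sv: "max_sv (R N) \<le> cS" using elim(1) by simp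
      have "max_sv (AN z N) \<le> real ?n * ((C + cS + cmod z) / \<delta> N)"
      proof (rule max_sv_le_entries[OF ANc[OF N] npos[OF N]])
        show "0 \<le> (C + cS + cmod z) / \<delta> N" using C cS(1) \<delta>[OF N] by simp
        fix k l assume kl: "k < ?n" "l < ?n"
        have "AN z N $$ (k, l) = complex_of_real (1 / \<delta> N) * (symbol_matrix N (e N) p $$ (k, l) + R N $$ (k, l) - z * of_bool (k = l))"
          using kl R[OF N] by (simp add: AN_def S_def symbol_matrix_def)
        hence "cmod (AN z N $$ (k, l)) = cmod (symbol_matrix N (e N) p $$ (k, l) + R N $$ (k, l) - z * of_bool (k = l)) / \<delta> N"
          using \<delta>[OF N] by (simp add: norm_mult norm_divide)
        also have "\<dots> \<le> (C + cS + cmod z) / \<delta> N"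
        proof (rule divide_right_mono)
          have eg: "e N k \<in> grid N" if "k < ?n" for k using bij_betwE[OF enum[OF N]] that by simp
          have "cmod (symbol_matrix N (e N) p $$ (k, l)) \<le> C"
            by (rule symbol_matrix_entry_bound[OF symbol N eg bound kl])
          moreover have "cmod (R N $$ (k, l)) \<le> cS"
            using entry_le_max_sv[OF R[OF N] npos[OF N] kl] sv by linarith
          moreover have "cmod (z * of_bool (k = l)) \<le> cmod z" by simp
          ultimately show "cmod (symbol_matrix N (e N) p $$ (k, l) + R N $$ (k, l) - z * of_bool (k = l)) \<le> C + cS + cmod z"
            using norm_triangle_ineq4[of "symbol_matrix N (e N) p $$ (k, l) + R N $$ (k, l)" "z * of_bool (k = l)"]
              norm_triangle_ineq[of "symbol_matrix N (e N) p $$ (k, l)" "R N $$ (k, l)"] by linarith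
        qed (use \<delta>[OF N] in simp)
        finally show "cmod (AN z N $$ (k, l)) \<le> (C + cS + cmod z) / \<delta> N" .
      qed
      also have "real ?n * ((C + cS + cmod z) / \<delta> N) = (C + cS + cmod z) * real N powr \<theta>"
      proof -
        have "1 / \<delta> N = real N powr (\<kappa>3 + \<delta>0)" unfolding \<delta>_def powr_minus_divide by simp
        moreover have "real ?n = real N powr real CARD('d)" using N by (simp add: powr_realpow)
        ultimately have "real ?n * (1 / \<delta> N) = real N powr \<theta>" by (simp only: powr_add[symmetric] \<theta>_def add.assoc)
        thus ?thesis by (metis mult.assoc mult.commute times_divide_eq_right mult.right_neutral)
      qed
      finally have "max_sv (AN z N) \<le> (C + cS + cmod z) * real N powr \<theta>" .
      moreover have "max_sv (AN z N) \<ge> 0"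
      proof -
        obtain u h where "svd ?n (AN z N) u h" using svd_exists[OF ANc[OF N]] by blast
        thus ?thesis by (rule svd_max(2)) (rule npos[OF N])
      qed
      ultimately show ?case by simp
    qed
  qed
  obtain \<beta> where \<beta>: "\<beta> > 0" and A3: "\<forall>A :: nat \<Rightarrow> complex mat.
      (\<forall>N\<ge>1. A N \<in> carrier_mat (N ^ CARD('d)) (N ^ CARD('d))) \<longrightarrow>
      (\<lambda>N. max_sv (A N)) \<in> O(\<lambda>N. real N powr \<theta>) \<longrightarrow>
      (\<lambda>N. measure (M N) {\<omega> \<in> space (M N). min_sv (A N + Q N \<omega>) \<le> real N powr (-\<beta>)}) \<longlonglongrightarrow> 0"
    using A3_ii[THEN spec, THEN mp, OF \<theta>] by (elim exE conjE)
  define F where "F z N = {\<omega> \<in> space (M N). min_sv (AN z N + Q N \<omega>) \<le> real N powr (-\<beta>)}" for z N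
  have Flim: "(\<lambda>N. measure (M N) (F z N)) \<longlonglongrightarrow> 0" for z
    unfolding F_def using A3[THEN spec, THEN mp, THEN mp, of "AN z"] ANc ANO by blast
  have Fs: "F z N \<in> sets (M N)" if N: "N \<ge> 1" for z N
    unfolding F_def by (rule min_sv_event_measurable[OF random[OF N] ANc[OF N] npos[OF N]]) (use N in simp)
  \<comment> \<open>The threshold exceeds the order of the mean by a factor
    \<open>N powr (\<delta>0 / 2)\<close>, so Markov's inequality makes this event rare.\<close>
  define G where "G N = {\<omega> \<in> space (M N). max_sv (Q N \<omega>) \<ge> real N powr (\<kappa>3 + \<delta>0 / 2)}" for N
  have Gs: "G N \<in> sets (M N)" if N: "N \<ge> 1" for N
    unfolding G_def using borel_measurable_integrable[OF A3_i(2)[OF N]] by measurable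
  have Glim: "(\<lambda>N. measure (M N) (G N)) \<longlonglongrightarrow> 0"
  proof (rule tendsto_sandwich[OF _ _ tendsto_const])
    show "(\<lambda>N. cQ * real N powr - (\<delta>0 / 2)) \<longlonglongrightarrow> 0"
      using tendsto_mult[OF tendsto_const[of cQ] tendsto_neg_powr[OF _ filterlim_real_sequentially, of "- (\<delta>0 / 2)"]] delta0 by simp
    show "\<forall>\<^sub>F N in sequentially. measure (M N) (G N) \<le> cQ * real N powr - (\<delta>0 / 2)"
      using cQ(2) eventually_ge_at_top[of 1]
    proof eventually_elim
      case (elim N)
      have N: "N \<ge> 1" by fact
      have "measure (M N) (G N) \<le> (LINT \<omega>|M N. max_sv (Q N \<omega>)) / real N powr (\<kappa>3 + \<delta>0 / 2)"
        unfolding G_def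
      proof (rule integral_Markov_inequality_measure[OF A3_i(2)[OF N] sets.empty_sets])
        show "AE \<omega> in M N. 0 \<le> max_sv (Q N \<omega>)"
        proof (rule AE_I2)
          fix \<omega> assume w: "\<omega> \<in> space (M N)"
          obtain u h where "svd (N ^ CARD('d)) (Q N \<omega>) u h" using svd_exists[OF Qc[OF N w]] by blast
          thus "0 \<le> max_sv (Q N \<omega>)" by (rule svd_max(2)) (rule npos[OF N])
        qed
      qed (use N in simp)
      also have "\<dots> \<le> (cQ * real N powr \<kappa>3) / real N powr (\<kappa>3 + \<delta>0 / 2)"
        using elim(1) by (intro divide_right_mono) auto
      also have "\<dots> = cQ * real N powr - (\<delta>0 / 2)"
      proof -
        have "real N powr \<kappa>3 / real N powr (\<kappa>3 + \<delta>0 / 2) = real N powr - (\<delta>0 / 2)"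
          unfolding powr_diff[symmetric] by simp
        thus ?thesis by (simp only: times_divide_eq_right[symmetric])
      qed
      finally show ?case .
    qed
  qed simp
  \<comment> \<open>Outside \<open>F z N\<close> the singular values at \<open>z\<close> exceed
    \<delta> times \<open>N powr - \<beta>\<close>; the factor 2 appears because \<open>h\<close>
    holds their squares.\<close>
  define q where "q = 2 * (\<kappa>3 + \<delta>0 + \<beta>)"
  have q: "q > 0" unfolding q_def using A3_i(1) delta0 \<beta> by simp
  have "(\<lambda>N. measure (M N) {\<omega> \<in> space (M N). \<epsilon> \<le> \<bar>(LINT z|spectral_measure (B N \<omega>). f z) - (LINT z|\<mu>. f z)\<bar>}) \<longlonglongrightarrow> 0"
    if f: "continuous_on UNIV f" "bounded (range f)" and \<epsilon>: "\<epsilon> > 0" for f :: "complex \<Rightarrow> real" and \<epsilon>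
  proof -
    obtain K where K: "\<And>u. \<bar>f u\<bar> \<le> K" using f(2) unfolding bounded_iff by auto
    \<comment> \<open>\<open>Z\<close> depends on \<open>f\<close> and \<epsilon>, but neither on N
      nor on the outcome, so finitely many sequences of events from (A3-ii) suffice.\<close>
    obtain Z r \<eta> where Z: "finite Z" and \<eta>: "\<eta> > 0" and crit: "\<forall>\<Lambda>. \<Lambda> \<noteq> {#} \<longrightarrow>
        (\<forall>z. cmod z \<le> r \<longrightarrow> z \<notin># \<Lambda> \<longrightarrow> avg \<Lambda> (\<lambda>u. ln (cmod (u - z))) \<le> potential \<mu> z + \<eta>) \<longrightarrow>
        (\<forall>z\<in>Z. z \<notin># \<Lambda> \<and> avg \<Lambda> (\<lambda>u. ln (cmod (u - z))) \<ge> potential \<mu> z - \<eta>) \<longrightarrow>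
        \<bar>avg \<Lambda> f - (LINT u|\<mu>. f u)\<bar> < \<epsilon>"
      using weak_convergence_criterion[OF \<mu> \<mu>s \<mu>K nz iln f(1) K \<epsilon>] by (elim exE conjE)
    define bad where "bad N = G N \<union> (\<Union>z\<in>Z. F z N)" for N
    have pc: "\<forall>\<^sub>F N in sequentially. \<forall>n h z. n > 0 \<longrightarrow> (\<forall>i<n. h i > 0) \<longrightarrow>
      (\<forall>\<tau>>0. \<bar>(\<Sum>i<n. ln (\<tau>\<^sup>2 + h i)) / real n - I \<tau> z\<bar> \<le> A * real N powr - c / \<tau>) \<longrightarrow>
      (\<Sum>i<n. ln (h i)) / (2 * real n) \<le> potential \<mu> z + \<eta> \<and>
      ((\<forall>i<n. real N powr - q \<le> h i) \<longrightarrow> potential \<mu> z - \<eta> \<le> (\<Sum>i<n. ln (h i)) / (2 * real n))"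
      by (rule potential_close[where I = I and U = "potential \<mu>", OF reg D A2(1) A c q \<eta>]) assumption+
    \<comment> \<open>Outside \<open>bad N\<close> the argument is deterministic. The inclusion also
      bounds the measure of the deviation set by that of an event, without a proof that the
      deviation set itself is measurable.\<close>
    have key: "\<forall>\<^sub>F N in sequentially. {\<omega> \<in> space (M N). \<epsilon> \<le> \<bar>(LINT z|spectral_measure (B N \<omega>). f z) - (LINT z|\<mu>. f z)\<bar>} \<subseteq> bad N"
      using asym pc eventually_ge_at_top[of 1]
    proof eventually_elim
      case (elim N)
      have N: "N \<ge> 1" by fact
      define n where "n = N ^ CARD('d)"
      have n: "n > 0" using npos[OF N] by (simp add: n_def)
      show ?case
      proof (rule subsetI, rule ccontr)
        fix \<omega> assume w: "\<omega> \<in> {\<omega> \<in> space (M N). \<epsilon> \<le> \<bar>(LINT z|spectral_measure (B N \<omega>). f z) - (LINT z|\<mu>. f z)\<bar>}" and nb: "\<omega> \<notin> bad N"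
        have ws: "\<omega> \<in> space (M N)" using w by simp
        have Qn: "Q N \<omega> \<in> carrier_mat n n" using Qc[OF N ws] by (simp add: n_def)
        have Bn: "B N \<omega> \<in> carrier_mat n n" using Sc[OF N] Qn by (simp add: B_def n_def)
        have Bz: "B N \<omega> - z \<cdot>\<^sub>m 1\<^sub>m n \<in> carrier_mat n n" for z
          by (intro minus_carrier_mat smult_carrier_mat one_carrier_mat)
        have svQ: "max_sv (Q N \<omega>) \<le> real N powr (\<kappa>3 + \<delta>0 / 2)" using nb ws by (simp add: bad_def G_def)
        define \<Lambda> where "\<Lambda> = proots (char_poly (B N \<omega>))"
        have \<Lambda>0: "\<Lambda> \<noteq> {#}" using proots_char_poly(1)[OF Bn n] n by (auto simp: \<Lambda>_def)
        have close: "avg \<Lambda> (\<lambda>u. ln (cmod (u - z))) \<le> potential \<mu> z + \<eta> \<and>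
          ((\<forall>i<n. real N powr - q \<le> h i) \<longrightarrow> potential \<mu> z - \<eta> \<le> avg \<Lambda> (\<lambda>u. ln (cmod (u - z))))"
          if svd: "svd n (B N \<omega> - z \<cdot>\<^sub>m 1\<^sub>m n) u h" and zn: "z \<notin># \<Lambda>" for z u h
        proof -
          have det: "det (B N \<omega> - z \<cdot>\<^sub>m 1\<^sub>m n) \<noteq> 0" using zn proots_char_poly(2)[OF Bn n] by (simp add: \<Lambda>_def)
          have avg: "avg \<Lambda> (\<lambda>u. ln (cmod (u - z))) = (\<Sum>i<n. ln (h i)) / (2 * real n)"
            using proots_char_poly(3)[OF Bn n] zn svd_log_det(2)[OF svd det] by (simp add: \<Lambda>_def)
          have "\<bar>(\<Sum>i<n. ln (\<tau>\<^sup>2 + h i)) / real n - I \<tau> z\<bar> \<le> A * real N powr - c / \<tau>" if "\<tau> > 0" for \<tau>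
            using elim(1)[THEN spec, THEN spec, THEN spec, THEN spec, THEN spec, THEN mp, THEN mp, THEN mp, THEN mp,
              of "Q N \<omega>" \<tau> z u h] Qn svQ that svd unfolding B_def S_def \<delta>_def n_def by blast
          thus ?thesis
            unfolding avg using elim(2)[THEN spec, THEN spec, THEN spec, THEN mp, THEN mp, THEN mp, of n h z] n svd_log_det(1)[OF svd det] by blast
        qed
        have up: "avg \<Lambda> (\<lambda>u. ln (cmod (u - z))) \<le> potential \<mu> z + \<eta>" if "z \<notin># \<Lambda>" for z
        proof -
          obtain u h where "svd n (B N \<omega> - z \<cdot>\<^sub>m 1\<^sub>m n) u h" using svd_exists[OF Bz] by blast
          from close[OF this that] show ?thesis ..
        qed
        have lo: "z \<notin># \<Lambda> \<and> avg \<Lambda> (\<lambda>u. ln (cmod (u - z))) \<ge> potential \<mu> z - \<eta>" if z: "z \<in> Z" for z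
        proof -
          obtain u h where svd: "svd n (B N \<omega> - z \<cdot>\<^sub>m 1\<^sub>m n) u h" using svd_exists[OF Bz] by blast
          have "\<omega> \<notin> F z N" using nb z by (auto simp: bad_def)
          hence ms: "real N powr - \<beta> < min_sv (AN z N + Q N \<omega>)" using ws by (simp add: F_def)
          have Xc: "AN z N + Q N \<omega> \<in> carrier_mat n n" using ANc[OF N] Qn by (simp add: n_def)
          have eq: "B N \<omega> - z \<cdot>\<^sub>m 1\<^sub>m n = complex_of_real (\<delta> N) \<cdot>\<^sub>m (AN z N + Q N \<omega>)"
            unfolding B_def AN_def n_def
            by (rule shift_scaled_sum) (use Sc[OF N] Qn \<delta>[OF N] in \<open>auto simp: n_def\<close>)
          have hq: "real N powr - q \<le> h i" if i: "i < n" for i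
          proof -
            have "real N powr - q = (\<delta> N * real N powr - \<beta>)\<^sup>2"
              unfolding \<delta>_def powr_add[symmetric] power2_eq_square q_def by (simp add: algebra_simps)
            also have "\<dots> \<le> (\<delta> N * min_sv (AN z N + Q N \<omega>))\<^sup>2"
              using ms \<delta>[OF N] by (intro power_mono mult_left_mono) auto
            also have "\<dots> \<le> h i" by (rule scaled_svd_lower[OF Xc n svd eq i])
            finally show ?thesis .
          qed
          \<comment> \<open>At an eigenvalue some singular value of the shifted matrix would vanish,
            against the lower bound \<open>hq\<close>.\<close>
          have zn: "z \<notin># \<Lambda>"
          proof
            assume "z \<in># \<Lambda>"
            hence "det (B N \<omega> - z \<cdot>\<^sub>m 1\<^sub>m n) = 0" using proots_char_poly(2)[OF Bn n] by (simp add: \<Lambda>_def)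
            hence "(\<Prod>i<n. h i) = 0" using svd_det[OF svd] by simp
            then obtain i where i: "i < n" "h i = 0" by auto
            have "real N powr - q > 0" using N by simp
            thus False using hq[OF i(1)] i(2) by simp
          qed
          show ?thesis using close[OF svd zn] hq zn by blast
        qed
        have "\<bar>avg \<Lambda> f - (LINT u|\<mu>. f u)\<bar> < \<epsilon>"
          using crit[THEN spec, of \<Lambda>] \<Lambda>0 up lo by blast
        moreover have "(LINT z|spectral_measure (B N \<omega>). f z) = avg \<Lambda> f"
          unfolding \<Lambda>_def by (rule integral_spectral_measure[OF Bn n borel_measurable_continuous_onI[OF f(1)]])
        ultimately show False using w by simp
      qed
    qed
    show ?thesis
    proof (rule tendsto_sandwich[OF _ _ tendsto_const])
      show "(\<lambda>N. measure (M N) (G N) + (\<Sum>z\<in>Z. measure (M N) (F z N))) \<longlonglongrightarrow> 0"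
        using tendsto_add[OF Glim tendsto_sum[of Z "\<lambda>z N. measure (M N) (F z N)" "\<lambda>_. 0"]] Flim by simp
      show "\<forall>\<^sub>F N in sequentially. measure (M N) {\<omega> \<in> space (M N). \<epsilon> \<le> \<bar>(LINT z|spectral_measure (B N \<omega>). f z) - (LINT z|\<mu>. f z)\<bar>}
         \<le> measure (M N) (G N) + (\<Sum>z\<in>Z. measure (M N) (F z N))"
        using key eventually_ge_at_top[of 1]
      proof eventually_elim
        case (elim N)
        have N: "N \<ge> 1" by fact
        interpret prob_space "M N" by (rule prob[OF N])
        have Us: "(\<Union>z\<in>Z. F z N) \<in> sets (M N)" using Fs[OF N] Z by (intro sets.finite_UN) auto
        have bs: "bad N \<in> sets (M N)" unfolding bad_def using Gs[OF N] Us by (rule sets.Un)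
        have "measure (M N) {\<omega> \<in> space (M N). \<epsilon> \<le> \<bar>(LINT z|spectral_measure (B N \<omega>). f z) - (LINT z|\<mu>. f z)\<bar>} \<le> measure (M N) (bad N)"
          by (rule finite_measure_mono[OF elim(1) bs])
        also have "\<dots> \<le> measure (M N) (G N) + measure (M N) (\<Union>z\<in>Z. F z N)"
          unfolding bad_def by (rule measure_Un_le[OF Gs[OF N] Us])
        also have "measure (M N) (\<Union>z\<in>Z. F z N) \<le> (\<Sum>z\<in>Z. measure (M N) (F z N))"
          using Fs[OF N] Z by (intro finite_measure_subadditive_finite) auto
        finally show ?case by simp
      qed
    qed simp
  qed
  thus ?thesis unfolding weakly_conv_in_prob_def law B_def S_def \<delta>_def by blast
qed

end
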